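(* There exists a constant $\eta\geq 0.002$ such that for all integers $\Delta\geq 3$, all integers $q\geq (2-\eta)\Delta$ and all $w\in [0,1]$ there exists a deterministic algorithm which, given an $n$-vertex graph $G$ of maximum degree at most $\Delta$ and $\varepsilon>0$, computes a number $\xi$ satisfying $$e^{-\varepsilon}\le \frac{Z_G(q;w)}{\xi}\le e^{\varepsilon}$$ in time polynomial in $n/\varepsilon$.
   Context: Graphs are finite and simple. For a graph $G=(V,E)$, a positive integer $q$ and $w\in\mathbb{C}$, the partition function of the $q$-state Potts model is $$Z_G(q;w):=\sum_{\phi:V\to [q]} w^{m(\phi)},$$ where $[q]=\{1,\ldots,q\}$ and $m(\phi)$ is the number of monochromatic edges, i.e. edges $\{u,v\}\in E$ with $\phi(u)=\phi(v)$. Convention: $w^0=1$ also for $w=0$, so $Z_G(q;0)$ is the number of proper $q$-colorings of $G$. The parameters $\Delta,q,w$ are fixed (not part of the input).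
   Formalization: The running time is polynomial in n/min(1,ε) rather than n/ε (for ε > 1 the literal bound fails, e.g. ε = cn with small c); the real numbers w and ε are accessed by comparing them with rationals. *)

theory Defs
  imports Complex_Main "HOL-Library.FuncSet" "HOL-Computational_Algebra.Polynomial"
begin

section \<open>Graphs and the Potts partition function\<close>

definition simple_graph :: "'v set \<Rightarrow> 'v set set \<Rightarrow> bool" where
  "simple_graph V E \<longleftrightarrow> finite V \<and> (\<forall>e\<in>E. e \<subseteq> V \<and> card e = 2)"

definition max_degree_le :: "'v set \<Rightarrow> 'v set set \<Rightarrow> nat \<Rightarrow> bool" where
  "max_degree_le V E \<Delta> \<longleftrightarrow> (\<forall>v\<in>V. card {e \<in> E. v \<in> e} \<le> \<Delta>)"

definition mono_edges :: "'v set set \<Rightarrow> ('v \<Rightarrow> nat) \<Rightarrow> 'v set set" where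
  "mono_edges E \<phi> = {e \<in> E. \<forall>u\<in>e. \<forall>v\<in>e. \<phi> u = \<phi> v}"

definition potts :: "'v set \<Rightarrow> 'v set set \<Rightarrow> nat \<Rightarrow> 'c::comm_semiring_1 \<Rightarrow> 'c" where
  "potts V E q w = (\<Sum>\<phi> \<in> V \<rightarrow>\<^sub>E {1..q}. w ^ card (mono_edges E \<phi>))"


section \<open>Algorithms\<close>

text \<open>
  Algorithms are programs of a deterministic random access machine over the natural numbers
  (Cook and Reckhow) and time is the number of executed instructions. As the only arithmetic
  operations are addition and truncated subtraction, the bit length of the contents of memory
  grows by at most one per step, so up to a polynomial this unit cost measure agrees with
  Turing machine time; in particular multiplication is not a unit cost operation.

  Registers are addressed directly, the heap indirectly.

  The weight and the accuracy are arbitrary real numbers. A program cannot hold them in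
  memory; it can only compare them with the quotient of two registers (\<open>JumpLeReal\<close>). These
  are binary encoded Dedekind cut queries: \<open>k\<close> bits of the number cost \<open>O(k)\<close> queries by
  bisection, and for a rational number a query could be replaced by a subroutine. Without some
  access of this kind no algorithm could exist when the fixed weight is not computable.
\<close>

datatype real_arg = Weight | Accuracy

datatype instr =
    Const nat nat
  | Add nat nat nat
  | Sub nat nat nat
  | Load nat nat
  | Store nat nat
  | JumpLe nat nat nat
  | JumpLeReal real_arg nat nat nat

record config =
  pc :: nat
  reg :: "nat \<Rightarrow> nat"
  heap :: "nat \<Rightarrow> nat"

fun exec :: "(real_arg \<Rightarrow> real) \<Rightarrow> instr \<Rightarrow> config \<Rightarrow> config" where
  "exec X (Const i c) s = s\<lparr>pc := pc s + 1, reg := (reg s)(i := c)\<rparr>"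
| "exec X (Add i j k) s = s\<lparr>pc := pc s + 1, reg := (reg s)(i := reg s j + reg s k)\<rparr>"
| "exec X (Sub i j k) s = s\<lparr>pc := pc s + 1, reg := (reg s)(i := reg s j - reg s k)\<rparr>"
| "exec X (Load i j) s = s\<lparr>pc := pc s + 1, reg := (reg s)(i := heap s (reg s j))\<rparr>"
| "exec X (Store i j) s = s\<lparr>pc := pc s + 1, heap := (heap s)(reg s i := reg s j)\<rparr>"
| "exec X (JumpLe i j l) s = s\<lparr>pc := (if reg s i \<le> reg s j then l else pc s + 1)\<rparr>"
| "exec X (JumpLeReal x i j l) s =
     s\<lparr>pc := (if real (reg s i) \<le> X x * real (reg s j) then l else pc s + 1)\<rparr>"

definition halted :: "instr list \<Rightarrow> config \<Rightarrow> bool" where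
  "halted P s \<longleftrightarrow> length P \<le> pc s"

definition step :: "(real_arg \<Rightarrow> real) \<Rightarrow> instr list \<Rightarrow> config \<Rightarrow> config" where
  "step X P s = (if halted P s then s else exec X (P ! pc s) s)"

text \<open>
  Graphs on the vertex set \<open>{..<n}\<close> are input as \<open>n\<close> in register 0 and the adjacency matrix,
  row by row, in the heap.
\<close>

definition graph_input :: "nat \<Rightarrow> nat set set \<Rightarrow> config" where
  "graph_input n E = \<lparr>pc = 0, reg = (\<lambda>_. 0)(0 := n),
     heap = (\<lambda>a. if a < n * n \<and> {a div n, a mod n} \<in> E then 1 else 0)\<rparr>"

text \<open>The output is a rational number, its numerator in register 0, its denominator in register 1.\<close>

definition outputs_in ::
  "instr list \<Rightarrow> real \<Rightarrow> nat \<Rightarrow> nat set set \<Rightarrow> real \<Rightarrow> nat \<Rightarrow> real \<Rightarrow> bool" where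
  "outputs_in P w n E \<epsilon> t \<xi> \<longleftrightarrow>
     (let s = (step (case_real_arg w \<epsilon>) P ^^ t) (graph_input n E)
      in halted P s \<and> reg s 1 \<noteq> 0 \<and> \<xi> = real (reg s 0) / real (reg s 1))"

text \<open>
  Running time polynomial in \<open>n / \<epsilon>\<close>: as usual this refers to accuracies \<open>\<epsilon> \<le> 1\<close>. For larger
  \<open>\<epsilon>\<close> the time is bounded by a polynomial in \<open>n\<close>; for \<open>\<epsilon>\<close> proportional to \<open>n\<close>, say, a bound in
  terms of \<open>n / \<epsilon>\<close> alone would not leave the time to read the graph.
\<close>

definition approximates_potts_in_poly_time :: "instr list \<Rightarrow> nat \<Rightarrow> nat \<Rightarrow> real \<Rightarrow> bool" where
  "approximates_potts_in_poly_time P \<Delta> q w \<longleftrightarrow>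
     (\<exists>p :: real poly. \<forall>n E \<epsilon>.
        simple_graph {..<n} E \<and> max_degree_le {..<n} E \<Delta> \<and> \<epsilon> > 0 \<longrightarrow>
        (\<exists>t \<xi>. outputs_in P w n E \<epsilon> t \<xi> \<and> real t \<le> poly p (real n / min 1 \<epsilon>) \<and>
           exp (- \<epsilon>) \<le> potts {..<n} E q w / \<xi> \<and> potts {..<n} E q w / \<xi> \<le> exp \<epsilon>))"

end

theory Submission imports Defs begin

text \<open>
  For a vertex \<open>v\<close> compare the two partition functions of the graph without \<open>v\<close> in which all neighbours of
  \<open>v\<close> feel a neighbour of colour \<open>i\<close>, respectively \<open>j\<close>. Switching the neighbours from \<open>j\<close> to \<open>i\<close> one
  at a time writes this ratio as a product over the neighbours whose factors are
  \<open>(1 - (1 - w) p i) / (1 - (1 - w) p j)\<close>, where \<open>p\<close> is the marginal distribution of the colour of one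
  neighbour in a graph without \<open>v\<close> (\<open>rat_telescope\<close>). That marginal is determined by the ratios of the
  neighbour, so the ratios obey a recursion on a tree of instances. Removed vertices
  survive as counts of coloured half-edges (``pins''), so the number of edges and pins at a vertex never grows,
  and every instance below the root has lost an edge: all its marginals are at most \<open>1 / s\<close> with
  \<open>s = q - \<Delta> + 1\<close> (\<open>marg_le\<close>). Cutting the recursion at depth \<open>O(log (n / \<epsilon>))\<close> leaves a tree of polynomial size,
  because the number of children of a node depends on \<open>\<Delta>\<close> and \<open>q\<close> only.

  The cut is harmless if the recursion contracts. Errors are measured by logarithms of ratios.
  An error \<open>D\<close> at a child contributes at most \<open>D / (s - 1)\<close> to its parent (\<open>Err_crude\<close>) and a node below
  the root has at most \<open>\<Delta> - 1\<close> children, so the error shrinks by \<open>(\<Delta> - 1) / (q - \<Delta>)\<close> per level, which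
  suffices for \<open>q \<ge> 2 \<Delta>\<close>. Below \<open>2 \<Delta>\<close> something must be gained from two successive levels
  (\<open>err_le_refined\<close>). A contribution is close to \<open>D / (s - 1)\<close> only if a colour \<open>j\<close> has a marginal
  close to the maximum \<open>1 / s\<close>. Then \<open>j\<close> is hardly ever blocked by the neighbours (\<open>top_colour\<close>), so the
  neighbours rarely have colour \<open>j\<close> (\<open>sum_marg_last_le\<close>), and this makes the errors of the ratios
  with respect to \<open>j\<close> smaller than \<open>D\<close> already one level below (\<open>sharp\<close>). The gain of about a third of a per
  cent pays for \<open>\<Delta> / (q - \<Delta>) \<le> 1000 / 998\<close>. It is needed for large \<open>\<Delta>\<close> only: for \<open>\<Delta> < 500\<close>
  the integer \<open>q \<ge> 1.998 \<Delta>\<close> satisfies \<open>q \<ge> 2 \<Delta>\<close>.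

  The partition function is a product, over the vertices, of sums of such ratios, hence approximable with a relative
  error \<open>\<epsilon>\<close> if every ratio is computed up to \<open>O(\<epsilon> / n)\<close>. Ratios are rounded to multiples of
  \<open>1 / M\<close> where \<open>M\<close> is of order \<open>n / \<epsilon>\<close>, and \<open>w\<close> is rounded to \<open>W / M\<close> (\<open>output_correct\<close>).

  For the machine, programs are written in a small language with natural number expressions and bounded loops,
  which is compiled to machine instructions (\<open>compile_correct\<close>). The program lays out
  the tree of instances in the heap, parents before children (\<open>build_correct\<close>), and evaluates the nodes in the opposite
  order (\<open>eval_correct\<close>). Multiplication is repeated addition, which is affordable since one factor
  is always bounded by a polynomial in \<open>M\<close> (\<open>quantities_bound\<close>).
\<close>

section \<open>Partition functions with pins\<close>

text \<open>\<open>m u a\<close> counts the removed neighbours of \<open>u\<close> that have been given the colour \<open>a\<close>.\<close>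

type_synonym pins = "nat \<Rightarrow> nat \<Rightarrow> nat"

definition tilt :: "nat set \<Rightarrow> nat \<Rightarrow> pins \<Rightarrow> pins" where
  "tilt B a m = (\<lambda>u b. m u b + (if u \<in> B \<and> b = a then 1 else 0))"

locale potts_model =
  fixes E :: "nat set set" and q :: nat and w :: real
  assumes edge_card: "\<And>e. e \<in> E \<Longrightarrow> card e = 2"
    and w_range: "0 \<le> w" "w \<le> 1"
begin

definition nb :: "nat set \<Rightarrow> nat \<Rightarrow> nat set" where
  "nb U v = {u \<in> U. {v, u} \<in> E}"

definition energy :: "nat set \<Rightarrow> pins \<Rightarrow> (nat \<Rightarrow> nat) \<Rightarrow> nat" where
  "energy U m \<phi> = card {e \<in> E. e \<subseteq> U \<and> (\<forall>u\<in>e. \<forall>v\<in>e. \<phi> u = \<phi> v)} + (\<Sum>u\<in>U. m u (\<phi> u))"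

definition Z :: "nat set \<Rightarrow> pins \<Rightarrow> real" where
  "Z U m = (\<Sum>\<phi> \<in> U \<rightarrow>\<^sub>E {..<q}. w ^ energy U m \<phi>)"

definition deg :: "nat set \<Rightarrow> pins \<Rightarrow> nat \<Rightarrow> nat" where
  "deg U m v = card (nb U v) + (\<Sum>a<q. m v a)"

lemma nb_irrefl: "v \<notin> nb U v"
  using edge_card[of "{v}"] by (auto simp: nb_def)

lemma nb_subset: "nb U v \<subseteq> U" by (auto simp: nb_def)

lemma nb_subset_remove: "nb U v \<subseteq> U - {v}" using nb_irrefl[of v U] nb_subset[of U v] by auto

lemma finite_nb: "finite U \<Longrightarrow> finite (nb U v)"
  by (rule finite_subset[OF nb_subset])

lemma energy_remove:
  assumes "finite U" "v \<in> U"
  shows "energy U m \<phi> = m v (\<phi> v) + energy (U - {v}) (tilt (nb U v) (\<phi> v) m) \<phi>"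
proof -
  let ?M = "\<lambda>e. \<forall>u\<in>e. \<forall>v\<in>e. \<phi> u = \<phi> v"
  let ?A = "{e \<in> E. e \<subseteq> U - {v} \<and> ?M e}" and ?S = "{u \<in> nb U v. \<phi> u = \<phi> v}"
  have fA: "finite ?A" by (rule finite_subset[of _ "Pow U"]) (use assms in auto)
  have fS: "finite ?S" using assms by (auto simp: finite_nb)
  have split: "{e \<in> E. e \<subseteq> U \<and> ?M e} = ?A \<union> (\<lambda>u. {v, u}) ` ?S"
  proof (intro equalityI subsetI)
    fix e assume e: "e \<in> {e \<in> E. e \<subseteq> U \<and> ?M e}"
    show "e \<in> ?A \<union> (\<lambda>u. {v, u}) ` ?S"
    proof (cases "v \<in> e")
      case True
      from e edge_card[of e] obtain x y where xy: "e = {x, y}" "x \<noteq> y"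
        by (auto simp: card_2_iff)
      then obtain u where "e = {v, u}" "u \<noteq> v" using True by auto
      then have "{v, u} \<in> E" "u \<in> U" "\<phi> u = \<phi> v" using e by blast+
      then have "u \<in> ?S" by (simp add: nb_def)
      then show ?thesis using \<open>e = {v, u}\<close> by blast
    next
      case False
      then have "e \<subseteq> U - {v}" using e by blast
      then show ?thesis using e by blast
    qed
  next
    fix e assume "e \<in> ?A \<union> (\<lambda>u. {v, u}) ` ?S"
    then show "e \<in> {e \<in> E. e \<subseteq> U \<and> ?M e}"
    proof
      assume "e \<in> (\<lambda>u. {v, u}) ` ?S"
      then obtain u where "u \<in> nb U v" "\<phi> u = \<phi> v" "e = {v, u}" by blast
      then show ?thesis using assms by (simp add: nb_def)
    qed blast
  qed
  have inj: "inj_on (\<lambda>u. {v, u}) ?S"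
    by (auto simp: inj_on_def doubleton_eq_iff)
  have "card {e \<in> E. e \<subseteq> U \<and> ?M e} = card ?A + card ?S"
    unfolding split by (subst card_Un_disjoint) (use fA fS card_image[OF inj] in auto)
  moreover have "(\<Sum>u\<in>U. m u (\<phi> u)) = m v (\<phi> v) + (\<Sum>u\<in>U-{v}. m u (\<phi> u))"
    using assms by (simp add: sum.remove)
  moreover have "(\<Sum>u\<in>U-{v}. tilt (nb U v) (\<phi> v) m u (\<phi> u)) = (\<Sum>u\<in>U-{v}. m u (\<phi> u)) + card ?S"
  proof -
    have "(\<Sum>u\<in>U-{v}. (if u \<in> nb U v \<and> \<phi> u = \<phi> v then 1 else 0)) = card ((U-{v}) \<inter> {u. u \<in> nb U v \<and> \<phi> u = \<phi> v})"
      using assms by (simp add: sum.If_cases)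
    also have "(U-{v}) \<inter> {u. u \<in> nb U v \<and> \<phi> u = \<phi> v} = ?S"
      using nb_subset_remove[of U v] by auto
    finally show ?thesis by (simp add: tilt_def sum.distrib)
  qed
  ultimately show ?thesis by (simp add: energy_def)
qed

lemma energy_cong:
  assumes "\<And>u. u \<in> U \<Longrightarrow> \<phi> u = \<psi> u" "\<And>u a. u \<in> U \<Longrightarrow> m u a = m' u a"
  shows "energy U m \<phi> = energy U m' \<psi>"
proof -
  have "{e \<in> E. e \<subseteq> U \<and> (\<forall>u\<in>e. \<forall>v\<in>e. \<phi> u = \<phi> v)} = {e \<in> E. e \<subseteq> U \<and> (\<forall>u\<in>e. \<forall>v\<in>e. \<psi> u = \<psi> v)}"
  proof -
    have "(\<forall>u\<in>e. \<forall>v\<in>e. \<phi> u = \<phi> v) = (\<forall>u\<in>e. \<forall>v\<in>e. \<psi> u = \<psi> v)" if "e \<subseteq> U" for e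
      using assms(1) that by (metis subsetD)
    then show ?thesis by blast
  qed
  then show ?thesis using assms by (simp add: energy_def)
qed

lemma Z_cong: "(\<And>u a. u \<in> U \<Longrightarrow> m u a = m' u a) \<Longrightarrow> Z U m = Z U m'"
  unfolding Z_def by (intro sum.cong refl arg_cong[where f = "(^) w"] energy_cong) auto

lemma Z_empty [simp]: "Z {} m = 1"
proof -
  have "{e \<in> E. e = {}} = {}" using edge_card by fastforce
  then have "{e \<in> E. e \<subseteq> {} \<and> (\<forall>u\<in>e. \<forall>v\<in>e. \<phi> u = \<phi> v)} = {}" for \<phi> :: "nat \<Rightarrow> nat"
    by auto
  then have "energy {} m \<phi> = 0" for \<phi> unfolding energy_def by simp
  then show ?thesis by (simp add: Z_def)
qed

lemma sum_PiE_remove: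
  fixes g :: "(nat \<Rightarrow> nat) \<Rightarrow> real"
  assumes "v \<in> U"
  shows "(\<Sum>\<phi> \<in> U \<rightarrow>\<^sub>E {..<q}. g \<phi>) = (\<Sum>a<q. \<Sum>\<phi> \<in> (U - {v}) \<rightarrow>\<^sub>E {..<q}. g (\<phi>(v := a)))"
proof -
  have U: "U = insert v (U - {v})" using assms by auto
  have "U \<rightarrow>\<^sub>E {..<q} = (\<lambda>(a, \<phi>). \<phi>(v := a)) ` ({..<q} \<times> ((U - {v}) \<rightarrow>\<^sub>E {..<q}))"
    using PiE_insert_eq[of v "U - {v}" "\<lambda>_. {..<q}"] U by simp
  moreover have "inj_on (\<lambda>(a, \<phi>). \<phi>(v := a)) ({..<q} \<times> ((U - {v}) \<rightarrow>\<^sub>E {..<q}))"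
    using inj_combinator[of v "U - {v}" "\<lambda>_. {..<q}"] by simp
  ultimately have "sum g (U \<rightarrow>\<^sub>E {..<q}) = (\<Sum>x\<in>{..<q} \<times> ((U - {v}) \<rightarrow>\<^sub>E {..<q}). g ((\<lambda>(a, \<phi>). \<phi>(v := a)) x))"
    by (simp add: sum.reindex o_def)
  also have "\<dots> = (\<Sum>a<q. \<Sum>\<phi> \<in> (U - {v}) \<rightarrow>\<^sub>E {..<q}. g (\<phi>(v := a)))"
    by (simp add: sum.cartesian_product case_prod_beta)
  finally show ?thesis .
qed

lemma Z_remove:
  assumes "finite U" "v \<in> U"
  shows "Z U m = (\<Sum>a<q. w ^ m v a * Z (U - {v}) (tilt (nb U v) a m))"
  unfolding Z_def sum_PiE_remove[OF assms(2)] sum_distrib_left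
proof (intro sum.cong refl)
  fix a \<phi>
  have "energy U m (\<phi>(v := a)) = m v a + energy (U - {v}) (tilt (nb U v) a m) (\<phi>(v := a))"
    using energy_remove[OF assms, of m "\<phi>(v := a)"] by (simp only: fun_upd_same)
  also have "energy (U - {v}) (tilt (nb U v) a m) (\<phi>(v := a)) = energy (U - {v}) (tilt (nb U v) a m) \<phi>"
    by (rule energy_cong) auto
  finally show "w ^ energy U m (\<phi>(v := a)) = w ^ m v a * w ^ energy (U - {v}) (tilt (nb U v) a m) \<phi>"
    by (simp only: power_add)
qed

definition weight :: "nat set \<Rightarrow> pins \<Rightarrow> nat \<Rightarrow> nat \<Rightarrow> real" where
  "weight U m v a = w ^ m v a * Z (U - {v}) (tilt (nb U v) a m)"

lemma Z_weight: "finite U \<Longrightarrow> v \<in> U \<Longrightarrow> Z U m = (\<Sum>a<q. weight U m v a)"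
  unfolding weight_def by (rule Z_remove)

text \<open>The new pin changes the weight of exactly those colourings that give \<open>u\<close> the colour \<open>a\<close>, by a factor \<open>w\<close>.\<close>

lemma Z_tilt_single:
  assumes "finite U" "u \<in> U" "a < q"
  shows "Z U (tilt {u} a m) = Z U m - (1 - w) * weight U m u a"
proof -
  have *: "weight U (tilt {u} a m) u b = (if b = a then w else 1) * weight U m u b" for b
  proof -
    have "Z (U - {u}) (tilt (nb U u) b (tilt {u} a m)) = Z (U - {u}) (tilt (nb U u) b m)"
      by (rule Z_cong) (auto simp: tilt_def)
    then show ?thesis by (auto simp: weight_def tilt_def)
  qed
  have "Z U (tilt {u} a m) = (\<Sum>b<q. (if b = a then w else 1) * weight U m u b)"
    using Z_weight[OF assms(1,2), of "tilt {u} a m"] * by simp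
  also have "\<dots> = (\<Sum>b<q. weight U m u b - (if b = a then (1 - w) * weight U m u b else 0))"
    by (intro sum.cong refl) (simp add: algebra_simps)
  also have "\<dots> = Z U m - (1 - w) * weight U m u a"
    using Z_weight[OF assms(1,2), of m] assms(3) by (simp add: sum_subtractf)
  finally show ?thesis .
qed

lemma energy_add:
  "energy U (\<lambda>u a. m u a + t u a) \<phi> = energy U m \<phi> + (\<Sum>u\<in>U. t u (\<phi> u))"
  by (simp add: energy_def sum.distrib)

lemma Z_add: "Z U (\<lambda>u a. m u a + t u a) = (\<Sum>\<phi> \<in> U \<rightarrow>\<^sub>E {..<q}. w ^ energy U m \<phi> * w ^ (\<Sum>u\<in>U. t u (\<phi> u)))"
  by (simp add: Z_def energy_add power_add)

lemma pow_w: "0 \<le> w ^ k" "w ^ k \<le> 1" using w_range by (auto simp: power_le_one)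

lemma Z_nonneg: "0 \<le> Z U m"
  unfolding Z_def by (intro sum_nonneg pow_w)

lemma Z_add_le: "Z U (\<lambda>u a. m u a + t u a) \<le> Z U m"
  unfolding Z_add unfolding Z_def
  by (intro sum_mono) (use pow_w in \<open>simp add: mult_left_le\<close>)

text \<open>Pins multiply the weight of each colouring by a number in \<open>[0, 1]\<close>, so the loss caused by the pins \<open>t\<close> is
  largest when the pins \<open>s\<close> are absent.\<close>

lemma Z_add_diff:
  "Z U (\<lambda>u a. m u a + s u a) - Z U (\<lambda>u a. m u a + s u a + t u a) \<le> Z U m - Z U (\<lambda>u a. m u a + t u a)"
  unfolding Z_def sum_subtractf[symmetric]
proof (intro sum_mono)
  fix \<phi>
  define x y z where "x = w ^ energy U m \<phi>" and "y = w ^ (\<Sum>u\<in>U. s u (\<phi> u))" and "z = w ^ (\<Sum>u\<in>U. t u (\<phi> u))"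
  have "energy U (\<lambda>u a. m u a + s u a + t u a) \<phi> = energy U m \<phi> + (\<Sum>u\<in>U. s u (\<phi> u)) + (\<Sum>u\<in>U. t u (\<phi> u))"
    by (simp add: energy_def sum.distrib)
  moreover have "x * (1 - z) * y \<le> x * (1 - z)"
    using pow_w by (intro mult_left_le) (auto simp: x_def y_def z_def)
  ultimately show "w ^ energy U (\<lambda>u a. m u a + s u a) \<phi> - w ^ energy U (\<lambda>u a. m u a + s u a + t u a) \<phi>
      \<le> w ^ energy U m \<phi> - w ^ energy U (\<lambda>u a. m u a + t u a) \<phi>"
    by (simp add: x_def y_def z_def power_add energy_add algebra_simps)
qed

lemma bernoulli: "1 - (1 - w) * real k \<le> w ^ k"
  using Bernoulli_inequality[of "w - 1" k] w_range by (simp add: algebra_simps)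

text \<open>In a colouring of the other vertices, each neighbour and each pin of \<open>v\<close> reduces the total weight of the
  \<open>q\<close> colours for \<open>v\<close> by at most \<open>1 - w\<close>; Bernoulli's inequality handles repeated colours.\<close>

lemma weight_sum_ge:
  assumes "finite U" "v \<in> U"
  shows "(real q - (1 - w) * real (deg U m v)) * Z (U - {v}) m \<le> Z U m"
proof -
  have t: "tilt (nb U v) a m = (\<lambda>u b. m u b + (if u \<in> nb U v \<and> b = a then 1 else 0))" for a
    by (simp add: tilt_def)
  define k where "k a \<phi> = m v a + (\<Sum>u\<in>U-{v}. if u \<in> nb U v \<and> \<phi> u = a then 1 else 0)" for a and \<phi> :: "nat \<Rightarrow> nat"
  have "Z U m = (\<Sum>a<q. \<Sum>\<phi> \<in> (U-{v}) \<rightarrow>\<^sub>E {..<q}. w ^ energy (U-{v}) m \<phi> * w ^ k a \<phi>)"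
    unfolding Z_remove[OF assms] t Z_add sum_distrib_left k_def by (simp add: power_add mult_ac)
  also have "\<dots> = (\<Sum>\<phi> \<in> (U-{v}) \<rightarrow>\<^sub>E {..<q}. w ^ energy (U-{v}) m \<phi> * (\<Sum>a<q. w ^ k a \<phi>))"
    by (subst sum.swap) (simp add: sum_distrib_left)
  also have "\<dots> \<ge> (\<Sum>\<phi> \<in> (U-{v}) \<rightarrow>\<^sub>E {..<q}. w ^ energy (U-{v}) m \<phi> * (real q - (1 - w) * real (deg U m v)))"
  proof (intro sum_mono mult_left_mono pow_w)
    fix \<phi> assume \<phi>: "\<phi> \<in> (U-{v}) \<rightarrow>\<^sub>E {..<q}"
    have "(\<Sum>a<q. k a \<phi>) = (\<Sum>a<q. m v a) + (\<Sum>u\<in>U-{v}. \<Sum>a<q. if u \<in> nb U v \<and> \<phi> u = a then 1 else 0)"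
      unfolding k_def sum.distrib by (subst sum.swap) simp
    also have "(\<Sum>u\<in>U-{v}. \<Sum>a<q. if u \<in> nb U v \<and> \<phi> u = a then 1 else (0::nat)) = (\<Sum>u\<in>U-{v}. if u \<in> nb U v then 1 else 0)"
    proof (intro sum.cong refl)
      fix u assume "u \<in> U - {v}"
      then have "\<phi> u < q" using \<phi> by auto
      then show "(\<Sum>a<q. if u \<in> nb U v \<and> \<phi> u = a then 1 else (0::nat)) = (if u \<in> nb U v then 1 else 0)"
        by (cases "u \<in> nb U v") simp_all
    qed
    also have "\<dots> = card (nb U v)"
      using assms nb_subset_remove[of U v] by (simp add: sum.If_cases Int_absorb1)
    finally have "(\<Sum>a<q. k a \<phi>) = deg U m v" by (simp add: deg_def)
    then have "real q - (1 - w) * real (deg U m v) = (\<Sum>a<q. 1 - (1 - w) * real (k a \<phi>))"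
      by (simp add: sum_subtractf sum_distrib_left[symmetric] of_nat_sum[symmetric] del: of_nat_sum)
    also have "\<dots> \<le> (\<Sum>a<q. w ^ k a \<phi>)" by (intro sum_mono bernoulli)
    finally show "real q - (1 - w) * real (deg U m v) \<le> (\<Sum>a<q. w ^ k a \<phi>)" .
  qed
  finally show ?thesis by (simp add: Z_def[of "U - {v}"] sum_distrib_left mult_ac)
qed

text \<open>The class of instances that the recursion stays in: turning an edge into a pin preserves \<open>deg\<close>.\<close>

definition admissible :: "nat \<Rightarrow> nat set \<Rightarrow> pins \<Rightarrow> bool" where
  "admissible \<Delta> U m \<longleftrightarrow> finite U \<and> (\<forall>u\<in>U. deg U m u \<le> \<Delta>)"

lemma admissible_finite: "admissible \<Delta> U m \<Longrightarrow> finite U"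
  by (simp add: admissible_def)

lemma nb_commute: "u \<in> U \<Longrightarrow> v \<in> U \<Longrightarrow> u \<in> nb U v \<longleftrightarrow> v \<in> nb U u"
  by (simp add: nb_def insert_commute)

lemma card_nb_remove:
  assumes "finite U" "v \<in> U" "u \<in> U - {v}"
  shows "card (nb (U - {v}) u) + (if u \<in> nb U v then 1 else 0) = card (nb U u)"
proof -
  have "nb (U - {v}) u = nb U u - {v}" by (auto simp: nb_def)
  moreover have "u \<in> nb U v \<longleftrightarrow> v \<in> nb U u" using assms nb_commute by auto
  ultimately show ?thesis using card_Suc_Diff1[OF finite_nb[OF assms(1)], of v u] by auto
qed

lemma sum_tilt_le: "(\<Sum>b<q. tilt B a m u b) \<le> (\<Sum>b<q. m u b) + (if u \<in> B then 1 else 0)"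
proof -
  have "(\<Sum>b<q. if u \<in> B \<and> b = a then 1 else (0::nat)) \<le> (if u \<in> B then 1 else 0)"
    by (cases "u \<in> B") simp_all
  then show ?thesis by (simp add: tilt_def sum.distrib)
qed

lemma deg_remove_tilt:
  assumes "finite U" "v \<in> U" "u \<in> U - {v}" "A \<inter> B = {}" "A \<union> B \<subseteq> nb U v"
  shows "deg (U - {v}) (tilt A i (tilt B j m)) u + (if u \<in> nb U v then 1 else 0)
    \<le> deg U m u + (if u \<in> A \<union> B then 1 else 0)"
proof -
  have "(\<Sum>b<q. tilt A i (tilt B j m) u b) \<le> (\<Sum>b<q. m u b) + (if u \<in> A \<union> B then 1 else 0)"
    using sum_tilt_le[of A i "tilt B j m" u] sum_tilt_le[of B j m u] assms(4)
    by (auto split: if_splits)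
  then show ?thesis using card_nb_remove[OF assms(1-3)] unfolding deg_def by linarith
qed

lemma admissible_tilt:
  assumes "admissible \<Delta> U m" "v \<in> U" "A \<inter> B = {}" "A \<union> B \<subseteq> nb U v"
  shows "admissible \<Delta> (U - {v}) (tilt A i (tilt B j m))"
  unfolding admissible_def
proof (intro conjI ballI)
  show "finite (U - {v})" using assms(1) by (simp add: admissible_def)
  fix u assume u: "u \<in> U - {v}"
  have "deg U m u \<le> \<Delta>" using assms(1) u by (auto simp: admissible_def)
  then show "deg (U - {v}) (tilt A i (tilt B j m)) u \<le> \<Delta>"
    using deg_remove_tilt[OF admissible_finite[OF assms(1)] assms(2) u assms(3,4), of i j m] assms(4)
    by (auto split: if_splits)
qed

lemma tilt_empty [simp]: "tilt {} a m = m" by (simp add: tilt_def)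

lemma admissible_tilt1:
  assumes "admissible \<Delta> U m" "v \<in> U" "B \<subseteq> nb U v"
  shows "admissible \<Delta> (U - {v}) (tilt B j m)"
  using admissible_tilt[OF assms(1,2), of "{}" B] assms(3) by simp

lemma Z_pos:
  assumes "admissible \<Delta> U m" "\<Delta> < q"
  shows "0 < Z U m"
proof -
  have "finite U" using assms(1) by (simp add: admissible_def)
  then show ?thesis using assms(1)
  proof (induction U rule: finite_psubset_induct)
    case (psubset U)
    show ?case
    proof (cases "U = {}")
      case False
      then obtain v where v: "v \<in> U" by auto
      have "0 < Z (U - {v}) m"
        by (rule psubset.IH) (use v admissible_tilt1[OF psubset.prems v, of "{}"] in auto)
      moreover have "(1 - w) * real (deg U m v) \<le> real (deg U m v)"
        using w_range by (simp add: mult_left_le_one_le)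
      moreover have "deg U m v < q" using psubset.prems v assms(2) by (fastforce simp: admissible_def)
      ultimately have "0 < (real q - (1 - w) * real (deg U m v)) * Z (U - {v}) m" by simp
      then show ?thesis using weight_sum_ge[OF psubset.hyps v, of m] by linarith
    qed simp
  qed
qed

definition nbl :: "nat set \<Rightarrow> nat \<Rightarrow> nat list" where
  "nbl U v = sorted_list_of_set (nb U v)"

text \<open>The intermediate stage in which the neighbours before number \<open>k\<close> have been switched to \<open>i\<close>, those
  after it are still at \<open>j\<close>, and neighbour \<open>k\<close> itself, the new root, feels neither.\<close>

definition child :: "nat set \<Rightarrow> pins \<Rightarrow> nat \<Rightarrow> nat \<Rightarrow> nat \<Rightarrow> nat \<Rightarrow> pins" where
  "child U m v k i j = tilt (set (take k (nbl U v))) i (tilt (set (drop (Suc k) (nbl U v))) j m)"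

definition marg :: "nat set \<Rightarrow> pins \<Rightarrow> nat \<Rightarrow> nat \<Rightarrow> real" where
  "marg U m v a = weight U m v a / Z U m"

definition rat :: "nat set \<Rightarrow> pins \<Rightarrow> nat \<Rightarrow> nat \<Rightarrow> nat \<Rightarrow> real" where
  "rat U m v i j = Z (U - {v}) (tilt (nb U v) i m) / Z (U - {v}) (tilt (nb U v) j m)"

lemma set_nbl: "finite U \<Longrightarrow> set (nbl U v) = nb U v"
  by (simp add: nbl_def finite_nb)

lemma distinct_nbl: "distinct (nbl U v)" by (simp add: nbl_def)

lemma length_nbl: "length (nbl U v) = card (nb U v)" by (simp add: nbl_def)

lemma set_take_drop:
  assumes "k < length xs"
  shows "set (take (Suc k) xs) = insert (xs ! k) (set (take k xs))"
    and "set (drop k xs) = insert (xs ! k) (set (drop (Suc k) xs))"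
  using assms by (simp_all add: take_Suc_conv_app_nth Cons_nth_drop_Suc[symmetric])

lemma distinct_take_drop:
  assumes "distinct xs" "k < length xs"
  shows "set (take k xs) \<inter> set (drop (Suc k) xs) = {}" "xs ! k \<notin> set (take k xs)" "xs ! k \<notin> set (drop (Suc k) xs)"
proof -
  have "distinct (take k xs @ xs ! k # drop (Suc k) xs)" using assms id_take_nth_drop[of k xs] by simp
  then show "set (take k xs) \<inter> set (drop (Suc k) xs) = {}" "xs ! k \<notin> set (take k xs)" "xs ! k \<notin> set (drop (Suc k) xs)"
    by auto
qed

lemma nbl_mem:
  assumes "finite U" "k < length (nbl U v)"
  shows "nbl U v ! k \<in> nb U v" "nbl U v ! k \<in> U - {v}"
  using nth_mem[OF assms(2)] set_nbl[OF assms(1)] nb_subset_remove[of U v] by auto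

lemma child_parts:
  assumes "finite U" "k < length (nbl U v)"
  shows "set (take k (nbl U v)) \<inter> set (drop (Suc k) (nbl U v)) = {}"
    "set (take k (nbl U v)) \<union> set (drop (Suc k) (nbl U v)) \<subseteq> nb U v"
  using distinct_take_drop[OF distinct_nbl assms(2)] set_nbl[OF assms(1)]
    set_take_subset[of k "nbl U v"] set_drop_subset[of "Suc k" "nbl U v"] by auto

lemma admissible_child:
  assumes "admissible \<Delta> U m" "v \<in> U" "k < length (nbl U v)"
  shows "admissible \<Delta> (U - {v}) (child U m v k i j)"
  unfolding child_def
  by (rule admissible_tilt[OF assms(1,2) child_parts[OF admissible_finite[OF assms(1)] assms(3)]])

text \<open>The new root has lost its edge to \<open>v\<close> without receiving a pin.\<close>

lemma deg_child:
  assumes "admissible \<Delta> U m" "v \<in> U" "k < length (nbl U v)"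
  shows "deg (U - {v}) (child U m v k i j) (nbl U v ! k) + 1 \<le> \<Delta>"
proof -
  have f: "finite U" by (rule admissible_finite[OF assms(1)])
  have "nbl U v ! k \<notin> set (take k (nbl U v)) \<union> set (drop (Suc k) (nbl U v))"
    using distinct_take_drop[OF distinct_nbl assms(3)] by auto
  moreover have "deg U m (nbl U v ! k) \<le> \<Delta>"
    using assms(1) nbl_mem[OF f assms(3)] by (auto simp: admissible_def)
  ultimately show ?thesis
    using deg_remove_tilt[OF f assms(2) nbl_mem(2)[OF f assms(3)] child_parts[OF f assms(3)], of i j m]
      nbl_mem(1)[OF f assms(3)] unfolding child_def by auto
qed

lemma Z_tilt_marg:
  assumes "admissible \<Delta> U m" "\<Delta> < q" "u \<in> U" "a < q"
  shows "Z U (tilt {u} a m) = Z U m * (1 - (1 - w) * marg U m u a)"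
proof -
  have "weight U m u a = Z U m * marg U m u a"
    using Z_pos[OF assms(1,2)] by (simp add: marg_def)
  then show ?thesis
    using Z_tilt_single[OF admissible_finite[OF assms(1)] assms(3,4), of m] by (simp add: algebra_simps)
qed

lemma tilt_insert: "x \<notin> B \<Longrightarrow> tilt (insert x B) a m = tilt {x} a (tilt B a m)"
  by (auto simp: tilt_def fun_eq_iff)

lemma tilt_commute: "tilt A a (tilt B b m) = tilt B b (tilt A a m)"
  by (simp add: tilt_def add_ac)

text \<open>Consecutive stages differ in one pin at neighbour \<open>k\<close>, and \<open>child\<close> with that pin at \<open>i\<close> or at
  \<open>j\<close> is the later or the earlier stage.\<close>

lemma rat_telescope:
  assumes adm: "admissible \<Delta> U m" "\<Delta> < q" and v: "v \<in> U" and ij: "i < q" "j < q"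
  defines "p \<equiv> \<lambda>k. marg (U - {v}) (child U m v k i j) (nbl U v ! k)"
  shows "rat U m v i j = (\<Prod>k<length (nbl U v). (1 - (1 - w) * p k i) / (1 - (1 - w) * p k j))"
proof -
  define us where "us = nbl U v"
  define Y where "Y k = Z (U - {v}) (tilt (set (take k us)) i (tilt (set (drop k us)) j m))" for k
  have f: "finite U" by (rule admissible_finite[OF adm(1)])
  have Ypos: "0 < Y k" for k
    unfolding Y_def
  proof (rule Z_pos[OF _ adm(2)], rule admissible_tilt[OF adm(1) v])
    show "set (take k us) \<inter> set (drop k us) = {}"
      using distinct_nbl[of U v] unfolding us_def by (metis append_take_drop_id distinct_append)
    show "set (take k us) \<union> set (drop k us) \<subseteq> nb U v"
      unfolding us_def using set_nbl[OF f] set_take_subset set_drop_subset by fastforce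
  qed
  have step: "Y (Suc k) / Y k = (1 - (1 - w) * p k i) / (1 - (1 - w) * p k j)" if k: "k < length us" for k
  proof -
    have k': "k < length (nbl U v)" using k by (simp add: us_def)
    note dt = distinct_take_drop[OF distinct_nbl k', folded us_def] and st = set_take_drop[OF k]
    note ac = admissible_child[OF adm(1) v k', of i j] and mem = nbl_mem(2)[OF f k', folded us_def]
    have "Y (Suc k) = Z (U - {v}) (tilt {us ! k} i (child U m v k i j))"
      unfolding Y_def child_def st us_def[symmetric] tilt_insert[OF dt(2)] ..
    moreover have "Y k = Z (U - {v}) (tilt {us ! k} j (child U m v k i j))"
      unfolding Y_def child_def st us_def[symmetric] tilt_insert[OF dt(3)]
        tilt_commute[of "{us ! k}" j "set (take k us)"] ..
    ultimately show ?thesis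
      using Z_tilt_marg[OF ac adm(2) mem ij(1)] Z_tilt_marg[OF ac adm(2) mem ij(2)] Z_pos[OF ac adm(2)]
      by (simp add: p_def us_def)
  qed
  have "(\<Prod>k<n. Y (Suc k) / Y k) = Y n / Y 0" for n
    using Ypos by (induction n) (auto simp: less_imp_neq[symmetric])
  from this[of "length us"] step have "(\<Prod>k<length us. (1 - (1 - w) * p k i) / (1 - (1 - w) * p k j)) = Y (length us) / Y 0"
    by (metis (no_types, lifting) lessThan_iff prod.cong)
  also have "\<dots> = rat U m v i j"
    by (simp add: rat_def Y_def us_def set_nbl[OF f])
  finally show ?thesis by (simp add: us_def)
qed

lemma marg_nonneg: "0 \<le> marg U m v a"
  by (simp add: marg_def weight_def Z_nonneg pow_w)

lemma tilt_le: "Z U (tilt B a m) \<le> Z U m"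
  unfolding tilt_def by (rule Z_add_le)

text \<open>Since \<open>v\<close> has degree less than \<open>\<Delta>\<close>, \<open>weight_sum_ge\<close> bounds the partition function from below by \<open>s\<close> times
  the one without \<open>v\<close>, which dominates the weight of any single colour.\<close>

lemma marg_le:
  assumes adm: "admissible \<Delta> U m" "\<Delta> < q" and v: "v \<in> U" and d: "deg U m v + 1 \<le> \<Delta>"
  shows "marg U m v a \<le> 1 / (real q - real \<Delta> + 1)"
proof -
  have f: "finite U" by (rule admissible_finite[OF adm(1)])
  have "(1 - w) * real (deg U m v) \<le> 1 * real (deg U m v)" using w_range by (intro mult_right_mono) auto
  then have "real q - real \<Delta> + 1 \<le> real q - (1 - w) * real (deg U m v)" using d by linarith
  then have ZU: "(real q - real \<Delta> + 1) * Z (U - {v}) m \<le> Z U m"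
    by (rule order_trans[OF mult_right_mono[OF _ Z_nonneg] weight_sum_ge[OF f v]])
  have Zm: "0 < Z (U - {v}) m" using Z_pos[OF admissible_tilt1[OF adm(1) v, of "{}" 0] adm(2)] by simp
  have wt: "weight U m v a \<le> Z (U - {v}) m"
  proof -
    have "weight U m v a \<le> 1 * Z (U - {v}) (tilt (nb U v) a m)"
      unfolding weight_def by (intro mult_right_mono pow_w Z_nonneg)
    then show ?thesis using tilt_le[of "U - {v}" "nb U v" a m] by simp
  qed
  have "marg U m v a \<le> Z (U - {v}) m / ((real q - real \<Delta> + 1) * Z (U - {v}) m)"
    unfolding marg_def using adm(2) Zm by (intro frac_le wt ZU) auto
  then show ?thesis using Zm by simp
qed

lemma Z_remove_rat:
  assumes adm: "admissible \<Delta> U m" "\<Delta> < q" and v: "v \<in> U"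
  shows "Z U m = (\<Sum>b<q. w ^ m v b * rat U m v b j) * Z (U - {v}) (tilt (nb U v) j m)"
proof -
  have "0 < Z (U - {v}) (tilt (nb U v) j m)"
    using Z_pos[OF admissible_tilt1[OF adm(1) v order_refl] adm(2)] .
  then show ?thesis unfolding Z_remove[OF admissible_finite[OF adm(1)] v] sum_distrib_right
    by (intro sum.cong refl) (simp add: rat_def)
qed

lemma rat_pos:
  assumes "admissible \<Delta> U m" "\<Delta> < q" "v \<in> U" shows "0 < rat U m v i j"
  unfolding rat_def using Z_pos[OF admissible_tilt1[OF assms(1,3) order_refl] assms(2)] by simp

text \<open>\<open>\<tau> a\<close> is the expected factor by which the neighbours damp colour \<open>a\<close> at \<open>v\<close>. In the marginals of the
  children, dropping the pins at \<open>i\<close> only increases the loss due to one more pin at \<open>j\<close>; these losses then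
  telescope to \<open>1 - \<tau> j\<close>. The denominators are partition functions of mixed stages, which a union
  bound keeps above \<open>\<tau> i + \<tau> j - 1\<close>.\<close>

lemma sum_marg_last_le:
  assumes adm: "admissible \<Delta> U m" "\<Delta> < q" and v: "v \<in> U" and ij: "i < q" "j < q"
  defines "\<tau> \<equiv> \<lambda>a. Z (U - {v}) (tilt (nb U v) a m) / Z (U - {v}) m"
  assumes \<tau>: "\<tau> i + \<tau> j > 1"
  shows "(\<Sum>k<length (nbl U v). (1 - w) * marg (U - {v}) (child U m v k i j) (nbl U v ! k) j)
    \<le> (1 - \<tau> j) / (\<tau> i + \<tau> j - 1)"
proof -
  let ?U = "U - {v}"
  define us where "us = nbl U v"
  have f: "finite U" by (rule admissible_finite[OF adm(1)])
  have Zm: "0 < Z ?U m" using Z_pos[OF admissible_tilt1[OF adm(1) v, of "{}" 0] adm(2)] by simp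
  define Y where "Y k = Z ?U (tilt (set (drop k us)) j m)" for k
  define L where "L = (\<tau> i + \<tau> j - 1) * Z ?U m"
  have Lpos: "0 < L" using \<tau> Zm by (simp add: L_def)
  have trm: "(1 - w) * marg ?U (child U m v k i j) (us ! k) j \<le> (Y (Suc k) - Y k) / L" if k: "k < length us" for k
  proof -
    have k': "k < length (nbl U v)" using k by (simp add: us_def)
    note dt = distinct_take_drop[OF distinct_nbl k', folded us_def] and st = set_take_drop[OF k]
    note ac = admissible_child[OF adm(1) v k', of i j] and mem = nbl_mem(2)[OF f k', folded us_def]
    define A B where "A = set (take k us)" and "B = set (drop (Suc k) us)"
    have AB: "A \<subseteq> nb U v" "B \<subseteq> nb U v"
      using child_parts[OF f k'] unfolding A_def B_def us_def by auto
    have ch: "child U m v k i j = tilt A i (tilt B j m)" by (simp add: child_def A_def B_def us_def)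
    have "(1 - w) * weight ?U (child U m v k i j) (us ! k) j
      = Z ?U (child U m v k i j) - Z ?U (tilt {us ! k} j (child U m v k i j))"
      using Z_tilt_single[OF _ mem ij(2)] f by simp
    also have "\<dots> \<le> Z ?U (tilt B j m) - Z ?U (tilt {us ! k} j (tilt B j m))"
      unfolding ch using Z_add_diff[of ?U "tilt B j m" "\<lambda>u b. if u \<in> A \<and> b = i then 1 else 0" "\<lambda>u b. if u \<in> {us ! k} \<and> b = j then 1 else 0"]
      unfolding tilt_def by simp
    also have "\<dots> = Y (Suc k) - Y k"
      unfolding Y_def st B_def tilt_insert[OF dt(3)] ..
    finally have num: "(1 - w) * weight ?U (child U m v k i j) (us ! k) j \<le> Y (Suc k) - Y k" .
    have "L = Z ?U (tilt (nb U v) j m) - (Z ?U m - Z ?U (tilt (nb U v) i m))"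
      using Zm by (simp add: L_def \<tau>_def field_simps)
    also have "\<dots> \<le> Z ?U (tilt (nb U v) i (tilt (nb U v) j m))"
      using Z_add_diff[of ?U m "\<lambda>u b. if u \<in> nb U v \<and> b = j then 1 else 0" "\<lambda>u b. if u \<in> nb U v \<and> b = i then 1 else 0"]
      unfolding tilt_def by simp
    also have "\<dots> \<le> Z ?U (tilt A i (tilt B j m))"
    proof -
      have e: "tilt (nb U v) i (tilt (nb U v) j m) = (\<lambda>u b. tilt A i (tilt B j m) u b + ((if u \<in> nb U v - A \<and> b = i then 1 else 0) + (if u \<in> nb U v - B \<and> b = j then 1 else 0)))"
        using AB by (auto simp: tilt_def fun_eq_iff)
      show ?thesis unfolding e by (rule Z_add_le)
    qed
    finally have den: "L \<le> Z ?U (child U m v k i j)" by (simp add: ch)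
    have "0 \<le> (1 - w) * weight ?U (child U m v k i j) (us ! k) j"
      using w_range by (simp add: weight_def pow_w Z_nonneg)
    then have "(1 - w) * weight ?U (child U m v k i j) (us ! k) j / Z ?U (child U m v k i j) \<le> (Y (Suc k) - Y k) / L"
      by (intro frac_le num den Lpos) (use num in linarith)
    then show ?thesis by (simp add: marg_def)
  qed
  have "(\<Sum>k<length us. (1 - w) * marg ?U (child U m v k i j) (us ! k) j) \<le> (\<Sum>k<length us. (Y (Suc k) - Y k) / L)"
    by (intro sum_mono) (use trm in auto)
  also have "\<dots> = (Y (length us) - Y 0) / L"
    by (simp add: sum_divide_distrib[symmetric] sum_lessThan_telescope)
  also have "\<dots> = (1 - \<tau> j) / (\<tau> i + \<tau> j - 1)"
    using Zm unfolding Y_def us_def L_def by (simp add: set_nbl[OF f] \<tau>_def field_simps)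
  finally show ?thesis by (simp add: us_def)
qed

text \<open>The marginal is at most \<open>1 / s\<close> times both damping factors of \<open>j\<close>, that of the pins and that of the neighbours.\<close>

lemma top_colour:
  assumes adm: "admissible \<Delta> U m" "\<Delta> < q" and v: "v \<in> U" and d: "deg U m v + 1 \<le> \<Delta>"
    and top: "\<theta> / (real q - real \<Delta> + 1) \<le> (1 - w) * marg U m v j"
  shows "\<theta> \<le> w ^ m v j" "\<theta> \<le> Z (U - {v}) (tilt (nb U v) j m) / Z (U - {v}) m"
proof -
  let ?s = "real q - real \<Delta> + 1" and ?U = "U - {v}"
  define c t where "c = 1 - w" and "t = Z (U - {v}) (tilt (nb U v) j m) / Z (U - {v}) m"
  have f: "finite U" by (rule admissible_finite[OF adm(1)])
  have Zm: "0 < Z ?U m" using Z_pos[OF admissible_tilt1[OF adm(1) v, of "{}" 0] adm(2)] by simp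
  have s: "0 < ?s" using adm(2) by simp
  have c: "0 \<le> c" "c \<le> 1" using w_range by (auto simp: c_def)
  have "c * real (deg U m v) \<le> 1 * real (deg U m v)" using c by (intro mult_right_mono) auto
  then have "?s \<le> real q - c * real (deg U m v)" using d by linarith
  then have ZU: "?s * Z ?U m \<le> Z U m"
    unfolding c_def by (rule order_trans[OF mult_right_mono[OF _ Z_nonneg] weight_sum_ge[OF f v]])
  have "\<theta> / ?s \<le> c * (weight U m v j / Z U m)" using top by (simp add: marg_def c_def)
  also have "\<dots> \<le> 1 * (weight U m v j / Z U m)"
    using c Z_nonneg by (intro mult_right_mono) (auto simp: weight_def pow_w)
  also have "\<dots> \<le> weight U m v j / (?s * Z ?U m)"
    using ZU s Zm Z_nonneg by (simp, intro divide_left_mono) (auto simp: weight_def pow_w intro!: mult_pos_pos Z_pos[OF adm])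
  also have "\<dots> = (weight U m v j / Z ?U m) / ?s" by simp
  finally have "\<theta> \<le> weight U m v j / Z ?U m" by (subst (asm) divide_le_cancel) (use s in linarith)
  then have *: "\<theta> \<le> w ^ m v j * t" by (simp add: weight_def t_def)
  have t: "0 \<le> t" "t \<le> 1" using Zm Z_nonneg tilt_le by (auto simp: t_def)
  show "\<theta> \<le> w ^ m v j" using * t pow_w[of "m v j"] mult_left_le[of t "w ^ m v j"] by linarith
  show "\<theta> \<le> Z (U - {v}) (tilt (nb U v) j m) / Z (U - {v}) m"
    using * t pow_w[of "m v j"] mult_right_le_one_le[of t "w ^ m v j"] unfolding t_def[symmetric] by (simp add: mult.commute)
qed

end

section \<open>Propagation of an error through one factor\<close>

text \<open>In logarithms a factor of the recursion is a difference of two values of this function.\<close>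

definition H :: "real \<Rightarrow> real" where "H x = - ln (1 - x)"

lemma H_mono: "a \<le> b \<Longrightarrow> b < 1 \<Longrightarrow> H a \<le> H b"
  by (simp add: H_def)

lemma H_ge: "a < 1 \<Longrightarrow> a \<le> H a"
  using ln_le_minus_one[of "1 - a"] by (simp add: H_def)

text \<open>The derivative of \<open>H\<close> is \<open>1 / (1 - x) \<le> s / (s - 1)\<close>.\<close>

lemma H_diff_le:
  assumes "a \<le> b" "b \<le> 1 / s" "1 < s"
  shows "H b - H a \<le> (b - a) * (s / (s - 1))"
proof -
  have b1: "b < 1" using assms(2,3) less_divide_eq_1[of 1 s] by (smt (verit) divide_less_eq_1)
  have "H b - H a = ln ((1 - a) / (1 - b))" using b1 assms(1) by (simp add: H_def ln_div)
  also have "\<dots> \<le> (1 - a) / (1 - b) - 1" using b1 assms(1) by (intro ln_le_minus_one) simp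
  also have "\<dots> = (b - a) / (1 - b)" using b1 by (simp add: field_simps)
  also have "\<dots> \<le> (b - a) / ((s - 1) / s)"
  proof (rule divide_left_mono)
    show "(s - 1) / s \<le> 1 - b" using assms(2,3) by (simp add: diff_divide_distrib)
  qed (use b1 assms in auto)
  finally show ?thesis by simp
qed

lemma exp_mean_le:
  fixes y :: real assumes "0 \<le> y" shows "exp y - 1 \<le> y * (exp y + 1) / 2"
proof -
  let ?h = "\<lambda>y::real. y * (exp y + 1) / 2 - (exp y - 1)"
  have "?h 0 \<le> ?h y"
  proof (rule DERIV_nonneg_imp_nondecreasing[OF assms])
    fix x :: real assume x: "0 \<le> x" "x \<le> y"
    have "(?h has_real_derivative ((exp x + 1) + x * exp x) / 2 - exp x) (at x)"
      by (auto intro!: derivative_eq_intros simp: field_simps)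
    moreover have "0 \<le> ((exp x + 1) + x * exp x) / 2 - exp x"
    proof -
      have "(1 - x) * exp x \<le> exp (- x) * exp x"
        using exp_ge_add_one_self[of "- x"] by (intro mult_right_mono) auto
      also have "\<dots> = 1" by (simp add: exp_minus)
      finally show ?thesis by (simp add: algebra_simps)
    qed
    ultimately show "\<exists>z. (?h has_real_derivative z) (at x) \<and> 0 \<le> z" by blast
  qed
  then show ?thesis by simp
qed

text \<open>As a function of \<open>y\<close>, \<open>H (a exp y)\<close> has derivative at most \<open>1 / (s - 1)\<close>, with equality only at
  \<open>a exp y = 1 / s\<close>. Starting from \<open>a \<le> \<theta> / s\<close> the average derivative is smaller.\<close>

lemma H_gain:
  assumes "0 \<le> a" "0 \<le> y" "a * exp y \<le> 1 / s" "a \<le> \<theta> / s" "1 < s"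
  shows "H (a * exp y) - H a \<le> (1 + \<theta>) / 2 * y / (s - 1)"
proof -
  have "a \<le> a * exp y" using assms by (simp add: mult_le_cancel_left1)
  then have "H (a * exp y) - H a \<le> (a * exp y - a) * (s / (s - 1))"
    by (rule H_diff_le[OF _ assms(3,5)])
  also have "\<dots> \<le> (((1 + \<theta>) / s) / 2 * y) * (s / (s - 1))"
  proof (rule mult_right_mono)
    have "a * exp y - a \<le> a * (y * (exp y + 1) / 2)"
      using mult_left_mono[OF exp_mean_le[OF assms(2)] assms(1)] by (simp add: algebra_simps)
    also have "\<dots> = (a * exp y + a) / 2 * y" by (simp add: algebra_simps)
    also have "\<dots> \<le> (1 / s + \<theta> / s) / 2 * y"
      by (intro mult_right_mono divide_right_mono add_mono assms) (use assms in auto)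
    finally show "a * exp y - a \<le> ((1 + \<theta>) / s) / 2 * y" by (simp add: add_divide_distrib)
  qed (use assms in auto)
  also have "\<dots> = (1 + \<theta>) / 2 * y / (s - 1)" using assms(5) by (simp add: field_simps)
  finally show ?thesis .
qed

lemma H_gain_abs:
  assumes "0 \<le> a" "a \<le> 1 / s" "a * exp y \<le> 1 / s" "min a (a * exp y) \<le> \<theta> / s" "1 < s"
  shows "\<bar>H (a * exp y) - H a\<bar> \<le> (1 + \<theta>) / 2 * \<bar>y\<bar> / (s - 1)"
proof (cases "0 \<le> y")
  case True
  have "a \<le> a * exp y" using assms True by (simp add: mult_le_cancel_left1)
  moreover have "a * exp y < 1" using assms(3,5) by (smt (verit) divide_less_eq_1)
  ultimately show ?thesis using H_gain[OF assms(1) True assms(3) _ assms(5), of \<theta>] H_mono[of a "a * exp y"] True assms(4)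
    by auto
next
  case False
  define b where "b = a * exp y"
  have ab: "a = b * exp (- y)" by (simp add: b_def exp_minus)
  have b0: "0 \<le> b" using assms by (simp add: b_def)
  have "b \<le> a" unfolding b_def using assms(1) False by (simp add: mult_left_le)
  moreover have "a < 1" using assms(2,5) by (smt (verit) divide_less_eq_1)
  moreover have "b \<le> \<theta> / s" using assms(4) \<open>b \<le> a\<close> by (simp add: b_def)
  ultimately show ?thesis using H_gain[OF b0, of "- y" s \<theta>] H_mono[of b a] False assms(2,5)
    unfolding b_def[symmetric] ab[symmetric] by auto
qed

lemma H_shift_le:
  assumes "0 \<le> \<mu>" "\<mu> \<le> \<rho>" "0 \<le> x" "\<rho> * exp x < 1"
  shows "H (\<mu> * exp x) - H \<mu> \<le> H (\<rho> * exp x) - H \<rho>"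
proof -
  have r1: "\<rho> \<le> \<rho> * exp x" using assms by (simp add: mult_le_cancel_left1)
  have m1: "\<mu> * exp x \<le> \<rho> * exp x" using assms by simp
  have "(1 - \<mu>) * (1 - \<rho> * exp x) \<le> (1 - \<rho>) * (1 - \<mu> * exp x)"
  proof -
    have "0 \<le> (\<rho> - \<mu>) * (exp x - 1)" using assms by simp
    then show ?thesis by (simp add: algebra_simps)
  qed
  then have "(1 - \<mu>) / (1 - \<mu> * exp x) \<le> (1 - \<rho>) / (1 - \<rho> * exp x)"
    using r1 m1 assms by (simp add: field_simps)
  then have "ln ((1 - \<mu>) / (1 - \<mu> * exp x)) \<le> ln ((1 - \<rho>) / (1 - \<rho> * exp x))"
    using r1 m1 assms by (intro ln_mono divide_pos_pos) linarith+
  then show ?thesis using r1 m1 assms by (simp add: H_def ln_div)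
qed

text \<open>The error of a factor in logarithms. Here \<open>\<rho>i\<close> and \<open>\<rho>j\<close> are the true marginals of the two colours, scaled by \<open>1 - w\<close>;
  the computed ones are \<open>\<rho>j exp x\<close> and \<open>\<rho>i exp (x + e)\<close>, where \<open>x\<close> is the error of the normalisation and
  \<open>e\<close> the error of the ratio of the two colours.\<close>

definition Err :: "real \<Rightarrow> real \<Rightarrow> real \<Rightarrow> real \<Rightarrow> real" where
  "Err \<rho>i \<rho>j x e = H (\<rho>j * exp x) - H \<rho>j - H (\<rho>i * exp (x + e)) + H \<rho>i"

locale two_colours =
  fixes s \<rho>i \<rho>j x e :: real
  assumes s: "1 < s" and ri: "0 \<le> \<rho>i" "\<rho>i \<le> 1 / s" and rj: "0 \<le> \<rho>j" "\<rho>j \<le> 1 / s"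
    and xj: "\<rho>j * exp x \<le> 1 / s" and base: "\<rho>i * exp e \<le> \<rho>j"
begin

lemma s1: "1 / s < 1" using s by simp

lemma xi: "\<rho>i * exp (x + e) \<le> \<rho>j * exp x"
  using mult_right_mono[OF base, of "exp x"] by (simp add: exp_add mult_ac)

text \<open>Move along the path \<open>\<rho>i\<close>, \<open>\<rho>i exp e\<close>, \<open>\<rho>i exp (x + e)\<close>. On its second part colour \<open>i\<close> stays below colour \<open>j\<close>,
  so by convexity of \<open>H\<close> the two changes due to \<open>x\<close> partly cancel.\<close>

lemma Err_split: "Err \<rho>i \<rho>j x e = ((H (\<rho>j * exp x) - H \<rho>j) - (H (\<rho>i * exp e * exp x) - H (\<rho>i * exp e))) + (H \<rho>i - H (\<rho>i * exp e))"
  by (simp add: Err_def exp_add mult_ac)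

lemma A_pos:
  assumes "0 \<le> x"
  shows "H (\<rho>i * exp e * exp x) - H (\<rho>i * exp e) \<le> H (\<rho>j * exp x) - H \<rho>j"
    "0 \<le> H (\<rho>i * exp e * exp x) - H (\<rho>i * exp e)"
proof -
  show "H (\<rho>i * exp e * exp x) - H (\<rho>i * exp e) \<le> H (\<rho>j * exp x) - H \<rho>j"
    by (rule H_shift_le) (use assms ri base xj s1 in auto)
  have "\<rho>i * exp e * 1 \<le> \<rho>i * exp e * exp x" using ri assms by (intro mult_left_mono) auto
  then have "\<rho>i * exp e \<le> \<rho>i * exp e * exp x" by simp
  moreover have "\<rho>i * exp e * exp x = \<rho>i * exp (x + e)" by (simp add: exp_add)
  then have "\<rho>i * exp e * exp x < 1" using xi xj s1 by linarith
  ultimately show "0 \<le> H (\<rho>i * exp e * exp x) - H (\<rho>i * exp e)" using H_mono by auto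
qed

lemma A_neg:
  assumes "x \<le> 0"
  shows "H (\<rho>i * exp e) - H (\<rho>i * exp e * exp x) \<le> H \<rho>j - H (\<rho>j * exp x)"
    "0 \<le> H (\<rho>i * exp e) - H (\<rho>i * exp e * exp x)"
proof -
  have e: "z = z * exp x * exp (- x)" for z by (simp add: exp_minus)
  have "H (\<rho>i * exp e * exp x * exp (- x)) - H (\<rho>i * exp e * exp x) \<le> H (\<rho>j * exp x * exp (- x)) - H (\<rho>j * exp x)"
    by (rule H_shift_le) (use assms ri base rj(1) order.strict_trans1[OF rj(2) s1] in \<open>auto simp: e[of \<rho>j, symmetric]\<close>)
  then show "H (\<rho>i * exp e) - H (\<rho>i * exp e * exp x) \<le> H \<rho>j - H (\<rho>j * exp x)"
    using e[of \<rho>j] e[of "\<rho>i * exp e"] by simp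
  have "\<rho>i * exp e * exp x \<le> \<rho>i * exp e" using ri assms by (simp add: mult_left_le)
  moreover have "\<rho>i * exp e < 1" using base rj s1 by auto
  ultimately show "0 \<le> H (\<rho>i * exp e) - H (\<rho>i * exp e * exp x)" using H_mono by auto
qed

lemma H_exp_mono: "0 \<le> y \<Longrightarrow> \<rho>i * exp y < 1 \<Longrightarrow> H \<rho>i \<le> H (\<rho>i * exp y)"
  by (rule H_mono) (use ri in \<open>auto simp: mult_le_cancel_left1\<close>)

lemma H_exp_anti: "y \<le> 0 \<Longrightarrow> H (\<rho>i * exp y) \<le> H \<rho>i"
  by (rule H_mono) (use ri s1 in \<open>auto simp: mult_left_le\<close>)

text \<open>Either the contributions of \<open>x\<close> and \<open>e\<close> cancel in part, and then only the larger one counts,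
  or the movements of the two colours add up, but then their total length is only \<open>\<bar>e\<bar>\<close>.\<close>

lemma Err_cases:
  defines "PJ \<equiv> \<bar>H (\<rho>j * exp x) - H \<rho>j\<bar>"
    and "BI \<equiv> \<bar>H (\<rho>i * exp e) - H \<rho>i\<bar>"
    and "QI \<equiv> \<bar>H (\<rho>i * exp (x + e)) - H \<rho>i\<bar>"
  shows "\<bar>Err \<rho>i \<rho>j x e\<bar> \<le> max PJ BI \<or>
    \<bar>x\<bar> + \<bar>x + e\<bar> = \<bar>e\<bar> \<and> x * e \<le> 0 \<and> \<bar>Err \<rho>i \<rho>j x e\<bar> \<le> PJ + QI"
proof -
  have m: "\<rho>i * exp e < 1" using base rj s1 by auto
  have mx: "\<rho>i * exp (x + e) < 1" using xi xj s1 by auto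
  note sp = Err_split
  consider (pp) "0 \<le> x" "0 \<le> e" | (nn) "x \<le> 0" "e \<le> 0" | (pn) "0 \<le> x" "e \<le> 0" | (np) "x \<le> 0" "0 \<le> e"
    by linarith
  then show ?thesis
  proof cases
    case pp
    have "H \<rho>i \<le> H (\<rho>i * exp e)" using H_exp_mono pp m by auto
    then have "\<bar>Err \<rho>i \<rho>j x e\<bar> \<le> max PJ BI"
      using A_pos[OF pp(1)] unfolding sp PJ_def BI_def by linarith
    then show ?thesis ..
  next
    case nn
    have "H (\<rho>i * exp e) \<le> H \<rho>i" using H_exp_anti nn by auto
    then have "\<bar>Err \<rho>i \<rho>j x e\<bar> \<le> max PJ BI"
      using A_neg[OF nn(1)] unfolding sp PJ_def BI_def by linarith
    then show ?thesis ..
  next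
    case pn
    have ge: "0 \<le> Err \<rho>i \<rho>j x e" using A_pos[OF pn(1)] H_exp_anti[OF pn(2)] unfolding sp by linarith
    show ?thesis
    proof (cases "0 \<le> x + e")
      case True
      have "\<bar>Err \<rho>i \<rho>j x e\<bar> \<le> max PJ BI" using ge H_exp_mono[OF True mx] unfolding Err_def PJ_def BI_def by linarith
      then show ?thesis ..
    next
      case False
      then have "\<bar>Err \<rho>i \<rho>j x e\<bar> \<le> PJ + QI" "\<bar>x\<bar> + \<bar>x + e\<bar> = \<bar>e\<bar>"
        using ge pn unfolding Err_def PJ_def QI_def by linarith+
      then show ?thesis using pn by (auto simp: mult_nonneg_nonpos)
    qed
  next
    case np
    have le: "Err \<rho>i \<rho>j x e \<le> 0" using A_neg[OF np(1)] H_exp_mono[OF np(2) m] unfolding sp by linarith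
    show ?thesis
    proof (cases "x + e \<le> 0")
      case True
      have "\<bar>Err \<rho>i \<rho>j x e\<bar> \<le> max PJ BI" using le H_exp_anti[OF True] unfolding Err_def PJ_def BI_def by linarith
      then show ?thesis ..
    next
      case False
      then have "\<bar>Err \<rho>i \<rho>j x e\<bar> \<le> PJ + QI" "\<bar>x\<bar> + \<bar>x + e\<bar> = \<bar>e\<bar>"
        using le np unfolding Err_def PJ_def QI_def by linarith+
      then show ?thesis using np by (auto simp: mult_nonpos_nonneg)
    qed
  qed
qed

lemma PJ_gain:
  assumes "min \<rho>j (\<rho>j * exp x) \<le> \<theta> / s"
  shows "\<bar>H (\<rho>j * exp x) - H \<rho>j\<bar> * (s - 1) \<le> (1 + \<theta>) / 2 * \<bar>x\<bar>"
  by (subst pos_le_divide_eq[symmetric], use s in simp, rule H_gain_abs) (use rj xj s assms in auto)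

lemma BI_gain:
  assumes "min \<rho>i (\<rho>i * exp e) \<le> \<theta> / s"
  shows "\<bar>H (\<rho>i * exp e) - H \<rho>i\<bar> * (s - 1) \<le> (1 + \<theta>) / 2 * \<bar>e\<bar>"
  by (subst pos_le_divide_eq[symmetric], use s in simp, rule H_gain_abs) (use ri rj base s assms in auto)

lemma QI_gain:
  assumes "min \<rho>i (\<rho>i * exp (x + e)) \<le> \<theta> / s"
  shows "\<bar>H (\<rho>i * exp (x + e)) - H \<rho>i\<bar> * (s - 1) \<le> (1 + \<theta>) / 2 * \<bar>x + e\<bar>"
  by (subst pos_le_divide_eq[symmetric], use s in simp, rule H_gain_abs) (use ri xi xj s assms in auto)

lemma Err_crude:
  assumes "\<bar>x\<bar> \<le> E" "\<bar>e\<bar> \<le> E"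
  shows "\<bar>Err \<rho>i \<rho>j x e\<bar> \<le> E / (s - 1)"
proof -
  have s0: "0 < s - 1" using s by simp
  have "\<bar>H (\<rho>j * exp x) - H \<rho>j\<bar> \<le> \<bar>x\<bar> / (s - 1)" using PJ_gain[of 1] rj by (simp add: pos_le_divide_eq[OF s0] min_le_iff_disj)
  moreover have "\<bar>H (\<rho>i * exp e) - H \<rho>i\<bar> \<le> \<bar>e\<bar> / (s - 1)" using BI_gain[of 1] ri by (simp add: pos_le_divide_eq[OF s0] min_le_iff_disj)
  moreover have "\<bar>H (\<rho>i * exp (x + e)) - H \<rho>i\<bar> \<le> \<bar>x + e\<bar> / (s - 1)" using QI_gain[of 1] ri by (simp add: pos_le_divide_eq[OF s0] min_le_iff_disj)
  moreover have "\<bar>x\<bar> / (s - 1) \<le> E / (s - 1)" "\<bar>e\<bar> / (s - 1) \<le> E / (s - 1)"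
    using assms s by (auto intro: divide_right_mono)
  moreover have "\<bar>x\<bar> / (s - 1) + \<bar>x + e\<bar> / (s - 1) = \<bar>e\<bar> / (s - 1)" if "\<bar>x\<bar> + \<bar>x + e\<bar> = \<bar>e\<bar>"
    using that by (metis add_divide_distrib)
  ultimately show ?thesis using Err_cases by (smt (verit))
qed

text \<open>Unlike \<open>Err_crude\<close> this bound is proportional to the marginals, so it can be summed over the children of a node.\<close>

lemma Err_upper:
  assumes "\<bar>x\<bar> \<le> E" "\<bar>e\<bar> \<le> E"
  shows "Err \<rho>i \<rho>j x e \<le> s / (s - 1) * (\<rho>i * E + \<rho>j * (exp E - 1))"
    and "- Err \<rho>i \<rho>j x e \<le> s / (s - 1) * (\<rho>j * E + \<rho>i * (exp E - 1))"
proof -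
  have K: "0 \<le> s / (s - 1)" using s by simp
  have E0: "0 \<le> E" using assms by linarith
  have ex: "\<bar>z\<bar> \<le> E \<Longrightarrow> exp z - 1 \<le> exp E - 1" "\<bar>z\<bar> \<le> E \<Longrightarrow> 1 - exp z \<le> E" for z :: real
    using exp_ge_add_one_self[of z] by (simp, linarith)
  have ux: "H (\<rho>j * exp x) - H \<rho>j \<le> s / (s - 1) * (\<rho>j * (exp E - 1))" if "0 \<le> x"
  proof -
    have "H (\<rho>j * exp x) - H \<rho>j \<le> (\<rho>j * exp x - \<rho>j) * (s / (s - 1))"
      using that rj xj s by (intro H_diff_le) (auto simp: mult_le_cancel_left1)
    also have "\<dots> = s / (s - 1) * (\<rho>j * (exp x - 1))" by (simp add: algebra_simps)
    also have "\<dots> \<le> s / (s - 1) * (\<rho>j * (exp E - 1))"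
      using ex(1)[OF assms(1)] K rj by (intro mult_left_mono) auto
    finally show ?thesis .
  qed
  have lx: "H \<rho>j - H (\<rho>j * exp x) \<le> s / (s - 1) * (\<rho>j * E)" if "x \<le> 0"
  proof -
    have "H \<rho>j - H (\<rho>j * exp x) \<le> (\<rho>j - \<rho>j * exp x) * (s / (s - 1))"
      using that rj xj s by (intro H_diff_le) (auto simp: mult_left_le)
    also have "\<dots> = s / (s - 1) * (\<rho>j * (1 - exp x))" by (simp add: algebra_simps)
    also have "\<dots> \<le> s / (s - 1) * (\<rho>j * E)"
      using ex(2)[OF assms(1)] K rj by (intro mult_left_mono) auto
    finally show ?thesis .
  qed
  have ue: "H (\<rho>i * exp e) - H \<rho>i \<le> s / (s - 1) * (\<rho>i * (exp E - 1))" if "0 \<le> e"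
  proof -
    have "H (\<rho>i * exp e) - H \<rho>i \<le> (\<rho>i * exp e - \<rho>i) * (s / (s - 1))"
      using that ri rj base s by (intro H_diff_le) (auto simp: mult_le_cancel_left1)
    also have "\<dots> = s / (s - 1) * (\<rho>i * (exp e - 1))" by (simp add: algebra_simps)
    also have "\<dots> \<le> s / (s - 1) * (\<rho>i * (exp E - 1))"
      using ex(1)[OF assms(2)] K ri by (intro mult_left_mono) auto
    finally show ?thesis .
  qed
  have le: "H \<rho>i - H (\<rho>i * exp e) \<le> s / (s - 1) * (\<rho>i * E)" if "e \<le> 0"
  proof -
    have "H \<rho>i - H (\<rho>i * exp e) \<le> (\<rho>i - \<rho>i * exp e) * (s / (s - 1))"
      using that ri s by (intro H_diff_le) (auto simp: mult_left_le)
    also have "\<dots> = s / (s - 1) * (\<rho>i * (1 - exp e))" by (simp add: algebra_simps)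
    also have "\<dots> \<le> s / (s - 1) * (\<rho>i * E)"
      using ex(2)[OF assms(2)] K ri by (intro mult_left_mono) auto
    finally show ?thesis .
  qed
  have n: "0 \<le> s / (s - 1) * (\<rho>j * (exp E - 1))" "0 \<le> s / (s - 1) * (\<rho>i * (exp E - 1))"
    "0 \<le> s / (s - 1) * (\<rho>j * E)" "0 \<le> s / (s - 1) * (\<rho>i * E)"
    by (intro mult_nonneg_nonneg K; use E0 ri rj in simp)+
  have m: "\<rho>i * exp e < 1" using base rj s1 by auto
  have A: "(H (\<rho>j * exp x) - H \<rho>j) - (H (\<rho>i * exp e * exp x) - H (\<rho>i * exp e)) \<le> s / (s - 1) * (\<rho>j * (exp E - 1))"
    using ux A_pos A_neg n by (cases "0 \<le> x") (smt (verit))+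
  have A': "- ((H (\<rho>j * exp x) - H \<rho>j) - (H (\<rho>i * exp e * exp x) - H (\<rho>i * exp e))) \<le> s / (s - 1) * (\<rho>j * E)"
    using lx A_pos A_neg n by (cases "0 \<le> x") (smt (verit))+
  have B: "H \<rho>i - H (\<rho>i * exp e) \<le> s / (s - 1) * (\<rho>i * E)"
    using le H_exp_mono[of e] m n by (cases "0 \<le> e") auto
  have B': "- (H \<rho>i - H (\<rho>i * exp e)) \<le> s / (s - 1) * (\<rho>i * (exp E - 1))"
    using ue H_exp_anti[of e] n by (cases "0 \<le> e") auto
  show "Err \<rho>i \<rho>j x e \<le> s / (s - 1) * (\<rho>i * E + \<rho>j * (exp E - 1))"
    unfolding Err_split distrib_left using A B by linarith
  show "- Err \<rho>i \<rho>j x e \<le> s / (s - 1) * (\<rho>j * E + \<rho>i * (exp E - 1))"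
    unfolding Err_split distrib_left using A' B' by linarith
qed

lemma lin_gain:
  fixes X :: real
  assumes "PJ \<le> (9875/10000) * X" "QI \<le> (99375/100000) * Y" "X + Y = Z" "0 \<le> X"
  shows "PJ + QI \<le> (99375/100000) * Z"
  using assms by simp

lemma lin_mixed:
  fixes X :: real
  assumes "PJ \<le> X" "QI \<le> (84/100) * Y" "X + Y = Z" "X \<le> (92/100) * D" "Z \<le> (10026/10000) * D" "0 < D"
  shows "PJ + QI \<le> (99/100) * D"
  using assms by simp

text \<open>The slope of \<open>H\<close> is bounded away from \<open>1 / (s - 1)\<close> unless \<open>\<rho>j\<close> is close to \<open>1 / s\<close>.\<close>

lemma Err_not_top:
  assumes "\<bar>x\<bar> \<le> D" "\<bar>e\<bar> \<le> D" "\<rho>j \<le> (975/1000) / s"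
  shows "\<bar>Err \<rho>i \<rho>j x e\<bar> \<le> (99375/100000) * D / (s - 1)"
proof -
  define PJ BI QI where "PJ = \<bar>H (\<rho>j * exp x) - H \<rho>j\<bar> * (s - 1)"
    and "BI = \<bar>H (\<rho>i * exp e) - H \<rho>i\<bar> * (s - 1)"
    and "QI = \<bar>H (\<rho>i * exp (x + e)) - H \<rho>i\<bar> * (s - 1)"
  have s0: "0 < s - 1" using s by simp
  have PJ: "PJ \<le> (9875/10000) * \<bar>x\<bar>" using PJ_gain[of "(975/1000)"] assms(3) unfolding PJ_def by (simp add: min_le_iff_disj)
  have BI: "BI \<le> (9875/10000) * \<bar>e\<bar>" using BI_gain[of "(975/1000)"] order_trans[OF base assms(3)] unfolding BI_def by (simp add: min_le_iff_disj)
  have QI1: "QI \<le> \<bar>x + e\<bar>" using QI_gain[of 1] ri unfolding QI_def by (simp add: min_le_iff_disj)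
  have "PJ + QI \<le> (99375/100000) * \<bar>e\<bar>" if sum: "\<bar>x\<bar> + \<bar>x + e\<bar> = \<bar>e\<bar>"
  proof (cases "min \<rho>i (\<rho>i * exp (x + e)) \<le> (9875/10000) / s")
    case True
    then have "QI \<le> (99375/100000) * \<bar>x + e\<bar>" using QI_gain[of "(9875/10000)"] unfolding QI_def by simp
    then show ?thesis using PJ sum abs_ge_zero[of x] by (metis lin_gain)
  next
    case False
    then have big: "(9875/10000) / s < \<rho>i" "(9875/10000) / s < \<rho>i * exp (x + e)" by auto
    have rjp: "0 < \<rho>j"
    proof -
      have "0 < (9875/10000) / s" using s by simp
      then have "0 < \<rho>j * exp x" using big(2) xi by linarith
      then show ?thesis by (simp add: zero_less_mult_iff)
    qed
    have "(9875/10000) / s < (975/1000) / s * exp x"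
      using big(2) xi mult_right_mono[OF assms(3), of "exp x"] by simp
    then have ex: "(9875/10000) < (975/1000) * exp x" using s by (simp add: field_simps)
    have "(9875/10000) / s < 1 / s * exp (x + e)"
      using big(2) mult_right_mono[OF ri(2), of "exp (x + e)"] by simp
    then have ei: "(9875/10000) < exp (x + e)" using s by (simp add: field_simps)
    have "1 < exp x" using ex by linarith
    then have x0: "0 < x" by simp
    have "\<bar>x + e\<bar> \<le> x"
    proof (rule ccontr)
      assume "\<not> \<bar>x + e\<bar> \<le> x"
      then have "x < - (x + e)" using sum x0 by linarith
      then have "exp x < exp (- (x + e))" by simp
      also have "\<dots> = 1 / exp (x + e)" by (metis exp_minus inverse_eq_divide)
      also have "\<dots> < 1 / (9875/10000)" by (rule divide_strict_left_mono) (use ei in auto)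
      finally show False using ex by simp
    qed
    then show ?thesis using PJ QI1 sum x0 by linarith
  qed
  moreover have "0 \<le> D" using assms by linarith
  ultimately have "\<bar>Err \<rho>i \<rho>j x e\<bar> * (s - 1) \<le> (99375/100000) * D"
  proof -
    assume *: "\<bar>x\<bar> + \<bar>x + e\<bar> = \<bar>e\<bar> \<Longrightarrow> PJ + QI \<le> (99375/100000) * \<bar>e\<bar>"
    from Err_cases show ?thesis
    proof
      assume "\<bar>Err \<rho>i \<rho>j x e\<bar> \<le> max \<bar>H (\<rho>j * exp x) - H \<rho>j\<bar> \<bar>H (\<rho>i * exp e) - H \<rho>i\<bar>"
      then have "\<bar>Err \<rho>i \<rho>j x e\<bar> * (s - 1) \<le> max PJ BI"
        using s0 by (auto simp: PJ_def BI_def max_def split: if_splits intro: mult_right_mono order_trans)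
      then show ?thesis using PJ BI assms by linarith
    next
      assume "\<bar>x\<bar> + \<bar>x + e\<bar> = \<bar>e\<bar> \<and> x * e \<le> 0 \<and>
        \<bar>Err \<rho>i \<rho>j x e\<bar> \<le> \<bar>H (\<rho>j * exp x) - H \<rho>j\<bar> + \<bar>H (\<rho>i * exp (x + e)) - H \<rho>i\<bar>"
      then have "\<bar>Err \<rho>i \<rho>j x e\<bar> * (s - 1) \<le> PJ + QI" "\<bar>x\<bar> + \<bar>x + e\<bar> = \<bar>e\<bar>"
        using s0 by (auto simp: PJ_def QI_def distrib_right[symmetric] simp del: mult_le_cancel_right intro!: mult_right_mono)
      then show ?thesis using * assms by linarith
    qed
  qed
  then show ?thesis by (rule pos_le_divide_eq[OF s0, THEN iffD2])
qed

text \<open>If \<open>\<rho>j\<close> is nearly maximal the gain comes from the smaller errors \<open>x\<close> and \<open>e\<close>. Nothing better than the crude bound on \<open>e\<close> is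
  needed when \<open>\<rho>i\<close> is not of the same order, nor when \<open>e\<close> is negative and \<open>D\<close> is large: then the slope of \<open>H\<close> at \<open>\<rho>i\<close>, respectively at
  \<open>\<rho>i exp e\<close>, is smaller.\<close>

lemma Err_top:
  assumes D: "0 < D" "\<bar>x\<bar> \<le> (92/100) * D" "x \<le> (26/1000)" "\<bar>e\<bar> \<le> (10026/10000) * D"
    and big: "(6/10) / s \<le> \<rho>i \<Longrightarrow> e \<le> (9/10) * D" "(6/10) / s \<le> \<rho>i \<Longrightarrow> D \<le> 1 / 2 \<Longrightarrow> - (9/10) * D \<le> e"
  shows "\<bar>Err \<rho>i \<rho>j x e\<bar> \<le> (99/100) * D / (s - 1)"
proof -
  define PJ BI QI where "PJ = \<bar>H (\<rho>j * exp x) - H \<rho>j\<bar> * (s - 1)"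
    and "BI = \<bar>H (\<rho>i * exp e) - H \<rho>i\<bar> * (s - 1)"
    and "QI = \<bar>H (\<rho>i * exp (x + e)) - H \<rho>i\<bar> * (s - 1)"
  have s0: "0 < s - 1" using s by simp
  have PJ: "PJ \<le> \<bar>x\<bar>" using PJ_gain[of 1] rj unfolding PJ_def by (simp add: min_le_iff_disj)
  have BI1: "BI \<le> \<bar>e\<bar>" using BI_gain[of 1] ri unfolding BI_def by (simp add: min_le_iff_disj)
  have QI1: "QI \<le> \<bar>x + e\<bar>" using QI_gain[of 1] ri unfolding QI_def by (simp add: min_le_iff_disj)
  have small: "\<rho>i * exp z \<le> t / s" if "exp z \<le> t" "0 \<le> t" for z t
    using mult_mono[OF ri(2) that(1)] s by simp
  have "BI \<le> (99/100) * D \<and> (\<bar>x\<bar> + \<bar>x + e\<bar> = \<bar>e\<bar> \<longrightarrow> x * e \<le> 0 \<longrightarrow> PJ + QI \<le> (99/100) * D)"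
  proof (cases "(6/10) / s \<le> \<rho>i")
    case False
    then have BI8: "BI \<le> (8/10) * \<bar>e\<bar>" and "QI \<le> (8/10) * \<bar>x + e\<bar>"
      using BI_gain[of "(6/10)"] QI_gain[of "(6/10)"] unfolding BI_def QI_def by auto
    then have "PJ + QI \<le> (99/100) * D" if "\<bar>x\<bar> + \<bar>x + e\<bar> = \<bar>e\<bar>"
      using lin_mixed[OF PJ order_trans[OF \<open>QI \<le> (8/10) * \<bar>x + e\<bar>\<close>] that D(2,4,1)] by simp
    then show ?thesis using BI8 D(1,4) by simp
  next
    case True
    show ?thesis
    proof (cases "\<bar>e\<bar> \<le> (9/10) * D")
      case True
      then show ?thesis using D BI1 QI1 PJ by (intro conjI impI) linarith+
    next
      case False
      then have e: "e < - (9/10) * D" and D2: "1 / 2 < D" using big[OF True] by linarith+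
      have e45: "e \<le> - (45/100)" using e D2 by linarith
      have up: "exp z \<le> 1 / (1 + y + y\<^sup>2 / 2)" if "z \<le> - y" "0 \<le> y" for z y :: real
      proof -
        have "exp z \<le> exp (- y)" using that by simp
        also have "\<dots> = 1 / exp y" by (simp add: exp_minus field_simps)
        also have "\<dots> \<le> 1 / (1 + y + y\<^sup>2 / 2)"
          using exp_lower_Taylor_quadratic[OF that(2)] that(2) by (intro divide_left_mono) (auto intro!: mult_pos_pos add_pos_nonneg)
        finally show ?thesis .
      qed
      have "exp e \<le> (66/100)" using up[OF e45] by (simp add: power2_eq_square)
      then have "BI \<le> (83/100) * \<bar>e\<bar>"
        using BI_gain[of "(66/100)"] small[of e "(66/100)"] unfolding BI_def by (simp add: min_le_iff_disj)
      moreover have "PJ + QI \<le> (99/100) * D" if "\<bar>x\<bar> + \<bar>x + e\<bar> = \<bar>e\<bar>" "x * e \<le> 0"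
      proof -
        have x0: "0 \<le> x" using that(2) e45 by (simp add: mult_le_0_iff)
        have "x + e \<le> - (424/1000)" using e45 D(3) by linarith
        then have "exp (x + e) \<le> (68/100)" using up[of "x + e" "(424/1000)"] by (simp add: power2_eq_square)
        then have "QI \<le> (84/100) * \<bar>x + e\<bar>"
          using QI_gain[of "(68/100)"] small[of "x + e" "(68/100)"] unfolding QI_def by (simp add: min_le_iff_disj)
        then show ?thesis using lin_mixed[OF PJ _ that(1) D(2,4,1)] by simp
      qed
      ultimately show ?thesis using D by (intro conjI impI) (linarith, blast)
    qed
  qed
  then have *: "BI \<le> (99/100) * D" "\<bar>x\<bar> + \<bar>x + e\<bar> = \<bar>e\<bar> \<Longrightarrow> x * e \<le> 0 \<Longrightarrow> PJ + QI \<le> (99/100) * D" by auto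
  have "\<bar>Err \<rho>i \<rho>j x e\<bar> * (s - 1) \<le> (99/100) * D"
    using Err_cases
  proof
    assume "\<bar>Err \<rho>i \<rho>j x e\<bar> \<le> max \<bar>H (\<rho>j * exp x) - H \<rho>j\<bar> \<bar>H (\<rho>i * exp e) - H \<rho>i\<bar>"
    then have "\<bar>Err \<rho>i \<rho>j x e\<bar> * (s - 1) \<le> max PJ BI"
      using s0 by (auto simp: PJ_def BI_def max_def split: if_splits intro: mult_right_mono order_trans)
    then show ?thesis using PJ * D by linarith
  next
    assume "\<bar>x\<bar> + \<bar>x + e\<bar> = \<bar>e\<bar> \<and> x * e \<le> 0 \<and>
      \<bar>Err \<rho>i \<rho>j x e\<bar> \<le> \<bar>H (\<rho>j * exp x) - H \<rho>j\<bar> + \<bar>H (\<rho>i * exp (x + e)) - H \<rho>i\<bar>"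
    then have "\<bar>Err \<rho>i \<rho>j x e\<bar> * (s - 1) \<le> PJ + QI" "\<bar>x\<bar> + \<bar>x + e\<bar> = \<bar>e\<bar>" "x * e \<le> 0"
      using s0 by (auto simp: PJ_def QI_def distrib_right[symmetric] simp del: mult_le_cancel_right intro!: mult_right_mono)
    then show ?thesis using * by linarith
  qed
  then show ?thesis by (rule pos_le_divide_eq[OF s0, THEN iffD2])
qed

end

section \<open>One vertex of the recursion\<close>

text \<open>The estimate of the normalising sum, corrected by the a priori bound on the marginal of colour \<open>j\<close>.\<close>

definition norm_est :: "nat \<Rightarrow> real \<Rightarrow> (nat \<Rightarrow> real) \<Rightarrow> (nat \<Rightarrow> nat \<Rightarrow> real) \<Rightarrow> nat \<Rightarrow> real" where
  "norm_est q s F R j = max (\<Sum>b<q. F b * R b j) (s * F j)"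

definition side :: "nat \<Rightarrow> real \<Rightarrow> real \<Rightarrow> (nat \<Rightarrow> real) \<Rightarrow> (nat \<Rightarrow> nat \<Rightarrow> real) \<Rightarrow> nat \<Rightarrow> nat \<Rightarrow> real" where
  "side q s c F R i j = (norm_est q s F R j - c * (F i * R i j)) / (norm_est q s F R j - c * F j)"

text \<open>The factor for colours \<open>i\<close> and \<open>j\<close> is computed relative to the colour that the estimates consider more likely. If the
  estimates are inconsistent about this, the two colours are almost equally likely and \<open>1\<close> will do.\<close>

definition fac :: "nat \<Rightarrow> real \<Rightarrow> real \<Rightarrow> (nat \<Rightarrow> real) \<Rightarrow> (nat \<Rightarrow> nat \<Rightarrow> real) \<Rightarrow> nat \<Rightarrow> nat \<Rightarrow> real" where
  "fac q s c F R i j = (if F i * R i j \<le> F j then side q s c F R i j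
     else if F j * R j i \<le> F i then 1 / side q s c F R j i else 1)"

text \<open>A vertex with true ratios \<open>\<tau> a / \<tau> b\<close> and estimated ratios \<open>R a b\<close>; \<open>F\<close> is the effect of its pins.\<close>

locale vertex =
  fixes q :: nat and s c :: real and F \<tau> :: "nat \<Rightarrow> real" and R :: "nat \<Rightarrow> nat \<Rightarrow> real"
  assumes s: "1 < s" and c: "0 \<le> c" "c \<le> 1"
    and F: "\<And>a. 0 \<le> F a" "\<And>a. F a \<le> 1"
    and \<tau>: "\<And>a. a < q \<Longrightarrow> 0 < \<tau> a"
    and R: "\<And>a b. a < q \<Longrightarrow> b < q \<Longrightarrow> 0 < R a b"
    and S_pos: "0 < (\<Sum>b<q. F b * \<tau> b)"
    and p_le: "\<And>a. a < q \<Longrightarrow> F a * \<tau> a / (\<Sum>b<q. F b * \<tau> b) \<le> 1 / s"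
begin

definition S where "S = (\<Sum>b<q. F b * \<tau> b)"
definition p where "p a = F a * \<tau> a / S"
definition \<rho> where "\<rho> a = c * p a"
definition e where "e a b = ln (R a b) - ln (\<tau> a / \<tau> b)"
definition xx where "xx j = ln (S / \<tau> j / norm_est q s F R j)"
definition err where "err i j = ln (fac q s c F R i j) - ln ((1 - \<rho> i) / (1 - \<rho> j))"

lemma S0: "0 < S" using S_pos by (simp add: S_def)

lemma p_nonneg: "a < q \<Longrightarrow> 0 \<le> p a"
  using F \<tau>[of a] S0 by (simp add: p_def)

lemma p_le': "a < q \<Longrightarrow> p a \<le> 1 / s" using p_le by (simp add: p_def S_def)

lemma \<rho>_range: "a < q \<Longrightarrow> 0 \<le> \<rho> a" "a < q \<Longrightarrow> \<rho> a \<le> p a" "a < q \<Longrightarrow> \<rho> a \<le> 1 / s"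
proof -
  assume a: "a < q"
  show "0 \<le> \<rho> a" using c p_nonneg[OF a] by (simp add: \<rho>_def)
  show "\<rho> a \<le> p a" using c p_nonneg[OF a] by (simp add: \<rho>_def mult_left_le_one_le)
  then show "\<rho> a \<le> 1 / s" using p_le'[OF a] by linarith
qed

lemma sum_p: "(\<Sum>a<q. p a) = 1"
  using S0 by (simp add: p_def sum_divide_distrib[symmetric]) (simp add: S_def)

lemma exp_e: "a < q \<Longrightarrow> b < q \<Longrightarrow> exp (e a b) = R a b * \<tau> b / \<tau> a"
  using R \<tau> by (simp add: e_def exp_diff)

lemma FR: "a < q \<Longrightarrow> j < q \<Longrightarrow> F a * R a j = p a * exp (e a j) * (S / \<tau> j)"
  using S0 \<tau>[of a] \<tau>[of j] by (simp add: p_def exp_e)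

lemma sum_FR: "j < q \<Longrightarrow> (\<Sum>b<q. F b * R b j) = (\<Sum>b<q. p b * exp (e b j)) * (S / \<tau> j)"
  unfolding sum_distrib_right by (intro sum.cong refl FR) auto

lemma sum_p_exp_pos:
  "0 < (\<Sum>b<q. p b * exp (e b j))"
proof -
  have "\<exists>a<q. 0 < p a"
  proof (rule ccontr)
    assume "\<not> (\<exists>a<q. 0 < p a)"
    then have "(\<Sum>a<q. p a) \<le> 0" by (intro sum_nonpos) force
    then show False using sum_p by simp
  qed
  then obtain a where "a < q" "0 < p a" by blast
  then show ?thesis using p_nonneg by (intro sum_pos2[of _ a]) auto
qed

lemma norm_pos: "j < q \<Longrightarrow> 0 < norm_est q s F R j"
proof -
  assume j: "j < q"
  have "0 < (\<Sum>b<q. F b * R b j)"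
    unfolding sum_FR[OF j] using S0 \<tau>[OF j] sum_p_exp_pos by simp
  then show ?thesis by (simp add: norm_est_def)
qed

lemma exp_xx: "j < q \<Longrightarrow> exp (xx j) = S / \<tau> j / norm_est q s F R j"
  using norm_pos S0 \<tau> by (simp add: xx_def)

lemma p_hat: "a < q \<Longrightarrow> j < q \<Longrightarrow> F a * R a j / norm_est q s F R j = p a * exp (xx j + e a j)"
  by (simp add: FR exp_add exp_xx)

lemma p_hat_base: "j < q \<Longrightarrow> F j / norm_est q s F R j = p j * exp (xx j)"
  using S0 \<tau>[of j] by (simp add: p_def exp_xx)

lemma p_hat_le: "j < q \<Longrightarrow> p j * exp (xx j) \<le> 1 / s"
proof -
  assume j: "j < q"
  have "s * F j \<le> norm_est q s F R j" by (simp add: norm_est_def)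
  then show ?thesis using s norm_pos[OF j] unfolding p_hat_base[OF j, symmetric] by (simp add: field_simps)
qed

text \<open>The estimated normalisation is an average of true quantities distorted by factors in \<open>[exp (- E), exp E]\<close>; by the
  a priori bound the correction in \<open>norm_est\<close> only moves it towards the truth.\<close>

lemma xx_le:
  assumes j: "j < q" and E: "\<And>b. b < q \<Longrightarrow> \<bar>e b j\<bar> \<le> E"
  shows "\<bar>xx j\<bar> \<le> E"
proof -
  have up: "(\<Sum>b<q. p b * exp (e b j)) \<le> exp E"
  proof -
    have "(\<Sum>b<q. p b * exp (e b j)) \<le> (\<Sum>b<q. p b * exp E)"
      using E p_nonneg by (intro sum_mono mult_left_mono) force+
    then show ?thesis by (simp add: sum_distrib_right[symmetric] sum_p)
  qed
  have lo: "exp (- E) \<le> (\<Sum>b<q. p b * exp (e b j))"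
  proof -
    have "(\<Sum>b<q. p b * exp (- E)) \<le> (\<Sum>b<q. p b * exp (e b j))"
      using E p_nonneg by (intro sum_mono mult_left_mono) force+
    then show ?thesis by (simp add: sum_distrib_right[symmetric] sum_p)
  qed
  have St: "0 < S / \<tau> j" using S0 \<tau>[OF j] by simp
  have sF: "s * F j \<le> S / \<tau> j"
    using p_le'[OF j] s S0 \<tau>[OF j] unfolding p_def by (simp add: field_simps)
  have E0: "0 \<le> E" using E[OF j] by linarith
  have "norm_est q s F R j \<le> exp E * (S / \<tau> j)"
  proof -
    have "S / \<tau> j \<le> exp E * (S / \<tau> j)" using mult_right_mono[of 1 "exp E" "S / \<tau> j"] St E0 by simp
    moreover have "(\<Sum>b<q. F b * R b j) \<le> exp E * (S / \<tau> j)"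
      unfolding sum_FR[OF j] using up St by (intro mult_right_mono) auto
    ultimately show ?thesis using sF unfolding norm_est_def by linarith
  qed
  moreover have "exp (- E) * (S / \<tau> j) \<le> norm_est q s F R j"
  proof -
    have "exp (- E) * (S / \<tau> j) \<le> (\<Sum>b<q. F b * R b j)"
      unfolding sum_FR[OF j] using lo St by (intro mult_right_mono) auto
    then show ?thesis by (simp add: norm_est_def)
  qed
  ultimately have N: "norm_est q s F R j \<le> exp E * (S / \<tau> j)" "exp (- E) * (S / \<tau> j) \<le> norm_est q s F R j" by auto
  have "exp (- E) * norm_est q s F R j \<le> S / \<tau> j"
    using mult_left_mono[OF N(1), of "exp (- E)"] unfolding mult.assoc[symmetric] exp_add[symmetric] by simp
  then have "exp (- E) \<le> exp (xx j)"
    unfolding exp_xx[OF j] by (rule pos_le_divide_eq[OF norm_pos[OF j], THEN iffD2])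
  have "S / \<tau> j \<le> exp E * norm_est q s F R j"
    using mult_left_mono[OF N(2), of "exp E"] unfolding mult.assoc[symmetric] exp_add[symmetric] by simp
  then have "exp (xx j) \<le> exp E"
    unfolding exp_xx[OF j] by (rule pos_divide_le_eq[OF norm_pos[OF j], THEN iffD2])
  then show ?thesis using \<open>exp (- E) \<le> exp (xx j)\<close> by auto
qed

lemma two_colours:
  assumes "i < q" "j < q" "F i * R i j \<le> F j"
  shows "two_colours s (\<rho> i) (\<rho> j) (xx j) (e i j)"
proof
  show "\<rho> j * exp (xx j) \<le> 1 / s"
  proof -
    have "\<rho> j * exp (xx j) \<le> p j * exp (xx j)" using \<rho>_range(2)[OF assms(2)] by simp
    then show ?thesis using p_hat_le[OF assms(2)] by linarith
  qed
  show "\<rho> i * exp (e i j) \<le> \<rho> j"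
  proof -
    have "p i * exp (e i j) * (S / \<tau> j) \<le> p j * (S / \<tau> j)"
      unfolding FR[OF assms(1,2), symmetric] using assms(3) S0 \<tau>[OF assms(2)] by (simp add: p_def)
    then have "p i * exp (e i j) \<le> p j" using S0 \<tau>[OF assms(2)] by (simp add: divide_right_mono divide_le_cancel)
    then show ?thesis using mult_left_mono[of "p i * exp (e i j)" "p j" c] c by (simp add: \<rho>_def mult_ac)
  qed
qed (use s \<rho>_range assms in auto)

lemma base_err:
  assumes "i < q" "j < q" "F i * R i j \<le> F j"
  shows "ln (side q s c F R i j) - ln ((1 - \<rho> i) / (1 - \<rho> j)) = Err (\<rho> i) (\<rho> j) (xx j) (e i j)"
proof -
  interpret two_colours s "\<rho> i" "\<rho> j" "xx j" "e i j" by (rule two_colours[OF assms])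
  have N: "0 < norm_est q s F R j" by (rule norm_pos[OF assms(2)])
  have i: "c * (F i * R i j) / norm_est q s F R j = \<rho> i * exp (xx j + e i j)"
  proof -
    have "c * (F i * R i j) / norm_est q s F R j = c * (F i * R i j / norm_est q s F R j)" by simp
    then show ?thesis unfolding p_hat[OF assms(1,2)] by (simp add: \<rho>_def)
  qed
  have j: "c * F j / norm_est q s F R j = \<rho> j * exp (xx j)"
    unfolding times_divide_eq_right[symmetric] p_hat_base[OF assms(2)] by (simp add: \<rho>_def)
  have "side q s c F R i j = (1 - c * (F i * R i j) / norm_est q s F R j) / (1 - c * F j / norm_est q s F R j)"
  proof -
    have *: "N - a = N * (1 - a / N)" if "0 < N" for N a :: real using that by (simp add: algebra_simps)
    show ?thesis unfolding side_def
      by (subst (1 2) *[OF N]) (use N in simp)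
  qed
  then have sd: "side q s c F R i j = (1 - \<rho> i * exp (xx j + e i j)) / (1 - \<rho> j * exp (xx j))"
    unfolding i j .
  have "\<rho> i * exp (xx j + e i j) < 1" "\<rho> j * exp (xx j) < 1" "\<rho> i < 1" "\<rho> j < 1"
    using xi xj s1 ri rj by linarith+
  then show ?thesis unfolding sd by (simp add: ln_div Err_def H_def)
qed

lemma err_base: "i < q \<Longrightarrow> j < q \<Longrightarrow> F i * R i j \<le> F j \<Longrightarrow> err i j = Err (\<rho> i) (\<rho> j) (xx j) (e i j)"
  using base_err by (simp add: err_def fac_def)

lemma \<rho>_less1: "a < q \<Longrightarrow> \<rho> a < 1"
  using \<rho>_range(3)[of a] s by (smt (verit) divide_less_eq_1)

lemma err_base':
  assumes "i < q" "j < q" "\<not> F i * R i j \<le> F j" "F j * R j i \<le> F i"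
  shows "err i j = - Err (\<rho> j) (\<rho> i) (xx i) (e j i)"
proof -
  have "err i j = ln (1 / side q s c F R j i) - ln ((1 - \<rho> i) / (1 - \<rho> j))"
    using assms by (simp add: err_def fac_def)
  also have "ln (1 / side q s c F R j i) = - ln (side q s c F R j i)"
    by (simp add: inverse_eq_divide[symmetric] ln_inverse)
  also have "ln ((1 - \<rho> i) / (1 - \<rho> j)) = - ln ((1 - \<rho> j) / (1 - \<rho> i))"
    using \<rho>_less1 assms by (simp add: ln_div)
  finally show ?thesis using base_err[OF assms(2,1,4)] by simp
qed

text \<open>Both tests failed, so the estimates say that each colour is the more likely one; the true ratio therefore lies within the
  errors of the two estimates.\<close>

lemma err_tie:
  assumes "i < q" "j < q" "\<not> F i * R i j \<le> F j" "\<not> F j * R j i \<le> F i"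
  obtains y where "\<rho> i = \<rho> j * exp y" "- e i j < y" "y < e j i" "err i j = H (\<rho> i) - H (\<rho> j)"
proof -
  have Fi: "0 < F i" using assms F(1)[of i] F(1)[of j] by (cases "F i = 0") auto
  have Fj: "0 < F j" using assms F(1)[of j] F(1)[of i] by (cases "F j = 0") auto
  define y where "y = ln (F i * \<tau> i / (F j * \<tau> j))"
  note t = \<tau>[OF assms(1)] \<tau>[OF assms(2)]
  have "p i = p j * exp y" using Fi Fj t by (simp add: y_def p_def)
  then have 1: "\<rho> i = \<rho> j * exp y" by (simp add: \<rho>_def)
  have yy: "y = ln (F i) + ln (\<tau> i) - ln (F j) - ln (\<tau> j)" using Fi Fj t by (simp add: y_def ln_div ln_mult)
  have "ln (F j) < ln (F i * R i j)" using assms Fj by simp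
  then have 2: "- e i j < y" using Fi R[OF assms(1,2)] t by (simp add: yy e_def ln_mult ln_div)
  have "ln (F i) < ln (F j * R j i)" using assms Fi by simp
  then have 3: "y < e j i" using Fj R[OF assms(2,1)] t by (simp add: yy e_def ln_mult ln_div)
  have "err i j = H (\<rho> i) - H (\<rho> j)" using assms \<rho>_less1[OF assms(1)] \<rho>_less1[OF assms(2)]
    by (simp add: err_def fac_def ln_div H_def)
  then show thesis using 1 2 3 that by blast
qed

lemma tie_gain:
  assumes "i < q" "j < q" "\<rho> i = \<rho> j * exp y" "min (\<rho> i) (\<rho> j) \<le> \<theta> / s"
  shows "\<bar>H (\<rho> i) - H (\<rho> j)\<bar> \<le> (1 + \<theta>) / 2 * \<bar>y\<bar> / (s - 1)"
  unfolding assms(3)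
  by (rule H_gain_abs) (use assms(4) \<rho>_range(1,3)[OF assms(2)] \<rho>_range(3)[OF assms(1)] s in \<open>simp_all add: assms(3)[symmetric] min.commute\<close>)

lemma err_crude:
  assumes ij: "i < q" "j < q" and E: "\<And>a b. a < q \<Longrightarrow> b < q \<Longrightarrow> \<bar>e a b\<bar> \<le> E"
  shows "\<bar>err i j\<bar> \<le> E / (s - 1)"
proof -
  consider (bs) "F i * R i j \<le> F j" | (bs') "\<not> F i * R i j \<le> F j" "F j * R j i \<le> F i"
    | (tie) "\<not> F i * R i j \<le> F j" "\<not> F j * R j i \<le> F i" by blast
  then show ?thesis
  proof cases
    case bs
    interpret two_colours s "\<rho> i" "\<rho> j" "xx j" "e i j" by (rule two_colours[OF ij bs])
    show ?thesis unfolding err_base[OF ij bs] using Err_crude xx_le E ij by blast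
  next
    case bs'
    interpret two_colours s "\<rho> j" "\<rho> i" "xx i" "e j i" by (rule two_colours[OF ij(2,1) bs'(2)])
    show ?thesis unfolding err_base'[OF ij bs'] abs_minus_cancel using Err_crude xx_le E ij by blast
  next
    case tie
    from err_tie[OF ij tie] obtain y where y: "\<rho> i = \<rho> j * exp y" "- e i j < y" "y < e j i" "err i j = H (\<rho> i) - H (\<rho> j)" .
    have "\<bar>err i j\<bar> \<le> \<bar>y\<bar> / (s - 1)"
      using tie_gain[OF ij y(1), of 1] \<rho>_range(3)[OF ij(2)] unfolding y(4) by (simp add: min_le_iff_disj)
    also have "\<dots> \<le> E / (s - 1)" using E[OF ij] E[OF ij(2,1)] y s by (intro divide_right_mono) auto
    finally show ?thesis .
  qed
qed

lemma err_upper: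
  assumes ij: "i < q" "j < q" and E: "\<And>a b. a < q \<Longrightarrow> b < q \<Longrightarrow> \<bar>e a b\<bar> \<le> E"
  shows "err i j \<le> s / (s - 1) * (\<rho> i * E + \<rho> j * (exp E - 1))"
    and "- err i j \<le> s / (s - 1) * (\<rho> j * E + \<rho> i * (exp E - 1))"
proof -
  have "err i j \<le> s / (s - 1) * (\<rho> i * E + \<rho> j * (exp E - 1)) \<and> - err i j \<le> s / (s - 1) * (\<rho> j * E + \<rho> i * (exp E - 1))"
  proof -
    consider (bs) "F i * R i j \<le> F j" | (bs') "\<not> F i * R i j \<le> F j" "F j * R j i \<le> F i"
      | (tie) "\<not> F i * R i j \<le> F j" "\<not> F j * R j i \<le> F i" by blast
    then show ?thesis
    proof cases
      case bs
      interpret two_colours s "\<rho> i" "\<rho> j" "xx j" "e i j" by (rule two_colours[OF ij bs])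
      show ?thesis unfolding err_base[OF ij bs] using Err_upper xx_le E ij by blast
    next
      case bs'
      interpret two_colours s "\<rho> j" "\<rho> i" "xx i" "e j i" by (rule two_colours[OF ij(2,1) bs'(2)])
      have "\<bar>xx i\<bar> \<le> E" "\<bar>e j i\<bar> \<le> E" using xx_le E ij by blast+
      from Err_upper[OF this] show ?thesis unfolding err_base'[OF ij bs'] by simp
    next
      case tie
      from err_tie[OF ij tie] obtain y where y: "\<rho> i = \<rho> j * exp y" "- e i j < y" "y < e j i" "err i j = H (\<rho> i) - H (\<rho> j)" .
      have yE: "\<bar>y\<bar> \<le> E" using E[OF ij] E[OF ij(2,1)] y by linarith
      have K: "0 \<le> s / (s - 1)" using s by simp
      have r: "0 \<le> \<rho> i" "0 \<le> \<rho> j" using \<rho>_range ij by auto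
      have E1: "0 \<le> E" "0 \<le> exp E - 1" using yE by auto
      have n: "0 \<le> s / (s - 1) * (\<rho> i * E + \<rho> j * (exp E - 1))" "0 \<le> s / (s - 1) * (\<rho> j * E + \<rho> i * (exp E - 1))"
        by (intro mult_nonneg_nonneg add_nonneg_nonneg K r E1)+
      have ex: "1 - exp z \<le> - z" for z :: real using exp_ge_add_one_self[of z] by linarith
      show ?thesis
      proof (cases "0 \<le> y")
        case True
        have le: "\<rho> j \<le> \<rho> i" using y(1) r True by (simp add: mult_le_cancel_left1)
        have "H (\<rho> i) - H (\<rho> j) \<le> (\<rho> i - \<rho> j) * (s / (s - 1))"
          by (rule H_diff_le[OF le \<rho>_range(3)[OF ij(1)] s])
        also have "\<rho> i - \<rho> j = \<rho> i * (1 - exp (- y))" using y(1) by (simp add: algebra_simps exp_minus)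
        also have "\<rho> i * (1 - exp (- y)) * (s / (s - 1)) \<le> (\<rho> i * E + \<rho> j * (exp E - 1)) * (s / (s - 1))"
        proof (rule mult_right_mono[OF _ K])
          have "\<rho> i * (1 - exp (- y)) \<le> \<rho> i * E" using ex[of "- y"] yE r by (intro mult_left_mono) auto
          moreover have "0 \<le> \<rho> j * (exp E - 1)" using r E1 by simp
          ultimately show "\<rho> i * (1 - exp (- y)) \<le> \<rho> i * E + \<rho> j * (exp E - 1)" by linarith
        qed
        finally show ?thesis using n(2) H_mono[OF le \<rho>_less1[OF ij(1)]] unfolding y(4) by (simp add: mult.commute)
      next
        case False
        have le: "\<rho> i \<le> \<rho> j" using y(1) r False by (simp add: mult_left_le)
        have "H (\<rho> j) - H (\<rho> i) \<le> (\<rho> j - \<rho> i) * (s / (s - 1))"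
          by (rule H_diff_le[OF le \<rho>_range(3)[OF ij(2)] s])
        also have "\<rho> j - \<rho> i = \<rho> j * (1 - exp y)" using y(1) by (simp add: algebra_simps)
        also have "\<rho> j * (1 - exp y) * (s / (s - 1)) \<le> (\<rho> j * E + \<rho> i * (exp E - 1)) * (s / (s - 1))"
        proof (rule mult_right_mono[OF _ K])
          have "\<rho> j * (1 - exp y) \<le> \<rho> j * E" using ex[of y] yE r by (intro mult_left_mono) auto
          moreover have "0 \<le> \<rho> i * (exp E - 1)" using r E1 by simp
          ultimately show "\<rho> j * (1 - exp y) \<le> \<rho> j * E + \<rho> i * (exp E - 1)" by linarith
        qed
        finally show ?thesis using n(1) H_mono[OF le \<rho>_less1[OF ij(2)]] unfolding y(4) by (simp add: mult.commute)
      qed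
    qed
  qed
  then show "err i j \<le> s / (s - 1) * (\<rho> i * E + \<rho> j * (exp E - 1))"
    and "- err i j \<le> s / (s - 1) * (\<rho> j * E + \<rho> i * (exp E - 1))" by auto
qed

text \<open>The smaller errors that one application of the recursion guarantees: for a colour \<open>j\<close> of nearly maximal marginal,
  the normalisation and the ratios with respect to \<open>j\<close> of the frequent colours are more precise than \<open>D\<close>. The numbers are not optimised.\<close>

definition sharp :: "real \<Rightarrow> bool" where
  "sharp D \<longleftrightarrow> (\<forall>a<q. \<forall>b<q. \<bar>e a b\<bar> \<le> (10026/10000) * D) \<and>
     (\<forall>j<q. (975/1000) / s < \<rho> j \<longrightarrow> \<bar>xx j\<bar> \<le> (92/100) * D \<and>
        (\<forall>i<q. (6/10) / s \<le> \<rho> i \<longrightarrow> e i j \<le> (9/10) * D \<and> (D \<le> 1 / 2 \<longrightarrow> - (9/10) * D \<le> e i j)))"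

text \<open>The a priori bound keeps the estimated marginal below \<open>1 / s\<close>, so a marginal that is nearly maximal leaves no room.\<close>

lemma xx_top: "j < q \<Longrightarrow> (975/1000) / s < \<rho> j \<Longrightarrow> xx j \<le> 26/1000"
proof -
  assume j: "j < q" and top: "(975/1000) / s < \<rho> j"
  have "(975/1000) / s * exp (xx j) \<le> p j * exp (xx j)"
    using top \<rho>_range(2)[OF j] by (intro mult_right_mono) auto
  also have "\<dots> \<le> 1 / s" by (rule p_hat_le[OF j])
  finally have "exp (xx j) \<le> 1000 / 975" using s by (simp add: field_simps)
  then show ?thesis using exp_ge_add_one_self[of "xx j"] by linarith
qed

lemma base_refined:
  assumes ij: "i < q" "j < q" and bs: "F i * R i j \<le> F j" and sh: "sharp D" and D: "0 < D"
  shows "\<bar>Err (\<rho> i) (\<rho> j) (xx j) (e i j)\<bar> \<le> (9965/10000) * D / (s - 1)"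
proof -
  interpret two_colours s "\<rho> i" "\<rho> j" "xx j" "e i j" by (rule two_colours[OF ij bs])
  have e: "\<And>a b. a < q \<Longrightarrow> b < q \<Longrightarrow> \<bar>e a b\<bar> \<le> (10026/10000) * D" using sh by (simp add: sharp_def)
  have x: "\<bar>xx j\<bar> \<le> (10026/10000) * D" using xx_le e ij by blast
  show ?thesis
  proof (cases "\<rho> j \<le> (975/1000) / s")
    case True
    have "\<bar>Err (\<rho> i) (\<rho> j) (xx j) (e i j)\<bar> \<le> (99375/100000) * ((10026/10000) * D) / (s - 1)"
      by (rule Err_not_top[OF x e[OF ij] True])
    also have "\<dots> \<le> (9965/10000) * D / (s - 1)" using s D by (intro divide_right_mono) auto
    finally show ?thesis .
  next
    case False
    then have top: "(975/1000) / s < \<rho> j" by simp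
    have "\<bar>Err (\<rho> i) (\<rho> j) (xx j) (e i j)\<bar> \<le> (99/100) * D / (s - 1)"
      by (rule Err_top[OF D _ xx_top[OF ij(2) top] e[OF ij]]) (use sh top ij in \<open>auto simp: sharp_def\<close>)
    also have "\<dots> \<le> (9965/10000) * D / (s - 1)" using s D by (intro divide_right_mono) auto
    finally show ?thesis .
  qed
qed

lemma err_refined:
  assumes ij: "i < q" "j < q" and sh: "sharp D" and D: "0 < D"
  shows "\<bar>err i j\<bar> \<le> (9965/10000) * D / (s - 1)"
proof -
  consider (bs) "F i * R i j \<le> F j" | (bs') "\<not> F i * R i j \<le> F j" "F j * R j i \<le> F i"
    | (tie) "\<not> F i * R i j \<le> F j" "\<not> F j * R j i \<le> F i" by blast
  then show ?thesis
  proof cases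
    case bs
    then show ?thesis unfolding err_base[OF ij bs] by (rule base_refined[OF ij _ sh D])
  next
    case bs'
    then show ?thesis unfolding err_base'[OF ij bs'] abs_minus_cancel by (intro base_refined[OF ij(2,1) _ sh D])
  next
    case tie
    from err_tie[OF ij tie] obtain y where y: "\<rho> i = \<rho> j * exp y" "- e i j < y" "y < e j i" "err i j = H (\<rho> i) - H (\<rho> j)" .
    have e: "\<And>a b. a < q \<Longrightarrow> b < q \<Longrightarrow> \<bar>e a b\<bar> \<le> (10026/10000) * D" using sh by (simp add: sharp_def)
    have "\<bar>H (\<rho> i) - H (\<rho> j)\<bar> * (s - 1) \<le> (9965/10000) * D"
    proof (cases "min (\<rho> i) (\<rho> j) \<le> (975/1000) / s")
      case True
      have "\<bar>H (\<rho> i) - H (\<rho> j)\<bar> \<le> (1 + 975/1000) / 2 * \<bar>y\<bar> / (s - 1)"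
        by (rule tie_gain[OF ij y(1) True])
      then have "\<bar>H (\<rho> i) - H (\<rho> j)\<bar> * (s - 1) \<le> (1 + 975/1000) / 2 * \<bar>y\<bar>" using s by (simp only: pos_le_divide_eq)
      moreover have "\<bar>y\<bar> \<le> (10026/10000) * D" using e[OF ij] e[OF ij(2,1)] y(2,3) by linarith
      ultimately show ?thesis using D by simp
    next
      case False
      then have top: "(975/1000) / s < \<rho> i" "(975/1000) / s < \<rho> j" by auto
      moreover have "(6/10) / s \<le> (975/1000) / s" using s by (intro divide_right_mono) auto
      ultimately have "(6/10) / s \<le> \<rho> i" "(6/10) / s \<le> \<rho> j" by linarith+
      then have "e i j \<le> (9/10) * D" "e j i \<le> (9/10) * D" using sh top ij unfolding sharp_def by blast+
      moreover have "\<bar>H (\<rho> i) - H (\<rho> j)\<bar> \<le> \<bar>y\<bar> / (s - 1)"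
        using tie_gain[OF ij y(1), of 1] \<rho>_range(3)[OF ij(2)] by (simp add: min_le_iff_disj)
      then have "\<bar>H (\<rho> i) - H (\<rho> j)\<bar> * (s - 1) \<le> \<bar>y\<bar>" using s by (simp only: pos_le_divide_eq)
      ultimately show ?thesis using y(2,3) D by linarith
    qed
    then show ?thesis unfolding y(4) using s by (simp only: pos_le_divide_eq)
  qed
qed

end

section \<open>Numerical estimates\<close>

lemma exp_convex_interp:
  fixes u \<theta> :: real assumes "0 \<le> \<theta>" "\<theta> \<le> 1"
  shows "exp (\<theta> * u) \<le> 1 + \<theta> * (exp u - 1)"
proof -
  have "exp (\<theta> * u) * (1 + (1 - \<theta>) * u) \<le> exp (\<theta> * u) * exp ((1 - \<theta>) * u)"
    using exp_ge_add_one_self[of "(1 - \<theta>) * u"] by (intro mult_left_mono) auto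
  also have "\<dots> = exp u" by (simp add: exp_add[symmetric] algebra_simps)
  finally have 1: "\<theta> * (exp (\<theta> * u) * (1 + (1 - \<theta>) * u)) \<le> \<theta> * exp u" using assms by (intro mult_left_mono)
  have "exp (\<theta> * u) * (1 - \<theta> * u) \<le> exp (\<theta> * u) * exp (- (\<theta> * u))"
    using exp_ge_add_one_self[of "- (\<theta> * u)"] by (intro mult_left_mono) auto
  also have "\<dots> = 1" by (simp add: exp_add[symmetric])
  finally have 2: "(1 - \<theta>) * (exp (\<theta> * u) * (1 - \<theta> * u)) \<le> (1 - \<theta>) * 1" using assms by (intro mult_left_mono) auto
  have "\<theta> * (exp (\<theta> * u) * (1 + (1 - \<theta>) * u)) + (1 - \<theta>) * (exp (\<theta> * u) * (1 - \<theta> * u)) = exp (\<theta> * u)"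
    by (simp add: algebra_simps)
  then show ?thesis using 1 2 by (simp add: algebra_simps)
qed

text \<open>Taylor's formula with a remainder that is good enough up to \<open>1.01\<close>, the largest initial error of the recursion.\<close>

lemma exp_upper_poly:
  fixes D :: real assumes "0 \<le> D" "D \<le> (101/100)"
  shows "exp D \<le> 1 + D + D^2/2 + D^3/6 + D^4/24 + D^5 * (31/1200)"
proof -
  obtain t where t: "\<bar>t\<bar> \<le> \<bar>D\<bar>" and eq: "exp D = (\<Sum>m<5. D ^ m / fact m) + exp t / fact 5 * D ^ 5"
    using Maclaurin_exp_le[of D 5] by blast
  have "exp t \<le> exp (101/100)" using t assms by simp
  also have "\<dots> = exp 1 * exp (1/100)" by (simp add: exp_add[symmetric])
  also have "\<dots> \<le> 3 * (1 + 1/100 + (1/100)^2)"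
    by (intro mult_mono exp_le exp_bound) auto
  also have "\<dots> \<le> 31/10" by (simp add: power2_eq_square)
  finally have "exp t / fact 5 * D ^ 5 \<le> (31/10) / fact 5 * D ^ 5"
    using assms by (intro mult_right_mono divide_right_mono) auto
  then show ?thesis unfolding eq by (simp add: numeral_eq_Suc)
qed

lemma exp_upper_175:
  fixes D :: real assumes "0 \<le> D" "D \<le> (101/100)"
  shows "exp D - 1 \<le> (175/100) * D"
proof -
  have p: "D ^ k \<le> (101/100) ^ k" for k using assms by (intro power_mono) auto
  have "exp D - 1 \<le> D * (1 + D/2 + D^2/6 + D^3/24 + D^4 * (31/1200))"
    using exp_upper_poly[OF assms] by (simp add: algebra_simps numeral_eq_Suc)
  also have "\<dots> \<le> D * (175/100)"
    using p[of 2] p[of 3] p[of 4] assms by (intro mult_left_mono) (simp_all add: field_simps)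
  finally show ?thesis by simp
qed

lemma exp_upper_131:
  fixes D :: real assumes "0 \<le> D" "D \<le> 1/2"
  shows "exp D - 1 \<le> (131/100) * D"
proof -
  have p: "D ^ k \<le> (1/2) ^ k" for k using assms by (intro power_mono) auto
  have "exp D - 1 \<le> D * (1 + D/2 + D^2/6 + D^3/24 + D^4 * (31/1200))"
    using exp_upper_poly[of D] assms by (simp add: algebra_simps numeral_eq_Suc)
  also have "\<dots> \<le> D * (131/100)"
    using p[of 2] p[of 3] p[of 4] assms by (intro mult_left_mono) (simp_all add: field_simps)
  finally show ?thesis by simp
qed

lemma exp_upper_103:
  fixes D :: real assumes "0 \<le> D" "D \<le> (3/100)"
  shows "exp D - 1 \<le> (103/100) * D"
proof -
  have "exp D - 1 \<le> D + D * D" using exp_bound[of D] assms by (simp add: power2_eq_square)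
  also have "\<dots> \<le> D + D * (3/100)" using assms by (intro add_left_mono mult_left_mono) auto
  finally show ?thesis by simp
qed

lemma ln_2_upper: "ln (20021/10000 :: real) \<le> 7/10"
proof -
  have "(20021/10000 :: real) \<le> (1 + 1091/100000) ^ 64" by (simp add: power_divide)
  then have "ln (20021/10000 :: real) \<le> ln ((1 + 1091/100000) ^ 64)" by (subst ln_le_cancel_iff) auto
  also have "\<dots> = 64 * ln (1 + 1091/100000)" by (subst ln_realpow) auto
  also have "\<dots> \<le> 64 * (1091/100000)" using ln_add_one_self_le_self2[of "1091/100000"] by auto
  finally show ?thesis by simp
qed

lemma ln_0585_upper: "- ln (585/1000 :: real) \<le> 574/1000"
proof -
  have "(1000/585 :: real) \<le> (1 + 1435/10000) ^ 4" by (simp add: power_divide)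
  then have "ln (1000/585 :: real) \<le> ln ((1 + 1435/10000) ^ 4)" by (subst ln_le_cancel_iff) auto
  also have "\<dots> = 4 * ln (1 + 1435/10000)" by (subst ln_realpow) auto
  also have "\<dots> \<le> 4 * (1435/10000)" using ln_add_one_self_le_self2[of "1435/10000"] by auto
  finally show ?thesis by (simp add: ln_div)
qed

section \<open>The normalising error\<close>

context vertex
begin

lemma exp_minus_xx: "j < q \<Longrightarrow> exp (- xx j) = max (\<Sum>b<q. p b * exp (e b j)) (s * p j)"
proof -
  assume j: "j < q"
  have St: "0 < S / \<tau> j" using S0 \<tau>[OF j] by simp
  have "exp (- xx j) = norm_est q s F R j / (S / \<tau> j)"
    unfolding exp_minus exp_xx[OF j] by simp
  also have "norm_est q s F R j = max ((\<Sum>b<q. p b * exp (e b j)) * (S / \<tau> j)) (s * p j * (S / \<tau> j))"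
    unfolding norm_est_def sum_FR[OF j] using S0 \<tau>[OF j] by (simp add: p_def)
  also have "\<dots> = max (\<Sum>b<q. p b * exp (e b j)) (s * p j) * (S / \<tau> j)"
  proof -
    have "max (x * c) (y * c) = max x y * c" if "0 < c" for x y c :: real
      using that by (simp add: max_mult_distrib_right)
    then show ?thesis using St by blast
  qed
  finally show ?thesis using S0 \<tau>[OF j] by simp
qed

text \<open>Jensen's inequality for the concave function \<open>x powr \<theta>\<close> takes \<open>\<theta>\<close> out of the exponential average.\<close>

lemma xx_lower:
  assumes j: "j < q" and \<theta>: "0 \<le> \<theta>" "\<theta> \<le> 1" and M: "\<And>b. b < q \<Longrightarrow> e b j \<le> \<theta> * M b"
    and Y: "(\<Sum>b<q. p b * exp (M b)) \<le> Y" "1 \<le> Y"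
  shows "- xx j \<le> \<theta> * ln Y"
proof -
  have "(\<Sum>b<q. p b * exp (e b j)) \<le> (\<Sum>b<q. p b * (exp (\<theta> * ln Y) * (1 + \<theta> * (exp (M b) / Y - 1))))"
  proof (intro sum_mono mult_left_mono)
    fix b assume "b \<in> {..<q}"
    then have "exp (e b j) \<le> exp (\<theta> * ln Y) * exp (\<theta> * (M b - ln Y))"
      using M by (simp add: exp_add[symmetric] algebra_simps)
    also have "\<dots> \<le> exp (\<theta> * ln Y) * (1 + \<theta> * (exp (M b - ln Y) - 1))"
      by (intro mult_left_mono exp_convex_interp \<theta>) auto
    also have "exp (M b - ln Y) = exp (M b) / Y" using Y by (simp add: exp_diff)
    finally show "exp (e b j) \<le> exp (\<theta> * ln Y) * (1 + \<theta> * (exp (M b) / Y - 1))" .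
  qed (use p_nonneg in auto)
  also have "\<dots> = exp (\<theta> * ln Y) * ((\<Sum>b<q. p b) * (1 - \<theta>) + \<theta> / Y * (\<Sum>b<q. p b * exp (M b)))"
    unfolding sum_distrib_left sum_distrib_right sum.distrib[symmetric]
    by (intro sum.cong refl) (simp add: algebra_simps)
  also have "\<dots> \<le> exp (\<theta> * ln Y) * (1 * (1 - \<theta>) + \<theta> / Y * Y)"
    unfolding sum_p using Y \<theta> by (intro mult_left_mono add_left_mono) auto
  also have "\<dots> = exp (\<theta> * ln Y)" using Y by simp
  finally have 1: "(\<Sum>b<q. p b * exp (e b j)) \<le> exp (\<theta> * ln Y)" .
  have "s * p j \<le> 1" using p_le'[OF j] s by (simp add: field_simps)
  moreover have "1 \<le> exp (\<theta> * ln Y)" using \<theta> Y by simp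
  ultimately have "exp (- xx j) \<le> exp (\<theta> * ln Y)" unfolding exp_minus_xx[OF j] using 1 by linarith
  then show ?thesis by simp
qed

text \<open>Jensen's inequality for the exponential function.\<close>

lemma xx_upper:
  assumes j: "j < q" and G: "\<And>b. b < q \<Longrightarrow> - e b j \<le> G b"
  shows "xx j \<le> (\<Sum>b<q. p b * G b)"
proof -
  define m where "m = (\<Sum>b<q. p b * e b j)"
  have "exp m * (1 + (m - m)) = (\<Sum>b<q. p b * (exp m * (1 + (e b j - m))))"
  proof -
    have "(\<Sum>b<q. p b * (exp m * (1 + (e b j - m)))) = exp m * ((\<Sum>b<q. p b) * (1 - m) + (\<Sum>b<q. p b * e b j))"
      unfolding sum_distrib_left sum_distrib_right sum.distrib[symmetric]
      by (intro sum.cong refl) (simp add: algebra_simps)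
    then show ?thesis unfolding sum_p m_def[symmetric] by simp
  qed
  also have "\<dots> \<le> (\<Sum>b<q. p b * exp (e b j))"
  proof (intro sum_mono mult_left_mono)
    fix b
    have "exp m * (1 + (e b j - m)) \<le> exp m * exp (e b j - m)"
      by (intro mult_left_mono exp_ge_add_one_self) auto
    then show "exp m * (1 + (e b j - m)) \<le> exp (e b j)" by (simp add: exp_add[symmetric])
  qed (use p_nonneg in auto)
  also have "\<dots> \<le> exp (- xx j)" unfolding exp_minus_xx[OF j] by simp
  finally have "m \<le> - xx j" by simp
  moreover have "- m \<le> (\<Sum>b<q. p b * G b)"
    unfolding m_def sum_negf[symmetric]
  proof (intro sum_mono)
    fix b assume "b \<in> {..<q}"
    then show "- (p b * e b j) \<le> p b * G b" using mult_left_mono[OF G p_nonneg, of b b] by simp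
  qed
  ultimately show ?thesis by linarith
qed

lemma sum_p_ln:
  assumes Y: "(\<Sum>b<q. p b * y b) \<le> Y" "0 < Y" and y: "\<And>b. b < q \<Longrightarrow> 0 < y b"
  shows "(\<Sum>b<q. p b * ln (y b)) \<le> ln Y"
proof -
  have "(\<Sum>b<q. p b * ln (y b)) \<le> (\<Sum>b<q. p b * (ln Y + (y b / Y - 1)))"
  proof (intro sum_mono mult_left_mono)
    fix b assume b: "b \<in> {..<q}"
    have "ln (y b / Y) \<le> y b / Y - 1" using y[of b] b Y by (intro ln_le_minus_one) auto
    then show "ln (y b) \<le> ln Y + (y b / Y - 1)" using y[of b] b Y by (simp add: ln_div)
  qed (use p_nonneg in auto)
  also have "\<dots> = (\<Sum>b<q. p b) * (ln Y - 1) + (\<Sum>b<q. p b * y b) / Y"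
    unfolding sum_distrib_right sum_divide_distrib sum.distrib[symmetric]
    by (intro sum.cong refl) (simp add: algebra_simps)
  also have "\<dots> \<le> ln Y" using Y unfolding sum_p by simp
  finally show ?thesis .
qed

end

section \<open>Contraction of the recursion\<close>

locale potts_tree = potts_model +
  fixes \<Delta> :: nat assumes \<Delta>: "\<Delta> < q"
begin

definition s where "s = real q - real \<Delta> + 1"

lemma s_gt: "1 < s" using \<Delta> by (simp add: s_def)

lemma Z_ge:
  assumes adm: "admissible \<Delta> U m" and v: "v \<in> U" and d: "deg U m v + 1 \<le> \<Delta>"
  shows "s * Z (U - {v}) m \<le> Z U m"
proof -
  have "(1 - w) * real (deg U m v) \<le> 1 * real (deg U m v)" using w_range by (intro mult_right_mono) auto
  then have "s \<le> real q - (1 - w) * real (deg U m v)" using d unfolding s_def by linarith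
  then show ?thesis
    by (rule order_trans[OF mult_right_mono[OF _ Z_nonneg] weight_sum_ge[OF admissible_finite[OF adm] v]])
qed

text \<open>The instances below the root.\<close>

definition proper where
  "proper U m v \<longleftrightarrow> admissible \<Delta> U m \<and> v \<in> U \<and> deg U m v + 1 \<le> \<Delta>"

definition positive where "positive R \<longleftrightarrow> (\<forall>a<q. \<forall>b<q. (0::real) < R a b)"

abbreviation F where "F m v \<equiv> \<lambda>a. w ^ m v a"
abbreviation T where "T U m v \<equiv> \<lambda>a. Z (U - {v}) (tilt (nb U v) a m)"

lemma T_pos: "admissible \<Delta> U m \<Longrightarrow> v \<in> U \<Longrightarrow> 0 < T U m v a"
  using Z_pos[OF admissible_tilt1[OF _ _ order_refl] \<Delta>] by blast

lemma vertex:
  assumes "proper U m v" "positive R"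
  shows "vertex q s (1 - w) (F m v) (T U m v) R"
proof
  have adm: "admissible \<Delta> U m" "v \<in> U" "deg U m v + 1 \<le> \<Delta>" using assms by (auto simp: proper_def)
  have S: "(\<Sum>b<q. w ^ m v b * T U m v b) = Z U m"
    using Z_remove[OF admissible_finite[OF adm(1)] adm(2)] by simp
  show "0 < (\<Sum>b<q. w ^ m v b * T U m v b)" unfolding S by (rule Z_pos[OF adm(1) \<Delta>])
  fix a
  show "w ^ m v a * T U m v a / (\<Sum>b<q. w ^ m v b * T U m v b) \<le> 1 / s"
    unfolding S s_def using marg_le[OF adm(1) \<Delta> adm(2,3), of a] by (simp add: marg_def weight_def)
  show "0 < T U m v a" by (rule T_pos[OF adm(1,2)])
qed (use s_gt w_range pow_w assms in \<open>auto simp: positive_def\<close>)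

lemma vertex_defs:
  assumes "proper U m v" "positive R"
  shows "vertex.\<rho> q (1 - w) (F m v) (T U m v) a = (1 - w) * marg U m v a"
    "vertex.p q (F m v) (T U m v) a = marg U m v a"
    "vertex.e (T U m v) R a b = ln (R a b) - ln (rat U m v a b)"
proof -
  interpret vertex q s "1 - w" "F m v" "T U m v" R by (rule vertex[OF assms])
  have "finite U" "v \<in> U" using assms admissible_finite by (auto simp: proper_def)
  then have "S = Z U m" using Z_remove[of U v m] by (simp add: S_def)
  then show "p a = marg U m v a" by (simp add: p_def marg_def weight_def)
  then show "\<rho> a = (1 - w) * marg U m v a" by (simp add: \<rho>_def)
  show "e a b = ln (R a b) - ln (rat U m v a b)" by (simp add: e_def rat_def)
qed

definition err_le where
  "err_le U m v R B \<longleftrightarrow> (\<forall>a<q. \<forall>b<q. \<bar>ln (R a b) - ln (rat U m v a b)\<bar> \<le> B)"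

abbreviation ch where "ch U v k \<equiv> nbl U v ! k"

lemma proper_child:
  assumes "admissible \<Delta> U m" "v \<in> U" "k < length (nbl U v)"
  shows "proper (U - {v}) (child U m v k i j) (ch U v k)"
  using admissible_child[OF assms] deg_child[OF assms] nbl_mem(2)[OF admissible_finite[OF assms(1)] assms(3)]
  by (simp add: proper_def)

definition cfac where
  "cfac U m v Rc k i j = fac q s (1 - w) (F (child U m v k i j) (ch U v k)) (Rc k i j) i j"

text \<open>\<open>R\<close> results from one step of the recursion applied to the estimates \<open>Rc\<close> of the children, up to a rounding
  error \<open>\<eta>\<close> of the logarithm.\<close>

definition computed where
  "computed U m v Rc R \<eta> \<longleftrightarrow> (\<forall>k<length (nbl U v). \<forall>i<q. \<forall>j<q. positive (Rc k i j)) \<and> positive R \<and>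
    (\<forall>i<q. \<forall>j<q. \<bar>ln (R i j) - (\<Sum>k<length (nbl U v). ln (cfac U m v Rc k i j))\<bar> \<le> \<eta>)"

definition rr where "rr U m v k i j a = (1 - w) * marg (U - {v}) (child U m v k i j) (ch U v k) a"

definition verr where
  "verr U m v Rc k i j = ln (cfac U m v Rc k i j) - ln ((1 - rr U m v k i j i) / (1 - rr U m v k i j j))"

lemma rr_range:
  assumes "admissible \<Delta> U m" "v \<in> U" "k < length (nbl U v)"
  shows "0 \<le> rr U m v k i j a" "rr U m v k i j a \<le> 1 / s" "rr U m v k i j a < 1"
proof -
  note p = proper_child[OF assms, of i j]
  have "marg (U - {v}) (child U m v k i j) (ch U v k) a \<le> 1 / s"
    using p marg_le[OF _ \<Delta>] unfolding proper_def s_def by blast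
  moreover have "rr U m v k i j a \<le> marg (U - {v}) (child U m v k i j) (ch U v k) a"
    unfolding rr_def using w_range marg_nonneg by (intro mult_left_le_one_le) auto
  ultimately show "rr U m v k i j a \<le> 1 / s" by linarith
  then show "rr U m v k i j a < 1" using s_gt by (smt (verit) divide_less_eq_1)
  show "0 \<le> rr U m v k i j a" using w_range marg_nonneg by (simp add: rr_def)
qed

lemma ln_rat:
  assumes "admissible \<Delta> U m" "v \<in> U" "i < q" "j < q"
  shows "ln (rat U m v i j) = (\<Sum>k<length (nbl U v). ln ((1 - rr U m v k i j i) / (1 - rr U m v k i j j)))"
  unfolding rat_telescope[OF assms(1) \<Delta> assms(2-4)] rr_def[symmetric]
proof (rule ln_prod)
  fix k assume "k \<in> {..<length (nbl U v)}"
  then have k: "k < length (nbl U v)" by simp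
  show "(1 - rr U m v k i j i) / (1 - rr U m v k i j j) \<noteq> 0"
    using rr_range(3)[OF assms(1,2) k, of i j i] rr_range(3)[OF assms(1,2) k, of i j j] by simp
qed simp

lemma ln_rat_H:
  assumes "admissible \<Delta> U m" "v \<in> U" "i < q" "j < q"
  shows "ln (rat U m v i j) = (\<Sum>k<length (nbl U v). H (rr U m v k i j j)) - (\<Sum>k<length (nbl U v). H (rr U m v k i j i))"
  unfolding ln_rat[OF assms] sum_subtractf[symmetric]
proof (intro sum.cong refl)
  fix k assume "k \<in> {..<length (nbl U v)}"
  then have k: "k < length (nbl U v)" by simp
  show "ln ((1 - rr U m v k i j i) / (1 - rr U m v k i j j)) = H (rr U m v k i j j) - H (rr U m v k i j i)"
    using rr_range(3)[OF assms(1,2) k, of i j i] rr_range(3)[OF assms(1,2) k, of i j j] by (simp add: ln_div H_def)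
qed

lemma abs_ln_rat_le:
  assumes "admissible \<Delta> U m" "v \<in> U" "i < q" "j < q"
  shows "\<bar>ln (rat U m v i j)\<bar> \<le> real (length (nbl U v)) / (s - 1)"
proof -
  have "\<bar>ln (rat U m v i j)\<bar> \<le> (\<Sum>k<length (nbl U v). \<bar>H (rr U m v k i j j) - H (rr U m v k i j i)\<bar>)"
    unfolding ln_rat_H[OF assms] sum_subtractf[symmetric] by (rule sum_abs)
  also have "\<dots> \<le> (\<Sum>k<length (nbl U v). 1 / (s - 1))"
  proof (intro sum_mono)
    fix k assume "k \<in> {..<length (nbl U v)}"
    then have k: "k < length (nbl U v)" by simp
    have *: "H b - H a \<le> 1 / (s - 1)" if ab: "a = rr U m v k i j i \<and> b = rr U m v k i j j \<or> a = rr U m v k i j j \<and> b = rr U m v k i j i" for a b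
    proof (cases "a \<le> b")
      case True
      have r: "0 \<le> a" "b \<le> 1 / s" using ab rr_range[OF assms(1,2) k, of i j] by auto
      have "H b - H a \<le> (b - a) * (s / (s - 1))" by (rule H_diff_le[OF True r(2) s_gt])
      also have "\<dots> \<le> 1 / s * (s / (s - 1))" using r s_gt by (intro mult_right_mono) auto
      finally show ?thesis using s_gt by simp
    next
      case False
      then have "H b \<le> H a" using ab rr_range(3)[OF assms(1,2) k, of i j] by (intro H_mono) auto
      moreover have "0 \<le> 1 / (s - 1)" using s_gt by simp
      ultimately show ?thesis by linarith
    qed
    show "\<bar>H (rr U m v k i j j) - H (rr U m v k i j i)\<bar> \<le> 1 / (s - 1)"
      using *[of "rr U m v k i j j" "rr U m v k i j i"] *[of "rr U m v k i j i" "rr U m v k i j j"] by (auto simp: abs_le_iff)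
  qed
  also have "\<dots> = real (length (nbl U v)) / (s - 1)" by simp
  finally show ?thesis .
qed

lemma verr_vertex:
  assumes "admissible \<Delta> U m" "v \<in> U" "k < length (nbl U v)" "positive (Rc k i j)"
  shows "verr U m v Rc k i j = vertex.err q s (1 - w) (F (child U m v k i j) (ch U v k))
     (T (U - {v}) (child U m v k i j) (ch U v k)) (Rc k i j) i j"
proof -
  note p = proper_child[OF assms(1-3), of i j]
  interpret vertex q s "1 - w" "F (child U m v k i j) (ch U v k)" "T (U - {v}) (child U m v k i j) (ch U v k)" "Rc k i j"
    by (rule vertex[OF p assms(4)])
  show ?thesis unfolding err_def verr_def cfac_def rr_def vertex_defs(1)[OF p assms(4)] by simp
qed

lemma total_error:
  assumes "admissible \<Delta> U m" "v \<in> U" "computed U m v Rc R \<eta>" "i < q" "j < q"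
  shows "\<bar>(ln (R i j) - ln (rat U m v i j)) - (\<Sum>k<length (nbl U v). verr U m v Rc k i j)\<bar> \<le> \<eta>"
proof -
  have "(\<Sum>k<length (nbl U v). verr U m v Rc k i j) = (\<Sum>k<length (nbl U v). ln (cfac U m v Rc k i j)) - ln (rat U m v i j)"
    unfolding ln_rat[OF assms(1,2,4,5)] verr_def by (simp add: sum_subtractf)
  then show ?thesis using assms(3-5) by (simp add: computed_def)
qed

lemma verr_crude:
  assumes "admissible \<Delta> U m" "v \<in> U" "k < length (nbl U v)" "positive (Rc k i j)" "i < q" "j < q"
    "err_le (U - {v}) (child U m v k i j) (ch U v k) (Rc k i j) B"
  shows "\<bar>verr U m v Rc k i j\<bar> \<le> B / (s - 1)"
    "verr U m v Rc k i j \<le> s / (s - 1) * (rr U m v k i j i * B + rr U m v k i j j * (exp B - 1))"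
    "- verr U m v Rc k i j \<le> s / (s - 1) * (rr U m v k i j j * B + rr U m v k i j i * (exp B - 1))"
proof -
  note p = proper_child[OF assms(1-3), of i j]
  interpret vertex q s "1 - w" "F (child U m v k i j) (ch U v k)" "T (U - {v}) (child U m v k i j) (ch U v k)" "Rc k i j"
    by (rule vertex[OF p assms(4)])
  have B: "\<And>a b. a < q \<Longrightarrow> b < q \<Longrightarrow> \<bar>e a b\<bar> \<le> B"
    using assms(7) unfolding vertex_defs(3)[OF p assms(4)] err_le_def by blast
  have \<rho>: "\<rho> a = rr U m v k i j a" for a unfolding vertex_defs(1)[OF p assms(4)] rr_def ..
  show "\<bar>verr U m v Rc k i j\<bar> \<le> B / (s - 1)"
    unfolding verr_vertex[where Rc = Rc, OF assms(1-4)] by (rule err_crude[OF assms(5,6) B])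
  show "verr U m v Rc k i j \<le> s / (s - 1) * (rr U m v k i j i * B + rr U m v k i j j * (exp B - 1))"
    "- verr U m v Rc k i j \<le> s / (s - 1) * (rr U m v k i j j * B + rr U m v k i j i * (exp B - 1))"
    unfolding verr_vertex[where Rc = Rc, OF assms(1-4)] using err_upper[OF assms(5,6) B] unfolding \<rho> by auto
qed

text \<open>Contraction by the number of children divided by \<open>s - 1\<close>.\<close>

lemma err_le_crude:
  assumes adm: "admissible \<Delta> U m" "v \<in> U" and comp: "computed U m v Rc R \<eta>"
    and B: "\<And>k i j. k < length (nbl U v) \<Longrightarrow> i < q \<Longrightarrow> j < q \<Longrightarrow> err_le (U - {v}) (child U m v k i j) (ch U v k) (Rc k i j) B"
  shows "err_le U m v R (real (card (nb U v)) * B / (s - 1) + \<eta>)"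
  unfolding err_le_def
proof (intro allI impI)
  fix i j assume ij: "i < q" "j < q"
  have "\<bar>\<Sum>k<length (nbl U v). verr U m v Rc k i j\<bar> \<le> (\<Sum>k<length (nbl U v). \<bar>verr U m v Rc k i j\<bar>)" by (rule sum_abs)
  also have "\<dots> \<le> (\<Sum>k<length (nbl U v). B / (s - 1))"
    by (intro sum_mono verr_crude(1) adm B) (use comp ij in \<open>auto simp: computed_def\<close>)
  finally show "\<bar>ln (R i j) - ln (rat U m v i j)\<bar> \<le> real (card (nb U v)) * B / (s - 1) + \<eta>"
    using total_error[OF adm comp ij] by (simp add: length_nbl)
qed

end

section \<open>Two-step contraction below twice the degree\<close>

text \<open>Ratios of at least \<open>1.998\<close>. The bound \<open>\<Delta> \<ge> 500\<close> makes \<open>s / (s - 1)\<close> negligible.\<close>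

locale potts_refined = potts_tree +
  assumes \<Delta>_large: "500 \<le> \<Delta>" and q_lower: "1998 * real \<Delta> \<le> 1000 * real q"
begin

lemma s_lower: "(998/1000) * real \<Delta> \<le> s - 1" "499 \<le> s - 1"
  using q_lower \<Delta>_large by (simp_all add: s_def)

lemma K_le: "s / (s - 1) \<le> 10021/10000"
proof -
  have "s / (s - 1) = 1 + 1 / (s - 1)" using s_gt by (simp add: field_simps)
  also have "1 / (s - 1) \<le> 1 / 499" using s_lower(2) by (intro divide_left_mono) auto
  finally show ?thesis by simp
qed

lemma frac_s_le: "real n \<le> real \<Delta> \<Longrightarrow> real n / (s - 1) \<le> 100201/100000"
proof -
  assume n: "real n \<le> real \<Delta>"
  have "real n \<le> (100201/100000) * (s - 1)" using s_lower(1) n by simp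
  then show ?thesis using s_gt by (simp add: pos_divide_le_eq)
qed

lemma q_div_s: "real q / s \<le> 20021/10000"
proof -
  have "real q \<le> (20021/10000) * s" using s_lower by (simp add: s_def)
  then show ?thesis using s_gt by (simp add: pos_divide_le_eq)
qed

lemma card_nb_le: "proper U m v \<Longrightarrow> real (card (nb U v)) \<le> real \<Delta>"
  by (simp add: proper_def deg_def)

lemma abs_ln_rat_le': "proper U m v \<Longrightarrow> i < q \<Longrightarrow> j < q \<Longrightarrow> \<bar>ln (rat U m v i j)\<bar> \<le> 100201/100000"
  using order_trans[OF abs_ln_rat_le frac_s_le] card_nb_le[of U m v] length_nbl[of U v] by (simp add: proper_def)

text \<open>Summation of \<open>Err_upper\<close> over the children. The sum of the marginals of \<open>j\<close> is at most \<open>\<sigma>\<close>; that of the marginals of \<open>i\<close> is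
  controlled through the ratio itself, whose logarithm is the difference of the two sums of \<open>H\<close>.\<close>

lemma e_bounds:
  assumes pr: "proper U m v" and comp: "computed U m v Rc R \<eta>" and ij: "i < q" "j < q"
    and B: "\<And>k i j. k < length (nbl U v) \<Longrightarrow> i < q \<Longrightarrow> j < q \<Longrightarrow> err_le (U - {v}) (child U m v k i j) (ch U v k) (Rc k i j) D"
    and D: "0 < D" "exp D - 1 \<le> g * D" "\<eta> \<le> D / 2000" "0 \<le> g"
    and \<sigma>: "(\<Sum>k<length (nbl U v). rr U m v k i j j) \<le> \<sigma>"
    and L: "- ln (rat U m v i j) \<le> L"
  defines "K \<equiv> 10021/10000 :: real"
  shows "ln (R i j) - ln (rat U m v i j) \<le> D * (K * (L + K * \<sigma> + g * \<sigma>) + 1/2000)"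
    and "- (ln (R i j) - ln (rat U m v i j)) \<le> D * (K * (\<sigma> + g * (L + K * \<sigma>)) + 1/2000)"
proof -
  have adm: "admissible \<Delta> U m" "v \<in> U" using pr by (auto simp: proper_def)
  define A1 B1 where "A1 = (\<Sum>k<length (nbl U v). rr U m v k i j i)" and "B1 = (\<Sum>k<length (nbl U v). rr U m v k i j j)"
  have K0: "0 \<le> s / (s - 1)" using s_gt by simp
  have AB: "0 \<le> A1" "0 \<le> B1"
    unfolding A1_def B1_def using rr_range(1)[OF adm] by (auto intro!: sum_nonneg)
  have HB: "(\<Sum>k<length (nbl U v). H (rr U m v k i j j)) \<le> K * B1"
    unfolding B1_def sum_distrib_left
  proof (intro sum_mono)
    fix k assume "k \<in> {..<length (nbl U v)}"
    then have k: "k < length (nbl U v)" by simp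
    note r = rr_range[OF adm k, of i j j]
    have "H (rr U m v k i j j) - H 0 \<le> (rr U m v k i j j - 0) * (s / (s - 1))"
      by (rule H_diff_le[OF r(1,2) s_gt])
    also have "\<dots> \<le> rr U m v k i j j * K" unfolding K_def using mult_left_mono[OF K_le r(1)] by simp
    finally show "H (rr U m v k i j j) \<le> K * rr U m v k i j j" by (simp add: H_def mult.commute)
  qed
  have HA: "A1 \<le> (\<Sum>k<length (nbl U v). H (rr U m v k i j i))"
    unfolding A1_def using rr_range(3)[OF adm] by (intro sum_mono H_ge) auto
  have A1: "A1 \<le> L + K * \<sigma>"
    using HA HB ln_rat_H[OF adm ij] L \<sigma>[folded B1_def] by (simp add: K_def)
  have ve: "(\<Sum>k<length (nbl U v). verr U m v Rc k i j) \<le> s / (s - 1) * (A1 * D + B1 * (exp D - 1))"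
    "- (\<Sum>k<length (nbl U v). verr U m v Rc k i j) \<le> s / (s - 1) * (B1 * D + A1 * (exp D - 1))"
    unfolding A1_def B1_def sum_distrib_left sum_distrib_right sum.distrib[symmetric] sum_negf[symmetric]
    using verr_crude(2,3)[where Rc = Rc, OF adm _ _ ij B[OF _ ij]] comp ij by (auto simp: computed_def intro!: sum_mono)
  have te: "\<bar>(ln (R i j) - ln (rat U m v i j)) - (\<Sum>k<length (nbl U v). verr U m v Rc k i j)\<bar> \<le> \<eta>"
    by (rule total_error[OF adm comp ij])
  have K1: "s / (s - 1) * x \<le> K * y" if "x \<le> y" "0 \<le> x" for x y
    using mult_mono[OF K_le that(1) _ that(2)] by (simp add: K_def)
  have gD: "0 \<le> g * D" "0 \<le> exp D - 1" using D by auto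
  have 1: "A1 * D + B1 * (exp D - 1) \<le> D * (L + K * \<sigma> + g * \<sigma>)"
  proof -
    have "A1 * D \<le> (L + K * \<sigma>) * D" using A1 D by (intro mult_right_mono) auto
    moreover have "B1 * (exp D - 1) \<le> \<sigma> * (g * D)"
      using \<sigma>[folded B1_def] AB D gD by (intro mult_mono) auto
    ultimately show ?thesis by (simp add: algebra_simps)
  qed
  have 2: "B1 * D + A1 * (exp D - 1) \<le> D * (\<sigma> + g * (L + K * \<sigma>))"
  proof -
    have "B1 * D \<le> \<sigma> * D" using \<sigma>[folded B1_def] D by (intro mult_right_mono) auto
    moreover have "A1 * (exp D - 1) \<le> (L + K * \<sigma>) * (g * D)"
      using A1 AB D gD by (intro mult_mono) auto
    ultimately show ?thesis by (simp add: algebra_simps)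
  qed
  have n1: "0 \<le> A1 * D + B1 * (exp D - 1)" and n2: "0 \<le> B1 * D + A1 * (exp D - 1)" using AB D gD by simp_all
  show "ln (R i j) - ln (rat U m v i j) \<le> D * (K * (L + K * \<sigma> + g * \<sigma>) + 1/2000)"
    using te ve(1) K1[OF 1 n1] D(3) by (simp add: algebra_simps)
  show "- (ln (R i j) - ln (rat U m v i j)) \<le> D * (K * (\<sigma> + g * (L + K * \<sigma>)) + 1/2000)"
    using te ve(2) K1[OF 2 n2] D(3) by (simp add: algebra_simps)
qed

text \<open>Let \<open>j\<close> have nearly maximal marginal. Ratios are at most \<open>exp 1.01\<close>, so no colour is strongly damped by
  the neighbours and the sum \<open>\<sigma>\<close> in \<open>e_bounds\<close> is small for all colours. The errors of the ratios with respect to \<open>j\<close>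
  are then governed by the logarithms of these ratios. The inverse ratios have average at most \<open>q / s\<close>, about \<open>2\<close>, so their logarithms have
  average at most about \<open>ln 2 < 0.7\<close>, which bounds the error of the normalisation. A colour whose own marginal is not small
  has a ratio that is not small either.\<close>

lemma sharp:
  assumes pr: "proper U m v" and comp: "computed U m v Rc R \<eta>"
    and B: "\<And>k i j. k < length (nbl U v) \<Longrightarrow> i < q \<Longrightarrow> j < q \<Longrightarrow> err_le (U - {v}) (child U m v k i j) (ch U v k) (Rc k i j) D"
    and D: "0 < D" "D \<le> 101/100" "\<eta> \<le> D / 2000"
  shows "vertex.sharp q s (1 - w) (F m v) (T U m v) R D"
proof -
  have adm: "admissible \<Delta> U m" "v \<in> U" "deg U m v + 1 \<le> \<Delta>" using pr by (auto simp: proper_def)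
  have pos: "positive R" using comp by (simp add: computed_def)
  interpret V: vertex q s "1 - w" "F m v" "T U m v" R by (rule vertex[OF pr pos])
  note vd = vertex_defs[OF pr pos]
  have g175: "exp D - 1 \<le> (175/100) * D" using exp_upper_175 D by simp
  have e_crude: "\<bar>V.e a b\<bar> \<le> (10026/10000) * D" if "a < q" "b < q" for a b
  proof -
    have "err_le U m v R (real (card (nb U v)) * D / (s - 1) + \<eta>)" by (rule err_le_crude[OF adm(1,2) comp B])
    moreover have "real (card (nb U v)) * D / (s - 1) \<le> (100201/100000) * D"
      using mult_right_mono[OF frac_s_le[OF card_nb_le[OF pr]], of D] D by simp
    moreover have "\<bar>V.e a b\<bar> \<le> real (card (nb U v)) * D / (s - 1) + \<eta>"
      using calculation(1) that unfolding vd err_le_def by blast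
    ultimately show ?thesis using D(1,3) by linarith
  qed
  have top: "\<bar>V.xx j\<bar> \<le> (92/100) * D \<and>
      (\<forall>i<q. (6/10) / s \<le> V.\<rho> i \<longrightarrow> V.e i j \<le> (9/10) * D \<and> (D \<le> 1 / 2 \<longrightarrow> - (9/10) * D \<le> V.e i j))"
    if j: "j < q" and tp: "(975/1000) / s < V.\<rho> j" for j
  proof -
    define t where "t a = T U m v a / Z (U - {v}) m" for a
    have Zm: "0 < Z (U - {v}) m" using Z_pos[OF admissible_tilt1[OF adm(1,2), of "{}" 0] \<Delta>] by simp
    have tc: "975/1000 \<le> w ^ m v j" "975/1000 \<le> t j"
      using top_colour[OF adm(1) \<Delta> adm(2,3), of "975/1000" j] tp unfolding vd s_def t_def by auto
    have t1: "t a \<le> 1" for a unfolding t_def using tilt_le[of "U - {v}" "nb U v" a m] Zm by simp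
    have rat_t: "rat U m v a j = t a / t j" for a
      using Zm by (simp add: rat_def t_def)
    have tpos: "0 < t a" for a using T_pos[OF adm(1,2)] Zm by (simp add: t_def)
    have sig: "(\<Sum>k<length (nbl U v). rr U m v k a j j) \<le> (25/1000) / (y - 25/1000)"
      if a: "a < q" and y: "y \<le> t a" "25/1000 < y" for a y
    proof -
      have "(\<Sum>k<length (nbl U v). rr U m v k a j j) \<le> (1 - t j) / (t a + t j - 1)"
        unfolding rr_def t_def by (rule sum_marg_last_le[OF adm(1) \<Delta> adm(2) a j])
          (use tc y in \<open>simp add: t_def[symmetric]\<close>)
      also have "\<dots> \<le> (25/1000) / (y - 25/1000)" using tc y t1 by (intro frac_le) auto
      finally show ?thesis .
    qed
    have ln_r: "\<bar>ln (rat U m v a j)\<bar> \<le> 100201/100000" if "a < q" for a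
      by (rule abs_ln_rat_le'[OF pr that j])
    have t35: "351/1000 \<le> t a" if a: "a < q" for a
    proof -
      have "ln (t j / t a) = - ln (rat U m v a j)" unfolding rat_t using tpos[of a] tpos[of j] by (simp add: ln_div)
      then have "ln (t j / t a) \<le> 101/100" using ln_r[OF a] by linarith
      then have "t j / t a \<le> exp (101/100)" using tpos by (metis divide_pos_pos exp_le_cancel_iff exp_ln)
      also have "\<dots> \<le> 27675/10000" using exp_upper_175[of "101/100"] by simp
      finally have "t j \<le> (27675/10000) * t a" using tpos by (simp add: pos_divide_le_eq)
      then show ?thesis using tc by simp
    qed
    have sig77: "(\<Sum>k<length (nbl U v). rr U m v k a j j) \<le> 77/1000" if "a < q" for a
      using sig[OF that t35[OF that]] by simp
    define y where "y b = t j / t b" for b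
    have ypos: "0 < y b" for b using tpos by (simp add: y_def)
    have ln_y: "ln (y b) = - ln (rat U m v b j)" for b
      unfolding rat_t y_def using tpos[of b] tpos[of j] by (simp add: ln_div)
    have sum_y: "(\<Sum>b<q. V.p b * y b) \<le> 20021/10000"
    proof -
      have "V.p b * y b = w ^ m v b * (T U m v j / Z U m)" for b
      proof -
        have "V.p b = w ^ m v b * T U m v b / Z U m" unfolding vd by (simp add: marg_def weight_def)
        moreover have "y b = T U m v j / T U m v b" using Zm by (simp add: y_def t_def)
        ultimately show ?thesis using T_pos[OF adm(1,2), of b] by simp
      qed
      then have "(\<Sum>b<q. V.p b * y b) = (\<Sum>b<q. w ^ m v b) * (T U m v j / Z U m)"
        by (simp only: sum_distrib_right)
      also have "\<dots> \<le> real q * (1 / s)"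
      proof (intro mult_mono)
        show "(\<Sum>b<q. w ^ m v b) \<le> real q" using sum_mono[of "{..<q}" "\<lambda>b. w ^ m v b" "\<lambda>_. 1"] pow_w by simp
        have "s * T U m v j \<le> s * Z (U - {v}) m" using s_gt tilt_le by (intro mult_left_mono) auto
        then have "s * T U m v j \<le> Z U m" using Z_ge[OF adm] by linarith
        then show "T U m v j / Z U m \<le> 1 / s" using s_gt Z_pos[OF adm(1) \<Delta>] by (simp add: field_simps)
        show "0 \<le> T U m v j / Z U m" using Z_nonneg by simp
      qed simp
      finally have "(\<Sum>b<q. V.p b * y b) \<le> real q / s" by simp
      then show ?thesis using q_div_s by linarith
    qed
    have lnY: "(\<Sum>b<q. V.p b * ln (y b)) \<le> 7/10"
      using V.sum_p_ln[OF sum_y _ ypos] ln_2_upper by simp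
    have e_pos: "V.e a j \<le> D / (101/100) * (ln (y a) + 2273/10000)" if a: "a < q" for a
    proof -
      have "V.e a j \<le> D * ((10021/10000) * (ln (y a) + (10021/10000) * (77/1000) + (175/100) * (77/1000)) + 1/2000)"
        unfolding vd by (rule e_bounds(1)[OF pr comp a j B D(1) g175 D(3) _ sig77[OF a]]) (auto simp: ln_y)
      also have "\<dots> = D / (101/100) * ((101/100) * ((10021/10000) * (ln (y a) + (10021/10000) * (77/1000) + (175/100) * (77/1000)) + 1/2000))"
        by simp
      also have "\<dots> \<le> D / (101/100) * (ln (y a) + 2273/10000)"
      proof (intro mult_left_mono)
        have "ln (y a) \<le> 100201/100000" using ln_r[OF a] ln_y[of a] by linarith
        then show "(101/100) * ((10021/10000) * (ln (y a) + (10021/10000) * (77/1000) + (175/100) * (77/1000)) + 1/2000) \<le> ln (y a) + 2273/10000"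
          by (simp add: field_simps)
      qed (use D in auto)
      finally show ?thesis .
    qed
    have xlow: "- V.xx j \<le> (92/100) * D"
    proof -
      have "- V.xx j \<le> D / (101/100) * ln (exp (2273/10000) * (20021/10000))"
      proof (rule V.xx_lower[OF j _ _ e_pos])
        have "(\<Sum>b<q. V.p b * exp (ln (y b) + 2273/10000)) = exp (2273/10000) * (\<Sum>b<q. V.p b * y b)"
          unfolding sum_distrib_left using ypos by (intro sum.cong refl) (simp add: exp_add)
        then show "(\<Sum>b<q. V.p b * exp (ln (y b) + 2273/10000)) \<le> exp (2273/10000) * (20021/10000)"
          using sum_y by simp
        have "1 * 1 \<le> exp (2273/10000) * (20021/10000 :: real)" by (intro mult_mono) auto
        then show "1 \<le> exp (2273/10000) * (20021/10000 :: real)" by simp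
      qed (use D in auto)
      also have "ln (exp (2273/10000) * (20021/10000 :: real)) = 2273/10000 + ln (20021/10000)" by (subst ln_mult) auto
      also have "D / (101/100) * (2273/10000 + ln (20021/10000)) \<le> D / (101/100) * (2273/10000 + 7/10)"
        using D ln_2_upper by (intro mult_left_mono) auto
      finally show ?thesis using D by simp
    qed
    \<comment> \<open>from \<open>0.03\<close> on, \<open>0.92 D\<close> exceeds the absolute bound \<open>0.026\<close>\<close>
    have xup: "V.xx j \<le> (92/100) * D"
    proof (cases "3/100 \<le> D")
      case True
      then show ?thesis using V.xx_top[OF j tp] by simp
    next
      case False
      then have g103: "exp D - 1 \<le> (103/100) * D" using exp_upper_103 D by simp
      have "V.xx j \<le> (\<Sum>b<q. V.p b * (D * ((10021/10000) * (77/1000 + (103/100) * (ln (y b) + (10021/10000) * (77/1000))) + 1/2000)))"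
      proof (rule V.xx_upper[OF j])
        fix b assume b: "b < q"
        show "- V.e b j \<le> D * ((10021/10000) * (77/1000 + (103/100) * (ln (y b) + (10021/10000) * (77/1000))) + 1/2000)"
          unfolding vd by (rule e_bounds(2)[OF pr comp b j B D(1) g103 D(3) _ sig77[OF b]]) (auto simp: ln_y)
      qed
      also have "\<dots> = D * ((10021/10000) * (103/100) * (\<Sum>b<q. V.p b * ln (y b))
         + ((10021/10000) * (77/1000 + (103/100) * ((10021/10000) * (77/1000))) + 1/2000) * (\<Sum>b<q. V.p b))"
        unfolding sum_distrib_left sum.distrib[symmetric]
        by (intro sum.cong refl) (simp add: algebra_simps)
      also have "\<dots> \<le> D * (92/100)"
        unfolding V.sum_p using lnY D by (intro mult_left_mono) auto
      finally show ?thesis by simp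
    qed
    have pair: "V.e i j \<le> (9/10) * D \<and> (D \<le> 1 / 2 \<longrightarrow> - (9/10) * D \<le> V.e i j)"
      if i: "i < q" and big: "(6/10) / s \<le> V.\<rho> i" for i
    proof -
      have "(6/10) / s \<le> V.p i" using big V.\<rho>_range(2)[OF i] by linarith
      moreover have "V.p j \<le> 1 / s" by (rule V.p_le'[OF j])
      ultimately have "(6/10) * V.p j \<le> V.p i" using s_gt by simp
      then have "(6/10) * (w ^ m v j * T U m v j) \<le> w ^ m v i * T U m v i"
        unfolding vd marg_def weight_def times_divide_eq_right
        by (subst (asm) divide_le_cancel) (use Z_pos[OF adm(1) \<Delta>] in blast)
      also have "\<dots> \<le> 1 * T U m v i" by (intro mult_right_mono pow_w Z_nonneg)
      finally have "(6/10) * (w ^ m v j * t j) \<le> t i"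
        unfolding t_def using Zm by (simp add: field_simps)
      moreover have "(975/1000) * t j \<le> w ^ m v j * t j" using tc tpos[of j] by (intro mult_right_mono) auto
      ultimately have tt: "(585/1000) * t j \<le> t i" by simp
      have "57/100 \<le> t i" using tt tc by simp
      then have sg: "(\<Sum>k<length (nbl U v). rr U m v k i j j) \<le> 46/1000" using sig[OF i, of "57/100"] by simp
      have "ln (585/1000) \<le> ln (rat U m v i j)"
        unfolding rat_t using tt tpos by (intro ln_mono) (auto simp: pos_le_divide_eq)
      then have L: "- ln (rat U m v i j) \<le> 574/1000" using ln_0585_upper by linarith
      have "V.e i j \<le> D * ((10021/10000) * (574/1000 + (10021/10000) * (46/1000) + (175/100) * (46/1000)) + 1/2000)"
        unfolding vd by (rule e_bounds(1)[OF pr comp i j B D(1) g175 D(3) _ sg L]) auto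
      also have "\<dots> \<le> D * (9/10)" using D by (intro mult_left_mono) auto
      finally have 1: "V.e i j \<le> (9/10) * D" by simp
      have 2: "- V.e i j \<le> (9/10) * D" if "D \<le> 1/2"
      proof -
        have g131: "exp D - 1 \<le> (131/100) * D" using exp_upper_131 D that by simp
        have "- V.e i j \<le> D * ((10021/10000) * (46/1000 + (131/100) * (574/1000 + (10021/10000) * (46/1000))) + 1/2000)"
          unfolding vd by (rule e_bounds(2)[OF pr comp i j B D(1) g131 D(3) _ sg L]) auto
        also have "\<dots> \<le> D * (9/10)" using D by (intro mult_left_mono) auto
        finally show ?thesis by simp
      qed
      show ?thesis using 1 2 by auto
    qed
    show ?thesis using xlow xup pair by (simp add: abs_le_iff)
  qed
  show ?thesis unfolding V.sharp_def using e_crude top by blast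
qed

text \<open>The gain at each child, \<open>0.9965\<close>, outweighs the factor \<open>\<Delta> / (s - 1) \<le> 1.00201\<close> and the rounding.\<close>

lemma err_le_refined:
  assumes pr: "proper U m v" and comp: "computed U m v Rc R \<eta>" and D: "0 < D" "\<eta> \<le> D / 2000"
    and sh: "\<And>k i j. k < length (nbl U v) \<Longrightarrow> i < q \<Longrightarrow> j < q \<Longrightarrow>
      vertex.sharp q s (1 - w) (F (child U m v k i j) (ch U v k)) (T (U - {v}) (child U m v k i j) (ch U v k)) (Rc k i j) D"
  shows "err_le U m v R ((9995/10000) * D)"
  unfolding err_le_def
proof (intro allI impI)
  fix i j assume ij: "i < q" "j < q"
  have adm: "admissible \<Delta> U m" "v \<in> U" using pr by (auto simp: proper_def)
  have "\<bar>\<Sum>k<length (nbl U v). verr U m v Rc k i j\<bar> \<le> (\<Sum>k<length (nbl U v). \<bar>verr U m v Rc k i j\<bar>)" by (rule sum_abs)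
  also have "\<dots> \<le> (\<Sum>k<length (nbl U v). (9965/10000) * D / (s - 1))"
  proof (intro sum_mono)
    fix k assume "k \<in> {..<length (nbl U v)}"
    then have k: "k < length (nbl U v)" by simp
    have pos: "positive (Rc k i j)" using comp k ij by (simp add: computed_def)
    interpret V: vertex q s "1 - w" "F (child U m v k i j) (ch U v k)" "T (U - {v}) (child U m v k i j) (ch U v k)" "Rc k i j"
      by (rule vertex[OF proper_child[OF adm k] pos])
    show "\<bar>verr U m v Rc k i j\<bar> \<le> (9965/10000) * D / (s - 1)"
      unfolding verr_vertex[where Rc = Rc, OF adm k pos] by (rule V.err_refined[OF ij sh[OF k ij] D(1)])
  qed
  also have "\<dots> = real (card (nb U v)) / (s - 1) * ((9965/10000) * D)" by (simp add: length_nbl)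
  also have "\<dots> \<le> (100201/100000) * ((9965/10000) * D)"
    using frac_s_le[OF card_nb_le[OF pr]] D by (intro mult_right_mono) auto
  finally have "\<bar>\<Sum>k<length (nbl U v). verr U m v Rc k i j\<bar> \<le> (100201/100000) * ((9965/10000) * D)" .
  then show "\<bar>ln (R i j) - ln (rat U m v i j)\<bar> \<le> (9995/10000) * D"
    using total_error[OF adm comp ij] D abs_triangle_ineq[of "ln (R i j) - ln (rat U m v i j) - (\<Sum>k<length (nbl U v). verr U m v Rc k i j)" "\<Sum>k<length (nbl U v). verr U m v Rc k i j"]
    unfolding diff_add_cancel by linarith
qed

end

section \<open>Changing the weight\<close>

lemma power_diff_le:
  fixes w w' :: real assumes "0 \<le> w'" "w' \<le> w" "w \<le> 1"
  shows "w ^ k - w' ^ k \<le> real k * (w - w')"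
proof (induction k)
  case (Suc k)
  have "w ^ Suc k - w' ^ Suc k = w * (w ^ k - w' ^ k) + w' ^ k * (w - w')" by (simp add: algebra_simps)
  also have "\<dots> \<le> 1 * (w ^ k - w' ^ k) + 1 * (w - w')"
    using assms by (intro add_mono mult_right_mono) (auto simp: power_le_one power_mono)
  finally show ?case using Suc by (simp add: algebra_simps)
qed simp

text \<open>When the vertices are removed one by one, the weights differ only in the pins of the removed vertex, of which there are at
  most \<open>\<Delta>\<close>.\<close>

lemma Z_weight_change:
  assumes "potts_model E w" "potts_model E w'" "w' \<le> w" "\<Delta> < q"
    and "potts_model.admissible E q \<Delta> U m"
  shows "potts_model.Z E q w U m \<le> (1 + real \<Delta> * (w - w')) ^ card U * potts_model.Z E q w' U m"
proof -
  interpret A: potts_model E q w by (rule assms(1))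
  interpret B: potts_model E q w' by (rule assms(2))
  have "finite U" using assms(5) by (rule B.admissible_finite)
  then show ?thesis using assms(5)
  proof (induction U arbitrary: m rule: finite_psubset_induct)
    case (psubset U)
    show ?case
    proof (cases "U = {}")
      case False
      then obtain v where v: "v \<in> U" by auto
      define g where "g = 1 + real \<Delta> * (w - w')"
      have g: "1 \<le> g" using assms(3) by (simp add: g_def)
      have adm: "B.admissible \<Delta> (U - {v}) (tilt (B.nb U v) a m)" for a
        by (rule B.admissible_tilt1[OF psubset.prems v order_refl])
      have IH: "A.Z (U - {v}) (tilt (B.nb U v) a m) \<le> g ^ card (U - {v}) * B.Z (U - {v}) (tilt (B.nb U v) a m)" for a
        unfolding g_def by (rule psubset.IH[OF _ adm]) (use v in auto)
      have d: "B.deg U m v \<le> \<Delta>" using psubset.prems v by (auto simp: B.admissible_def)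
      have "A.Z U m = (\<Sum>a<q. w ^ m v a * A.Z (U - {v}) (tilt (B.nb U v) a m))"
        by (rule A.Z_remove[OF psubset.hyps v])
      also have "\<dots> \<le> (\<Sum>a<q. w ^ m v a * (g ^ card (U - {v}) * B.Z (U - {v}) (tilt (B.nb U v) a m)))"
        by (intro sum_mono mult_left_mono IH A.pow_w)
      also have "\<dots> = g ^ card (U - {v}) * (\<Sum>a<q. w ^ m v a * B.Z (U - {v}) (tilt (B.nb U v) a m))"
        by (simp add: sum_distrib_left mult_ac)
      also have "\<dots> \<le> g ^ card (U - {v}) * (g * B.Z U m)"
      proof (rule mult_left_mono)
        have "(\<Sum>a<q. w ^ m v a * B.Z (U - {v}) (tilt (B.nb U v) a m)) - B.Z U m
          = (\<Sum>a<q. (w ^ m v a - w' ^ m v a) * B.Z (U - {v}) (tilt (B.nb U v) a m))"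
          unfolding B.Z_remove[OF psubset.hyps v] sum_subtractf[symmetric] by (simp add: algebra_simps)
        also have "\<dots> \<le> (\<Sum>a<q. real (m v a) * (w - w') * B.Z (U - {v}) m)"
          using assms(3) A.w_range B.w_range
          by (intro sum_mono mult_mono power_diff_le B.tilt_le B.Z_nonneg) auto
        also have "\<dots> = real (\<Sum>a<q. m v a) * ((w - w') * B.Z (U - {v}) m)"
          by (simp add: sum_distrib_right sum_distrib_left mult_ac)
        also have "\<dots> \<le> real \<Delta> * ((w - w') * B.Z U m)"
        proof (intro mult_mono)
          show "real (\<Sum>a<q. m v a) \<le> real \<Delta>" using d by (simp add: B.deg_def del: of_nat_sum)
          have "(1 - w') * real (B.deg U m v) \<le> 1 * real (B.deg U m v)"
            using B.w_range by (intro mult_right_mono) auto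
          then have "1 \<le> real q - (1 - w') * real (B.deg U m v)" using d assms(4) by linarith
          then have "1 * B.Z (U - {v}) m \<le> B.Z U m"
            by (rule order_trans[OF mult_right_mono[OF _ B.Z_nonneg] B.weight_sum_ge[OF psubset.hyps v]])
          then show "B.Z (U - {v}) m \<le> B.Z U m" by simp
        qed (use assms(3) B.Z_nonneg in auto)
        finally show "(\<Sum>a<q. w ^ m v a * B.Z (U - {v}) (tilt (B.nb U v) a m)) \<le> g * B.Z U m"
          by (simp add: g_def algebra_simps)
      qed (use g in simp)
      also have "\<dots> = g ^ card U * B.Z U m"
        using card_Suc_Diff1[OF psubset.hyps v] by (metis mult.assoc power_Suc2)
      finally show ?thesis by (simp add: g_def)
    qed simp
  qed
qed

lemma Z_weight_mono:
  assumes "potts_model E w" "potts_model E w'" "w' \<le> w"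
  shows "potts_model.Z E q w' U m \<le> potts_model.Z E q w U m"
proof -
  interpret A: potts_model E q w by (rule assms(1))
  interpret B: potts_model E q w' by (rule assms(2))
  show ?thesis unfolding A.Z_def B.Z_def
    using assms(3) B.w_range by (intro sum_mono power_mono) auto
qed

section \<open>The estimates in integer arithmetic\<close>

text \<open>These are \<open>norm_est\<close>, \<open>side\<close> and \<open>fac\<close> with all arguments multiplied by common powers of \<open>M\<close>; fractions are pairs.\<close>

definition inorm :: "nat \<Rightarrow> nat \<Rightarrow> nat \<Rightarrow> (nat \<Rightarrow> nat) \<Rightarrow> (nat \<Rightarrow> nat \<Rightarrow> nat) \<Rightarrow> nat \<Rightarrow> nat" where
  "inorm q sn M F R j = max (\<Sum>b<q. F b * R b j) (sn * (F j * M))"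

definition iside :: "nat \<Rightarrow> nat \<Rightarrow> nat \<Rightarrow> nat \<Rightarrow> (nat \<Rightarrow> nat) \<Rightarrow> (nat \<Rightarrow> nat \<Rightarrow> nat) \<Rightarrow> nat \<Rightarrow> nat \<Rightarrow> nat \<times> nat" where
  "iside q sn M W F R i j =
    (M * inorm q sn M F R j - (M - W) * (F i * R i j), M * inorm q sn M F R j - (M - W) * (F j * M))"

definition ifac :: "nat \<Rightarrow> nat \<Rightarrow> nat \<Rightarrow> nat \<Rightarrow> (nat \<Rightarrow> nat) \<Rightarrow> (nat \<Rightarrow> nat \<Rightarrow> nat) \<Rightarrow> nat \<Rightarrow> nat \<Rightarrow> nat \<times> nat" where
  "ifac q sn M W F R i j = (if F i * R i j \<le> F j * M then iside q sn M W F R i j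
     else if F j * R j i \<le> F i * M then prod.swap (iside q sn M W F R j i) else (1, 1))"

context potts_model
begin

definition iF :: "nat \<Rightarrow> nat \<Rightarrow> nat \<Rightarrow> pins \<Rightarrow> nat \<Rightarrow> nat \<Rightarrow> nat" where
  "iF \<Delta> M W m v a = W ^ m v a * M ^ (\<Delta> - m v a)"

text \<open>\<open>M\<close> times the estimate of the ratio after \<open>t\<close> levels of the recursion, rounded down at each level.\<close>

primrec est :: "nat \<Rightarrow> nat \<Rightarrow> nat \<Rightarrow> nat \<Rightarrow> nat set \<Rightarrow> pins \<Rightarrow> nat \<Rightarrow> nat \<Rightarrow> nat \<Rightarrow> nat" where
  "est \<Delta> M W 0 = (\<lambda>U m v i j. M)"
| "est \<Delta> M W (Suc t) = (\<lambda>U m v i j.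
    let f = (\<lambda>k. ifac q (q - \<Delta> + 1) M W (iF \<Delta> M W (child U m v k i j) (nbl U v ! k))
        (est \<Delta> M W t (U - {v}) (child U m v k i j) (nbl U v ! k)) i j)
    in (M * (\<Prod>k<length (nbl U v). fst (f k))) div (\<Prod>k<length (nbl U v). snd (f k)))"

end

locale potts_alg = potts_tree +
  fixes M W :: nat
  assumes M: "6 \<le> M" and WM: "W \<le> M" and w_eq: "w = real W / real M"
    and ratio: "real \<Delta> \<le> (101/100) * (real q - real \<Delta>)"
begin

abbreviation "sn \<equiv> q - \<Delta> + 1"
abbreviation "ee \<equiv> est \<Delta> M W"

lemma sn: "real sn = s" using \<Delta> by (simp add: s_def)

definition rv where "rv R a b = real (R a b) / real M" for R :: "nat \<Rightarrow> nat \<Rightarrow> nat"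

lemma M0: "0 < real M" using M by simp

lemma c_eq: "1 - w = real (M - W) / real M"
  using M0 WM by (simp add: w_eq of_nat_diff diff_divide_distrib)

lemma iF_real:
  assumes "m v a \<le> \<Delta>" shows "real (iF \<Delta> M W m v a) = w ^ m v a * real M ^ \<Delta>"
proof -
  have "real M ^ \<Delta> = real M ^ m v a * real M ^ (\<Delta> - m v a)" using assms by (simp add: power_add[symmetric])
  then show ?thesis using M0 by (simp add: iF_def w_eq power_divide)
qed

context
  fixes m :: pins and v :: nat and R :: "nat \<Rightarrow> nat \<Rightarrow> nat" and X :: real
  assumes m: "\<And>a. a < q \<Longrightarrow> m v a \<le> \<Delta>"
begin

abbreviation (input) "fF \<equiv> iF \<Delta> M W m v"

lemma iFR: "a < q \<Longrightarrow> real (fF a * R a b) = real M ^ Suc \<Delta> * (F m v a * rv R a b)"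
  using M0 m by (simp add: iF_real rv_def)

lemma iFM: "a < q \<Longrightarrow> real (fF a * M) = real M ^ Suc \<Delta> * F m v a"
  using M0 m by (simp add: iF_real)

lemma inorm_real: "j < q \<Longrightarrow> real (inorm q sn M fF R j) = real M ^ Suc \<Delta> * norm_est q s (F m v) (rv R) j"
proof -
  assume j: "j < q"
  have "real (\<Sum>b<q. fF b * R b j) = real M ^ Suc \<Delta> * (\<Sum>b<q. F m v b * rv R b j)"
    unfolding of_nat_sum sum_distrib_left by (intro sum.cong refl iFR) auto
  moreover have "real (sn * (fF j * M)) = real M ^ Suc \<Delta> * (s * F m v j)"
    using iFM[OF j] unfolding of_nat_mult[of sn] sn by simp
  ultimately show ?thesis
    using M0 unfolding inorm_def norm_est_def of_nat_max by (simp add: max_mult_distrib_left del: power_Suc)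
qed

lemma inorm_ge: "i < q \<Longrightarrow> fF i * R i j \<le> inorm q sn M fF R j" "fF j * M \<le> inorm q sn M fF R j"
proof -
  show "i < q \<Longrightarrow> fF i * R i j \<le> inorm q sn M fF R j"
    unfolding inorm_def by (intro max.coboundedI1 member_le_sum) auto
  show "fF j * M \<le> inorm q sn M fF R j" unfolding inorm_def by (intro max.coboundedI2) simp
qed

lemma iside_real:
  assumes "i < q" "j < q"
  shows "real (fst (iside q sn M W fF R i j)) = real M ^ (\<Delta> + 2) * (norm_est q s (F m v) (rv R) j - (1 - w) * (F m v i * rv R i j))"
    "real (snd (iside q sn M W fF R i j)) = real M ^ (\<Delta> + 2) * (norm_est q s (F m v) (rv R) j - (1 - w) * F m v j)"
proof -
  have le: "(M - W) * x \<le> M * inorm q sn M fF R j" if "x \<le> inorm q sn M fF R j" for x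
    using that by (intro mult_mono) auto
  have c: "real (M - W) = real M * (1 - w)" using M0 by (simp add: c_eq)
  show "real (fst (iside q sn M W fF R i j)) = real M ^ (\<Delta> + 2) * (norm_est q s (F m v) (rv R) j - (1 - w) * (F m v i * rv R i j))"
    unfolding iside_def fst_conv of_nat_diff[OF le[OF inorm_ge(1)[OF assms(1)]]] of_nat_mult[of M] of_nat_mult[of "M - W"] inorm_real[OF assms(2)] iFR[OF assms(1)] c
    by (simp add: algebra_simps)
  show "real (snd (iside q sn M W fF R i j)) = real M ^ (\<Delta> + 2) * (norm_est q s (F m v) (rv R) j - (1 - w) * F m v j)"
    unfolding iside_def snd_conv of_nat_diff[OF le[OF inorm_ge(2)]] of_nat_mult[of M] of_nat_mult[of "M - W"] inorm_real[OF assms(2)] iFM[OF assms(2)] c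
    by (simp add: algebra_simps)
qed

lemma base_iff: "i < q \<Longrightarrow> j < q \<Longrightarrow> fF i * R i j \<le> fF j * M \<longleftrightarrow> F m v i * rv R i j \<le> F m v j"
proof -
  assume ij: "i < q" "j < q"
  have "fF i * R i j \<le> fF j * M \<longleftrightarrow> real (fF i * R i j) \<le> real (fF j * M)" by (simp only: of_nat_le_iff)
  also have "\<dots> \<longleftrightarrow> F m v i * rv R i j \<le> F m v j"
    unfolding iFR[OF ij(1)] iFM[OF ij(2)] using M0 by (simp del: power_Suc)
  finally show ?thesis .
qed

lemma ifac_real:
  assumes ij: "i < q" "j < q" and np: "\<And>j. j < q \<Longrightarrow> 0 < norm_est q s (F m v) (rv R) j"
    and R: "\<And>a b. a < q \<Longrightarrow> b < q \<Longrightarrow> 0 < R a b"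
  shows "fac q s (1 - w) (F m v) (rv R) i j = real (fst (ifac q sn M W fF R i j)) / real (snd (ifac q sn M W fF R i j))"
    "0 < fst (ifac q sn M W fF R i j)" "0 < snd (ifac q sn M W fF R i j)"
    "(s - 1) / s \<le> fac q s (1 - w) (F m v) (rv R) i j"
    "fac q s (1 - w) (F m v) (rv R) i j \<le> s / (s - 1)"
proof -
  note s1 = s_gt
  have base: "side q s (1 - w) (F m v) (rv R) a b = real (fst (iside q sn M W fF R a b)) / real (snd (iside q sn M W fF R a b)) \<and>
     0 < fst (iside q sn M W fF R a b) \<and> 0 < snd (iside q sn M W fF R a b) \<and>
     1 \<le> side q s (1 - w) (F m v) (rv R) a b \<and> side q s (1 - w) (F m v) (rv R) a b \<le> s / (s - 1)"
    if ab: "a < q" "b < q" and le: "F m v a * rv R a b \<le> F m v b" for a b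
  proof -
    define N x y where "N = norm_est q s (F m v) (rv R) b" and "x = (1 - w) * (F m v a * rv R a b)" and "y = (1 - w) * F m v b"
    have N: "0 < N" using np[OF ab(2)] by (simp add: N_def)
    have xy: "x \<le> y" unfolding x_def y_def using le w_range by (intro mult_left_mono) auto
    have x0: "0 \<le> x" using w_range pow_w by (simp add: x_def rv_def)
    have "s * F m v b \<le> N" by (simp add: N_def norm_est_def)
    moreover have "y \<le> F m v b" unfolding y_def using w_range pow_w by (intro mult_left_le_one_le) auto
    ultimately have "s * y \<le> N" using s1 by (smt (verit) mult_left_mono)
    then have sy: "y \<le> N / s" using s1 by (simp add: field_simps)
    have Ns: "N / s < N" using N s1 by (simp add: field_simps)
    have den: "(s - 1) / s * N \<le> N - y" using sy s1 by (simp add: field_simps)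
    have num: "0 < N - x" "0 < N - y" using xy sy Ns by linarith+
    have sd: "side q s (1 - w) (F m v) (rv R) a b = (N - x) / (N - y)" by (simp add: side_def N_def x_def y_def)
    note sr = iside_real[OF ab, folded N_def x_def y_def]
    have "0 < real (fst (iside q sn M W fF R a b))" "0 < real (snd (iside q sn M W fF R a b))"
      unfolding sr using num M0 by simp_all
    moreover have "(N - x) / (N - y) = real (fst (iside q sn M W fF R a b)) / real (snd (iside q sn M W fF R a b))"
      unfolding sr using M0 by simp
    moreover have "1 \<le> (N - x) / (N - y)" using num xy by simp
    moreover have "(N - x) / (N - y) \<le> N / ((s - 1) / s * N)"
      using den num x0 N s1 by (intro frac_le) auto
    moreover have "N / ((s - 1) / s * N) = s / (s - 1)" using N by simp
    ultimately show ?thesis unfolding sd by (simp only: of_nat_0_less_iff)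
  qed
  have s2: "(s - 1) / s \<le> 1" "1 \<le> s / (s - 1)" using s1 by auto
  have "fac q s (1 - w) (F m v) (rv R) i j = real (fst (ifac q sn M W fF R i j)) / real (snd (ifac q sn M W fF R i j)) \<and>
    0 < fst (ifac q sn M W fF R i j) \<and> 0 < snd (ifac q sn M W fF R i j) \<and>
    (s - 1) / s \<le> fac q s (1 - w) (F m v) (rv R) i j \<and> fac q s (1 - w) (F m v) (rv R) i j \<le> s / (s - 1)"
  proof -
    consider (1) "F m v i * rv R i j \<le> F m v j" | (2) "\<not> F m v i * rv R i j \<le> F m v j" "F m v j * rv R j i \<le> F m v i"
      | (3) "\<not> F m v i * rv R i j \<le> F m v j" "\<not> F m v j * rv R j i \<le> F m v i" by blast
    then show ?thesis
    proof cases
      case 1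
      then show ?thesis using base[OF ij 1] base_iff[OF ij] s2 by (auto simp: fac_def ifac_def)
    next
      case 2
      note b = base[OF ij(2,1) 2(2)]
      have "(s - 1) / s \<le> 1 / side q s (1 - w) (F m v) (rv R) j i"
      proof -
        have "1 / (s / (s - 1)) \<le> 1 / side q s (1 - w) (F m v) (rv R) j i"
          using b s1 by (intro divide_left_mono) auto
        then show ?thesis by simp
      qed
      moreover have "1 / side q s (1 - w) (F m v) (rv R) j i \<le> 1" using b by auto
      then have "1 / side q s (1 - w) (F m v) (rv R) j i \<le> s / (s - 1)" using s2(2) by (rule order_trans)
      ultimately show ?thesis using b 2 base_iff[OF ij] base_iff[OF ij(2,1)] s2
        by (auto simp: fac_def ifac_def)
    next
      case 3
      then show ?thesis using base_iff[OF ij] base_iff[OF ij(2,1)] s2 by (auto simp: fac_def ifac_def)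
    qed
  qed
  then show "fac q s (1 - w) (F m v) (rv R) i j = real (fst (ifac q sn M W fF R i j)) / real (snd (ifac q sn M W fF R i j))"
    "0 < fst (ifac q sn M W fF R i j)" "0 < snd (ifac q sn M W fF R i j)"
    "(s - 1) / s \<le> fac q s (1 - w) (F m v) (rv R) i j"
    "fac q s (1 - w) (F m v) (rv R) i j \<le> s / (s - 1)" by auto
qed

end

lemma pins_le:
  assumes "admissible \<Delta> U m" "v \<in> U" "a < q" shows "m v a \<le> \<Delta>"
proof -
  have "m v a \<le> (\<Sum>a<q. m v a)" using assms(3) by (intro member_le_sum) auto
  also have "\<dots> \<le> deg U m v" by (simp add: deg_def)
  also have "\<dots> \<le> \<Delta>" using assms(1,2) by (auto simp: admissible_def)
  finally show ?thesis .
qed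

text \<open>Rounding down is a relative error of order \<open>1 / M\<close> because the ratios are bounded away from \<open>0\<close>.\<close>

lemma floor_ln:
  assumes Q: "1/3 \<le> Q" and x: "real x \<le> real M * Q" "real M * Q < real x + 1"
  shows "0 < x" "\<bar>ln (real x / real M) - ln Q\<bar> \<le> 6 / real M"
proof -
  have "real M / 3 \<le> real M * Q" using Q M0 by simp
  then have x1: "real M / 6 \<le> real x" using x(2) M by linarith
  then show x0: "0 < x" using M0 by (metis divide_pos_pos linorder_not_less of_nat_0_less_iff order_less_le_trans zero_less_numeral)
  have Q0: "0 < Q" using Q by linarith
  have "real x / real M \<le> Q" using x(1) M0 by (simp add: field_simps)
  then have "ln (real x / real M) \<le> ln Q" using x0 M0 Q0 by (intro ln_mono) auto
  moreover have "ln Q - ln (real x / real M) \<le> 6 / real M"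
  proof -
    have "ln Q - ln (real x / real M) = ln (real M * Q / real x)"
      using x0 M0 Q0 by (simp add: ln_div ln_mult)
    also have "\<dots> \<le> real M * Q / real x - 1" using x0 M0 Q0 by (intro ln_le_minus_one) auto
    also have "\<dots> = (real M * Q - real x) / real x" using x0 by (simp add: field_simps)
    also have "\<dots> \<le> 1 / (real M / 6)" using x x1 M0 by (intro frac_le) auto
    finally show ?thesis by simp
  qed
  ultimately show "\<bar>ln (real x / real M) - ln Q\<bar> \<le> 6 / real M" by simp
qed

lemma power_s_ge: "f \<le> \<Delta> \<Longrightarrow> 1/3 \<le> ((s - 1) / s) ^ f"
proof -
  assume f: "f \<le> \<Delta>"
  have s0: "0 < s - 1" using s_gt by simp
  have "1 / exp (1 / (s - 1)) \<le> (s - 1) / s"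
  proof -
    have "s / (s - 1) = 1 + 1 / (s - 1)" using s0 by (simp add: field_simps)
    also have "\<dots> \<le> exp (1 / (s - 1))" by (rule exp_ge_add_one_self)
    finally have "1 / exp (1 / (s - 1)) \<le> 1 / (s / (s - 1))" using s0 by (intro divide_left_mono) auto
    then show ?thesis by simp
  qed
  then have "(1 / exp (1 / (s - 1))) ^ f \<le> ((s - 1) / s) ^ f" by (intro power_mono) auto
  moreover have "(1 / exp (1 / (s - 1))) ^ f = 1 / exp (real f / (s - 1))"
    by (simp add: power_one_over exp_of_nat_mult[symmetric])
  moreover have "exp (real f / (s - 1)) \<le> 3"
  proof -
    have "real f \<le> (101/100) * (s - 1)" using f ratio by (simp add: s_def)
    then have "real f / (s - 1) \<le> 101/100" using s0 by (simp add: pos_divide_le_eq)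
    then have "exp (real f / (s - 1)) \<le> exp (101/100)" by simp
    also have "\<dots> \<le> 3" using exp_upper_175[of "101/100"] by simp
    finally show ?thesis .
  qed
  moreover have "1 / 3 \<le> 1 / exp (real f / (s - 1))" using calculation(3) by (intro divide_left_mono) auto
  ultimately show ?thesis by linarith
qed

lemma rv_positive: "(\<And>a b. a < q \<Longrightarrow> b < q \<Longrightarrow> 0 < R a b) \<Longrightarrow> positive (rv R)"
  using M0 by (simp add: positive_def rv_def)

abbreviation crs where "crs t U m v k i j \<equiv> rv (ee t (U - {v}) (child U m v k i j) (ch U v k))"

lemma est_step:
  assumes adm: "admissible \<Delta> U m" "v \<in> U" and ij: "i < q" "j < q"
    and pos: "\<And>k a b. k < length (nbl U v) \<Longrightarrow> a < q \<Longrightarrow> b < q \<Longrightarrow> 0 < ee t (U - {v}) (child U m v k i j) (ch U v k) a b"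
  shows "0 < ee (Suc t) U m v i j"
    "\<bar>ln (rv (ee (Suc t) U m v) i j) - (\<Sum>k<length (nbl U v). ln (cfac U m v (crs t U m v) k i j))\<bar> \<le> 6 / real M"
proof -
  define f where "f k = ifac q sn M W (iF \<Delta> M W (child U m v k i j) (ch U v k)) (ee t (U - {v}) (child U m v k i j) (ch U v k)) i j" for k
  define c where "c k = cfac U m v (crs t U m v) k i j" for k
  define l where "l = length (nbl U v)"
  have l: "l \<le> \<Delta>" using adm by (auto simp: l_def length_nbl admissible_def deg_def)
  have k: "c k = real (fst (f k)) / real (snd (f k)) \<and> 0 < fst (f k) \<and> 0 < snd (f k) \<and> (s - 1) / s \<le> c k" if k: "k < l" for k
  proof -
    have k': "k < length (nbl U v)" using k by (simp add: l_def)
    have pr: "proper (U - {v}) (child U m v k i j) (ch U v k)" by (rule proper_child[OF adm k'])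
    then have a: "admissible \<Delta> (U - {v}) (child U m v k i j)" "ch U v k \<in> U - {v}" by (auto simp: proper_def)
    have ps: "positive (crs t U m v k i j)" using pos[OF k'] by (rule rv_positive)
    interpret V: vertex q s "1 - w" "F (child U m v k i j) (ch U v k)" "T (U - {v}) (child U m v k i j) (ch U v k)" "crs t U m v k i j"
      by (rule vertex[OF pr ps])
    show ?thesis unfolding c_def cfac_def f_def
      using ifac_real[where m = "child U m v k i j" and v = "ch U v k" and R = "ee t (U - {v}) (child U m v k i j) (ch U v k)",
          OF pins_le[OF a] ij V.norm_pos pos[OF k']] by simp
  qed
  define Q where "Q = (\<Prod>k<l. c k)"
  define n d where "n = (\<Prod>k<l. fst (f k))" and "d = (\<Prod>k<l. snd (f k))"
  have d0: "0 < d" unfolding d_def using k by (intro prod_pos) auto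
  have Qnd: "Q = real n / real d" unfolding Q_def n_def d_def of_nat_prod prod_dividef[symmetric] using k by (intro prod.cong) auto
  have s0: "0 \<le> (s - 1) / s" using s_gt by simp
  have "((s - 1) / s) ^ l \<le> Q"
  proof -
    have "(\<Prod>k<l. (s - 1) / s) \<le> (\<Prod>k<l. c k)" using k s0 by (intro prod_mono) blast
    then show ?thesis by (simp only: Q_def prod_constant card_lessThan)
  qed
  then have Q3: "1/3 \<le> Q" using power_s_ge[OF l] by linarith
  have est: "ee (Suc t) U m v i j = (M * n) div d"
    by (simp add: n_def d_def f_def l_def Let_def)
  have fl: "real (M * n div d) \<le> real M * Q" "real M * Q < real (M * n div d) + 1"
  proof -
    have "real M * Q = real (M * n) / real d" by (simp add: Qnd)
    moreover have "real (M * n div d) \<le> real (M * n) / real d" by (rule of_nat_div_le_of_nat)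
    moreover have "real (M * n) / real d - real (M * n div d) < 1"
    proof -
      have "M * n < (M * n div d + 1) * d" using d0 by (metis div_less_iff_less_mult less_add_one)
      then have "real (M * n) < real ((M * n div d + 1) * d)" by (simp only: of_nat_less_iff)
      then show ?thesis using d0 by (simp add: field_simps)
    qed
    ultimately show "real (M * n div d) \<le> real M * Q" "real M * Q < real (M * n div d) + 1" by linarith+
  qed
  show "0 < ee (Suc t) U m v i j" unfolding est by (rule floor_ln(1)[OF Q3 fl])
  have "ln Q = (\<Sum>k<l. ln (c k))" unfolding Q_def
    using k by (intro ln_prod) (auto simp: less_imp_neq[symmetric])
  then show "\<bar>ln (rv (ee (Suc t) U m v) i j) - (\<Sum>k<length (nbl U v). ln (cfac U m v (crs t U m v) k i j))\<bar> \<le> 6 / real M"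
    using floor_ln(2)[OF Q3 fl] by (simp only: rv_def est c_def l_def)
qed

lemma est_pos: "admissible \<Delta> U m \<Longrightarrow> v \<in> U \<Longrightarrow> i < q \<Longrightarrow> j < q \<Longrightarrow> 0 < ee t U m v i j"
proof (induction t arbitrary: U m v i j)
  case 0
  then show ?case using M by simp
next
  case (Suc t)
  show ?case
    by (rule est_step(1)[OF Suc.prems(1-4)], rule Suc.IH) (use proper_child[OF Suc.prems(1,2)] in \<open>auto simp: proper_def\<close>)
qed

text \<open>This makes the results for real estimates available to the integer recursion.\<close>

lemma est_computed:
  assumes adm: "admissible \<Delta> U m" "v \<in> U"
  shows "computed U m v (crs t U m v) (rv (ee (Suc t) U m v)) (6 / real M)"
  unfolding computed_def
proof (intro conjI allI impI)
  have pos: "0 < ee t (U - {v}) (child U m v k i j) (ch U v k) a b" if "k < length (nbl U v)" "a < q" "b < q" for k i j a b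
    using est_pos proper_child[OF adm that(1)] that unfolding proper_def by blast
  show "positive (crs t U m v k i j)" if "k < length (nbl U v)" for k i j
    by (rule rv_positive[OF pos[OF that]])
  show "positive (rv (ee (Suc t) U m v))" by (rule rv_positive[OF est_pos[OF adm]])
  show "\<bar>ln (rv (ee (Suc t) U m v) i j) - (\<Sum>k<length (nbl U v). ln (cfac U m v (crs t U m v) k i j))\<bar> \<le> 6 / real M"
    if "i < q" "j < q" for i j by (rule est_step(2)[OF adm that pos])
qed

end

text \<open>\<open>Kc \<Delta> / M\<close> is the level of error at which rounding stops the contraction by \<open>kap\<close>.\<close>

definition Kc :: "nat \<Rightarrow> real" where "Kc \<Delta> = 24 * real \<Delta> + 12000"
text \<open>A contraction rate that is valid for all \<open>q\<close> in question: for \<open>q \<ge> 2 \<Delta>\<close> it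
  comes from \<open>(\<Delta> - 1) / \<Delta>\<close>, in the refined case it is at least \<open>0.9995\<close>.\<close>

definition kap :: "nat \<Rightarrow> real" where "kap \<Delta> = 1 - 1 / (2 * (real \<Delta> + 1000))"

lemma kap_range: "0 < kap \<Delta>" "kap \<Delta> < 1" "9995/10000 \<le> kap \<Delta>"
proof -
  have "1 / (2 * (real \<Delta> + 1000)) \<le> 1 / 2000" by (intro divide_left_mono) auto
  then show "9995/10000 \<le> kap \<Delta>" by (simp add: kap_def)
  then show "0 < kap \<Delta>" by linarith
  show "kap \<Delta> < 1" by (simp add: kap_def)
qed

locale potts_approx = potts_alg +
  assumes \<Delta>3: "3 \<le> \<Delta>" and MK: "Kc \<Delta> \<le> real M"
    and regime: "2 * \<Delta> \<le> q \<or> 500 \<le> \<Delta> \<and> 1998 * real \<Delta> \<le> 1000 * real q"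
begin

lemma err_le_mono: "err_le U m v R B \<Longrightarrow> B \<le> B' \<Longrightarrow> err_le U m v R B'"
  unfolding err_le_def by (meson order_trans)

lemma est_crude:
  assumes adm: "admissible \<Delta> U m" "v \<in> U"
    and D: "\<And>U m v. proper U m v \<Longrightarrow> err_le U m v (rv (ee t U m v)) D"
  shows "err_le U m v (rv (ee (Suc t) U m v)) (real (card (nb U v)) * D / (s - 1) + 6 / real M)"
  by (rule err_le_crude[OF adm est_computed[OF adm]], rule D, rule proper_child[OF adm])

lemma card_nb_ratio: "real (card (nb U v)) \<le> real \<Delta> \<Longrightarrow> real (card (nb U v)) / (s - 1) \<le> 101/100"
  using ratio s_gt by (simp add: s_def pos_divide_le_eq)

lemma est_0:
  assumes "proper U m v" shows "err_le U m v (rv (ee 0 U m v)) (101/100)"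
  unfolding err_le_def
proof (intro allI impI)
  fix a b assume ab: "a < q" "b < q"
  have adm: "admissible \<Delta> U m" "v \<in> U" and d: "real (card (nb U v)) \<le> real \<Delta>"
    using assms by (auto simp: proper_def deg_def)
  have "\<bar>ln (rat U m v a b)\<bar> \<le> 101/100"
    using abs_ln_rat_le[OF adm ab] card_nb_ratio[OF d] unfolding length_nbl by linarith
  then show "\<bar>ln (rv (ee 0 U m v) a b) - ln (rat U m v a b)\<bar> \<le> 101/100"
    using M0 by (simp add: rv_def)
qed

text \<open>For \<open>q \<ge> 2 \<Delta>\<close> each step contracts. Otherwise the first step only provides \<open>sharp\<close> and the second one contracts.\<close>

lemma two_steps:
  assumes D: "\<And>U m v. proper U m v \<Longrightarrow> err_le U m v (rv (ee t U m v)) D"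
    and DK: "Kc \<Delta> / real M \<le> D" "D \<le> 101/100" and pr: "proper U m v"
  shows "err_le U m v (rv (ee (Suc (Suc t)) U m v)) (kap \<Delta> * D)"
proof -
  have K0: "0 < Kc \<Delta>" by (simp add: Kc_def add_nonneg_pos)
  then have D0: "0 < D" using DK M0 by (smt (verit) divide_pos_pos)
  have adm: "admissible \<Delta> U m" "v \<in> U" using pr by (auto simp: proper_def)
  from regime show ?thesis
  proof
    assume q2: "2 * \<Delta> \<le> q"
    define k where "k = (real \<Delta> - 1) / real \<Delta>"
    have k: "0 \<le> k" "k \<le> 1" using \<Delta>3 by (auto simp: k_def)
    have deg: "real (card (nb U v)) / (s - 1) \<le> k" if "proper U m v" for U m v
    proof -
      have "real (card (nb U v)) \<le> real \<Delta> - 1" using that by (simp add: proper_def deg_def)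
      moreover have "real \<Delta> \<le> s - 1" using q2 \<Delta> by (simp add: s_def)
      ultimately show ?thesis unfolding k_def using \<Delta>3 by (intro frac_le) auto
    qed
    have step: "err_le U m v (rv (ee (Suc t) U m v)) (k * D + 6 / real M)"
      if pr: "proper U m v" and D: "\<And>U m v. proper U m v \<Longrightarrow> err_le U m v (rv (ee t U m v)) D" and D0: "0 < D" for U m v D t
    proof -
      have "real (card (nb U v)) * D / (s - 1) \<le> k * D"
        using mult_right_mono[OF deg[OF pr], of D] D0 by simp
      moreover have "err_le U m v (rv (ee (Suc t) U m v)) (real (card (nb U v)) * D / (s - 1) + 6 / real M)"
        using pr by (intro est_crude D) (auto simp: proper_def)
      ultimately show ?thesis by (elim err_le_mono) simp
    qed
    have D1: "0 < k * D + 6 / real M" using k D0 M0 by (simp add: add_nonneg_pos)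
    have "err_le U m v (rv (ee (Suc (Suc t)) U m v)) (k * (k * D + 6 / real M) + 6 / real M)"
      by (rule step[OF pr _ D1], rule step[OF _ D D0])
    moreover have "k * (k * D + 6 / real M) + 6 / real M \<le> kap \<Delta> * D"
    proof -
      have 1: "k * (k * D + 6 / real M) \<le> 1 * (k * D + 6 / real M)" using k D1 by (intro mult_right_mono) auto
      have 2: "12 / real M \<le> 1 / (2 * real \<Delta>) * D"
      proof -
        have "24 * real \<Delta> / real M \<le> Kc \<Delta> / real M" using M0 by (intro divide_right_mono) (auto simp: Kc_def)
        then have "24 * real \<Delta> / real M \<le> D" using DK by linarith
        then have "1 / (2 * real \<Delta>) * (24 * real \<Delta> / real M) \<le> 1 / (2 * real \<Delta>) * D" by (intro mult_left_mono) auto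
        then show ?thesis using \<Delta>3 by simp
      qed
      have 3: "k = 1 - 1 / real \<Delta>" using \<Delta>3 by (simp add: k_def field_simps)
      have 4: "(1 - 1 / real \<Delta> + 1 / (2 * real \<Delta>)) * D \<le> kap \<Delta> * D"
      proof (rule mult_right_mono)
        have "1 / (2 * (real \<Delta> + 1000)) \<le> 1 / (2 * real \<Delta>)" using \<Delta>3 by (intro divide_left_mono) auto
        then show "1 - 1 / real \<Delta> + 1 / (2 * real \<Delta>) \<le> kap \<Delta>" by (simp add: kap_def)
      qed (use D0 in simp)
      have "k * (k * D + 6 / real M) + 6 / real M \<le> k * D + 12 / real M" using 1 by simp
      also have "\<dots> \<le> k * D + 1 / (2 * real \<Delta>) * D" by (rule add_left_mono[OF 2])
      also have "\<dots> = (1 - 1 / real \<Delta> + 1 / (2 * real \<Delta>)) * D" unfolding 3 by (simp only: distrib_right)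
      also note 4
      finally show ?thesis .
    qed
    ultimately show ?thesis by (rule err_le_mono)
  next
    assume "500 \<le> \<Delta> \<and> 1998 * real \<Delta> \<le> 1000 * real q"
    then interpret potts_refined E q w \<Delta> by unfold_locales auto
    have eta: "6 / real M \<le> D / 2000"
    proof -
      have "12000 / real M \<le> Kc \<Delta> / real M" using M0 by (intro divide_right_mono) (auto simp: Kc_def)
      then show ?thesis using DK by simp
    qed
    have sh: "vertex.sharp q s (1 - w) (F m v) (T U m v) (rv (ee (Suc t) U m v)) D" if pr: "proper U m v" for U m v
    proof -
      have adm: "admissible \<Delta> U m" "v \<in> U" using pr by (auto simp: proper_def)
      show ?thesis
        by (rule sharp[OF pr est_computed[OF adm] _ D0 DK(2) eta], rule D, rule proper_child[OF adm])
    qed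
    have "err_le U m v (rv (ee (Suc (Suc t)) U m v)) ((9995/10000) * D)"
      by (rule err_le_refined[OF pr est_computed[OF adm] D0 eta], rule sh, rule proper_child[OF adm])
    moreover have "(9995/10000) * D \<le> kap \<Delta> * D" using kap_range D0 by (intro mult_right_mono) auto
    ultimately show ?thesis by (rule err_le_mono)
  qed
qed

lemma est_even:
  "proper U m v \<Longrightarrow> err_le U m v (rv (ee (2 * t) U m v)) (max ((101/100) * kap \<Delta> ^ t) (Kc \<Delta> / real M))"
proof (induction t arbitrary: U m v)
  case 0
  have "101/100 \<le> max ((101/100) * kap \<Delta> ^ 0) (Kc \<Delta> / real M)" by simp
  then have "err_le U m v (rv (ee 0 U m v)) (max ((101/100) * kap \<Delta> ^ 0) (Kc \<Delta> / real M))"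
    by (rule err_le_mono[OF est_0[OF 0]])
  then show ?case unfolding mult_0_right .
next
  case (Suc t)
  let ?D = "max ((101/100) * kap \<Delta> ^ t) (Kc \<Delta> / real M)"
  have K0: "0 < Kc \<Delta>" by (simp add: Kc_def add_nonneg_pos)
  have k1: "kap \<Delta> ^ t \<le> 1" using kap_range[of \<Delta>] by (intro power_le_one) auto
  have "Kc \<Delta> / real M \<le> 1" using MK M0 by simp
  then have D1: "?D \<le> 101/100" using k1 by (intro max.boundedI) linarith+
  have "err_le U m v (rv (ee (Suc (Suc (2 * t))) U m v)) (kap \<Delta> * ?D)"
    by (rule two_steps[OF Suc.IH max.cobounded2 D1 Suc.prems])
  moreover have "kap \<Delta> * ?D \<le> max ((101/100) * kap \<Delta> ^ Suc t) (Kc \<Delta> / real M)"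
  proof -
    have "kap \<Delta> * (Kc \<Delta> / real M) \<le> Kc \<Delta> / real M"
      using kap_range[of \<Delta>] K0 M0 by (intro mult_left_le_one_le) auto
    moreover have "kap \<Delta> * max x y = max (kap \<Delta> * x) (kap \<Delta> * y)" for x y
      using kap_range(1)[of \<Delta>] by (simp add: max_mult_distrib_left)
    moreover have "kap \<Delta> * ((101/100) * kap \<Delta> ^ t) = (101/100) * kap \<Delta> ^ Suc t" by simp
    ultimately show ?thesis by (metis max.mono order_refl)
  qed
  ultimately have "err_le U m v (rv (ee (Suc (Suc (2 * t))) U m v)) (max ((101/100) * kap \<Delta> ^ Suc t) (Kc \<Delta> / real M))"
    by (rule err_le_mono)
  moreover have "2 * Suc t = Suc (Suc (2 * t))" by simp
  ultimately show ?case by (simp only:)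
qed

text \<open>The root may have \<open>\<Delta>\<close> children, too many for the contraction; but one step
  applied to the good estimates of the children loses only a constant factor.\<close>

lemma est_root:
  assumes adm: "admissible \<Delta> U m" "v \<in> U" and t: "kap \<Delta> ^ t \<le> y / real M" "0 \<le> y"
  shows "err_le U m v (rv (ee (Suc (2 * t)) U m v)) ((2 * y + 2 * Kc \<Delta> + 6) / real M)"
proof -
  let ?D = "max ((101/100) * kap \<Delta> ^ t) (Kc \<Delta> / real M)"
  have K0: "0 < Kc \<Delta>" by (simp add: Kc_def add_nonneg_pos)
  have D0: "0 \<le> ?D" using K0 M0 by (simp add: le_max_iff_disj)
  have d: "real (card (nb U v)) \<le> real \<Delta>" using adm by (auto simp: admissible_def deg_def)
  have "real (card (nb U v)) * ?D / (s - 1) \<le> (101/100) * ?D"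
    using mult_right_mono[OF card_nb_ratio[OF d] D0] by simp
  also have "\<dots> \<le> (101/100) * ((101/100) * (y / real M) + Kc \<Delta> / real M)"
    using t K0 M0 by (intro mult_left_mono) (auto simp: add_increasing add_increasing2)
  also have "\<dots> \<le> (2 * y + 2 * Kc \<Delta>) / real M"
    using t K0 M0 by (simp add: add_divide_distrib[symmetric] divide_right_mono field_simps)
  finally have "real (card (nb U v)) * ?D / (s - 1) + 6 / real M \<le> (2 * y + 2 * Kc \<Delta> + 6) / real M"
    by (simp add: add_divide_distrib)
  moreover have "err_le U m v (rv (ee (Suc (2 * t)) U m v)) (real (card (nb U v)) * ?D / (s - 1) + 6 / real M)"
    by (rule est_crude[OF adm est_even])
  ultimately show ?thesis by (elim err_le_mono)
qed

end

section \<open>The partition function as a product\<close>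

context potts_model
begin

text \<open>The vertices are removed in increasing order, each leaving pins of colour \<open>0\<close>; any colour would do.\<close>

primrec chain :: "nat \<Rightarrow> nat \<Rightarrow> pins" where
  "chain n 0 = (\<lambda>_ _. 0)"
| "chain n (Suc v) = tilt (nb {v..<n} v) 0 (chain n v)"

lemma chain_admissible:
  assumes "admissible \<Delta> {..<n} (\<lambda>_ _. 0)" "v \<le> n"
  shows "admissible \<Delta> {v..<n} (chain n v)"
  using assms(2)
proof (induction v)
  case 0
  then show ?case using assms(1) by (simp add: lessThan_atLeast0)
next
  case (Suc v)
  have "{v..<n} - {v} = {Suc v..<n}" by auto
  then show ?case using admissible_tilt1[OF Suc.IH, of v] Suc.prems by auto
qed

definition iS :: "nat \<Rightarrow> nat \<Rightarrow> nat \<Rightarrow> nat \<Rightarrow> nat \<Rightarrow> nat \<Rightarrow> nat" where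
  "iS \<Delta> M W t n v = (\<Sum>b<q. iF \<Delta> M W (chain n v) v b * est \<Delta> M W t {v..<n} (chain n v) v b 0)"

end

context potts_approx
begin

text \<open>Removing the vertices one by one, each with \<open>Z_remove_rat\<close>, leaves the empty graph.\<close>

lemma Z_product:
  assumes "admissible \<Delta> {..<n} (\<lambda>_ _. 0)" "v \<le> n"
  shows "Z {..<n} (\<lambda>_ _. 0) = (\<Prod>x<v. \<Sum>b<q. F (chain n x) x b * rat {x..<n} (chain n x) x b 0) * Z {v..<n} (chain n v)"
  using assms(2)
proof (induction v)
  case 0
  then show ?case by (simp add: lessThan_atLeast0)
next
  case (Suc v)
  have "{v..<n} - {v} = {Suc v..<n}" by auto
  then show ?case using Suc Z_remove_rat[OF chain_admissible[OF assms(1)] \<Delta>, of v v 0] by (simp add: mult_ac)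
qed

lemma product_error:
  assumes adm: "admissible \<Delta> {..<n} (\<lambda>_ _. 0)" and t: "kap \<Delta> ^ t \<le> y / real M" "0 \<le> y"
  defines "B \<equiv> (2 * y + 2 * Kc \<Delta> + 6) / real M"
  shows "exp (- (real n * B)) * Z {..<n} (\<lambda>_ _. 0) \<le> real (\<Prod>v<n. iS \<Delta> M W (Suc (2 * t)) n v) / real ((M ^ Suc \<Delta>) ^ n)"
    "real (\<Prod>v<n. iS \<Delta> M W (Suc (2 * t)) n v) / real ((M ^ Suc \<Delta>) ^ n) \<le> exp (real n * B) * Z {..<n} (\<lambda>_ _. 0)"
proof -
  define st where "st v = (\<Sum>b<q. F (chain n v) v b * rat {v..<n} (chain n v) v b 0)" for v
  define se where "se v = real (iS \<Delta> M W (Suc (2 * t)) n v) / real (M ^ Suc \<Delta>)" for v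
  have q0: "0 < q" using \<Delta> by simp
  have each: "exp (- B) * st v \<le> se v \<and> se v \<le> exp B * st v \<and> 0 \<le> st v" if v: "v < n" for v
  proof -
    let ?U = "{v..<n}" and ?m = "chain n v"
    have a: "admissible \<Delta> ?U ?m" "v \<in> ?U" using chain_admissible[OF adm, of v] v by auto
    define R where "R = ee (Suc (2 * t)) ?U ?m v"
    have er: "err_le ?U ?m v (rv R) B" unfolding R_def B_def by (rule est_root[OF a t])
    have se: "se v = (\<Sum>b<q. F ?m v b * rv R b 0)"
    proof -
      have "real (iS \<Delta> M W (Suc (2 * t)) n v) = (\<Sum>b<q. real (iF \<Delta> M W ?m v b * R b 0))"
        unfolding iS_def R_def by (simp only: of_nat_sum)
      also have "\<dots> = (\<Sum>b<q. real M ^ Suc \<Delta> * (F ?m v b * rv R b 0))"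
        by (intro sum.cong refl iFR pins_le[OF a]) auto
      finally show ?thesis using M0 by (simp add: se_def sum_distrib_left[symmetric] del: power_Suc)
    qed
    have tm: "exp (- B) * rat ?U ?m v b 0 \<le> rv R b 0 \<and> rv R b 0 \<le> exp B * rat ?U ?m v b 0" if b: "b < q" for b
    proof -
      have r: "0 < rat ?U ?m v b 0" by (rule rat_pos[OF a(1) \<Delta> a(2)])
      have p: "0 < rv R b 0" using est_pos[OF a b q0] M0 by (simp add: rv_def R_def del: est.simps)
      have "\<bar>ln (rv R b 0) - ln (rat ?U ?m v b 0)\<bar> \<le> B" using er b q0 unfolding err_le_def by blast
      then have "- B + ln (rat ?U ?m v b 0) \<le> ln (rv R b 0)" "ln (rv R b 0) \<le> B + ln (rat ?U ?m v b 0)" by linarith+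
      then have "exp (- B + ln (rat ?U ?m v b 0)) \<le> exp (ln (rv R b 0))" "exp (ln (rv R b 0)) \<le> exp (B + ln (rat ?U ?m v b 0))" by simp_all
      then show ?thesis unfolding exp_add using r p by simp
    qed
    have "exp (- B) * st v \<le> se v"
      unfolding se st_def sum_distrib_left
    proof (intro sum_mono)
      fix b assume "b \<in> {..<q}"
      then show "exp (- B) * (F ?m v b * rat ?U ?m v b 0) \<le> F ?m v b * rv R b 0"
        by (subst mult.left_commute) (intro mult_left_mono conjunct1[OF tm] pow_w; simp)
    qed
    moreover have "se v \<le> exp B * st v"
      unfolding se st_def sum_distrib_left
    proof (intro sum_mono)
      fix b assume "b \<in> {..<q}"
      then show "F ?m v b * rv R b 0 \<le> exp B * (F ?m v b * rat ?U ?m v b 0)"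
        by (subst mult.left_commute) (intro mult_left_mono conjunct2[OF tm] pow_w; simp)
    qed
    moreover have "0 \<le> st v" unfolding st_def using rat_pos[OF a(1) \<Delta> a(2)]
      by (intro sum_nonneg mult_nonneg_nonneg pow_w) (simp add: less_imp_le)
    ultimately show ?thesis by blast
  qed
  have ZP: "Z {..<n} (\<lambda>_ _. 0) = (\<Prod>v<n. st v)"
    using Z_product[OF adm order_refl] by (simp add: st_def)
  have SP: "real (\<Prod>v<n. iS \<Delta> M W (Suc (2 * t)) n v) / real ((M ^ Suc \<Delta>) ^ n) = (\<Prod>v<n. se v)"
    unfolding se_def prod_dividef of_nat_prod by simp
  have "exp (- (real n * B)) * (\<Prod>v<n. st v) = (\<Prod>v<n. exp (- B) * st v)"
    unfolding prod.distrib by (simp add: exp_of_nat_mult[symmetric])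
  also have "\<dots> \<le> (\<Prod>v<n. se v)" using each by (intro prod_mono) auto
  finally show "exp (- (real n * B)) * Z {..<n} (\<lambda>_ _. 0) \<le> real (\<Prod>v<n. iS \<Delta> M W (Suc (2 * t)) n v) / real ((M ^ Suc \<Delta>) ^ n)"
    unfolding ZP SP .
  have "(\<Prod>v<n. se v) \<le> (\<Prod>v<n. exp B * st v)"
  proof (intro prod_mono conjI)
    fix v assume "v \<in> {..<n}"
    then have "exp (- B) * st v \<le> se v" "se v \<le> exp B * st v" "0 \<le> st v" using each[of v] by simp_all
    moreover from this have "0 \<le> exp (- B) * st v" by simp
    ultimately show "0 \<le> se v" "se v \<le> exp B * st v" by linarith+
  qed
  also have "\<dots> = exp (real n * B) * (\<Prod>v<n. st v)"
    unfolding prod.distrib by (simp add: exp_of_nat_mult[symmetric])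
  finally show "real (\<Prod>v<n. iS \<Delta> M W (Suc (2 * t)) n v) / real ((M ^ Suc \<Delta>) ^ n) \<le> exp (real n * B) * Z {..<n} (\<lambda>_ _. 0)"
    unfolding ZP SP .
qed

end

lemma potts_eq_Z:
  fixes w :: real
  assumes "simple_graph V E" "potts_model E w"
  shows "potts V E q w = potts_model.Z E q w V (\<lambda>_ _. 0)"
proof -
  interpret potts_model E q w by (rule assms(2))
  have sub: "e \<subseteq> V" if "e \<in> E" for e using assms(1) that by (auto simp: simple_graph_def)
  show ?thesis unfolding potts_def Z_def
  proof (rule sum.reindex_bij_witness[where i = "\<lambda>\<phi>. restrict (\<lambda>x. Suc (\<phi> x)) V" and j = "\<lambda>\<phi>. restrict (\<lambda>x. \<phi> x - 1) V"])
    fix \<phi> :: "nat \<Rightarrow> nat" assume \<phi>: "\<phi> \<in> V \<rightarrow>\<^sub>E {1..q}"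
    then have pos: "\<phi> x \<ge> 1" "\<phi> x \<le> q" if "x \<in> V" for x using that by (auto simp: PiE_iff)
    show "restrict (\<lambda>x. \<phi> x - 1) V \<in> V \<rightarrow>\<^sub>E {..<q}" using pos by fastforce
    show "restrict (\<lambda>x. Suc (restrict (\<lambda>x. \<phi> x - 1) V x)) V = \<phi>"
      using \<phi> pos by (intro ext) (auto simp: restrict_def PiE_iff extensional_def)
    have "mono_edges E \<phi> = {e \<in> E. e \<subseteq> V \<and> (\<forall>u\<in>e. \<forall>v\<in>e. restrict (\<lambda>x. \<phi> x - 1) V u = restrict (\<lambda>x. \<phi> x - 1) V v)}"
    proof -
      have "(\<forall>u\<in>e. \<forall>v\<in>e. \<phi> u = \<phi> v) = (\<forall>u\<in>e. \<forall>v\<in>e. restrict (\<lambda>x. \<phi> x - 1) V u = restrict (\<lambda>x. \<phi> x - 1) V v)"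
        if "e \<in> E" for e
      proof -
        have "\<phi> u = \<phi> v \<longleftrightarrow> restrict (\<lambda>x. \<phi> x - 1) V u = restrict (\<lambda>x. \<phi> x - 1) V v" if "u \<in> e" "v \<in> e" for u v
          using pos[of u] pos[of v] sub[OF \<open>e \<in> E\<close>] that by (auto simp: subset_iff)
        then show ?thesis by (intro ball_cong refl)
      qed
      then have "e \<in> E \<and> (\<forall>u\<in>e. \<forall>v\<in>e. \<phi> u = \<phi> v) \<longleftrightarrow>
        e \<in> E \<and> e \<subseteq> V \<and> (\<forall>u\<in>e. \<forall>v\<in>e. restrict (\<lambda>x. \<phi> x - 1) V u = restrict (\<lambda>x. \<phi> x - 1) V v)" for e
        using sub[of e] by (metis (no_types))
      then show ?thesis unfolding mono_edges_def by (rule Collect_cong)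
    qed
    then show "w ^ energy V (\<lambda>_ _. 0) (restrict (\<lambda>x. \<phi> x - 1) V) = w ^ card (mono_edges E \<phi>)"
      by (simp add: energy_def)
  next
    fix \<phi> :: "nat \<Rightarrow> nat" assume \<phi>: "\<phi> \<in> V \<rightarrow>\<^sub>E {..<q}"
    show "restrict (\<lambda>x. Suc (\<phi> x)) V \<in> V \<rightarrow>\<^sub>E {1..q}" unfolding restrict_PiE_iff using \<phi> by (auto simp: Suc_le_eq)
    show "restrict (\<lambda>x. restrict (\<lambda>x. Suc (\<phi> x)) V x - 1) V = \<phi>"
      using \<phi> by (intro ext) (auto simp: restrict_def PiE_iff extensional_def)
  qed
qed

lemma (in potts_model) admissible_zero:
  assumes "simple_graph {..<n} E" "max_degree_le {..<n} E \<Delta>"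
  shows "admissible \<Delta> {..<n} (\<lambda>_ _. 0)"
  unfolding admissible_def
proof (intro conjI ballI)
  fix u assume u: "u \<in> {..<n}"
  have fE: "finite {e \<in> E. u \<in> e}"
    by (rule finite_subset[of _ "Pow {..<n}"]) (use assms in \<open>auto simp: simple_graph_def\<close>)
  have "(\<lambda>x. {u, x}) ` nb {..<n} u \<subseteq> {e \<in> E. u \<in> e}" by (auto simp: nb_def)
  moreover have "inj_on (\<lambda>x. {u, x}) (nb {..<n} u)" by (auto simp: inj_on_def doubleton_eq_iff)
  ultimately have "card (nb {..<n} u) \<le> card {e \<in> E. u \<in> e}" using card_inj_on_le fE by blast
  also have "\<dots> \<le> \<Delta>" using assms(2) u by (simp add: max_degree_le_def)
  finally show "deg {..<n} (\<lambda>_ _. 0) u \<le> \<Delta>" by (simp add: deg_def)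
qed simp

text \<open>Three errors add up: the cut of the recursion (\<open>y / M\<close>), the rounding of the ratios (\<open>Kc \<Delta> / M\<close>) and the rounding
  of \<open>w\<close>, each multiplied by the number of vertices.\<close>

lemma output_correct:
  fixes w \<epsilon> y :: real
  assumes graph: "simple_graph {..<n} E" "max_degree_le {..<n} E \<Delta>"
    and w: "0 \<le> w" "w \<le> 1" and dl: "3 \<le> \<Delta>" "\<Delta> < q"
    and regime: "2 * \<Delta> \<le> q \<or> 500 \<le> \<Delta> \<and> 1998 * real \<Delta> \<le> 1000 * real q"
    and W: "W \<le> M" "real W \<le> w * real M" "w * real M \<le> real W + 1"
    and M: "Kc \<Delta> \<le> real M"
    and t: "kap \<Delta> ^ t \<le> y / real M" "0 \<le> y"
    and eps: "real n * (2 * y + 2 * Kc \<Delta> + 6 + real \<Delta>) \<le> \<epsilon> * real M"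
  defines "\<xi> \<equiv> real (\<Prod>v<n. potts_model.iS E q \<Delta> M W (Suc (2 * t)) n v) / real ((M ^ Suc \<Delta>) ^ n)"
  shows "exp (- \<epsilon>) \<le> potts {..<n} E q w / \<xi>" "potts {..<n} E q w / \<xi> \<le> exp \<epsilon>"
proof -
  have M6: "6 \<le> M"
  proof -
    have "6 \<le> Kc \<Delta>" by (simp add: Kc_def add_increasing)
    then show ?thesis using M by linarith
  qed
  then have M0: "0 < real M" by simp
  define w' where "w' = real W / real M"
  have "w - w' = (w * real M - real W) / real M" using M0 by (simp add: w'_def diff_divide_distrib)
  also have "\<dots> \<le> 1 / real M" using W M0 by (intro divide_right_mono) auto
  finally have "w - w' \<le> 1 / real M" .
  then have w': "0 \<le> w'" "w' \<le> w" "w - w' \<le> 1 / real M" "w' \<le> 1"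
    using W M0 by (auto simp: w'_def pos_divide_le_eq)
  have ec: "card e = 2" if "e \<in> E" for e using graph that by (auto simp: simple_graph_def)
  have A: "potts_model E w" and Bm: "potts_model E w'" using ec w w' by (unfold_locales; auto)+
  have rt: "real \<Delta> \<le> (101/100) * (real q - real \<Delta>)" using regime dl by (auto simp: algebra_simps)
  interpret A: potts_model E q w by (rule A)
  interpret potts_approx E q w' \<Delta> M W
    using ec w w' dl M6 W rt M regime by unfold_locales (auto simp: w'_def)
  have adm: "admissible \<Delta> {..<n} (\<lambda>_ _. 0)" by (rule A.admissible_zero[OF graph])
  define B where "B = (2 * y + 2 * Kc \<Delta> + 6) / real M"
  define z z' where "z = A.Z {..<n} (\<lambda>_ _. 0)" and "z' = Z {..<n} (\<lambda>_ _. 0)"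
  have xi: "exp (- (real n * B)) * z' \<le> \<xi>" "\<xi> \<le> exp (real n * B) * z'"
    unfolding z'_def B_def \<xi>_def by (rule product_error[OF adm t])+
  have z': "0 < z'" unfolding z'_def by (rule Z_pos[OF adm dl(2)])
  then have xi0: "0 < \<xi>" using xi(1) by (smt (verit) exp_gt_zero mult_pos_pos)
  have zz: "z' \<le> z" unfolding z_def z'_def by (rule Z_weight_mono[OF A Bm w'(2)])
  have zz': "z \<le> exp (real n * (real \<Delta> / real M)) * z'"
  proof -
    have "z \<le> (1 + real \<Delta> * (w - w')) ^ n * z'"
      unfolding z_def z'_def using Z_weight_change[OF A Bm w'(2) dl(2) adm] by simp
    also have "\<dots> \<le> exp (real \<Delta> / real M) ^ n * z'"
    proof (intro mult_right_mono power_mono)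
      have "real \<Delta> * (w - w') \<le> real \<Delta> / real M" using mult_left_mono[of "w - w'" "1 / real M" "real \<Delta>"] w' by simp
      then show "1 + real \<Delta> * (w - w') \<le> exp (real \<Delta> / real M)" using exp_ge_add_one_self[of "real \<Delta> / real M"] by linarith
    qed (use z' w' in auto)
    finally show ?thesis unfolding exp_of_nat_mult[symmetric] .
  qed
  have e: "real n * B + real n * (real \<Delta> / real M) \<le> \<epsilon>"
  proof -
    have "real n * B + real n * (real \<Delta> / real M) = real n * (2 * y + 2 * Kc \<Delta> + 6 + real \<Delta>) / real M"
      by (simp add: B_def add_divide_distrib algebra_simps)
    also have "\<dots> \<le> \<epsilon>" using eps M0 by (simp add: pos_divide_le_eq)
    finally show ?thesis .
  qed
  have d0: "0 \<le> real n * (real \<Delta> / real M)" by simp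
  have e1: "real n * B - \<epsilon> \<le> 0" and e2: "real n * (real \<Delta> / real M) \<le> \<epsilon> - real n * B"
    using e d0 by linarith+
  have p: "potts {..<n} E q w = z" unfolding z_def by (rule potts_eq_Z[OF graph(1) A])
  have "\<xi> * exp (- \<epsilon>) \<le> exp (real n * B) * z' * exp (- \<epsilon>)" using xi by (intro mult_right_mono) auto
  also have "\<dots> = exp (real n * B - \<epsilon>) * z'" by (simp add: exp_diff exp_minus field_simps)
  also have "\<dots> \<le> 1 * z'" using e1 z' by (intro mult_right_mono) auto
  finally show "exp (- \<epsilon>) \<le> potts {..<n} E q w / \<xi>" unfolding p using xi0 zz by (simp add: pos_le_divide_eq mult.commute)
  have "z \<le> exp (real n * (real \<Delta> / real M)) * z'" by (rule zz')
  also have "\<dots> \<le> exp (\<epsilon> - real n * B) * z'" using z' by (intro mult_right_mono iffD2[OF exp_le_cancel_iff] e2) auto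
  also have "\<dots> = exp \<epsilon> * (exp (- (real n * B)) * z')" by (simp add: exp_diff exp_minus field_simps)
  also have "\<dots> \<le> exp \<epsilon> * \<xi>" using xi by (intro mult_left_mono) auto
  finally show "potts {..<n} E q w / \<xi> \<le> exp \<epsilon>" unfolding p using xi0 by (simp add: pos_divide_le_eq)
qed

section \<open>A structured language\<close>

text \<open>\<open>Rd\<close> reads the heap. Products and quotients are compiled to loops.\<close>

datatype exp = N nat | V nat | Plus exp exp | Minus exp exp | Times exp exp | Quot exp exp | Rd exp

text \<open>\<open>Wr\<close> writes the heap. \<open>IfW\<close> compares a quotient with the weight. \<open>Grow x\<close> increases register \<open>x + 1\<close>
  until its product with the accuracy reaches register \<open>x\<close>. The body of \<open>For x e\<close> runs for the values
  below \<open>e\<close>, which is evaluated once, and may overwrite \<open>x\<close> without effect on the loop.\<close>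

datatype com =
    Skip
  | Asg nat exp
  | Wr exp exp
  | Seq com com
  | IfLe exp exp com com
  | IfW exp exp com com
  | For nat exp com
  | Grow nat

type_synonym store = "(nat \<Rightarrow> nat) \<times> (nat \<Rightarrow> nat)"

primrec eval :: "exp \<Rightarrow> store \<Rightarrow> nat" where
  "eval (N c) s = c"
| "eval (V x) s = fst s x"
| "eval (Plus a b) s = eval a s + eval b s"
| "eval (Minus a b) s = eval a s - eval b s"
| "eval (Times a b) s = eval a s * eval b s"
| "eval (Quot a b) s = eval a s div eval b s"
| "eval (Rd a) s = snd s (eval a s)"

primrec etime :: "exp \<Rightarrow> store \<Rightarrow> nat" where
  "etime (N c) s = 1"
| "etime (V x) s = 2"
| "etime (Plus a b) s = etime a s + etime b s + 1"
| "etime (Minus a b) s = etime a s + etime b s + 1"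
| "etime (Times a b) s = etime a s + etime b s + 4 * eval b s + 5"
| "etime (Quot a b) s = etime a s + etime b s + 4 * (eval a s div eval b s) + 7"
| "etime (Rd a) s = etime a s + 1"

primrec iter :: "(nat \<Rightarrow> 'a \<Rightarrow> 'a) \<Rightarrow> nat \<Rightarrow> 'a \<Rightarrow> 'a" where
  "iter f 0 s = s"
| "iter f (Suc i) s = f i (iter f i s)"

definition put :: "nat \<Rightarrow> nat \<Rightarrow> store \<Rightarrow> store" where
  "put x a s = ((fst s)(x := a), snd s)"

definition grown :: "(real_arg \<Rightarrow> real) \<Rightarrow> nat \<Rightarrow> nat \<Rightarrow> nat" where
  "grown X a b = (LEAST k. b \<le> k \<and> real a \<le> X Accuracy * real k)"

primrec sem :: "(real_arg \<Rightarrow> real) \<Rightarrow> com \<Rightarrow> store \<Rightarrow> store" where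
  "sem X Skip = (\<lambda>s. s)"
| "sem X (Asg x e) = (\<lambda>s. put x (eval e s) s)"
| "sem X (Wr a b) = (\<lambda>s. (fst s, (snd s)(eval a s := eval b s)))"
| "sem X (Seq c d) = (\<lambda>s. sem X d (sem X c s))"
| "sem X (IfLe a b c d) = (\<lambda>s. if eval a s \<le> eval b s then sem X c s else sem X d s)"
| "sem X (IfW a b c d) = (\<lambda>s. if real (eval a s) \<le> X Weight * real (eval b s) then sem X c s else sem X d s)"
| "sem X (For x e c) = (\<lambda>s. iter (\<lambda>i s. sem X c (put x i s)) (eval e s) s)"
| "sem X (Grow x) = (\<lambda>s. put (Suc x) (grown X (fst s x) (fst s (Suc x))) s)"

primrec time :: "(real_arg \<Rightarrow> real) \<Rightarrow> com \<Rightarrow> store \<Rightarrow> nat" where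
  "time X Skip = (\<lambda>s. 0)"
| "time X (Asg x e) = (\<lambda>s. etime e s + 2)"
| "time X (Wr a b) = (\<lambda>s. etime a s + etime b s + 1)"
| "time X (Seq c d) = (\<lambda>s. time X c s + time X d (sem X c s))"
| "time X (IfLe a b c d) = (\<lambda>s. etime a s + etime b s + 2 + (if eval a s \<le> eval b s then time X c s else time X d s))"
| "time X (IfW a b c d) = (\<lambda>s. etime a s + etime b s + 2 + (if real (eval a s) \<le> X Weight * real (eval b s) then time X c s else time X d s))"
| "time X (For x e c) = (\<lambda>s. etime e s + 2 +
     (\<Sum>i<eval e s. time X c (put x i (iter (\<lambda>i s. sem X c (put x i s)) i s)) + 6))"
| "time X (Grow x) = (\<lambda>s. 4 * (grown X (fst s x) (fst s (Suc x)) - fst s (Suc x)) + 1)"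

section \<open>Compilation\<close>

primrec elen :: "exp \<Rightarrow> nat" where
  "elen (N c) = 1"
| "elen (V x) = 2"
| "elen (Plus a b) = elen a + elen b + 1"
| "elen (Minus a b) = elen a + elen b + 1"
| "elen (Times a b) = elen a + elen b + 8"
| "elen (Quot a b) = elen a + elen b + 10"
| "elen (Rd a) = elen a + 1"

definition mul_code :: "nat \<Rightarrow> nat \<Rightarrow> instr list" where
  "mul_code p t = [Const (t+2) 0, Const (t+3) 0, Const (t+4) 1, JumpLe (t+1) (t+3) (p+7),
     Add (t+2) (t+2) t, Sub (t+1) (t+1) (t+4), JumpLe 0 0 (p+3), Add t (t+2) (t+3)]"

definition div_code :: "nat \<Rightarrow> nat \<Rightarrow> instr list" where
  "div_code p t = [Const (t+2) 0, Const (t+3) 0, Const (t+4) 1, JumpLe (t+1) (t+3) (p+9),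
     JumpLe (t+1) t (p+6), JumpLe 0 0 (p+9), Sub t t (t+1), Add (t+2) (t+2) (t+4), JumpLe 0 0 (p+4), Add t (t+2) (t+3)]"

text \<open>The result is placed in register \<open>t\<close>; registers from \<open>t\<close> on are scratch space. The code starts at address \<open>l\<close>,
  as jumps are absolute.\<close>

primrec ecode :: "nat \<Rightarrow> nat \<Rightarrow> exp \<Rightarrow> instr list" where
  "ecode l t (N c) = [Const t c]"
| "ecode l t (V x) = [Const t 0, Add t t x]"
| "ecode l t (Plus a b) = ecode l t a @ ecode (l + elen a) (t+1) b @ [Add t t (t+1)]"
| "ecode l t (Minus a b) = ecode l t a @ ecode (l + elen a) (t+1) b @ [Sub t t (t+1)]"
| "ecode l t (Times a b) = ecode l t a @ ecode (l + elen a) (t+1) b @ mul_code (l + elen a + elen b) t"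
| "ecode l t (Quot a b) = ecode l t a @ ecode (l + elen a) (t+1) b @ div_code (l + elen a + elen b) t"
| "ecode l t (Rd a) = ecode l t a @ [Load t t]"

primrec clen :: "com \<Rightarrow> nat" where
  "clen Skip = 0"
| "clen (Asg x e) = elen e + 2"
| "clen (Wr a b) = elen a + elen b + 1"
| "clen (Seq c d) = clen c + clen d"
| "clen (IfLe a b c d) = elen a + elen b + clen d + clen c + 2"
| "clen (IfW a b c d) = elen a + elen b + clen d + clen c + 2"
| "clen (For x e c) = elen e + clen c + 7"
| "clen (Grow x) = 4"

primrec ccode :: "nat \<Rightarrow> nat \<Rightarrow> com \<Rightarrow> instr list" where
  "ccode l t Skip = []"
| "ccode l t (Asg x e) = ecode l t e @ [Const x 0, Add x x t]"
| "ccode l t (Wr a b) = ecode l t a @ ecode (l + elen a) (t+1) b @ [Store t (t+1)]"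
| "ccode l t (Seq c d) = ccode l t c @ ccode (l + clen c) t d"
| "ccode l t (IfLe a b c d) = (let k = l + elen a + elen b in
     ecode l t a @ ecode (l + elen a) (t+1) b @ [JumpLe t (t+1) (k + clen d + 2)] @ ccode (k + 1) t d @
     [JumpLe 0 0 (k + clen d + clen c + 2)] @ ccode (k + clen d + 2) t c)"
| "ccode l t (IfW a b c d) = (let k = l + elen a + elen b in
     ecode l t a @ ecode (l + elen a) (t+1) b @ [JumpLeReal Weight t (t+1) (k + clen d + 2)] @ ccode (k + 1) t d @
     [JumpLe 0 0 (k + clen d + clen c + 2)] @ ccode (k + clen d + 2) t c)"
| "ccode l t (For x e c) = (let k = l + elen e in
     ecode l t e @ [Const (t+1) 0, JumpLe t (t+1) (k + clen c + 7), Const x 0, Add x x (t+1)] @ ccode (k + 4) (t+2) c @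
     [Const (t+2) 1, Add (t+1) (t+1) (t+2), JumpLe 0 0 (k + 1)])"
| "ccode l t (Grow x) = [JumpLeReal Accuracy x (Suc x) (l+4), Const t 1, Add (Suc x) (Suc x) t, JumpLe 0 0 l]"

lemma length_ecode [simp]: "length (ecode l t e) = elen e"
  by (induction e arbitrary: l t) (auto simp: mul_code_def div_code_def)

lemma length_ccode [simp]: "length (ccode l t c) = clen c"
  by (induction c arbitrary: l t) (auto simp: Let_def)

primrec evars :: "exp \<Rightarrow> nat set" where
  "evars (N c) = {}"
| "evars (V x) = {x}"
| "evars (Plus a b) = evars a \<union> evars b"
| "evars (Minus a b) = evars a \<union> evars b"
| "evars (Times a b) = evars a \<union> evars b"
| "evars (Quot a b) = evars a \<union> evars b"
| "evars (Rd a) = evars a"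

primrec cvars :: "com \<Rightarrow> nat set" where
  "cvars Skip = {}"
| "cvars (Asg x e) = insert x (evars e)"
| "cvars (Wr a b) = evars a \<union> evars b"
| "cvars (Seq c d) = cvars c \<union> cvars d"
| "cvars (IfLe a b c d) = evars a \<union> evars b \<union> cvars c \<union> cvars d"
| "cvars (IfW a b c d) = evars a \<union> evars b \<union> cvars c \<union> cvars d"
| "cvars (For x e c) = insert x (evars e \<union> cvars c)"
| "cvars (Grow x) = {x, Suc x}"

lemma eval_cong: "(\<And>x. x \<in> evars e \<Longrightarrow> r x = r' x) \<Longrightarrow> eval e (r, h) = eval e (r', h)"
  by (induction e) auto

lemma etime_cong: "(\<And>x. x \<in> evars e \<Longrightarrow> r x = r' x) \<Longrightarrow> etime e (r, h) = etime e (r', h)"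
  using eval_cong[of _ r r' h] by (induction e) auto

section \<open>Correctness of the compiler\<close>

abbreviation conf :: "nat \<Rightarrow> (nat \<Rightarrow> nat) \<Rightarrow> (nat \<Rightarrow> nat) \<Rightarrow> config" where
  "conf p r h \<equiv> \<lparr>pc = p, reg = r, heap = h\<rparr>"

definition code_at :: "instr list \<Rightarrow> nat \<Rightarrow> instr list \<Rightarrow> bool" where
  "code_at P l c \<longleftrightarrow> l + length c \<le> length P \<and> (\<forall>i<length c. P ! (l + i) = c ! i)"

lemma code_at_append: "code_at P l (c @ d) \<longleftrightarrow> code_at P l c \<and> code_at P (l + length c) d"
proof -
  have "(\<forall>i<length c + length d. P ! (l + i) = (c @ d) ! i) \<longleftrightarrow>
    (\<forall>i<length c. P ! (l + i) = c ! i) \<and> (\<forall>i<length d. P ! (l + length c + i) = d ! i)"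
  proof (intro iffI conjI allI impI)
    fix i assume *: "\<forall>i<length c + length d. P ! (l + i) = (c @ d) ! i"
    { assume "i < length c" then show "P ! (l + i) = c ! i" using *[rule_format, of i] by (simp add: nth_append) }
    { assume "i < length d" then show "P ! (l + length c + i) = d ! i"
        using *[rule_format, of "length c + i"] by (simp add: add.assoc) }
  next
    fix i assume *: "(\<forall>i<length c. P ! (l + i) = c ! i) \<and> (\<forall>i<length d. P ! (l + length c + i) = d ! i)" "i < length c + length d"
    show "P ! (l + i) = (c @ d) ! i"
    proof (cases "i < length c")
      case False
      then have "i - length c < length d" using * by simp
      then have "P ! (l + length c + (i - length c)) = d ! (i - length c)" using * by blast
      then show ?thesis using False by (simp add: nth_append)
    qed (use * in \<open>simp add: nth_append\<close>)
  qed
  then show ?thesis by (auto simp: code_at_def)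
qed

lemma code_at_Cons: "code_at P l (i # c) \<longleftrightarrow> l < length P \<and> P ! l = i \<and> code_at P (Suc l) c"
  using code_at_append[of P l "[i]" c] by (auto simp: code_at_def)

lemma code_at_Nil: "code_at P l [] \<longleftrightarrow> l \<le> length P"
  by (simp add: code_at_def)

definition runs where
  "runs X P n s s' \<longleftrightarrow> (step X P ^^ n) s = s'"

lemma runs_0: "runs X P 0 s s" by (simp add: runs_def)

lemma runs_add: "runs X P m s s' \<Longrightarrow> runs X P n s' s'' \<Longrightarrow> runs X P (m + n) s s''"
  by (simp add: runs_def add.commute[of m n] funpow_add)

lemma runs_step:
  "runs X P n (exec X i (conf l r h)) s' \<Longrightarrow> l < length P \<Longrightarrow> P ! l = i \<Longrightarrow> runs X P (Suc n) (conf l r h) s'"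
  by (simp add: runs_def funpow_swap1 step_def halted_def del: funpow.simps exec.simps add: funpow_Suc_right)

lemma runs_step':
  "exec X i (conf l r h) = s' \<Longrightarrow> l < length P \<Longrightarrow> P ! l = i \<Longrightarrow> runs X P 1 (conf l r h) s'"
  using runs_step[of X P 0 i l r h s'] runs_0[of X P s'] by simp

lemma mul_loop:
  assumes c: "code_at P p (mul_code p t)"
    and "r (t+3) = 0" "r (t+4) = 1"
  shows "\<exists>r'. runs X P (4 * r (t+1) + 2) (conf (p+3) r h) (conf (p+8) r' h) \<and>
    r' t = r (t+2) + r t * r (t+1) \<and> (\<forall>x<t. r' x = r x)"
  using assms(2,3)
proof (induction "r (t+1)" arbitrary: r)
  case 0
  have "runs X P 1 (conf (p+3) r h) (conf (p+7) r h)"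
    by (rule runs_step', use c 0 in \<open>simp_all add: mul_code_def code_at_Cons numeral_eq_Suc\<close>)
  moreover have "runs X P 1 (conf (p+7) r h) (conf (p+8) (r(t := r (t+2) + r (t+3))) h)"
    by (rule runs_step', use c in \<open>simp_all add: mul_code_def code_at_Cons numeral_eq_Suc\<close>)
  ultimately have "runs X P (1 + 1) (conf (p+3) r h) (conf (p+8) (r(t := r (t+2) + r (t+3))) h)" by (rule runs_add)
  moreover have "4 * r (t+1) + 2 = 1 + 1" using 0 by simp
  ultimately have "runs X P (4 * r (t+1) + 2) (conf (p+3) r h) (conf (p+8) (r(t := r (t+2) + r (t+3))) h)" by (simp only:)
  then show ?case using 0 by (intro exI[of _ "r(t := r (t+2) + r (t+3))"] conjI) (assumption, simp_all)
next
  case (Suc n)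
  define r1 where "r1 = r(t+2 := r (t+2) + r t, t+1 := n)"
  have s: "runs X P 4 (conf (p+3) r h) (conf (p+3) r1 h)"
  proof -
    have n: "r (Suc t) = Suc n" using Suc(2) by simp
    have "runs X P 1 (conf (p+3) r h) (conf (p+4) r h)"
      by (rule runs_step', use c Suc.prems n in \<open>simp_all add: mul_code_def code_at_Cons numeral_eq_Suc\<close>)
    moreover have "runs X P 1 (conf (p+4) r h) (conf (p+5) (r(t+2 := r (t+2) + r t)) h)"
      by (rule runs_step', use c in \<open>simp_all add: mul_code_def code_at_Cons numeral_eq_Suc\<close>)
    moreover have "runs X P 1 (conf (p+5) (r(t+2 := r (t+2) + r t)) h) (conf (p+6) r1 h)"
      by (rule runs_step', use c Suc.prems n in \<open>simp_all add: r1_def mul_code_def code_at_Cons numeral_eq_Suc\<close>)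
    moreover have "runs X P 1 (conf (p+6) r1 h) (conf (p+3) r1 h)"
      by (rule runs_step', use c in \<open>simp_all add: mul_code_def code_at_Cons numeral_eq_Suc\<close>)
    ultimately have "runs X P (1 + (1 + (1 + 1))) (conf (p+3) r h) (conf (p+3) r1 h)"
      using runs_add by meson
    then show ?thesis by (simp add: numeral_eq_Suc)
  qed
  have "\<exists>r'. runs X P (4 * r1 (t+1) + 2) (conf (p+3) r1 h) (conf (p+8) r' h) \<and>
    r' t = r1 (t+2) + r1 t * r1 (t+1) \<and> (\<forall>x<t. r' x = r1 x)"
    by (rule Suc(1)) (use Suc.prems in \<open>auto simp: r1_def\<close>)
  then obtain r' where r': "runs X P (4 * r1 (t+1) + 2) (conf (p+3) r1 h) (conf (p+8) r' h)"
    "r' t = r1 (t+2) + r1 t * r1 (t+1)" "\<forall>x<t. r' x = r1 x" by blast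
  have "r (t+1) = Suc n" using Suc(2) by simp
  moreover have "runs X P (4 + (4 * r1 (t+1) + 2)) (conf (p+3) r h) (conf (p+8) r' h)"
    by (rule runs_add[OF s r'(1)])
  ultimately have "runs X P (4 * r (t+1) + 2) (conf (p+3) r h) (conf (p+8) r' h)" by (simp add: r1_def)
  then show ?case using r'(2,3) \<open>r (t+1) = Suc n\<close> by (intro exI[of _ r']) (auto simp: r1_def)
qed

lemma mul_correct:
  assumes c: "code_at P p (mul_code p t)"
  shows "\<exists>r'. runs X P (4 * r (t+1) + 5) (conf p r h) (conf (p+8) r' h) \<and>
    r' t = r t * r (t+1) \<and> (\<forall>x<t. r' x = r x)"
proof -
  define r1 where "r1 = r(t+2 := 0, t+3 := 0, t+4 := 1)"
  have "runs X P 1 (conf p r h) (conf (p+1) (r(t+2 := 0)) h)"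
    by (rule runs_step', use c in \<open>simp_all add: mul_code_def code_at_Cons\<close>)
  moreover have "runs X P 1 (conf (p+1) (r(t+2 := 0)) h) (conf (p+2) (r(t+2 := 0, t+3 := 0)) h)"
    by (rule runs_step', use c in \<open>simp_all add: mul_code_def code_at_Cons numeral_eq_Suc\<close>)
  moreover have "runs X P 1 (conf (p+2) (r(t+2 := 0, t+3 := 0)) h) (conf (p+3) r1 h)"
    by (rule runs_step', use c in \<open>simp_all add: r1_def mul_code_def code_at_Cons numeral_eq_Suc\<close>)
  ultimately have s: "runs X P (1 + (1 + 1)) (conf p r h) (conf (p+3) r1 h)" using runs_add by meson
  obtain r' where r': "runs X P (4 * r1 (t+1) + 2) (conf (p+3) r1 h) (conf (p+8) r' h)"
    "r' t = r1 (t+2) + r1 t * r1 (t+1)" "\<forall>x<t. r' x = r1 x"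
    using mul_loop[OF c, of r1 X h] by (auto simp: r1_def)
  have "runs X P (1 + (1 + 1) + (4 * r1 (t+1) + 2)) (conf p r h) (conf (p+8) r' h)" by (rule runs_add[OF s r'(1)])
  then have "runs X P (4 * r (t+1) + 5) (conf p r h) (conf (p+8) r' h)" by (simp add: r1_def numeral_eq_Suc)
  then show ?thesis using r'(2,3) by (intro exI[of _ r']) (auto simp: r1_def)
qed

lemma div_loop:
  assumes c: "code_at P p (div_code p t)"
    and "r (t+3) = 0" "r (t+4) = 1" "0 < r (t+1)"
  shows "\<exists>r'. runs X P (4 * (r t div r (t+1)) + 3) (conf (p+4) r h) (conf (p+10) r' h) \<and>
    r' t = r (t+2) + r t div r (t+1) \<and> (\<forall>x<t. r' x = r x)"
  using assms(2-4)
proof (induction "r t" arbitrary: r rule: less_induct)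
  case less
  show ?case
  proof (cases "r (t+1) \<le> r t")
    case False
    have "runs X P 1 (conf (p+4) r h) (conf (p+5) r h)"
      by (rule runs_step', use c False in \<open>simp_all add: div_code_def code_at_Cons numeral_eq_Suc\<close>)
    moreover have "runs X P 1 (conf (p+5) r h) (conf (p+9) r h)"
      by (rule runs_step', use c in \<open>simp_all add: div_code_def code_at_Cons numeral_eq_Suc\<close>)
    moreover have "runs X P 1 (conf (p+9) r h) (conf (p+10) (r(t := r (t+2) + r (t+3))) h)"
      by (rule runs_step', use c in \<open>simp_all add: div_code_def code_at_Cons numeral_eq_Suc\<close>)
    ultimately have "runs X P (1 + (1 + 1)) (conf (p+4) r h) (conf (p+10) (r(t := r (t+2) + r (t+3))) h)"
      using runs_add by meson
    then show ?thesis using False less.prems by (intro exI[of _ "r(t := r (t+2) + r (t+3))"]) (simp add: numeral_eq_Suc)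
  next
    case True
    define r1 where "r1 = r(t := r t - r (t+1), t+2 := r (t+2) + 1)"
    have s: "runs X P 4 (conf (p+4) r h) (conf (p+4) r1 h)"
    proof -
      have "runs X P 1 (conf (p+4) r h) (conf (p+6) r h)"
        by (rule runs_step', use c True in \<open>simp_all add: div_code_def code_at_Cons numeral_eq_Suc\<close>)
      moreover have "runs X P 1 (conf (p+6) r h) (conf (p+7) (r(t := r t - r (t+1))) h)"
        by (rule runs_step', use c in \<open>simp_all add: div_code_def code_at_Cons numeral_eq_Suc\<close>)
      moreover have "runs X P 1 (conf (p+7) (r(t := r t - r (t+1))) h) (conf (p+8) r1 h)"
        by (rule runs_step', use c less.prems in \<open>simp_all add: r1_def div_code_def code_at_Cons numeral_eq_Suc\<close>)
      moreover have "runs X P 1 (conf (p+8) r1 h) (conf (p+4) r1 h)"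
        by (rule runs_step', use c in \<open>simp_all add: div_code_def code_at_Cons numeral_eq_Suc\<close>)
      ultimately have "runs X P (1 + (1 + (1 + 1))) (conf (p+4) r h) (conf (p+4) r1 h)"
        using runs_add by meson
      then show ?thesis by (simp add: numeral_eq_Suc)
    qed
    have "\<exists>r'. runs X P (4 * (r1 t div r1 (t+1)) + 3) (conf (p+4) r1 h) (conf (p+10) r' h) \<and>
      r' t = r1 (t+2) + r1 t div r1 (t+1) \<and> (\<forall>x<t. r' x = r1 x)"
      by (rule less.hyps) (use less.prems True in \<open>auto simp: r1_def\<close>)
    then obtain r' where r': "runs X P (4 * (r1 t div r1 (t+1)) + 3) (conf (p+4) r1 h) (conf (p+10) r' h)"
      "r' t = r1 (t+2) + r1 t div r1 (t+1)" "\<forall>x<t. r' x = r1 x" by blast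
    have d: "r t div r (t+1) = Suc (r1 t div r1 (t+1))"
      using True less.prems by (simp add: r1_def le_div_geq)
    have "runs X P (4 + (4 * (r1 t div r1 (t+1)) + 3)) (conf (p+4) r h) (conf (p+10) r' h)"
      by (rule runs_add[OF s r'(1)])
    moreover have "4 + (4 * (r1 t div r1 (t+1)) + 3) = 4 * (r t div r (t+1)) + 3" unfolding d by simp
    ultimately have "runs X P (4 * (r t div r (t+1)) + 3) (conf (p+4) r h) (conf (p+10) r' h)" by (simp only:)
    moreover have "r' t = r (t+2) + r t div r (t+1)" unfolding d r'(2) by (simp add: r1_def)
    moreover have "\<forall>x<t. r' x = r x" using r'(3) by (simp add: r1_def)
    ultimately show ?thesis by blast
  qed
qed

lemma div_correct:
  assumes c: "code_at P p (div_code p t)"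
  shows "\<exists>n r'. n \<le> 4 * (r t div r (t+1)) + 7 \<and> runs X P n (conf p r h) (conf (p+10) r' h) \<and>
    r' t = r t div r (t+1) \<and> (\<forall>x<t. r' x = r x)"
proof -
  define r1 where "r1 = r(t+2 := 0, t+3 := 0, t+4 := 1)"
  have "runs X P 1 (conf p r h) (conf (p+1) (r(t+2 := 0)) h)"
    by (rule runs_step', use c in \<open>simp_all add: div_code_def code_at_Cons\<close>)
  moreover have "runs X P 1 (conf (p+1) (r(t+2 := 0)) h) (conf (p+2) (r(t+2 := 0, t+3 := 0)) h)"
    by (rule runs_step', use c in \<open>simp_all add: div_code_def code_at_Cons numeral_eq_Suc\<close>)
  moreover have "runs X P 1 (conf (p+2) (r(t+2 := 0, t+3 := 0)) h) (conf (p+3) r1 h)"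
    by (rule runs_step', use c in \<open>simp_all add: r1_def div_code_def code_at_Cons numeral_eq_Suc\<close>)
  ultimately have s: "runs X P (1 + (1 + 1)) (conf p r h) (conf (p+3) r1 h)" using runs_add by meson
  show ?thesis
  proof (cases "r (t+1) = 0")
    case True
    have "runs X P 1 (conf (p+3) r1 h) (conf (p+9) r1 h)"
      by (rule runs_step', use c True in \<open>simp_all add: r1_def div_code_def code_at_Cons numeral_eq_Suc\<close>)
    moreover have "runs X P 1 (conf (p+9) r1 h) (conf (p+10) (r1(t := r1 (t+2) + r1 (t+3))) h)"
      by (rule runs_step', use c in \<open>simp_all add: div_code_def code_at_Cons numeral_eq_Suc\<close>)
    ultimately have "runs X P (1 + (1 + 1) + (1 + 1)) (conf p r h) (conf (p+10) (r1(t := r1 (t+2) + r1 (t+3))) h)"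
      using runs_add s by meson
    then show ?thesis using True by (intro exI[of _ "1 + (1 + 1) + (1 + 1)"] exI[of _ "r1(t := r1 (t+2) + r1 (t+3))"]) (simp add: r1_def)
  next
    case False
    have s2: "runs X P 1 (conf (p+3) r1 h) (conf (p+4) r1 h)"
      by (rule runs_step', use c False in \<open>simp_all add: r1_def div_code_def code_at_Cons numeral_eq_Suc\<close>)
    obtain r' where r': "runs X P (4 * (r1 t div r1 (t+1)) + 3) (conf (p+4) r1 h) (conf (p+10) r' h)"
      "r' t = r1 (t+2) + r1 t div r1 (t+1)" "\<forall>x<t. r' x = r1 x"
      using div_loop[OF c, of r1 X h] False by (auto simp: r1_def)
    have "runs X P (1 + (1 + 1) + (1 + (4 * (r1 t div r1 (t+1)) + 3))) (conf p r h) (conf (p+10) r' h)"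
      by (rule runs_add[OF s runs_add[OF s2 r'(1)]])
    then show ?thesis using r'(2,3)
      by (intro exI[of _ "1 + (1 + 1) + (1 + (4 * (r1 t div r1 (t+1)) + 3))"] exI[of _ r']) (auto simp: r1_def)
  qed
qed

lemma ecode_correct:
  assumes "code_at P l (ecode l t e)" "\<And>x. x \<in> evars e \<Longrightarrow> x < t"
  shows "\<exists>n r'. n \<le> etime e (r, h) \<and> runs X P n (conf l r h) (conf (l + elen e) r' h) \<and>
    r' t = eval e (r, h) \<and> (\<forall>x<t. r' x = r x)"
  using assms
proof (induction e arbitrary: l t r)
  case (N c)
  have "runs X P 1 (conf l r h) (conf (l+1) (r(t := c)) h)"
    by (rule runs_step', use N in \<open>simp_all add: code_at_Cons\<close>)
  then show ?case by (intro exI[of _ 1] exI[of _ "r(t := c)"] conjI) (simp only: etime.simps, simp only: elen.simps, simp, simp)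
next
  case (V x)
  have "runs X P 1 (conf l r h) (conf (l+1) (r(t := 0)) h)"
    by (rule runs_step', use V in \<open>simp_all add: code_at_Cons\<close>)
  moreover have "runs X P 1 (conf (l+1) (r(t := 0)) h) (conf (l+2) (r(t := r x)) h)"
    by (rule runs_step', use V in \<open>simp_all add: code_at_Cons\<close>)
  ultimately have "runs X P (1 + 1) (conf l r h) (conf (l+2) (r(t := r x)) h)" by (rule runs_add)
  then show ?case by (intro exI[of _ "1+1"] exI[of _ "r(t := r x)"] conjI) (simp, simp only: elen.simps, simp, simp)
next
  case (Rd a)
  obtain n r' where a: "n \<le> etime a (r, h)" "runs X P n (conf l r h) (conf (l + elen a) r' h)"
    "r' t = eval a (r, h)" "\<forall>x<t. r' x = r x"
    using Rd.IH[of l t r] Rd.prems by (auto simp: code_at_append)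
  have "runs X P 1 (conf (l + elen a) r' h) (conf (l + elen a + 1) (r'(t := h (r' t))) h)"
    by (rule runs_step', use Rd in \<open>simp_all add: code_at_append code_at_Cons\<close>)
  note st = runs_add[OF a(2) this]
  define r2 where "r2 = r'(t := h (r' t))"
  have "r2 t = h (eval a (r, h))" "\<forall>x<t. r2 x = r x" using a(3,4) by (simp_all add: r2_def)
  then show ?case using a(1) st[folded r2_def]
    by (intro exI[of _ "n+1"] exI[of _ r2]) (simp add: add.assoc)
next
  case (Plus a b)
  obtain n r1 where a: "n \<le> etime a (r, h)" "runs X P n (conf l r h) (conf (l + elen a) r1 h)"
    "r1 t = eval a (r, h)" "\<forall>x<t. r1 x = r x"
    using Plus.IH(1)[of l t r] Plus.prems by (auto simp: code_at_append)
  obtain k r2 where b: "k \<le> etime b (r1, h)" "runs X P k (conf (l + elen a) r1 h) (conf (l + elen a + elen b) r2 h)"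
    "r2 (t+1) = eval b (r1, h)" "\<forall>x<t+1. r2 x = r1 x"
    using Plus.IH(2)[of "l + elen a" "t+1" r1] Plus.prems by (fastforce simp: code_at_append)
  have eq: "eval b (r1, h) = eval b (r, h)" "etime b (r1, h) = etime b (r, h)"
    using eval_cong[of b r1 r h] etime_cong[of b r1 r h] a(4) Plus.prems(2) by auto
  have "runs X P 1 (conf (l + elen a + elen b) r2 h) (conf (l + elen a + elen b + 1) (r2(t := r2 t + r2 (t+1))) h)"
    by (rule runs_step', use Plus.prems in \<open>simp_all add: code_at_append code_at_Cons\<close>)
  note st = runs_add[OF a(2) runs_add[OF b(2) this]]
  define r3 where "r3 = r2(t := r2 t + r2 (t+1))"
  have "r3 t = eval a (r, h) + eval b (r, h)" "\<forall>x<t. r3 x = r x" using a(3,4) b(3,4) eq by (simp_all add: r3_def)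
  then show ?case using a(1) b(1) eq st[folded r3_def]
    by (intro exI[of _ "n+(k+1)"] exI[of _ r3]) (simp add: add.assoc)
next
  case (Minus a b)
  obtain n r1 where a: "n \<le> etime a (r, h)" "runs X P n (conf l r h) (conf (l + elen a) r1 h)"
    "r1 t = eval a (r, h)" "\<forall>x<t. r1 x = r x"
    using Minus.IH(1)[of l t r] Minus.prems by (auto simp: code_at_append)
  obtain k r2 where b: "k \<le> etime b (r1, h)" "runs X P k (conf (l + elen a) r1 h) (conf (l + elen a + elen b) r2 h)"
    "r2 (t+1) = eval b (r1, h)" "\<forall>x<t+1. r2 x = r1 x"
    using Minus.IH(2)[of "l + elen a" "t+1" r1] Minus.prems by (fastforce simp: code_at_append)
  have eq: "eval b (r1, h) = eval b (r, h)" "etime b (r1, h) = etime b (r, h)"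
    using eval_cong[of b r1 r h] etime_cong[of b r1 r h] a(4) Minus.prems(2) by auto
  have "runs X P 1 (conf (l + elen a + elen b) r2 h) (conf (l + elen a + elen b + 1) (r2(t := r2 t - r2 (t+1))) h)"
    by (rule runs_step', use Minus.prems in \<open>simp_all add: code_at_append code_at_Cons\<close>)
  note st = runs_add[OF a(2) runs_add[OF b(2) this]]
  define r3 where "r3 = r2(t := r2 t - r2 (t+1))"
  have "r3 t = eval a (r, h) - eval b (r, h)" "\<forall>x<t. r3 x = r x" using a(3,4) b(3,4) eq by (simp_all add: r3_def)
  then show ?case using a(1) b(1) eq st[folded r3_def]
    by (intro exI[of _ "n+(k+1)"] exI[of _ r3]) (simp add: add.assoc)
next
  case (Times a b)
  obtain n r1 where a: "n \<le> etime a (r, h)" "runs X P n (conf l r h) (conf (l + elen a) r1 h)"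
    "r1 t = eval a (r, h)" "\<forall>x<t. r1 x = r x"
    using Times.IH(1)[of l t r] Times.prems by (auto simp: code_at_append)
  obtain k r2 where b: "k \<le> etime b (r1, h)" "runs X P k (conf (l + elen a) r1 h) (conf (l + elen a + elen b) r2 h)"
    "r2 (t+1) = eval b (r1, h)" "\<forall>x<t+1. r2 x = r1 x"
    using Times.IH(2)[of "l + elen a" "t+1" r1] Times.prems by (fastforce simp: code_at_append)
  have eq: "eval b (r1, h) = eval b (r, h)" "etime b (r1, h) = etime b (r, h)"
    using eval_cong[of b r1 r h] etime_cong[of b r1 r h] a(4) Times.prems(2) by auto
  obtain r3 where m: "runs X P (4 * r2 (t+1) + 5) (conf (l + elen a + elen b) r2 h) (conf (l + elen a + elen b + 8) r3 h)"
    "r3 t = r2 t * r2 (t+1)" "\<forall>x<t. r3 x = r2 x"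
    using mul_correct[of P "l + elen a + elen b" t X r2 h] Times.prems by (auto simp: code_at_append)
  from runs_add[OF a(2) runs_add[OF b(2) m(1)]] show ?case using a b eq m(2,3)
    by (intro exI[of _ "n+(k+(4 * r2 (t+1) + 5))"] exI[of _ r3]) (simp add: add.assoc)
next
  case (Quot a b)
  obtain n r1 where a: "n \<le> etime a (r, h)" "runs X P n (conf l r h) (conf (l + elen a) r1 h)"
    "r1 t = eval a (r, h)" "\<forall>x<t. r1 x = r x"
    using Quot.IH(1)[of l t r] Quot.prems by (auto simp: code_at_append)
  obtain k r2 where b: "k \<le> etime b (r1, h)" "runs X P k (conf (l + elen a) r1 h) (conf (l + elen a + elen b) r2 h)"
    "r2 (t+1) = eval b (r1, h)" "\<forall>x<t+1. r2 x = r1 x"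
    using Quot.IH(2)[of "l + elen a" "t+1" r1] Quot.prems by (fastforce simp: code_at_append)
  have eq: "eval b (r1, h) = eval b (r, h)" "etime b (r1, h) = etime b (r, h)"
    using eval_cong[of b r1 r h] etime_cong[of b r1 r h] a(4) Quot.prems(2) by auto
  obtain d r3 where m: "d \<le> 4 * (r2 t div r2 (t+1)) + 7" "runs X P d (conf (l + elen a + elen b) r2 h) (conf (l + elen a + elen b + 10) r3 h)"
    "r3 t = r2 t div r2 (t+1)" "\<forall>x<t. r3 x = r2 x"
    using div_correct[of P "l + elen a + elen b" t r2 X h] Quot.prems by (auto simp: code_at_append)
  from runs_add[OF a(2) runs_add[OF b(2) m(2)]] show ?case using a b eq m(1,3,4)
    by (intro exI[of _ "n+(k+d)"] exI[of _ r3]) (simp add: add.assoc)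
qed

definition agree :: "nat \<Rightarrow> (nat \<Rightarrow> nat) \<Rightarrow> (nat \<Rightarrow> nat) \<Rightarrow> bool" where
  "agree t r r' \<longleftrightarrow> (\<forall>x<t. r x = r' x)"

lemma agree_eval:
  assumes "agree t0 \<rho> (fst s)" "\<And>x. x \<in> evars e \<Longrightarrow> x < t0"
  shows "eval e (\<rho>, snd s) = eval e s" "etime e (\<rho>, snd s) = etime e s"
  using eval_cong[of e \<rho> "fst s" "snd s"] etime_cong[of e \<rho> "fst s" "snd s"] assms by (auto simp: agree_def)

lemma ecode_agree:
  assumes "code_at P l (ecode l t e)" "\<And>x. x \<in> evars e \<Longrightarrow> x < t0" "t0 \<le> t" "agree t0 \<rho> (fst s)"
  shows "\<exists>n \<rho>'. n \<le> etime e s \<and> runs X P n (conf l \<rho> (snd s)) (conf (l + elen e) \<rho>' (snd s)) \<and>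
    \<rho>' t = eval e s \<and> agree t \<rho>' \<rho> \<and> agree t0 \<rho>' (fst s)"
proof -
  have v: "x < t" if "x \<in> evars e" for x using assms(2)[OF that] assms(3) by simp
  obtain n r' where n: "n \<le> etime e (\<rho>, snd s)" "runs X P n (conf l \<rho> (snd s)) (conf (l + elen e) r' (snd s))"
    "r' t = eval e (\<rho>, snd s)" "\<forall>x<t. r' x = \<rho> x"
    using ecode_correct[of P l t e \<rho> "snd s" X] assms(1) v by blast
  have "eval e (\<rho>, snd s) = eval e s" "etime e (\<rho>, snd s) = etime e s"
    using agree_eval[OF assms(4)] assms(2) by auto
  then show ?thesis using n assms(3,4) by (intro exI[of _ n] exI[of _ r']) (auto simp: agree_def)
qed

lemma ecode2_agree:
  assumes "code_at P l (ecode l t a)" "code_at P (l + elen a) (ecode (l + elen a) (t+1) b)"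
    "\<And>x. x \<in> evars a \<union> evars b \<Longrightarrow> x < t0" "t0 \<le> t" "agree t0 \<rho> (fst s)"
  shows "\<exists>n \<rho>'. n \<le> etime a s + etime b s \<and> runs X P n (conf l \<rho> (snd s)) (conf (l + elen a + elen b) \<rho>' (snd s)) \<and>
    \<rho>' t = eval a s \<and> \<rho>' (t+1) = eval b s \<and> agree t \<rho>' \<rho> \<and> agree t0 \<rho>' (fst s)"
proof -
  obtain n r1 where a: "n \<le> etime a s" "runs X P n (conf l \<rho> (snd s)) (conf (l + elen a) r1 (snd s))"
    "r1 t = eval a s" "agree t r1 \<rho>" "agree t0 r1 (fst s)"
    using ecode_agree[OF assms(1) _ assms(4,5), of X] assms(3) by blast
  have t1: "t0 \<le> t + 1" using assms(4) by simp
  obtain k r2 where b: "k \<le> etime b s" "runs X P k (conf (l + elen a) r1 (snd s)) (conf (l + elen a + elen b) r2 (snd s))"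
    "r2 (t+1) = eval b s" "agree (t+1) r2 r1" "agree t0 r2 (fst s)"
    using ecode_agree[OF assms(2) _ t1 a(5), of X] assms(3) by blast
  have "r2 t = eval a s" "agree t r2 \<rho>" using b(4) a(3,4) by (auto simp: agree_def)
  then show ?thesis using a(1) b(1,3,5) runs_add[OF a(2) b(2)] by (intro exI[of _ "n+k"] exI[of _ r2]) simp
qed

lemma ccode_correct:
  assumes "code_at P l (ccode l t c)" "\<And>x. x \<in> cvars c \<Longrightarrow> x < t0" "t0 \<le> t" "agree t0 \<rho> (fst s)" "0 < X Accuracy"
  shows "\<exists>n \<rho>'. n \<le> time X c s \<and> runs X P n (conf l \<rho> (snd s)) (conf (l + clen c) \<rho>' (snd (sem X c s))) \<and>
    agree t0 \<rho>' (fst (sem X c s)) \<and> (\<forall>x. t0 \<le> x \<longrightarrow> x < t \<longrightarrow> \<rho>' x = \<rho> x)"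
  using assms(1-4)
proof (induction c arbitrary: l t \<rho> s)
  case Skip
  show ?case using Skip runs_0 by (intro exI[of _ 0] exI[of _ \<rho>]) auto
next
  case (Asg x e)
  obtain n r1 where a: "n \<le> etime e s" "runs X P n (conf l \<rho> (snd s)) (conf (l + elen e) r1 (snd s))"
    "r1 t = eval e s" "agree t r1 \<rho>" "agree t0 r1 (fst s)"
    using ecode_agree[OF _ _ Asg.prems(3,4), of P l e X] Asg.prems by (auto simp: code_at_append)
  have x: "x < t0" by (rule Asg.prems(2)) simp
  then have "x \<noteq> t" using Asg.prems(3) by simp
  have "runs X P 1 (conf (l + elen e) r1 (snd s)) (conf (l + elen e + 1) (r1(x := 0)) (snd s))"
    by (rule runs_step', use Asg.prems in \<open>simp_all add: code_at_append code_at_Cons\<close>)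
  moreover have "runs X P 1 (conf (l + elen e + 1) (r1(x := 0)) (snd s)) (conf (l + elen e + 2) (r1(x := eval e s)) (snd s))"
    by (rule runs_step', use Asg.prems(1) \<open>x \<noteq> t\<close> a(3) in \<open>simp_all add: code_at_append code_at_Cons\<close>)
  ultimately have "runs X P (1 + 1) (conf (l + elen e) r1 (snd s)) (conf (l + elen e + 2) (r1(x := eval e s)) (snd s))" by (rule runs_add)
  note st = runs_add[OF a(2) this]
  define r2 where "r2 = r1(x := eval e s)"
  have "agree t0 r2 (fst (put x (eval e s) s))" "\<forall>z. t0 \<le> z \<longrightarrow> z < t \<longrightarrow> r2 z = \<rho> z"
    using a(4,5) x by (auto simp: r2_def put_def agree_def)
  moreover have "snd (put x (eval e s) s) = snd s" by (simp add: put_def)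
  ultimately show ?case using a(1) st[folded r2_def]
    by (intro exI[of _ "n+(1+1)"] exI[of _ r2]) (simp add: add.assoc)
next
  case (Wr a b)
  obtain n r1 where a: "n \<le> etime a s + etime b s" "runs X P n (conf l \<rho> (snd s)) (conf (l + elen a + elen b) r1 (snd s))"
    "r1 t = eval a s" "r1 (t+1) = eval b s" "agree t r1 \<rho>" "agree t0 r1 (fst s)"
    using ecode2_agree[OF _ _ _ Wr.prems(3,4), of P l a b X] Wr.prems by (auto simp: code_at_append)
  have "runs X P 1 (conf (l + elen a + elen b) r1 (snd s)) (conf (l + elen a + elen b + 1) r1 ((snd s)(eval a s := eval b s)))"
    by (rule runs_step', use Wr.prems a(3,4) in \<open>simp_all add: code_at_append code_at_Cons\<close>)
  note st = runs_add[OF a(2) this]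
  define h' where "h' = (snd s)(eval a s := eval b s)"
  have "sem X (Wr a b) s = (fst s, h')" by (simp add: h'_def)
  then show ?case using a(1,5,6) st[folded h'_def]
    by (intro exI[of _ "n+1"] exI[of _ r1]) (auto simp: agree_def add.assoc simp del: sem.simps)
next
  case (Seq c d)
  obtain n r1 where a: "n \<le> time X c s" "runs X P n (conf l \<rho> (snd s)) (conf (l + clen c) r1 (snd (sem X c s)))"
    "agree t0 r1 (fst (sem X c s))" "\<forall>x. t0 \<le> x \<longrightarrow> x < t \<longrightarrow> r1 x = \<rho> x"
    using Seq.IH(1)[of l t \<rho> s] Seq.prems by (auto simp: code_at_append)
  obtain k r2 where b: "k \<le> time X d (sem X c s)"
    "runs X P k (conf (l + clen c) r1 (snd (sem X c s))) (conf (l + clen c + clen d) r2 (snd (sem X d (sem X c s))))"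
    "agree t0 r2 (fst (sem X d (sem X c s)))" "\<forall>x. t0 \<le> x \<longrightarrow> x < t \<longrightarrow> r2 x = r1 x"
    using Seq.IH(2)[of "l + clen c" t r1 "sem X c s"] Seq.prems a(3) by (auto simp: code_at_append)
  show ?case using a(1,4) b(1,3,4) runs_add[OF a(2) b(2)]
    by (intro exI[of _ "n+k"] exI[of _ r2]) (auto simp: add.assoc)
next
  case (IfLe a b c d)
  define k where "k = l + elen a + elen b"
  obtain n r1 where a: "n \<le> etime a s + etime b s" "runs X P n (conf l \<rho> (snd s)) (conf k r1 (snd s))"
    "r1 t = eval a s" "r1 (t+1) = eval b s" "agree t r1 \<rho>" "agree t0 r1 (fst s)"
    using ecode2_agree[OF _ _ _ IfLe.prems(3,4), of P l a b X] IfLe.prems by (auto simp: code_at_append Let_def k_def)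
  have cd: "code_at P (k+1) (ccode (k+1) t d)" "code_at P (k + clen d + 2) (ccode (k + clen d + 2) t c)"
    using IfLe.prems(1) by (auto simp: code_at_append Let_def k_def code_at_Cons)
  show ?case
  proof (cases "eval a s \<le> eval b s")
    case True
    have j: "runs X P 1 (conf k r1 (snd s)) (conf (k + clen d + 2) r1 (snd s))"
      by (rule runs_step', use IfLe.prems a(3,4) True in \<open>simp_all add: code_at_append code_at_Cons Let_def k_def\<close>)
    obtain m r2 where b: "m \<le> time X c s" "runs X P m (conf (k + clen d + 2) r1 (snd s)) (conf (k + clen d + 2 + clen c) r2 (snd (sem X c s)))"
      "agree t0 r2 (fst (sem X c s))" "\<forall>x. t0 \<le> x \<longrightarrow> x < t \<longrightarrow> r2 x = r1 x"
      using IfLe.IH(1)[OF cd(2) _ IfLe.prems(3) a(6)] IfLe.prems(2) by auto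
    show ?thesis using a(1,5) b(1,3,4) True runs_add[OF a(2) runs_add[OF j b(2)]]
      by (intro exI[of _ "n+(1+m)"] exI[of _ r2]) (auto simp: agree_def k_def add_ac)
  next
    case False
    have j: "runs X P 1 (conf k r1 (snd s)) (conf (k + 1) r1 (snd s))"
      by (rule runs_step', use IfLe.prems a(3,4) False in \<open>simp_all add: code_at_append code_at_Cons Let_def k_def\<close>)
    obtain m r2 where b: "m \<le> time X d s" "runs X P m (conf (k + 1) r1 (snd s)) (conf (k + 1 + clen d) r2 (snd (sem X d s)))"
      "agree t0 r2 (fst (sem X d s))" "\<forall>x. t0 \<le> x \<longrightarrow> x < t \<longrightarrow> r2 x = r1 x"
      using IfLe.IH(2)[OF cd(1) _ IfLe.prems(3) a(6)] IfLe.prems(2) by auto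
    have j2: "runs X P 1 (conf (k + 1 + clen d) r2 (snd (sem X d s))) (conf (k + clen d + clen c + 2) r2 (snd (sem X d s)))"
      by (rule runs_step', use IfLe.prems in \<open>simp_all add: code_at_append code_at_Cons Let_def k_def\<close>)
    show ?thesis using a(1,5) b(1,3,4) False runs_add[OF a(2) runs_add[OF j runs_add[OF b(2) j2]]]
      by (intro exI[of _ "n+(1+(m+1))"] exI[of _ r2]) (auto simp: agree_def k_def add_ac)
  qed
next
  case (IfW a b c d)
  define k where "k = l + elen a + elen b"
  obtain n r1 where a: "n \<le> etime a s + etime b s" "runs X P n (conf l \<rho> (snd s)) (conf k r1 (snd s))"
    "r1 t = eval a s" "r1 (t+1) = eval b s" "agree t r1 \<rho>" "agree t0 r1 (fst s)"
    using ecode2_agree[OF _ _ _ IfW.prems(3,4), of P l a b X] IfW.prems by (auto simp: code_at_append Let_def k_def)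
  have cd: "code_at P (k+1) (ccode (k+1) t d)" "code_at P (k + clen d + 2) (ccode (k + clen d + 2) t c)"
    using IfW.prems(1) by (auto simp: code_at_append Let_def k_def code_at_Cons)
  show ?case
  proof (cases "real (eval a s) \<le> X Weight * real (eval b s)")
    case True
    have j: "runs X P 1 (conf k r1 (snd s)) (conf (k + clen d + 2) r1 (snd s))"
      by (rule runs_step', use IfW.prems a(3,4) True in \<open>simp_all add: code_at_append code_at_Cons Let_def k_def\<close>)
    obtain m r2 where b: "m \<le> time X c s" "runs X P m (conf (k + clen d + 2) r1 (snd s)) (conf (k + clen d + 2 + clen c) r2 (snd (sem X c s)))"
      "agree t0 r2 (fst (sem X c s))" "\<forall>x. t0 \<le> x \<longrightarrow> x < t \<longrightarrow> r2 x = r1 x"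
      using IfW.IH(1)[OF cd(2) _ IfW.prems(3) a(6)] IfW.prems(2) by auto
    show ?thesis using a(1,5) b(1,3,4) True runs_add[OF a(2) runs_add[OF j b(2)]]
      by (intro exI[of _ "n+(1+m)"] exI[of _ r2]) (auto simp: agree_def k_def add_ac)
  next
    case False
    have j: "runs X P 1 (conf k r1 (snd s)) (conf (k + 1) r1 (snd s))"
      by (rule runs_step', use IfW.prems a(3,4) False in \<open>simp_all add: code_at_append code_at_Cons Let_def k_def\<close>)
    obtain m r2 where b: "m \<le> time X d s" "runs X P m (conf (k + 1) r1 (snd s)) (conf (k + 1 + clen d) r2 (snd (sem X d s)))"
      "agree t0 r2 (fst (sem X d s))" "\<forall>x. t0 \<le> x \<longrightarrow> x < t \<longrightarrow> r2 x = r1 x"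
      using IfW.IH(2)[OF cd(1) _ IfW.prems(3) a(6)] IfW.prems(2) by auto
    have j2: "runs X P 1 (conf (k + 1 + clen d) r2 (snd (sem X d s))) (conf (k + clen d + clen c + 2) r2 (snd (sem X d s)))"
      by (rule runs_step', use IfW.prems in \<open>simp_all add: code_at_append code_at_Cons Let_def k_def\<close>)
    show ?thesis using a(1,5) b(1,3,4) False runs_add[OF a(2) runs_add[OF j runs_add[OF b(2) j2]]]
      by (intro exI[of _ "n+(1+(m+1))"] exI[of _ r2]) (auto simp: agree_def k_def add_ac)
  qed
next
  case (Grow x)
  define y where "y = Suc x"
  have xy: "x < t0" "y < t0" "x \<noteq> y" using Grow.prems(2) by (auto simp: y_def)
  have yt: "y \<noteq> t" using xy Grow.prems(3) by simp
  define m where "m = grown X (fst s x) (fst s y)"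
  have ex: "\<exists>k. fst s y \<le> k \<and> real (fst s x) \<le> X Accuracy * real k"
  proof -
    obtain k where "real (fst s x) / X Accuracy \<le> real k" using real_arch_simple by blast
    then have "real (fst s x) \<le> X Accuracy * real k" using assms(5) by (simp add: pos_divide_le_eq mult.commute)
    also have "\<dots> \<le> X Accuracy * real (max (fst s y) k)" using assms(5) by (intro mult_left_mono) auto
    finally show ?thesis by (intro exI[of _ "max (fst s y) k"]) auto
  qed
  have mle: "fst s y \<le> m" "real (fst s x) \<le> X Accuracy * real m"
    using LeastI_ex[OF ex] unfolding m_def grown_def by auto
  have below: "\<not> real (fst s x) \<le> X Accuracy * real k" if "fst s y \<le> k" "k < m" for k
    using not_less_Least[of k "\<lambda>k. fst s y \<le> k \<and> real (fst s x) \<le> X Accuracy * real k"] that unfolding m_def grown_def by auto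
  have "\<exists>\<rho>'. runs X P (4 * (m - r y) + 1) (conf l r (snd s)) (conf (l+4) \<rho>' (snd s)) \<and> \<rho>' y = m \<and> (\<forall>z<t. z \<noteq> y \<longrightarrow> \<rho>' z = r z)"
    if "r x = fst s x" "fst s y \<le> r y" "r y \<le> m" for r
    using that
  proof (induction "m - r y" arbitrary: r)
    case 0
    have "runs X P 1 (conf l r (snd s)) (conf (l+4) r (snd s))"
      by (rule runs_step', use Grow.prems 0 mle in \<open>simp_all add: y_def[symmetric] code_at_Cons\<close>)
    then show ?case using 0 by (intro exI[of _ r]) simp
  next
    case (Suc i)
    have lt: "r y < m" using Suc(2) by simp
    define r1 where "r1 = r(t := 1, y := r y + 1)"
    have nb: "\<not> real (r x) \<le> X Accuracy * real (r y)" using below[OF Suc.prems(2) lt] Suc.prems by simp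
    have "runs X P 1 (conf l r (snd s)) (conf (l+1) r (snd s))"
      by (rule runs_step', use Grow.prems nb in \<open>simp_all add: y_def[symmetric] code_at_Cons\<close>)
    moreover have "runs X P 1 (conf (l+1) r (snd s)) (conf (l+2) (r(t := 1)) (snd s))"
      by (rule runs_step', use Grow.prems in \<open>simp_all add: y_def[symmetric] code_at_Cons\<close>)
    moreover have "runs X P 1 (conf (l+2) (r(t := 1)) (snd s)) (conf (l+3) r1 (snd s))"
      by (rule runs_step', use Grow.prems(1) xy yt in \<open>simp_all add: y_def[symmetric] code_at_Cons r1_def numeral_eq_Suc\<close>)
    moreover have "runs X P 1 (conf (l+3) r1 (snd s)) (conf l r1 (snd s))"
      by (rule runs_step', use Grow.prems in \<open>simp_all add: y_def[symmetric] code_at_Cons numeral_eq_Suc\<close>)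
    ultimately have s4: "runs X P (1 + (1 + (1 + 1))) (conf l r (snd s)) (conf l r1 (snd s))"
      using runs_add by meson
    have "\<exists>\<rho>'. runs X P (4 * (m - r1 y) + 1) (conf l r1 (snd s)) (conf (l+4) \<rho>' (snd s)) \<and> \<rho>' y = m \<and> (\<forall>z<t. z \<noteq> y \<longrightarrow> \<rho>' z = r1 z)"
      by (rule Suc(1)) (use Suc.prems Suc(2) lt xy Grow.prems(3) in \<open>auto simp: r1_def\<close>)
    then obtain \<rho>' where p: "runs X P (4 * (m - r1 y) + 1) (conf l r1 (snd s)) (conf (l+4) \<rho>' (snd s))"
      "\<rho>' y = m" "\<forall>z<t. z \<noteq> y \<longrightarrow> \<rho>' z = r1 z" by blast
    have "1 + (1 + (1 + 1)) + (4 * (m - r1 y) + 1) = 4 * (m - r y) + 1" using lt by (simp add: r1_def)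
    then have "runs X P (4 * (m - r y) + 1) (conf l r (snd s)) (conf (l+4) \<rho>' (snd s))"
      using runs_add[OF s4 p(1)] by (simp only:)
    then show ?case using p(2,3) by (intro exI[of _ \<rho>']) (simp add: r1_def)
  qed
  from this[of \<rho>] obtain \<rho>' where p: "runs X P (4 * (m - \<rho> y) + 1) (conf l \<rho> (snd s)) (conf (l+4) \<rho>' (snd s))"
    "\<rho>' y = m" "\<forall>z<t. z \<noteq> y \<longrightarrow> \<rho>' z = \<rho> z"
    using Grow.prems(4) xy mle by (auto simp: agree_def)
  have "\<rho> y = fst s y" using Grow.prems(4) xy by (simp add: agree_def)
  then show ?case using p xy Grow.prems(3,4)
    by (intro exI[of _ "4 * (m - \<rho> y) + 1"] exI[of _ \<rho>']) (auto simp: agree_def put_def m_def y_def[symmetric])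
next
  case (For x e c)
  define k where "k = l + elen e"
  define f where "f = (\<lambda>i s. sem X c (put x i s))"
  define n where "n = eval e s"
  obtain d r1 where a: "d \<le> etime e s" "runs X P d (conf l \<rho> (snd s)) (conf k r1 (snd s))"
    "r1 t = n" "agree t r1 \<rho>" "agree t0 r1 (fst s)"
    using ecode_agree[OF _ _ For.prems(3,4), of P l e X] For.prems by (auto simp: code_at_append Let_def k_def n_def)
  have x: "x < t0" by (rule For.prems(2)) simp
  then have xt: "x \<noteq> t" "x \<noteq> Suc t" using For.prems(3) by auto
  have code: "code_at P k [Const (t+1) 0, JumpLe t (t+1) (k + clen c + 7), Const x 0, Add x x (t+1)]"
    "code_at P (k + 4) (ccode (k + 4) (t+2) c)"
    "code_at P (k + 4 + clen c) [Const (t+2) 1, Add (t+1) (t+1) (t+2), JumpLe 0 0 (k + 1)]"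
    using For.prems(1) by (auto simp: Let_def k_def code_at_append code_at_Cons code_at_Nil numeral_eq_Suc)
  define q0 where "q0 = r1(t+1 := 0)"
  have q0: "q0 t = n" "q0 (t+1) = 0" "agree t0 q0 (fst s)" "\<forall>z. t0 \<le> z \<longrightarrow> z < t \<longrightarrow> q0 z = \<rho> z"
    using a For.prems(3) by (auto simp: q0_def agree_def)
  have loop: "\<exists>b r. b \<le> (\<Sum>j<i. time X c (put x j (iter f j s)) + 6) \<and>
      runs X P b (conf (k+1) q0 (snd s)) (conf (k+1) r (snd (iter f i s))) \<and>
      r t = n \<and> r (t+1) = i \<and> agree t0 r (fst (iter f i s)) \<and> (\<forall>z. t0 \<le> z \<longrightarrow> z < t \<longrightarrow> r z = \<rho> z)"
    if "i \<le> n" for i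
    using that
  proof (induction i)
    case 0
    show ?case using q0 runs_0
      by (intro exI[of _ 0] exI[of _ q0]) simp
  next
    case (Suc i)
    then obtain b r where b: "b \<le> (\<Sum>j<i. time X c (put x j (iter f j s)) + 6)"
      "runs X P b (conf (k+1) q0 (snd s)) (conf (k+1) r (snd (iter f i s)))"
      "r t = n" "r (t+1) = i" "agree t0 r (fst (iter f i s))" "\<forall>z. t0 \<le> z \<longrightarrow> z < t \<longrightarrow> r z = \<rho> z"
      using Suc_leD by blast
    define u where "u = iter f i s"
    have j1: "runs X P 1 (conf (k+1) r (snd u)) (conf (k+2) r (snd u))"
      by (rule runs_step', use code(1) b(3,4) Suc.prems in \<open>simp_all add: code_at_Cons\<close>)
    have j2: "runs X P 1 (conf (k+2) r (snd u)) (conf (k+3) (r(x := 0)) (snd u))"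
      by (rule runs_step', use code(1) in \<open>simp_all add: code_at_Cons numeral_eq_Suc\<close>)
    have j3: "runs X P 1 (conf (k+3) (r(x := 0)) (snd u)) (conf (k+4) (r(x := i)) (snd u))"
      by (rule runs_step', use code(1) b(4) xt in \<open>simp_all add: code_at_Cons numeral_eq_Suc\<close>)
    have ag: "agree t0 (r(x := i)) (fst (put x i u))" using b(5) by (simp add: agree_def put_def u_def)
    have t2: "t0 \<le> t + 2" using For.prems(3) by simp
    obtain m r' where m: "m \<le> time X c (put x i u)"
      "runs X P m (conf (k+4) (r(x := i)) (snd u)) (conf (k+4+clen c) r' (snd (f i u)))"
      "agree t0 r' (fst (f i u))" "\<forall>z. t0 \<le> z \<longrightarrow> z < t+2 \<longrightarrow> r' z = (r(x := i)) z"
    proof -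
      have sp: "snd (put x i u) = snd u" by (simp add: put_def)
      have v: "\<And>y. y \<in> cvars c \<Longrightarrow> y < t0" using For.prems(2) by simp
      show ?thesis using For.IH[OF code(2) v t2 ag] that unfolding sp f_def by blast
    qed
    have r': "r' t = n" "r' (Suc t) = i" "\<forall>z. t0 \<le> z \<longrightarrow> z < t \<longrightarrow> r' z = \<rho> z"
      using m(4) b(3,4,6) x For.prems(3) by auto
    define q6 where "q6 = r'(t+2 := 1, t+1 := Suc i)"
    have q6: "q6 t = n" "q6 (Suc t) = Suc i" "\<forall>z. t0 \<le> z \<longrightarrow> z < t \<longrightarrow> q6 z = \<rho> z"
      using r' by (auto simp: q6_def)
    have j4: "runs X P 1 (conf (k+4+clen c) r' (snd (f i u))) (conf (k+5+clen c) (r'(t+2 := 1)) (snd (f i u)))"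
      by (rule runs_step', use code(3) in \<open>simp_all add: code_at_Cons numeral_eq_Suc\<close>)
    have j5: "runs X P 1 (conf (k+5+clen c) (r'(t+2 := 1)) (snd (f i u))) (conf (k+6+clen c) q6 (snd (f i u)))"
      by (rule runs_step', use code(3) r' in \<open>simp_all add: q6_def code_at_Cons numeral_eq_Suc\<close>)
    have j6: "runs X P 1 (conf (k+6+clen c) q6 (snd (f i u))) (conf (k+1) q6 (snd (f i u)))"
      by (rule runs_step', use code(3) in \<open>simp_all add: code_at_Cons numeral_eq_Suc\<close>)
    have "runs X P (b + (1 + (1 + (1 + (m + (1 + (1 + 1))))))) (conf (k+1) q0 (snd s)) (conf (k+1) q6 (snd (f i u)))"
      by (rule runs_add[OF b(2)[folded u_def] runs_add[OF j1 runs_add[OF j2 runs_add[OF j3 runs_add[OF m(2) runs_add[OF j4 runs_add[OF j5 j6]]]]]]])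
    moreover have "agree t0 q6 (fst (f i u))" using m(3) For.prems(3) by (simp add: agree_def q6_def)
    ultimately show ?case using b(1) m(1) q6
      by (intro exI[of _ "b + (1 + (1 + (1 + (m + (1 + (1 + 1))))))"] exI[of _ q6]) (auto simp: u_def)
  qed
  obtain b r where b: "b \<le> (\<Sum>j<n. time X c (put x j (iter f j s)) + 6)"
    "runs X P b (conf (k+1) q0 (snd s)) (conf (k+1) r (snd (iter f n s)))"
    "r t = n" "r (t+1) = n" "agree t0 r (fst (iter f n s))" "\<forall>z. t0 \<le> z \<longrightarrow> z < t \<longrightarrow> r z = \<rho> z"
    using loop[OF order_refl] by auto
  have i1: "runs X P 1 (conf k r1 (snd s)) (conf (k+1) q0 (snd s))"
    by (rule runs_step', use code(1) in \<open>simp_all add: q0_def code_at_Cons\<close>)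
  have i2: "runs X P 1 (conf (k+1) r (snd (iter f n s))) (conf (k+clen c+7) r (snd (iter f n s)))"
    by (rule runs_step', use code(1) b(3,4) in \<open>simp_all add: code_at_Cons\<close>)
  have "runs X P (d + (1 + (b + 1))) (conf l \<rho> (snd s)) (conf (k+clen c+7) r (snd (iter f n s)))"
    by (rule runs_add[OF a(2) runs_add[OF i1 runs_add[OF b(2) i2]]])
  then show ?case using a(1) b(1,5,6)
    by (intro exI[of _ "d + (1 + (b + 1))"] exI[of _ r]) (simp add: n_def f_def k_def add_ac)
qed

text \<open>The variables of the program are the registers below \<open>t0\<close>, so the scratch registers do not interfere.\<close>

lemma compile_correct:
  assumes "\<And>x. x \<in> cvars c \<Longrightarrow> x < t0" "0 < X Accuracy"
  shows "\<exists>n r. n \<le> time X c (r0, h0) \<and> (step X (ccode 0 t0 c) ^^ n) (conf 0 r0 h0) = conf (clen c) r (snd (sem X c (r0, h0))) \<and>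
    (\<forall>x<t0. r x = fst (sem X c (r0, h0)) x)"
proof -
  have "code_at (ccode 0 t0 c) 0 (ccode 0 t0 c)" by (simp add: code_at_def)
  from ccode_correct[of "ccode 0 t0 c" 0 t0 c t0 r0 "(r0, h0)" X, OF this _ order_refl _ assms(2)]
  show ?thesis using assms(1) by (auto simp: agree_def runs_def)
qed

section \<open>Reasoning about programs\<close>

primrec assigned :: "com \<Rightarrow> nat set" where
  "assigned Skip = {}"
| "assigned (Asg x e) = {x}"
| "assigned (Wr a b) = {}"
| "assigned (Seq c d) = assigned c \<union> assigned d"
| "assigned (IfLe a b c d) = assigned c \<union> assigned d"
| "assigned (IfW a b c d) = assigned c \<union> assigned d"
| "assigned (For x e c) = insert x (assigned c)"
| "assigned (Grow x) = {Suc x}"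

primrec no_write :: "com \<Rightarrow> bool" where
  "no_write Skip = True"
| "no_write (Asg x e) = True"
| "no_write (Wr a b) = False"
| "no_write (Seq c d) = (no_write c \<and> no_write d)"
| "no_write (IfLe a b c d) = (no_write c \<and> no_write d)"
| "no_write (IfW a b c d) = (no_write c \<and> no_write d)"
| "no_write (For x e c) = no_write c"
| "no_write (Grow x) = True"

lemma put_simps [simp]: "fst (put x a s) y = (if y = x then a else fst s y)" "snd (put x a s) = snd s"
  by (auto simp: put_def)

lemma sem_unassigned: "y \<notin> assigned c \<Longrightarrow> fst (sem X c s) y = fst s y"
proof (induction c arbitrary: s)
  case (For x e c)
  have "fst (iter (\<lambda>i s. sem X c (put x i s)) n s) y = fst s y" for n
    by (induction n) (use For in auto)
  then show ?case by simp
qed auto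

lemma sem_no_write: "no_write c \<Longrightarrow> snd (sem X c s) = snd s"
proof (induction c arbitrary: s)
  case (For x e c)
  have "snd (iter (\<lambda>i s. sem X c (put x i s)) n s) = snd s" for n
    by (induction n) (use For in auto)
  then show ?case by simp
qed auto

text \<open>The usual invariant rule, with a bound on the running time when each iteration takes at most \<open>T\<close>.\<close>

lemma for_rule:
  assumes "I 0 s" "\<And>i s. i < m \<Longrightarrow> I i s \<Longrightarrow> I (Suc i) (sem X c (put x i s)) \<and> time X c (put x i s) \<le> T"
    and "eval e s = m"
  shows "I m (sem X (For x e c) s)" "time X (For x e c) s \<le> etime e s + 2 + m * (T + 6)"
proof -
  let ?f = "\<lambda>i s. sem X c (put x i s)"
  have I: "I i (iter ?f i s)" if "i \<le> m" for i
    using that by (induction i) (use assms(1,2) in auto)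
  then show "I m (sem X (For x e c) s)" using assms(3) by simp
  have "(\<Sum>i<m. time X c (put x i (iter ?f i s)) + 6) \<le> (\<Sum>i<m. T + 6)"
    using I assms(2) by (intro sum_mono) auto
  then show "time X (For x e c) s \<le> etime e s + 2 + m * (T + 6)" using assms(3) by simp
qed

section \<open>Bounds on the integer estimates\<close>

lemma inorm_le:
  assumes "\<And>a. a < q \<Longrightarrow> F a \<le> fb" "\<And>a b. a < q \<Longrightarrow> b < q \<Longrightarrow> R a b \<le> rb" "j < q"
  shows "inorm q sn M F R j \<le> q * (fb * rb) + sn * (fb * M)"
proof -
  have "(\<Sum>b<q. F b * R b j) \<le> (\<Sum>b<q. fb * rb)" using assms by (intro sum_mono mult_mono) auto
  then have "(\<Sum>b<q. F b * R b j) \<le> q * (fb * rb)" by simp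
  moreover have "sn * (F j * M) \<le> sn * (fb * M)" using assms by (intro mult_left_mono mult_right_mono) auto
  ultimately show ?thesis unfolding inorm_def by (intro max.boundedI) linarith+
qed

lemma ifac_le:
  assumes "\<And>a. a < q \<Longrightarrow> F a \<le> fb" "\<And>a b. a < q \<Longrightarrow> b < q \<Longrightarrow> R a b \<le> rb" "i < q" "j < q"
  shows "fst (ifac q sn M W F R i j) \<le> M * (q * (fb * rb) + sn * (fb * M)) + 1"
    "snd (ifac q sn M W F R i j) \<le> M * (q * (fb * rb) + sn * (fb * M)) + 1"
proof -
  have *: "M * inorm q sn M F R a - z \<le> M * (q * (fb * rb) + sn * (fb * M)) + 1" if "a < q" for a z
  proof -
    have "inorm q sn M F R a \<le> q * (fb * rb) + sn * (fb * M)" by (rule inorm_le[OF assms(1,2) that])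
    then have "M * inorm q sn M F R a \<le> M * (q * (fb * rb) + sn * (fb * M))" by (rule mult_left_mono) simp
    then show ?thesis by linarith
  qed
  show "fst (ifac q sn M W F R i j) \<le> M * (q * (fb * rb) + sn * (fb * M)) + 1"
    "snd (ifac q sn M W F R i j) \<le> M * (q * (fb * rb) + sn * (fb * M)) + 1"
    using *[OF assms(3)] *[OF assms(4)] by (auto simp: ifac_def iside_def)
qed

lemma ifac_cong:
  assumes "\<And>a. a < q \<Longrightarrow> F a = F' a" "\<And>a b. a < q \<Longrightarrow> b < q \<Longrightarrow> R a b = R' a b" "i < q" "j < q"
  shows "ifac q sn M W F R i j = ifac q sn M W F' R' i j"
proof -
  have "inorm q sn M F R a = inorm q sn M F' R' a" if "a < q" for a
    using assms that by (simp add: inorm_def)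
  then show ?thesis using assms by (simp add: ifac_def iside_def)
qed

text \<open>The normalisation is at least \<open>sn\<close> times the quantity that is subtracted from it, so denominators do not degenerate.\<close>

lemma ifac_fst_le:
  assumes "2 \<le> sn" shows "fst (ifac q sn M W F R i j) \<le> 2 * snd (ifac q sn M W F R i j)"
proof -
  have *: "M * inorm q sn M F R b - z \<le> 2 * (M * inorm q sn M F R b - y)" if "y \<le> (M - W) * (F b * M)" for b y z
  proof -
    have "2 * (F b * M) \<le> sn * (F b * M)" using assms by simp
    also have "\<dots> \<le> inorm q sn M F R b" by (simp add: inorm_def)
    finally have "M * (2 * (F b * M)) \<le> M * inorm q sn M F R b" by (rule mult_left_mono) simp
    moreover have "(M - W) * (F b * M) \<le> M * (F b * M)" by (intro mult_right_mono) auto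
    ultimately show ?thesis using that by linarith
  qed
  show ?thesis by (auto simp: ifac_def iside_def intro!: * mult_left_mono)
qed

text \<open>Estimates stay bounded independently of the depth: each of the at most \<open>\<Delta>\<close> factors is at most \<open>2\<close>.\<close>

lemma (in potts_model) est_le:
  assumes "2 \<le> q - \<Delta> + 1" "length (nbl U v) \<le> \<Delta>"
  shows "est \<Delta> M W t U m v i j \<le> 2 ^ \<Delta> * M"
proof (cases t)
  case (Suc t')
  define f where "f k = ifac q (q - \<Delta> + 1) M W (iF \<Delta> M W (child U m v k i j) (nbl U v ! k))
        (est \<Delta> M W t' (U - {v}) (child U m v k i j) (nbl U v ! k)) i j" for k
  let ?l = "length (nbl U v)"
  define n d where "n = (\<Prod>k<?l. fst (f k))" and "d = (\<Prod>k<?l. snd (f k))"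
  have "n \<le> (\<Prod>k<?l. 2 * snd (f k))"
    unfolding n_def f_def using ifac_fst_le[OF assms(1)] by (intro prod_mono) auto
  also have "\<dots> = 2 ^ ?l * d" by (simp add: d_def prod.distrib)
  also have "\<dots> \<le> 2 ^ \<Delta> * d" using assms(2) by (intro mult_right_mono power_increasing) auto
  finally have "M * n \<le> M * 2 ^ \<Delta> * d" by (simp add: mult.assoc)
  then have "M * n div d \<le> M * 2 ^ \<Delta> * d div d" by (rule div_le_mono)
  also have "\<dots> \<le> M * 2 ^ \<Delta>" by (cases "d = 0") auto
  finally show ?thesis using Suc by (simp add: n_def d_def f_def Let_def mult.commute)
qed simp

section \<open>The program\<close>

locale program =
  fixes q \<Delta> :: nat
begin

text \<open>The number of children of a node: one for each neighbour and pair of colours.\<close>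

definition bb where "bb = \<Delta> * (q * q)"
definition sn where "sn = q - \<Delta> + 1"

text \<open>
  Variables hold: 0 the number \<open>n\<close> of vertices, 3 \<open>M\<close>, 4 \<open>W\<close>, 7 the number of nodes of the tree, 8 the size
  of the record of a node, 9 the address of the first record, 10 the depth, 11 the vertex to be removed, 13 a node, 14 the
  address of its parent or child, 15 its own address, 16 the position of a neighbour, 17 and 18 two colours, 19 to 21 row and column
  during copying, 22 a root, 24 and 25 a product of fractions, 31 and 32 the result, 40 a pair of colours; the
  others are temporary. The heap contains the adjacency matrix, then the \<open>\<Delta> + 1\<close> possible weights of the pins of a vertex,
  then the records.
\<close>

definition cnt_at where "cnt_at base row a = Rd (Plus (V base) (Plus (Times row (N (q+1))) a))"
definition root_addr where "root_addr base = Plus (V base) (Times (V 0) (N (q+1)))"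
definition lev_addr where "lev_addr base = Plus (V base) (Plus (Times (V 0) (N (q+1))) (N 1))"
definition val_addr where "val_addr base e = Plus (V base) (Plus (Plus (Times (V 0) (N (q+1))) (N 2)) e)"
definition F_at where "F_at a = Rd (Plus (Times (V 0) (V 0)) (cnt_at 14 (V 22) a))"
definition R_at where "R_at a b = Rd (val_addr 14 (Plus (Times a (N q)) b))"

text \<open>The pair \<open>iside\<close> of the colour \<open>i\<close> and the colour in variable \<open>col\<close>, stored in \<open>o1\<close> and \<open>o2\<close>; the variables \<open>fi\<close>, \<open>fj\<close> and \<open>rij\<close>
  already hold the weights of the two colours and the estimate of their ratio.\<close>

definition SIDE where
  "SIDE col fi rij fj o1 o2 =
   Seq (Asg 28 (N 0)) (Seq (For 27 (N q) (Asg 28 (Plus (V 28) (Times (F_at (V 27)) (R_at (V 27) (V col))))))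
   (Seq (Asg 39 (Times (Times (V fj) (V 3)) (N sn)))
   (Seq (IfLe (V 28) (V 39) (Asg 28 (V 39)) Skip)
   (Seq (Asg o1 (Minus (Times (V 28) (V 3)) (Times (Times (V fi) (V rij)) (Minus (V 3) (V 4)))))
        (Asg o2 (Minus (Times (V 28) (V 3)) (Times (Times (V fj) (V 3)) (Minus (V 3) (V 4)))))))))"

definition FACTOR where
  "FACTOR = Seq (Asg 29 (F_at (V 17))) (Seq (Asg 30 (F_at (V 18)))
    (Seq (Asg 37 (R_at (V 17) (V 18))) (Seq (Asg 38 (R_at (V 18) (V 17)))
    (IfLe (Times (V 29) (V 37)) (Times (V 30) (V 3)) (SIDE 18 29 37 30 35 36)
      (IfLe (Times (V 30) (V 38)) (Times (V 29) (V 3)) (SIDE 17 30 38 29 36 35)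
        (Seq (Asg 35 (N 1)) (Asg 36 (N 1))))))))"

definition VALUE where
  "VALUE = For 16 (N \<Delta>)
     (Seq (Asg 14 (Plus (V 9) (Times (Plus (Plus (Times (V 13) (N bb)) (N 1)) (Plus (Times (V 16) (N (q*q))) (V 40))) (V 8))))
     (Seq (Asg 22 (Rd (root_addr 14)))
     (IfLe (Plus (V 22) (N 1)) (V 0)
       (Seq FACTOR (Seq (Asg 24 (Times (V 24) (V 35))) (Asg 25 (Times (V 25) (V 36))))) Skip)))"

text \<open>Children have larger numbers than their parents, so the nodes are visited in decreasing order. At the last level the fraction
  stays \<open>M / 1\<close>, the trivial estimate.\<close>

definition EVAL where
  "EVAL = For 12 (V 7) (Seq (Asg 13 (Minus (Minus (V 7) (N 1)) (V 12)))
     (Seq (Asg 15 (Plus (V 9) (Times (V 13) (V 8))))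
     (IfLe (Plus (Rd (root_addr 15)) (N 1)) (V 0)
       (For 40 (N (q*q)) (Seq (Asg 17 (Quot (V 40) (N q))) (Seq (Asg 18 (Minus (V 40) (Times (V 17) (N q))))
         (Seq (Asg 24 (V 3)) (Seq (Asg 25 (N 1))
         (Seq (IfLe (Plus (Rd (lev_addr 15)) (N 1)) (V 10) VALUE Skip)
           (Wr (val_addr 15 (V 40)) (Quot (V 24) (V 25)))))))))
       Skip)))"

end

text \<open>All parameters of a run, with a bound \<open>Q\<close> on all numbers that the running time depends on.\<close>

locale run = potts_model E q w + program q \<Delta> for E :: "nat set set" and q \<Delta> :: nat and w :: real +
  fixes X :: "real_arg \<Rightarrow> real" and n M W NN d Q :: nat
  assumes q0: "0 < q" and \<Delta>q: "\<Delta> < q" and WM: "W \<le> M" and M0: "0 < M"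
    and Q: "1 \<le> Q" "n \<le> Q" "q + 1 \<le> Q" "q * q \<le> Q" "bb \<le> Q" "\<Delta> + 1 \<le> Q" "sn \<le> Q" "M \<le> Q" "NN \<le> Q"
      "n * (q + 1) + 2 + q * q \<le> Q" "2 ^ \<Delta> * M \<le> Q"
      "M * (q * (M ^ \<Delta> * (2 ^ \<Delta> * M)) + sn * (M ^ \<Delta> * M)) + 1 \<le> Q"
begin

definition Bsz where "Bsz = n * (q + 1) + 2 + q * q"
definition A0 where "A0 = n * n + \<Delta> + 1"

definition env :: "store \<Rightarrow> bool" where
  "env s \<longleftrightarrow> fst s 0 = n \<and> fst s 3 = M \<and> fst s 4 = W \<and> fst s 7 = NN \<and> fst s 8 = Bsz \<and> fst s 9 = A0 \<and> fst s 10 = d \<and>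
    (\<forall>u<n. \<forall>v<n. snd s (u * n + v) = (if {u, v} \<in> E then 1 else 0)) \<and>
    (\<forall>k\<le>\<Delta>. snd s (n * n + k) = W ^ k * M ^ (\<Delta> - k))"

lemma env_cong:
  assumes "env s" "\<And>x. x \<in> {0, 3, 4, 7, 8, 9, 10} \<Longrightarrow> fst s' x = fst s x" "\<And>a. a < A0 \<Longrightarrow> snd s' a = snd s a"
  shows "env s'"
proof -
  have "u * n + v < n * n" if "u < n" "v < n" for u v
  proof -
    have "u * n + v < (u + 1) * n" using that by simp
    also have "\<dots> \<le> n * n" using that by (intro mult_right_mono) auto
    finally show ?thesis .
  qed
  then have "u * n + v < A0" if "u < n" "v < n" for u v using that by (fastforce simp: A0_def)
  then have adj: "snd s' (u * n + v) = snd s (u * n + v)" if "u < n" "v < n" for u v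
    using that by (intro assms(3)) auto
  have tab: "snd s' (n * n + k) = snd s (n * n + k)" if "k \<le> \<Delta>" for k
    using that by (intro assms(3)) (simp add: A0_def)
  show ?thesis using assms(1,2) unfolding env_def by (simp add: adj tab)
qed

definition Fh :: "store \<Rightarrow> nat \<Rightarrow> nat" where
  "Fh s a = snd s (n * n + snd s (fst s 14 + (fst s 22 * (q + 1) + a)))"
definition Rh :: "store \<Rightarrow> nat \<Rightarrow> nat \<Rightarrow> nat" where
  "Rh s a b = snd s (fst s 14 + (n * (q + 1) + 2 + (a * q + b)))"

lemma F_at_eval: "env s \<Longrightarrow> eval (F_at (V x)) s = Fh s (fst s x)" "env s \<Longrightarrow> etime (F_at (V x)) s \<le> 40 * Q"
  using Q(1,2,3) by (auto simp: F_at_def cnt_at_def Fh_def env_def)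

lemma R_at_eval: "env s \<Longrightarrow> eval (R_at (V x) (V y)) s = Rh s (fst s x) (fst s y)" "env s \<Longrightarrow> etime (R_at (V x) (V y)) s \<le> 40 * Q"
  using Q(1,2,3) by (auto simp: R_at_def val_addr_def Rh_def env_def)

lemma side_correct:
  assumes env: "env s" and R: "\<And>a b. a < q \<Longrightarrow> b < q \<Longrightarrow> Rh s a b \<le> Q"
    and col: "col \<in> {17, 18}" "fst s col < q"
    and regs: "fi \<in> {29, 30}" "fj \<in> {29, 30}" "rij \<in> {37, 38}" "o1 \<in> {35, 36}" "o2 \<in> {35, 36}" "o1 \<noteq> o2"
    and v: "fst s fi = Fh s i" "fst s rij = Rh s i (fst s col)" "fst s fj = Fh s (fst s col)" "i < q"
  shows "fst (sem X (SIDE col fi rij fj o1 o2) s) o1 = fst (iside q sn M W (Fh s) (Rh s) i (fst s col))"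
    "fst (sem X (SIDE col fi rij fj o1 o2) s) o2 = snd (iside q sn M W (Fh s) (Rh s) i (fst s col))"
    "time X (SIDE col fi rij fj o1 o2) s \<le> 300 * Q * Q"
proof -
  let ?j = "fst s col"
  define L where "L = For 27 (N q) (Asg 28 (Plus (V 28) (Times (F_at (V 27)) (R_at (V 27) (V col)))))"
  define s0 where "s0 = put 28 0 s"
  define s1 where "s1 = sem X L s0"
  define I where "I b s' \<longleftrightarrow> (\<forall>x. x \<notin> {27, 28} \<longrightarrow> fst s' x = fst s x) \<and> snd s' = snd s \<and> fst s' 28 = (\<Sum>a<b. Fh s a * Rh s a ?j)" for b s'
  have env': "env s'" if "\<forall>x. x \<notin> {27, 28} \<longrightarrow> fst s' x = fst s x" "snd s' = snd s" for s'
    using env that by (simp add: env_def)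
  have body: "I (Suc b) (sem X (Asg 28 (Plus (V 28) (Times (F_at (V 27)) (R_at (V 27) (V col))))) (put 27 b s')) \<and>
      time X (Asg 28 (Plus (V 28) (Times (F_at (V 27)) (R_at (V 27) (V col))))) (put 27 b s') \<le> 100 * Q"
    if "b < q" "I b s'" for b s'
  proof -
    have e: "env (put 27 b s')" using that(2) by (intro env') (auto simp: I_def)
    have FR: "Fh (put 27 b s') = Fh s" "Rh (put 27 b s') = Rh s" "fst (put 27 b s') col = ?j"
      using that(2) col by (auto simp: I_def Fh_def Rh_def fun_eq_iff)
    have "Rh s b ?j \<le> Q" using R that(1) col(2) by simp
    then show ?thesis using that(2) F_at_eval[OF e, of 27] R_at_eval[OF e, of 27 col] FR Q(1)
      by (auto simp: I_def)
  qed
  have I0: "I 0 s0" by (simp add: I_def s0_def)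
  note lp = for_rule[where I = I and X = X and x = 27 and e = "N q" and m = q and s = s0, OF I0 body, folded L_def s1_def]
  have I1: "I q s1" and t1: "time X L s0 \<le> 3 + q * (100 * Q + 6)" using lp by auto
  have r1: "fst s1 x = fst s x" if "x \<notin> {27, 28}" for x using I1 that by (simp add: I_def)
  have S1: "fst s1 28 = (\<Sum>a<q. Fh s a * Rh s a ?j)" using I1 by (simp add: I_def)
  have e3: "fst s1 3 = M" "fst s1 4 = W" using env r1 by (auto simp: env_def)
  have ri: "fst s1 fi = Fh s i" "fst s1 rij = Rh s i ?j" "fst s1 fj = Fh s ?j"
    using v r1 regs by auto
  have Rij: "Rh s i ?j \<le> Q" using R v(4) col(2) by simp
  define B where "B = IfLe (V 28) (V 39) (Asg 28 (V 39)) Skip"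
  define e1 e2 where "e1 = Minus (Times (V 28) (V 3)) (Times (Times (V fi) (V rij)) (Minus (V 3) (V 4)))"
    and "e2 = Minus (Times (V 28) (V 3)) (Times (Times (V fj) (V 3)) (Minus (V 3) (V 4)))"
  have SD: "SIDE col fi rij fj o1 o2 = Seq (Asg 28 (N 0)) (Seq L (Seq (Asg 39 (Times (Times (V fj) (V 3)) (N sn)))
     (Seq B (Seq (Asg o1 e1) (Asg o2 e2)))))"
    by (simp only: SIDE_def L_def B_def e1_def e2_def)
  define s2 where "s2 = put 39 (Fh s ?j * M * sn) s1"
  define s3 where "s3 = sem X B s2"
  define s4 where "s4 = put o1 (eval e1 s3) s3"
  have s2: "put 39 (eval (Times (Times (V fj) (V 3)) (N sn)) s1) s1 = s2"
    using ri e3 by (simp add: s2_def)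
  have s0': "put 28 (eval (N 0) s) s = s0" by (simp add: s0_def)
  have sm: "sem X (SIDE col fi rij fj o1 o2) s = put o2 (eval e2 s4) s4"
    unfolding SD sem.simps(2,4) s0' s1_def[symmetric] s2 s3_def[symmetric] s4_def[symmetric] ..
  have "fst s3 28 = (if fst s1 28 \<le> Fh s ?j * M * sn then Fh s ?j * M * sn else fst s1 28)"
    by (simp add: s3_def B_def s2_def)
  also have "\<dots> = inorm q sn M (Fh s) (Rh s) ?j"
    by (simp add: inorm_def S1 mult_ac max_def)
  finally have s3i: "fst s3 28 = inorm q sn M (Fh s) (Rh s) ?j" .
  have s3o: "fst s3 x = fst s1 x" if "x \<noteq> 28" "x \<noteq> 39" for x using that by (simp add: s3_def B_def s2_def)
  have s3r: "fst s3 3 = M" "fst s3 4 = W" "fst s3 fi = Fh s i" "fst s3 rij = Rh s i ?j" "fst s3 fj = Fh s ?j"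
    using s3o e3 ri regs by auto
  have s4r: "fst s4 3 = M" "fst s4 4 = W" "fst s4 fj = Fh s ?j" "fst s4 28 = fst s3 28"
    using s3r regs by (auto simp: s4_def)
  show "fst (sem X (SIDE col fi rij fj o1 o2) s) o1 = fst (iside q sn M W (Fh s) (Rh s) i ?j)"
    using regs(6) by (simp add: sm s4_def e1_def s3i s3r iside_def mult_ac)
  show "fst (sem X (SIDE col fi rij fj o1 o2) s) o2 = snd (iside q sn M W (Fh s) (Rh s) i ?j)"
    using s3i by (simp add: sm e2_def s4r iside_def mult_ac)
  have tm: "time X (SIDE col fi rij fj o1 o2) s = 3 + (time X L s0 + (etime (Times (Times (V fj) (V 3)) (N sn)) s1 + 2
     + (time X B s2 + (etime e1 s3 + 2 + (etime e2 s4 + 2)))))"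
    unfolding SD time.simps(2,4) sem.simps(2,4) s0' s1_def[symmetric] s2 s3_def[symmetric] s4_def[symmetric] etime.simps(1) by simp
  have t2: "etime (Times (Times (V fj) (V 3)) (N sn)) s1 \<le> 30 * Q" using ri e3 Q(1,7,8) by simp
  have t3: "time X B s2 \<le> 10 * Q" using Q(1) by (simp add: B_def)
  have t4: "etime e1 s3 \<le> 50 * Q" using s3r Rij Q(1,8) by (simp add: e1_def)
  have t5: "etime e2 s4 \<le> 50 * Q" using s4r Q(1,8) by (simp add: e2_def)
  have "q * (100 * Q + 6) \<le> Q * (106 * Q)" using Q(1,3) by (intro mult_mono) auto
  then have "time X (SIDE col fi rij fj o1 o2) s \<le> 12 + 106 * (Q * Q) + 150 * Q" using tm t1 t2 t3 t4 t5 by simp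
  moreover have "Q \<le> Q * Q" "1 \<le> Q * Q" using Q(1) by auto
  ultimately show "time X (SIDE col fi rij fj o1 o2) s \<le> 300 * Q * Q" unfolding mult.assoc using Q(1) by linarith
qed

lemma side_assigned: "assigned (SIDE col fi rij fj o1 o2) = {27, 28, 39, o1, o2}"
  "no_write (SIDE col fi rij fj o1 o2)" by (auto simp: SIDE_def)

lemma factor_assigned: "assigned FACTOR = {27, 28, 29, 30, 35, 36, 37, 38, 39}" "no_write FACTOR"
  by (auto simp: FACTOR_def side_assigned)

lemma factor_correct:
  assumes env: "env s" and R: "\<And>a b. a < q \<Longrightarrow> b < q \<Longrightarrow> Rh s a b \<le> Q"
    and ij: "fst s 17 < q" "fst s 18 < q"
  shows "fst (sem X FACTOR s) 35 = fst (ifac q sn M W (Fh s) (Rh s) (fst s 17) (fst s 18))"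
    "fst (sem X FACTOR s) 36 = snd (ifac q sn M W (Fh s) (Rh s) (fst s 17) (fst s 18))"
    "time X FACTOR s \<le> 600 * Q * Q"
proof -
  let ?i = "fst s 17" and ?j = "fst s 18"
  define s4 where "s4 = put 38 (Rh s ?j ?i) (put 37 (Rh s ?i ?j) (put 30 (Fh s ?j) (put 29 (Fh s ?i) s)))"
  have ev: "env (put x a s')" if "env s'" "x \<in> {29, 30, 37, 38}" for x a s' using that by (auto simp: env_def)
  have FR: "Fh (put x a s') = Fh s'" "Rh (put x a s') = Rh s'" if "x \<in> {29, 30, 37, 38}" for x a s'
    using that by (auto simp: Fh_def Rh_def fun_eq_iff)
  have e1: "env (put 29 (Fh s ?i) s)" by (rule ev[OF env]) simp
  have e2: "env (put 30 (Fh s ?j) (put 29 (Fh s ?i) s))" by (rule ev[OF e1]) simp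
  have e3: "env (put 37 (Rh s ?i ?j) (put 30 (Fh s ?j) (put 29 (Fh s ?i) s)))" by (rule ev[OF e2]) simp
  have e4: "env s4" unfolding s4_def by (rule ev[OF e3]) simp
  have FR4: "Fh s4 = Fh s" "Rh s4 = Rh s" unfolding s4_def by (simp_all add: FR)
  have r4: "fst s4 29 = Fh s ?i" "fst s4 30 = Fh s ?j" "fst s4 37 = Rh s ?i ?j" "fst s4 38 = Rh s ?j ?i" "fst s4 17 = ?i" "fst s4 18 = ?j"
    by (simp_all add: s4_def)
  define c where "c = IfLe (Times (V 29) (V 37)) (Times (V 30) (V 3)) (SIDE 18 29 37 30 35 36)
      (IfLe (Times (V 30) (V 38)) (Times (V 29) (V 3)) (SIDE 17 30 38 29 36 35)
        (Seq (Asg 35 (N 1)) (Asg 36 (N 1))))"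
  have sm: "sem X FACTOR s = sem X c s4"
    by (simp add: FACTOR_def c_def s4_def F_at_eval[OF env] F_at_eval[OF e1] R_at_eval[OF e2] R_at_eval[OF e3] FR)
  have "time X FACTOR s = etime (F_at (V 17)) s + 2 + (etime (F_at (V 18)) (put 29 (Fh s ?i) s) + 2
    + (etime (R_at (V 17) (V 18)) (put 30 (Fh s ?j) (put 29 (Fh s ?i) s)) + 2
    + (etime (R_at (V 18) (V 17)) (put 37 (Rh s ?i ?j) (put 30 (Fh s ?j) (put 29 (Fh s ?i) s))) + 2 + time X c s4)))"
    by (simp add: FACTOR_def c_def s4_def F_at_eval[OF env] F_at_eval[OF e1] R_at_eval[OF e2] R_at_eval[OF e3] FR)
  then have tm: "time X FACTOR s \<le> 168 * Q + time X c s4"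
    using F_at_eval(2)[OF env, of 17] F_at_eval(2)[OF e1, of 18] R_at_eval(2)[OF e2, of 17 18] R_at_eval(2)[OF e3, of 18 17] Q(1) by linarith
  have M4: "fst s4 3 = M" using e4 by (simp add: env_def)
  have R4: "\<And>a b. a < q \<Longrightarrow> b < q \<Longrightarrow> Rh s4 a b \<le> Q" using R FR4 by simp
  note sd1 = side_correct[OF e4 R4, of 18 29 30 37 35 36 ?i] and sd2 = side_correct[OF e4 R4, of 17 30 29 38 36 35 ?j]
  have Rq: "Rh s ?i ?j \<le> Q" "Rh s ?j ?i \<le> Q" using R ij by auto
  have QQ: "Q \<le> Q * Q" using Q(1) by simp
  show "fst (sem X FACTOR s) 35 = fst (ifac q sn M W (Fh s) (Rh s) ?i ?j)"
    "fst (sem X FACTOR s) 36 = snd (ifac q sn M W (Fh s) (Rh s) ?i ?j)"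
    unfolding sm c_def using sd1(1,2) sd2(1,2) r4 FR4 M4 ij by (auto simp: ifac_def)
  have "time X c s4 \<le> 70 * Q + 300 * Q * Q"
    unfolding c_def using sd1(3) sd2(3) r4 FR4 M4 ij Rq Q(1,8) by auto
  then show "time X FACTOR s \<le> 600 * Q * Q" using tm QQ unfolding mult.assoc by linarith
qed

end

section \<open>Evaluation of the tree of instances\<close>

text \<open>Every loop raises the exponent of \<open>Q\<close> by one.\<close>

lemma loop_bound:
  fixes Q :: nat
  assumes "1 \<le> Q" "m \<le> Q" "T \<le> c * Q ^ k" "e \<le> c' * Q"
  shows "e + 2 + m * (T + 6) \<le> (c + c' + 8) * Q ^ Suc k"
proof -
  have k: "1 \<le> Q ^ k" using assms(1) by simp
  have "m * (T + 6) \<le> Q * (c * Q ^ k + 6 * Q ^ k)" using assms k by (intro mult_mono add_mono) auto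
  moreover have "e + 2 \<le> (c' + 2) * Q" using assms by (simp add: algebra_simps)
  moreover have "(c' + 2) * Q \<le> (c' + 2) * (Q * Q ^ k)" using k by (intro mult_left_mono) auto
  ultimately show ?thesis by (simp add: algebra_simps)
qed

type_synonym inst = "nat set \<times> pins \<times> nat \<times> nat"

context run
begin

definition base where "base x = A0 + x * Bsz"

lemma base_disjoint:
  assumes "o1 < Bsz" "o2 < Bsz" "base x + o1 = base y + o2"
  shows "x = y" "o1 = o2"
proof -
  have eq: "x * Bsz + o1 = y * Bsz + o2" using assms(3) by (simp add: base_def)
  have "(x * Bsz + o1) div Bsz = x" "(y * Bsz + o2) div Bsz = y" using assms by auto
  then show "x = y" using eq by simp
  then show "o1 = o2" using eq by simp
qed

lemma base_ge: "A0 \<le> base x" by (simp add: base_def)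

text \<open>Row \<open>u\<close> has the pins of \<open>u\<close> in its first \<open>q\<close> cells and then a flag for membership in \<open>U\<close>. The root and the level follow
  the rows.\<close>

definition inst_at :: "(nat \<Rightarrow> nat) \<Rightarrow> nat \<Rightarrow> nat set \<Rightarrow> pins \<Rightarrow> nat \<Rightarrow> nat \<Rightarrow> bool" where
  "inst_at h B U m v l \<longleftrightarrow> (\<forall>u<n. h (B + (u * (q+1) + q)) = (if u \<in> U then 1 else 0)) \<and>
     (\<forall>u<n. \<forall>a<q. h (B + (u * (q+1) + a)) = m u a) \<and> h (B + n * (q+1)) = v \<and> h (B + (n * (q+1) + 1)) = l"

text \<open>A missing node has the impossible root \<open>n\<close>.\<close>

definition enc :: "(nat \<Rightarrow> nat) \<Rightarrow> nat \<Rightarrow> inst option \<Rightarrow> bool" where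
  "enc h x nd = (case nd of None \<Rightarrow> h (base x + n * (q+1)) = n
     | Some (U, m, v, l) \<Rightarrow> inst_at h (base x) U m v l \<and> U \<subseteq> {..<n} \<and> v \<in> U \<and> admissible \<Delta> U m)"

lemma row_less: "u < n \<Longrightarrow> a \<le> q \<Longrightarrow> u * (q+1) + a < n * (q+1)"
proof -
  assume "u < n" "a \<le> q"
  then have "u * (q+1) + a < (u+1) * (q+1)" by simp
  also have "\<dots> \<le> n * (q+1)" using \<open>u < n\<close> by (intro mult_right_mono) auto
  finally show ?thesis .
qed

lemma enc_cong:
  assumes "\<And>off. off < n * (q+1) + 2 \<Longrightarrow> h (base x + off) = h' (base x + off)"
  shows "enc h x nd = enc h' x nd"
proof -
  have r: "h (base x + (u * (q+1) + a)) = h' (base x + (u * (q+1) + a))" if "u < n" "a \<le> q" for u a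
    using row_less[OF that] by (intro assms) simp
  show ?thesis using r[of _ q] r assms[of "n * (q+1)"] assms[of "n * (q+1) + 1"]
    by (auto simp: enc_def inst_at_def split: option.split)
qed

text \<open>The number of a child among its siblings encodes the neighbour and the two colours.\<close>

definition kid :: "inst \<Rightarrow> nat \<Rightarrow> inst option" where
  "kid nd D = (case nd of (U, m, v, l) \<Rightarrow>
     let k = D div (q*q); e = D mod (q*q) in
     if k < length (nbl U v) then Some (U - {v}, child U m v k (e div q) (e mod q), nbl U v ! k, Suc l) else None)"

text \<open>The complete tree in heap order, the children of node \<open>x\<close> being the nodes \<open>bb * x + 1\<close> to \<open>bb * x + bb\<close>.\<close>

fun node :: "inst \<Rightarrow> nat \<Rightarrow> inst option" where
  "node nd0 0 = Some nd0"
| "node nd0 (Suc y) = (case node nd0 (y div bb) of None \<Rightarrow> None | Some nd \<Rightarrow> kid nd (y mod bb))"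

lemma node_child:
  assumes "D < bb" "node nd0 x = Some nd"
  shows "node nd0 (bb * x + 1 + D) = kid nd D"
  using assms by simp

text \<open>The nodes of level \<open>l\<close> are among the first \<open>1 + bb + \<dots> + bb ^ l \<le> (bb + 1) ^ l\<close> nodes.\<close>

lemma node_level:
  assumes "0 < bb"
  shows "node nd0 x = Some (U, m, v, l) \<Longrightarrow> snd (snd (snd nd0)) = 0 \<Longrightarrow> x + 1 \<le> (bb + 1) ^ l"
proof (induction nd0 x arbitrary: U m v l rule: node.induct)
  case (2 nd0 y)
  then obtain U' m' v' l' where p: "node nd0 (y div bb) = Some (U', m', v', l')" "kid (U', m', v', l') (y mod bb) = Some (U, m, v, l)"
    by (auto split: option.splits)
  have l: "l = Suc l'" using p(2) by (auto simp: kid_def Let_def split: if_splits)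
  have IH: "y div bb + 1 \<le> (bb + 1) ^ l'" by (rule 2(1)[OF p(1) 2(3)])
  have "y < bb * (y div bb + 1)" using assms by (metis dividend_less_times_div mult.commute mult_Suc_right Suc_eq_plus1)
  then have "Suc y + 1 \<le> bb * (y div bb + 1) + (y div bb + 1)" by simp
  also have "\<dots> \<le> (bb + 1) * (bb + 1) ^ l'" using IH mult_le_mono2[OF IH, of "bb + 1"] by (simp add: algebra_simps)
  finally show ?case by (simp add: l)
qed auto

lemma pins_small: "admissible \<Delta> U m \<Longrightarrow> v \<in> U \<Longrightarrow> a < q \<Longrightarrow> m v a \<le> \<Delta>"
proof -
  assume a: "admissible \<Delta> U m" "v \<in> U" "a < q"
  have "m v a \<le> (\<Sum>a<q. m v a)" using a(3) by (intro member_le_sum) auto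
  also have "\<dots> \<le> deg U m v" by (simp add: deg_def)
  also have "\<dots> \<le> \<Delta>" using a by (auto simp: admissible_def)
  finally show ?thesis .
qed

lemma length_nbl_le: "admissible \<Delta> U m \<Longrightarrow> v \<in> U \<Longrightarrow> length (nbl U v) \<le> \<Delta>"
  by (auto simp: admissible_def deg_def length_nbl)

definition vals_at :: "(nat \<Rightarrow> nat) \<Rightarrow> nat \<Rightarrow> nat \<Rightarrow> nat set \<Rightarrow> pins \<Rightarrow> nat \<Rightarrow> bool" where
  "vals_at h x t U m v \<longleftrightarrow> (\<forall>e<q*q. h (base x + (n * (q+1) + 2 + e)) = est \<Delta> M W t U m v (e div q) (e mod q))"

lemma pair_less: "a < q \<Longrightarrow> b < q \<Longrightarrow> a * q + b < q * q"
proof -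
  assume "a < q" "b < q"
  then have "a * q + b < (a+1) * q" by simp
  also have "\<dots> \<le> q * q" using \<open>a < q\<close> by (intro mult_right_mono) auto
  finally show ?thesis .
qed

lemma est_Q: "admissible \<Delta> U m \<Longrightarrow> v \<in> U \<Longrightarrow> est \<Delta> M W t U m v i j \<le> Q"
proof -
  assume a: "admissible \<Delta> U m" "v \<in> U"
  have "est \<Delta> M W t U m v i j \<le> 2 ^ \<Delta> * M" by (rule est_le[OF _ length_nbl_le[OF a]]) (use \<Delta>q in simp)
  then show ?thesis using Q(11) by simp
qed

lemma node_F:
  assumes env: "env s" and nd: "enc (snd s) c (Some (U, m, v, l))" and r: "fst s 14 = base c" "fst s 22 = v" and a: "a < q"
  shows "Fh s a = iF \<Delta> M W m v a"
proof -
  have v: "v < n" "m v a \<le> \<Delta>" "snd s (base c + (v * (q+1) + a)) = m v a"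
    using nd pins_small[of U m v a] a by (auto simp: enc_def inst_at_def)
  then show ?thesis using env r by (simp add: Fh_def iF_def env_def)
qed

lemma node_R:
  assumes "vals_at (snd s) c t U m v" "fst s 14 = base c" "a < q" "b < q"
  shows "Rh s a b = est \<Delta> M W t U m v a b"
  using assms pair_less[OF assms(3,4)] by (simp add: Rh_def vals_at_def)

definition ifac_of where
  "ifac_of t U m v i j k = ifac q (q - \<Delta> + 1) M W (iF \<Delta> M W (child U m v k i j) (nbl U v ! k))
        (est \<Delta> M W t (U - {v}) (child U m v k i j) (nbl U v ! k)) i j"

lemma prod_min: "(\<Prod>k'<min (Suc k) l. f k') = (\<Prod>k'<min k l. f k') * (if k < l then f k else (1::nat))"
  by (auto simp: min_def le_Suc_eq)

lemma value_correct:
  assumes env: "env s" and x: "fst s 13 = x" and e: "fst s 40 = e" "e < q * q" "fst s 17 = e div q" "fst s 18 = e mod q"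
    and v: "fst s 24 = M" "fst s 25 = 1"
    and adm: "admissible \<Delta> U m" "v \<in> U" "U \<subseteq> {..<n}"
    and kids: "\<And>k. k < \<Delta> \<Longrightarrow> enc (snd s) (bb * x + 1 + (k * (q*q) + e)) (kid (U, m, v, l) (k * (q*q) + e))"
    and vals: "\<And>k. k < length (nbl U v) \<Longrightarrow> vals_at (snd s) (bb * x + 1 + (k * (q*q) + e)) t (U - {v}) (child U m v k (e div q) (e mod q)) (nbl U v ! k)"
  shows "fst (sem X VALUE s) 24 = M * (\<Prod>k<length (nbl U v). fst (ifac_of t U m v (e div q) (e mod q) k))"
    "fst (sem X VALUE s) 25 = (\<Prod>k<length (nbl U v). snd (ifac_of t U m v (e div q) (e mod q) k))"
    "time X VALUE s \<le> 1000 * Q ^ 3"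
proof -
  define i j where "i = e div q" and "j = e mod q"
  have ij: "i < q" "j < q" using e(2) q0 by (auto simp: i_def j_def less_mult_imp_div_less)
  define ln where "ln = length (nbl U v)"
  have lnd: "ln \<le> \<Delta>" using length_nbl_le[OF adm(1,2)] by (simp add: ln_def)
  define f where "f = ifac_of t U m v i j"
  define body where "body = Seq (Asg 14 (Plus (V 9) (Times (Plus (Plus (Times (V 13) (N bb)) (N 1)) (Plus (Times (V 16) (N (q*q))) (V 40))) (V 8))))
     (Seq (Asg 22 (Rd (root_addr 14)))
     (IfLe (Plus (V 22) (N 1)) (V 0)
       (Seq FACTOR (Seq (Asg 24 (Times (V 24) (V 35))) (Asg 25 (Times (V 25) (V 36))))) Skip))"
  have VB: "VALUE = For 16 (N \<Delta>) body" by (simp add: VALUE_def body_def)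
  define I where "I k s' \<longleftrightarrow> env s' \<and> fst s' 13 = x \<and> fst s' 40 = e \<and> fst s' 17 = i \<and> fst s' 18 = j \<and> snd s' = snd s \<and>
     fst s' 24 = M * (\<Prod>k'<min k ln. fst (f k')) \<and> fst s' 25 = (\<Prod>k'<min k ln. snd (f k'))" for k s'
  have step: "I (Suc k) (sem X body (put 16 k s')) \<and> time X body (put 16 k s') \<le> 900 * Q ^ 2" if k: "k < \<Delta>" and I: "I k s'" for k s'
  proof -
    define c where "c = bb * x + 1 + (k * (q*q) + e)"
    define s1 where "s1 = put 14 (base c) (put 16 k s')"
    define r where "r = snd s (base c + n * (q+1))"
    define s2 where "s2 = put 22 r s1"
    have env1: "env s1" "env s2" "env (put 16 k s')" using I by (auto simp: s1_def s2_def I_def env_def)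
    have reg: "fst s2 13 = x" "fst s2 40 = e" "fst s2 17 = i" "fst s2 18 = j" "snd s2 = snd s" "fst s2 14 = base c" "fst s2 22 = r"
      "fst s2 24 = fst s' 24" "fst s2 25 = fst s' 25" "fst s2 0 = n"
      using I env1 by (auto simp: s1_def s2_def I_def env_def)
    have ev: "fst s' 9 = A0" "fst s' 8 = Bsz" "fst s' 13 = x" "fst s' 40 = e" "fst s' 0 = n" "snd s' = snd s" using I by (auto simp: I_def env_def)
    have a1: "sem X (Asg 14 (Plus (V 9) (Times (Plus (Plus (Times (V 13) (N bb)) (N 1)) (Plus (Times (V 16) (N (q*q))) (V 40))) (V 8)))) (put 16 k s') = s1"
      using ev by (simp add: s1_def base_def c_def algebra_simps)
    have a2: "sem X (Asg 22 (Rd (root_addr 14))) s1 = s2"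
      using ev by (simp add: s2_def s1_def r_def root_addr_def)
    define R where "R = IfLe (Plus (V 22) (N 1)) (V 0)
       (Seq FACTOR (Seq (Asg 24 (Times (V 24) (V 35))) (Asg 25 (Times (V 25) (V 36))))) Skip"
    have sb: "sem X body (put 16 k s') = sem X R s2"
      unfolding body_def sem.simps(4) a1 a2 R_def ..
    have tb: "time X body (put 16 k s') \<le> 90 * Q + time X R s2"
    proof -
      have "time X (Asg 14 (Plus (V 9) (Times (Plus (Plus (Times (V 13) (N bb)) (N 1)) (Plus (Times (V 16) (N (q*q))) (V 40))) (V 8)))) (put 16 k s') \<le> 50 * Q"
        using ev Q(1,4,5,10) by (simp add: Bsz_def)
      moreover have "time X (Asg 22 (Rd (root_addr 14))) s1 \<le> 30 * Q"
        using Q(1,3) by (simp add: root_addr_def)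
      ultimately show ?thesis unfolding body_def time.simps(4) a1 a2 R_def by linarith
    qed
    have en: "enc (snd s) c (kid (U, m, v, l) (k * (q*q) + e))" unfolding c_def by (rule kids[OF k])
    have kd: "kid (U, m, v, l) (k * (q*q) + e) = (if k < ln then Some (U - {v}, child U m v k i j, nbl U v ! k, Suc l) else None)"
    proof -
      have "q*q \<noteq> 0" using e(2) by (intro notI) simp
      then have "(k * (q*q) + e) div (q*q) = k" "(k * (q*q) + e) mod (q*q) = e"
        using e(2) by (simp_all only: div_mult_self3 mod_mult_self3 div_less mod_less) simp_all
      then show ?thesis by (simp only: kid_def Let_def i_def j_def ln_def prod.case)
    qed
    show ?thesis
    proof (cases "k < ln")
      case False
      then have "r = n" using en kd by (simp add: enc_def r_def)
      then have "sem X R s2 = s2" "time X R s2 \<le> 20 * Q" using reg Q(1) by (auto simp: R_def)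
      moreover have "Q \<le> Q ^ 2" using Q(1) by (simp add: power2_eq_square)
      moreover have "min (Suc k) ln = min k ln" using False by simp
      ultimately show ?thesis using I env1 reg tb sb unfolding I_def by simp
    next
      case True
      let ?U = "U - {v}" and ?m = "child U m v k i j" and ?v = "nbl U v ! k"
      have en': "enc (snd s2) c (Some (?U, ?m, ?v, Suc l))" using en kd True reg by simp
      then have rv: "r = ?v" "r < n" "admissible \<Delta> ?U ?m" "?v \<in> ?U" unfolding reg(5) by (auto simp: enc_def inst_at_def r_def)
      have vs: "vals_at (snd s2) c t ?U ?m ?v" using vals[of k] True by (simp add: reg c_def ln_def i_def j_def)
      have Fe: "Fh s2 a = iF \<Delta> M W ?m ?v a" if "a < q" for a by (rule node_F[OF env1(2) en' reg(6) _ that]) (simp add: reg rv)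
      have Re: "Rh s2 a b = est \<Delta> M W t ?U ?m ?v a b" if "a < q" "b < q" for a b by (rule node_R[OF vs reg(6) that])
      have RQ: "Rh s2 a b \<le> Q" if "a < q" "b < q" for a b using Re[OF that] est_Q[OF rv(3,4)] by simp
      have ic: "ifac q sn M W (Fh s2) (Rh s2) i j = f k"
        unfolding f_def ifac_of_def sn_def by (rule ifac_cong[OF Fe Re ij])
      have fa: "fst (sem X FACTOR s2) 35 = fst (f k)" "fst (sem X FACTOR s2) 36 = snd (f k)" "time X FACTOR s2 \<le> 600 * Q * Q"
        using factor_correct[OF env1(2) RQ] ij ic reg by auto
      define s3 where "s3 = sem X FACTOR s2"
      have s3r: "fst s3 y = fst s2 y" if "y \<notin> {27, 28, 29, 30, 35, 36, 37, 38, 39}" for y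
        unfolding s3_def by (rule sem_unassigned) (use that in \<open>simp add: factor_assigned\<close>)
      have s3h: "snd s3 = snd s2" unfolding s3_def by (rule sem_no_write[OF factor_assigned(2)])
      have env3: "env s3" using env1(2) s3r s3h by (simp add: env_def)
      have iFb: "iF \<Delta> M W ?m ?v a \<le> M ^ \<Delta>" if "a < q" for a
      proof -
        have "W ^ ?m ?v a * M ^ (\<Delta> - ?m ?v a) \<le> M ^ ?m ?v a * M ^ (\<Delta> - ?m ?v a)"
          using WM by (intro mult_right_mono power_mono) auto
        then show ?thesis using pins_small[OF rv(3,4) that] by (simp add: iF_def power_add[symmetric])
      qed
      have "est \<Delta> M W t ?U ?m ?v a b \<le> 2 ^ \<Delta> * M" for a b
        using est_le[OF _ length_nbl_le[OF rv(3,4)]] \<Delta>q by simp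
      then have fQ: "fst (f k) \<le> Q" "snd (f k) \<le> Q"
        using ifac_le[of q "iF \<Delta> M W ?m ?v" "M ^ \<Delta>" "est \<Delta> M W t ?U ?m ?v" "2 ^ \<Delta> * M" i j sn M W, OF iFb _ ij] Q(12)
        unfolding f_def ifac_of_def sn_def by fastforce+
      have cond: "eval (Plus (V 22) (N 1)) s2 \<le> eval (V 0) s2" using reg rv by simp
      have sR: "sem X R s2 = put 25 (fst s3 25 * fst s3 36) (put 24 (fst s3 24 * fst s3 35) s3)"
        using cond by (simp add: R_def s3_def)
      have tR: "time X R s2 \<le> 20 + 600 * Q * Q + 40 * Q"
        using cond fa fQ Q(1) by (simp add: R_def s3_def)
      have Q2: "Q \<le> Q ^ 2" "1 \<le> Q ^ 2" "600 * Q * Q = 600 * Q ^ 2" using Q(1) by (auto simp: power2_eq_square)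
      have I': "I (Suc k) (sem X R s2)"
        unfolding I_def sR using env3 s3r s3h reg fa I True prod_min[of _ k ln]
        by (simp add: s3_def[symmetric] env_def I_def mult.assoc)
      show ?thesis using I' tb tR Q2 unfolding sb by linarith
    qed
  qed
  have I0: "I 0 s" using env x e v by (simp add: I_def i_def j_def)
  note lp = for_rule[where I = I and X = X and x = 16 and e = "N \<Delta>" and m = \<Delta> and s = s, OF I0 step, folded VB]
  have "I \<Delta> (sem X VALUE s)" using lp by simp
  then show "fst (sem X VALUE s) 24 = M * (\<Prod>k<length (nbl U v). fst (ifac_of t U m v (e div q) (e mod q) k))"
    "fst (sem X VALUE s) 25 = (\<Prod>k<length (nbl U v). snd (ifac_of t U m v (e div q) (e mod q) k))"
    using lnd by (simp_all add: I_def f_def i_def j_def ln_def min_absorb2)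
  have "time X VALUE s \<le> 1 + 2 + \<Delta> * (900 * Q ^ 2 + 6)" using lp by simp
  also have "\<dots> \<le> (900 + 1 + 8) * Q ^ Suc 2" using Q(1,6) by (intro loop_bound) auto
  also have "\<dots> \<le> 1000 * Q ^ 3" by (simp add: numeral_eq_Suc)
  finally show "time X VALUE s \<le> 1000 * Q ^ 3" .
qed

lemma value_assigned: "assigned VALUE = {14, 16, 22, 24, 25} \<union> {27, 28, 29, 30, 35, 36, 37, 38, 39}" "no_write VALUE"
  by (auto simp: VALUE_def factor_assigned)

text \<open>The state in which the nodes from \<open>z\<close> on have been evaluated. A node of level \<open>l\<close> gets the estimate of depth \<open>d - l\<close>.\<close>

definition tree :: "inst \<Rightarrow> (nat \<Rightarrow> nat) \<Rightarrow> nat \<Rightarrow> bool" where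
  "tree nd0 h z \<longleftrightarrow> (\<forall>y<NN. enc h y (node nd0 y)) \<and>
     (\<forall>y U m v l. z \<le> y \<longrightarrow> y < NN \<longrightarrow> node nd0 y = Some (U, m, v, l) \<longrightarrow> vals_at h y (d - l) U m v)"

lemma write_value:
  fixes h :: "nat \<Rightarrow> nat" and x z :: nat
  assumes "e < q*q"
  defines "h' \<equiv> h(base x + (n * (q+1) + 2 + e) := z)"
  shows "a < A0 \<Longrightarrow> h' a = h a" "enc h' y nd = enc h y nd" "y \<noteq> x \<Longrightarrow> vals_at h' y t U m v = vals_at h y t U m v"
    "e' < q*q \<Longrightarrow> h' (base x + (n * (q+1) + 2 + e')) = (if e' = e then z else h (base x + (n * (q+1) + 2 + e')))"
proof -
  have o: "n * (q+1) + 2 + e < Bsz" using assms by (simp add: Bsz_def)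
  show "a < A0 \<Longrightarrow> h' a = h a" using base_ge[of x] by (simp add: h'_def)
  have "h' (base y + off) = h (base y + off)" if "off < n * (q+1) + 2" for off
  proof -
    have "base y + off \<noteq> base x + (n * (q+1) + 2 + e)"
      using base_disjoint(2)[OF _ o, of off y x] that by (auto simp: Bsz_def)
    then show ?thesis by (simp add: h'_def)
  qed
  then show "enc h' y nd = enc h y nd" by (rule enc_cong)
  show "vals_at h' y t U m v = vals_at h y t U m v" if "y \<noteq> x"
  proof -
    have "h' (base y + (n * (q+1) + 2 + e')) = h (base y + (n * (q+1) + 2 + e'))" if e': "e' < q*q" for e'
    proof -
      have "base y + (n * (q+1) + 2 + e') \<noteq> base x + (n * (q+1) + 2 + e)"
        using base_disjoint(1)[OF _ o, of "n * (q+1) + 2 + e'" y x] e' \<open>y \<noteq> x\<close> by (auto simp: Bsz_def)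
      then show ?thesis unfolding h'_def by (rule fun_upd_other)
    qed
    then show ?thesis unfolding vals_at_def by metis
  qed
  show "e' < q*q \<Longrightarrow> h' (base x + (n * (q+1) + 2 + e')) = (if e' = e then z else h (base x + (n * (q+1) + 2 + e')))"
    by (simp add: h'_def)
qed

definition pair_loop where
  "pair_loop = For 40 (N (q*q)) (Seq (Asg 17 (Quot (V 40) (N q))) (Seq (Asg 18 (Minus (V 40) (Times (V 17) (N q))))
         (Seq (Asg 24 (V 3)) (Seq (Asg 25 (N 1))
         (Seq (IfLe (Plus (Rd (lev_addr 15)) (N 1)) (V 10) VALUE Skip)
           (Wr (val_addr 15 (V 40)) (Quot (V 24) (V 25))))))))"

lemma pair_loop_correct:
  assumes NN: "NN = (bb + 1) ^ d" "0 < bb" and l0: "snd (snd (snd nd0)) = 0"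
    and env: "env s" and x: "fst s 13 = x" "fst s 15 = base x" "x < NN" and nd: "node nd0 x = Some (U, m, v, l)"
    and tr: "tree nd0 (snd s) (Suc x)"
  shows "env (sem X pair_loop s)" "tree nd0 (snd (sem X pair_loop s)) x" "time X pair_loop s \<le> 1200 * Q ^ 4"
proof -
  define body where "body = Seq (Asg 17 (Quot (V 40) (N q))) (Seq (Asg 18 (Minus (V 40) (Times (V 17) (N q))))
         (Seq (Asg 24 (V 3)) (Seq (Asg 25 (N 1))
         (Seq (IfLe (Plus (Rd (lev_addr 15)) (N 1)) (V 10) VALUE Skip)
           (Wr (val_addr 15 (V 40)) (Quot (V 24) (V 25)))))))"
  have PL: "pair_loop = For 40 (N (q*q)) body" by (simp add: pair_loop_def body_def)
  define J where "J e s' \<longleftrightarrow> env s' \<and> fst s' 13 = x \<and> fst s' 15 = base x \<and> tree nd0 (snd s') (Suc x) \<and>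
     (\<forall>e'<e. snd s' (base x + (n * (q+1) + 2 + e')) = est \<Delta> M W (d - l) U m v (e' div q) (e' mod q))" for e s'
  have step: "J (Suc e) (sem X body (put 40 e s')) \<and> time X body (put 40 e s') \<le> 1150 * Q ^ 3" if e: "e < q * q" and J: "J e s'" for e s'
  proof -
    define s1 where "s1 = put 25 1 (put 24 M (put 18 (e mod q) (put 17 (e div q) (put 40 e s'))))"
    define A where "A = IfLe (Plus (Rd (lev_addr 15)) (N 1)) (V 10) VALUE Skip"
    define C where "C = Wr (val_addr 15 (V 40)) (Quot (V 24) (V 25))"
    define s2 where "s2 = sem X A s1"
    have ev: "fst s' 0 = n" "fst s' 3 = M" "fst s' 10 = d" "fst s' 13 = x" "fst s' 15 = base x" using J by (auto simp: J_def env_def)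
    have sb: "sem X body (put 40 e s') = sem X C s2"
      using ev by (simp add: body_def s2_def A_def C_def s1_def minus_div_mult_eq_mod)
    have eQ: "e \<le> Q" "e div q \<le> Q" using e Q(4) div_le_dividend[of e q] by linarith+
    have tb: "time X body (put 40 e s') \<le> 40 * Q + time X A s1 + time X C s2"
      using ev eQ Q(1,3) by (simp add: body_def s2_def A_def C_def s1_def minus_div_mult_eq_mod)
    have env1: "env s1" using J by (simp add: J_def s1_def env_def)
    have h1: "snd s1 = snd s'" by (simp add: s1_def)
    have r1: "fst s1 13 = x" "fst s1 15 = base x" "fst s1 40 = e" "fst s1 17 = e div q" "fst s1 18 = e mod q" "fst s1 24 = M" "fst s1 25 = 1" "fst s1 0 = n" "fst s1 10 = d"
      using ev by (simp_all add: s1_def)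
    have encx: "\<And>y. y < NN \<Longrightarrow> enc (snd s1) y (node nd0 y)" using J by (simp add: J_def tree_def h1)
    have ex: "inst_at (snd s1) (base x) U m v l" "U \<subseteq> {..<n}" "v \<in> U" "admissible \<Delta> U m"
      using encx[OF x(3)] nd by (auto simp: enc_def)
    have lev: "eval (Plus (Rd (lev_addr 15)) (N 1)) s1 = l + 1" using ex(1) r1 by (simp add: lev_addr_def inst_at_def)
    have A1: "fst s2 24 div fst s2 25 = est \<Delta> M W (d - l) U m v (e div q) (e mod q) \<and> time X A s1 \<le> 1050 * Q ^ 3"
    proof (cases "l + 1 \<le> d")
      case False
      have "Q \<le> Q ^ 3" using Q(1) by (simp add: power_increasing[of 1 3 Q, simplified])
      moreover have "time X A s1 \<le> 40 * Q" using False lev r1 Q(1,3) by (simp add: A_def lev_addr_def)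
      ultimately show ?thesis using False lev r1 by (simp add: s2_def A_def)
    next
      case True
      define t where "t = d - l - 1"
      have dt: "d - l = Suc t" using True by (simp add: t_def)
      have cN: "bb * x + 1 + (k * (q*q) + e) < NN" "k * (q*q) + e < bb" if "k < \<Delta>" for k
      proof -
        have "k * (q*q) + e < (k + 1) * (q*q)" using e by simp
        also have "\<dots> \<le> bb" unfolding bb_def using that by (intro mult_right_mono) auto
        finally show D: "k * (q*q) + e < bb" .
        then have "bb * x + 1 + (k * (q*q) + e) < (bb + 1) * (x + 1)" by (simp add: algebra_simps)
        also have "\<dots> \<le> (bb + 1) * (bb + 1) ^ l" by (intro mult_left_mono node_level[OF NN(2) nd l0]) simp
        also have "\<dots> \<le> (bb + 1) ^ d" using True power_increasing[of "Suc l" d "bb + 1"] by simp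
        finally show "bb * x + 1 + (k * (q*q) + e) < NN" by (simp add: NN(1))
      qed
      have nk: "node nd0 (bb * x + 1 + (k * (q*q) + e)) = kid (U, m, v, l) (k * (q*q) + e)" if "k < \<Delta>" for k
        by (rule node_child[OF cN(2)[OF that] nd])
      have K1: "enc (snd s1) (bb * x + 1 + (k * (q*q) + e)) (kid (U, m, v, l) (k * (q*q) + e))" if "k < \<Delta>" for k
        using encx[OF cN(1)[OF that]] nk[OF that] by simp
      have K2: "vals_at (snd s1) (bb * x + 1 + (k * (q*q) + e)) t (U - {v}) (child U m v k (e div q) (e mod q)) (nbl U v ! k)"
        if k: "k < length (nbl U v)" for k
      proof -
        have k': "k < \<Delta>" using k length_nbl_le[OF ex(4,3)] by simp
        have "q*q \<noteq> 0" using e by (intro notI) simp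
        then have "(k * (q*q) + e) div (q*q) = k" "(k * (q*q) + e) mod (q*q) = e"
          using e by (simp_all only: div_mult_self3 mod_mult_self3 div_less mod_less) simp_all
        then have kd: "kid (U, m, v, l) (k * (q*q) + e) = Some (U - {v}, child U m v k (e div q) (e mod q), nbl U v ! k, Suc l)"
          using k by (simp add: kid_def)
        have "x < bb * x + 1 + (k * (q*q) + e)" using NN(2) by (simp add: less_Suc_eq_le trans_le_add1)
        then have "vals_at (snd s1) (bb * x + 1 + (k * (q*q) + e)) (d - Suc l) (U - {v}) (child U m v k (e div q) (e mod q)) (nbl U v ! k)"
          using J cN(1)[OF k'] nk[OF k'] kd unfolding J_def tree_def h1 by (metis Suc_leI)
        then show ?thesis by (simp add: t_def)
      qed
      note vc = value_correct[OF env1 r1(1) r1(3) e r1(4,5,6,7) ex(4,3,2) K1 K2]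
      have "fst s2 24 div fst s2 25 = est \<Delta> M W (Suc t) U m v (e div q) (e mod q)"
        using True lev r1 vc(1,2) by (simp add: s2_def A_def ifac_of_def Let_def)
      moreover have "time X A s1 \<le> 40 * Q + 1000 * Q ^ 3" using True lev r1 vc(3) Q(1,3) by (simp add: A_def lev_addr_def)
      moreover have "Q \<le> Q ^ 3" using Q(1) by (simp add: power_increasing[of 1 3 Q, simplified])
      ultimately show ?thesis unfolding dt by simp
    qed
    have r2: "fst s2 y = fst s1 y" if "y \<notin> {14, 16, 22, 24, 25, 27, 28, 29, 30, 35, 36, 37, 38, 39}" for y
      unfolding s2_def by (rule sem_unassigned) (use that in \<open>simp add: A_def value_assigned\<close>)
    have h2: "snd s2 = snd s'" unfolding s2_def h1[symmetric] by (rule sem_no_write) (simp add: A_def value_assigned)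
    have sC: "sem X C s2 = (fst s2, (snd s')(base x + (n * (q+1) + 2 + e) := est \<Delta> M W (d - l) U m v (e div q) (e mod q)))"
      using A1 r1 r2 by (simp add: C_def val_addr_def h2)
    have "env (sem X C s2)"
      by (rule env_cong[OF env1]) (use r2 write_value(1)[OF e] in \<open>auto simp: sC h1\<close>)
    moreover have "tree nd0 (snd (sem X C s2)) (Suc x)"
      using J write_value(2,3)[OF e] by (simp add: sC J_def tree_def Suc_le_eq)
    moreover have "snd (sem X C s2) (base x + (n * (q+1) + 2 + e')) = est \<Delta> M W (d - l) U m v (e' div q) (e' mod q)" if "e' < Suc e" for e'
    proof -
      have "e' < q*q" using that e by simp
      then show ?thesis using J that unfolding sC snd_conv write_value(4)[OF e \<open>e' < q*q\<close>] by (auto simp: J_def)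
    qed
    ultimately have J': "J (Suc e) (sem X C s2)" using r1 r2 by (simp add: J_def sC)
    have "time X C s2 \<le> 40 * Q" using A1 est_Q[OF ex(4,3), of "d - l" "e div q" "e mod q"] Q(1,3) by (simp add: C_def val_addr_def)
    moreover have "Q \<le> Q ^ 3" using Q(1) by (simp add: power_increasing[of 1 3 Q, simplified])
    ultimately show ?thesis using J' tb A1 unfolding sb by simp
  qed
  have J0: "J 0 s" using env x tr by (simp add: J_def)
  note lp = for_rule[where I = J and X = X and x = 40 and e = "N (q*q)" and m = "q*q" and s = s, OF J0 step, folded PL]
  have Je: "J (q*q) (sem X pair_loop s)" using lp by simp
  then show "env (sem X pair_loop s)" by (simp add: J_def)
  have "vals_at (snd (sem X pair_loop s)) x (d - l) U m v" using Je by (simp add: J_def vals_at_def)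
  then show "tree nd0 (snd (sem X pair_loop s)) x" using Je nd unfolding J_def tree_def
    by (metis Suc_leI le_neq_implies_less option.inject prod.inject)
  have "time X pair_loop s \<le> 1 + 2 + q*q * (1150 * Q ^ 3 + 6)" using lp by simp
  also have "\<dots> \<le> (1150 + 1 + 8) * Q ^ Suc 3" using Q(1,4) by (intro loop_bound) auto
  also have "\<dots> \<le> 1200 * Q ^ 4" by (simp add: numeral_eq_Suc)
  finally show "time X pair_loop s \<le> 1200 * Q ^ 4" .
qed

lemma eval_correct:
  assumes NN: "NN = (bb + 1) ^ d" "0 < bb" and env: "env s" and enc: "\<And>y. y < NN \<Longrightarrow> enc (snd s) y (node (U, m, v, 0) y)"
  shows "env (sem X EVAL s)" "enc (snd (sem X EVAL s)) 0 (Some (U, m, v, 0))" "vals_at (snd (sem X EVAL s)) 0 d U m v"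
    "time X EVAL s \<le> 1300 * Q ^ 5"
proof -
  let ?nd = "(U, m, v, 0)"
  define body where "body = Seq (Asg 13 (Minus (Minus (V 7) (N 1)) (V 12)))
     (Seq (Asg 15 (Plus (V 9) (Times (V 13) (V 8))))
     (IfLe (Plus (Rd (root_addr 15)) (N 1)) (V 0) pair_loop Skip))"
  have EV: "EVAL = For 12 (V 7) body" by (simp add: EVAL_def body_def pair_loop_def)
  define J where "J y s' \<longleftrightarrow> env s' \<and> tree ?nd (snd s') (NN - y)" for y s'
  have step: "J (Suc y) (sem X body (put 12 y s')) \<and> time X body (put 12 y s') \<le> 1260 * Q ^ 4" if y: "y < NN" and J: "J y s'" for y s'
  proof -
    define x where "x = NN - 1 - y"
    have x: "x < NN" "NN - y = Suc x" "NN - Suc y = x" using y by (auto simp: x_def)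
    define s1 where "s1 = put 15 (base x) (put 13 x (put 12 y s'))"
    define R where "R = IfLe (Plus (Rd (root_addr 15)) (N 1)) (V 0) pair_loop Skip"
    have ev: "fst s' 0 = n" "fst s' 7 = NN" "fst s' 8 = Bsz" "fst s' 9 = A0" using J by (auto simp: J_def env_def)
    have sb: "sem X body (put 12 y s') = sem X R s1" using ev by (simp add: body_def R_def s1_def x_def base_def)
    have tb: "time X body (put 12 y s') \<le> 30 * Q + time X R s1"
      using ev Q(1,10) by (simp add: body_def R_def s1_def x_def base_def Bsz_def)
    have env1: "env s1" and tr: "tree ?nd (snd s1) (Suc x)" using J x(2) by (auto simp: J_def s1_def env_def)
    have en: "enc (snd s1) x (node ?nd x)" using tr x(1) by (simp add: tree_def)
    have r1: "fst s1 0 = n" "fst s1 15 = base x" using ev by (auto simp: s1_def)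
    have Q4: "Q \<le> Q ^ 4" using Q(1) by (simp add: power_increasing[of 1 4 Q, simplified])
    have te: "etime (Plus (Rd (root_addr 15)) (N 1)) s1 + etime (V 0) s1 + 2 \<le> 30 * Q" using Q(1,3) by (simp add: root_addr_def)
    have ee: "eval (Plus (Rd (root_addr 15)) (N 1)) s1 = snd s1 (base x + n * (q+1)) + 1" using r1 by (simp add: root_addr_def)
    show ?thesis
    proof (cases "node ?nd x")
      case None
      then have "snd s1 (base x + n * (q+1)) = n" using en by (simp add: enc_def)
      then have no: "\<not> eval (Plus (Rd (root_addr 15)) (N 1)) s1 \<le> eval (V 0) s1" using ee r1 by simp
      then have R: "sem X R s1 = s1" "time X R s1 \<le> 30 * Q" using te by (simp_all add: R_def)
      have "tree ?nd (snd s1) x" using tr None unfolding tree_def by (metis Suc_leI le_neq_implies_less option.distinct(1))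
      then have "J (Suc y) (sem X body (put 12 y s'))" using env1 R sb by (simp add: J_def x(3))
      then show ?thesis using tb R(2) Q4 by linarith
    next
      case (Some a)
      obtain U' m' v' l' where a: "a = (U', m', v', l')" by (cases a) auto
      have nd: "node ?nd x = Some (U', m', v', l')" using Some a by simp
      have "snd s1 (base x + n * (q+1)) < n" using en nd by (auto simp: enc_def inst_at_def)
      then have yes: "eval (Plus (Rd (root_addr 15)) (N 1)) s1 \<le> eval (V 0) s1" using ee r1 by simp
      then have R: "sem X R s1 = sem X pair_loop s1" "time X R s1 \<le> 30 * Q + time X pair_loop s1" using te by (simp_all add: R_def)
      have x13: "fst s1 13 = x" by (simp add: s1_def)
      note pl = pair_loop_correct[OF NN _ env1 x13 r1(2) x(1) nd tr, simplified]
      have "J (Suc y) (sem X body (put 12 y s'))" using pl(1,2) R sb by (simp add: J_def x(3))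
      then show ?thesis using tb R(2) Q4 pl(3) by linarith
    qed
  qed
  have J0: "J 0 s" using env enc by (simp add: J_def tree_def)
  have e7: "eval (V 7) s = NN" using env by (simp add: env_def)
  note lp = for_rule[where I = J and X = X and x = 12 and e = "V 7" and m = NN and s = s, OF J0 step e7, folded EV]
  have Je: "J NN (sem X EVAL s)" using lp by simp
  then show "env (sem X EVAL s)" by (simp add: J_def)
  have "0 < NN" using NN by simp
  then show "enc (snd (sem X EVAL s)) 0 (Some ?nd)" "vals_at (snd (sem X EVAL s)) 0 d U m v"
    using Je by (auto simp: J_def tree_def)
  have "time X EVAL s \<le> 2 + 2 + NN * (1260 * Q ^ 4 + 6)" using lp(2) by simp
  also have "\<dots> \<le> (1260 + 2 + 8) * Q ^ Suc 4" using Q(1,9) by (intro loop_bound) auto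
  also have "\<dots> \<le> 1300 * Q ^ 5" by (simp add: numeral_eq_Suc)
  finally show "time X EVAL s \<le> 1300 * Q ^ 5" .
qed

end

section \<open>Construction of the tree of instances\<close>

text \<open>Scanning the vertices in increasing order, the program finds the position of a neighbour by counting its predecessors.\<close>

lemma sorted_locate:
  fixes u :: nat
  assumes "sorted_wrt (<) xs" "u \<in> set xs"
  defines "p \<equiv> card {x \<in> set xs. x < u}"
  shows "p < length xs" "xs ! p = u" "u \<in> set (take k xs) \<longleftrightarrow> p < k" "u \<in> set (drop (Suc k) xs) \<longleftrightarrow> k < p"
proof -
  obtain p' where p': "p' < length xs" "xs ! p' = u" using assms(2) by (auto simp: in_set_conv_nth)
  have lt: "xs ! a < xs ! b" if "a < b" "b < length xs" for a b using assms(1) that by (simp add: sorted_wrt_iff_nth_less)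
  have eq: "xs ! a = u \<longleftrightarrow> a = p'" if "a < length xs" for a
    using lt[of a p'] lt[of p' a] p' that by (cases a p' rule: linorder_cases) auto
  have "{x \<in> set xs. x < u} = (!) xs ` {..<p'}"
  proof (intro set_eqI iffI)
    fix x assume "x \<in> {x \<in> set xs. x < u}"
    then obtain a where a: "a < length xs" "xs ! a = x" "x < u" by (auto simp: in_set_conv_nth)
    then have "a < p'" using lt[of p' a] p' by (cases a p' rule: linorder_cases) auto
    then show "x \<in> (!) xs ` {..<p'}" using a by auto
  qed (use lt p' in auto)
  moreover have "inj_on ((!) xs) {..<p'}" using assms(1) p'(1)
    by (intro inj_on_nth) (auto simp: strict_sorted_iff)
  ultimately have pp: "p = p'" by (simp add: p_def card_image)
  then show "p < length xs" "xs ! p = u" using p' by auto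
  show "u \<in> set (take k xs) \<longleftrightarrow> p < k"
  proof
    assume "u \<in> set (take k xs)"
    then obtain a where "a < k" "a < length xs" "xs ! a = u" by (auto simp: in_set_conv_nth)
    then show "p < k" using eq[of a] pp by simp
  next
    assume "p < k"
    then have "p < length (take k xs)" "take k xs ! p = u" using p' pp by auto
    then show "u \<in> set (take k xs)" by (metis nth_mem)
  qed
  show "u \<in> set (drop (Suc k) xs) \<longleftrightarrow> k < p"
  proof
    assume "u \<in> set (drop (Suc k) xs)"
    then obtain a where "a < length xs - Suc k" "xs ! (Suc k + a) = u" by (auto simp: in_set_conv_nth)
    then show "k < p" using eq[of "Suc k + a"] pp by auto
  next
    assume "k < p"
    then have "p - Suc k < length (drop (Suc k) xs)" "drop (Suc k) xs ! (p - Suc k) = u" using p' pp by auto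
    then show "u \<in> set (drop (Suc k) xs)" by (metis nth_mem)
  qed
qed

context potts_model
begin

lemma nbl_locate:
  fixes u v :: nat
  assumes "finite U" "u \<in> nb U v"
  defines "p \<equiv> card {x \<in> nb U v. x < u}"
  shows "p < length (nbl U v)" "nbl U v ! p = u" "u \<in> set (take k (nbl U v)) \<longleftrightarrow> p < k" "u \<in> set (drop (Suc k) (nbl U v)) \<longleftrightarrow> k < p"
proof -
  have s: "sorted_wrt (<) (nbl U v)" by (simp add: nbl_def)
  have u: "u \<in> set (nbl U v)" using assms set_nbl by simp
  note l = sorted_locate[OF s u, unfolded set_nbl[OF assms(1)], folded p_def]
  show "p < length (nbl U v)" "nbl U v ! p = u" "u \<in> set (take k (nbl U v)) \<longleftrightarrow> p < k" "u \<in> set (drop (Suc k) (nbl U v)) \<longleftrightarrow> k < p"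
    by (fact l)+
qed

lemma child_row:
  fixes u v :: nat
  assumes "finite U"
  defines "p \<equiv> card {x \<in> nb U v. x < u}"
  shows "child U m v k i j u a = m u a + (if u \<in> nb U v \<and> (p < k \<and> a = i \<or> k < p \<and> a = j) then 1 else 0)"
proof (cases "u \<in> nb U v")
  case True
  then show ?thesis using nbl_locate(3,4)[OF assms(1) True] by (auto simp: child_def tilt_def p_def)
next
  case False
  then have "u \<notin> set (take k (nbl U v))" "u \<notin> set (drop (Suc k) (nbl U v))"
    using set_nbl[OF assms(1)] in_set_takeD in_set_dropD by metis+
  then show ?thesis using False by (simp add: child_def tilt_def)
qed

lemma card_less_Suc_nb:
  assumes "finite U"
  shows "card {x \<in> nb U v. x < Suc u} = card {x \<in> nb U v. x < u} + (if u \<in> nb U v then 1 else 0)"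
proof -
  have "{x \<in> nb U v. x < Suc u} = (if u \<in> nb U v then insert u {x \<in> nb U v. x < u} else {x \<in> nb U v. x < u})"
    by (auto simp: less_Suc_eq)
  then show ?thesis using finite_nb[OF assms] by simp
qed

lemma nth_nbl_iff:
  assumes "finite U" "k < length (nbl U v)"
  shows "nbl U v ! k = u \<longleftrightarrow> u \<in> nb U v \<and> card {x \<in> nb U v. x < u} = k"
proof
  assume *: "nbl U v ! k = u"
  then have u: "u \<in> nb U v" using nbl_mem(1)[OF assms] by simp
  then show "u \<in> nb U v \<and> card {x \<in> nb U v. x < u} = k"
    using * nbl_locate(1,2)[OF assms(1) u] nth_eq_iff_index_eq[OF distinct_nbl _ assms(2)] by auto
qed (use nbl_locate(2)[OF assms(1)] in auto)

end

context program
begin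

definition "row_addr base row a = Plus (V base) (Plus (Times (V row) (N (q+1))) a)"

definition "COPY_ROW = For 21 (N (q+1)) (Wr (row_addr 15 20 (V 21)) (Rd (row_addr 14 20 (V 21))))"

definition "PIN c = Wr (row_addr 15 20 (V c)) (Plus (Rd (row_addr 15 20 (V c))) (N 1))"

text \<open>Variable 19 counts the neighbours of the parent's root met so far. Comparison with the number of the child's
  own neighbour (16) tells whether the present vertex gets a pin of the first colour, is the new root, or gets a pin of the second.\<close>

definition "NEIGHBOUR = Seq (IfLe (Plus (V 19) (N 1)) (V 16) (PIN 17) (IfLe (V 19) (V 16) (Asg 33 (V 20)) (PIN 18)))
  (Asg 19 (Plus (V 19) (N 1)))"

definition "ROW = Seq COPY_ROW
  (IfLe (N 1) (Rd (Plus (Times (V 22) (V 0)) (V 20))) (IfLe (N 1) (Rd (row_addr 14 20 (N q))) NEIGHBOUR Skip) Skip)"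

text \<open>Decodes the number of node \<open>y + 1\<close>, where \<open>y\<close> is variable 12, into its parent, neighbour and colours.\<close>

definition "LOCATE = Seq (Asg 14 (Plus (V 9) (Times (Quot (V 12) (N bb)) (V 8))))
  (Seq (Asg 23 (Minus (V 12) (Times (Quot (V 12) (N bb)) (N bb))))
  (Seq (Asg 15 (Plus (V 9) (Times (Plus (V 12) (N 1)) (V 8))))
  (Seq (Asg 16 (Quot (V 23) (N (q*q))))
  (Seq (Asg 23 (Minus (V 23) (Times (V 16) (N (q*q)))))
  (Seq (Asg 17 (Quot (V 23) (N q)))
  (Seq (Asg 18 (Minus (V 23) (Times (V 17) (N q))))
  (Seq (Asg 22 (Rd (root_addr 14)))
  (Seq (Asg 19 (N 0)) (Asg 33 (V 0))))))))))"

definition "NODE = Seq (IfLe (Plus (V 22) (N 1)) (V 0) (Seq (For 20 (V 0) ROW) (Wr (row_addr 15 22 (N q)) (N 0))) Skip)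
  (Seq (Wr (root_addr 15) (V 33)) (Wr (lev_addr 15) (Plus (Rd (lev_addr 14)) (N 1))))"

definition "BUILD = For 12 (Minus (V 7) (N 1)) (Seq LOCATE NODE)"

lemma build_assigned:
  "assigned COPY_ROW = {21}" "assigned NEIGHBOUR = {33, 19}" "assigned ROW = {19, 21, 33}"
  "assigned LOCATE = {14, 15, 16, 17, 18, 19, 22, 23, 33}" "assigned NODE = {19, 20, 21, 33}"
  "assigned BUILD = {12, 14, 15, 16, 17, 18, 19, 20, 21, 22, 23, 33}"
  by (auto simp: COPY_ROW_def NEIGHBOUR_def ROW_def LOCATE_def NODE_def BUILD_def PIN_def)

end

context run
begin

lemma copy_row_correct:
  assumes r: "fst s 14 = B" "fst s 15 = B'" "fst s 20 = u" and B: "B + (u * (q+1) + q) < B'"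
  shows "snd (sem X COPY_ROW s) a = (if B' + u * (q+1) \<le> a \<and> a < B' + u * (q+1) + (q+1) then snd s (a - B' + B) else snd s a)"
    "time X COPY_ROW s \<le> 100 * Q ^ 2"
proof -
  define o' where "o' = u * (q+1)"
  define body where "body = Wr (row_addr 15 20 (V 21)) (Rd (row_addr 14 20 (V 21)))"
  have CR: "COPY_ROW = For 21 (N (q+1)) body" by (simp add: COPY_ROW_def body_def)
  define I where "I c s' \<longleftrightarrow> fst s' 14 = B \<and> fst s' 15 = B' \<and> fst s' 20 = u \<and>
    (\<forall>a. snd s' a = (if B' + o' \<le> a \<and> a < B' + o' + c then snd s (a - B' + B) else snd s a))" for c and s' :: store
  have step: "I (Suc c) (sem X body (put 21 c s')) \<and> time X body (put 21 c s') \<le> 60 * Q ^ 1" if c: "c < q + 1" and I: "I c s'" for c s'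
  proof -
    have "B + (o' + c) < B'" using B c by (simp add: o'_def)
    then have rd: "snd s' (B + (o' + c)) = snd s (B + (o' + c))" using I by (simp add: I_def)
    have sm: "sem X body (put 21 c s') = (fst (put 21 c s'), (snd s')(B' + (o' + c) := snd s (B + (o' + c))))"
      using I rd by (simp add: body_def row_addr_def I_def o'_def)
    have "I (Suc c) (sem X body (put 21 c s'))"
      unfolding sm using I by (auto simp: I_def add_ac)
    moreover have "time X body (put 21 c s') \<le> 60 * Q ^ 1" using Q(1,3) by (simp add: body_def row_addr_def)
    ultimately show ?thesis by blast
  qed
  have I0: "I 0 s" using r by (simp add: I_def)
  have e: "eval (N (q+1)) s = q + 1" by simp
  note lp = for_rule[where I = I and X = X and x = 21 and e = "N (q+1)" and m = "q+1" and s = s, OF I0 step e, folded CR]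
  show "snd (sem X COPY_ROW s) a = (if B' + u * (q+1) \<le> a \<and> a < B' + u * (q+1) + (q+1) then snd s (a - B' + B) else snd s a)"
    using lp(1) by (simp add: I_def o'_def)
  have "time X COPY_ROW s \<le> 1 + 2 + (q+1) * (60 * Q ^ 1 + 6)" using lp(2) by simp
  also have "\<dots> \<le> (60 + 1 + 8) * Q ^ Suc 1" using Q(1,3) by (intro loop_bound) auto
  also have "\<dots> \<le> 100 * Q ^ 2" by (simp add: numeral_eq_Suc)
  finally show "time X COPY_ROW s \<le> 100 * Q ^ 2" .
qed

lemma base_less: "x < y \<Longrightarrow> off < Bsz \<Longrightarrow> base x + off < base y"
proof -
  assume "x < y" "off < Bsz"
  then have "x * Bsz + off < (x + 1) * Bsz" by simp
  also have "\<dots> \<le> y * Bsz" using \<open>x < y\<close> by (intro mult_right_mono) auto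
  finally show ?thesis by (simp add: base_def)
qed

lemma cells_small: "u < n \<Longrightarrow> a \<le> q \<Longrightarrow> u * (q+1) + a < Bsz" "n * (q+1) < Bsz" "n * (q+1) + 1 < Bsz"
  using row_less[of u a] by (auto simp: Bsz_def)

text \<open>The rows below \<open>u\<close> of the new node at \<open>B\<close> are finished, except that the flag of \<open>v\<close> is still set.\<close>

definition rows_done where
  "rows_done h B U m v k i j u \<longleftrightarrow> (\<forall>u'<u. \<forall>a\<le>q. h (B + (u' * (q+1) + a)) = (if a = q then (if u' \<in> U then 1 else 0) else child U m v k i j u' a))"

lemma row_correct:
  assumes env: "env s" and r: "fst s 14 = base x" "fst s 15 = base y" "x < y" "fst s 16 = k" "fst s 17 = i" "fst s 18 = j"
      "fst s 20 = u" "fst s 22 = v" and u: "u < n" and ij: "i < q" "j < q"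
    and inst: "inst_at (snd s) (base x) U m v l" "v < n" "finite U"
    and r19: "fst s 19 = card {x \<in> nb U v. x < u}"
    and r33: "fst s 33 = (if k < length (nbl U v) \<and> nbl U v ! k < u then nbl U v ! k else n)"
    and rows: "rows_done (snd s) (base y) U m v k i j u"
  defines "s' \<equiv> sem X ROW s"
  shows "\<And>a. a < base y \<Longrightarrow> snd s' a = snd s a" "fst s' 19 = card {x \<in> nb U v. x < Suc u}"
    "fst s' 33 = (if k < length (nbl U v) \<and> nbl U v ! k < Suc u then nbl U v ! k else n)"
    "rows_done (snd s') (base y) U m v k i j (Suc u)" "time X ROW s \<le> 250 * Q ^ 2"
proof -
  define p where "p = card {x \<in> nb U v. x < u}"
  define B where "B = base y"
  have cs: "base x + (u * (q+1) + a) < B" if "a \<le> q" for a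
    unfolding B_def by (rule base_less[OF r(3) cells_small(1)[OF u that]])
  have cs': "base x + (u * (q+1) + q) < base y" using cs[of q] by (simp add: B_def)
  define s1 where "s1 = sem X COPY_ROW s"
  have h1: "snd s1 a = (if B + u * (q+1) \<le> a \<and> a < B + u * (q+1) + (q+1) then snd s (a - B + base x) else snd s a)" for a
    unfolding s1_def B_def by (rule copy_row_correct(1)[OF r(1,2,7) cs'])
  have t1: "time X COPY_ROW s \<le> 100 * Q ^ 2" by (rule copy_row_correct(2)[OF r(1,2,7) cs'])
  have f1: "fst s1 z = fst s z" if "z \<noteq> 21" for z unfolding s1_def by (rule sem_unassigned) (use that in \<open>simp add: build_assigned\<close>)
  have low: "snd s1 a = snd s a" if "a < B" for a using that h1 by simp
  have new: "snd s1 (B + (u * (q+1) + a)) = (if a = q then (if u \<in> U then 1 else 0) else m u a)" if "a \<le> q" for a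
  proof -
    have "snd s1 (B + (u * (q+1) + a)) = snd s (base x + (u * (q+1) + a))" using that unfolding h1 by (simp add: add_ac)
    then show ?thesis using inst(1) u that by (auto simp: inst_at_def)
  qed
  have old: "snd s1 (B + (u' * (q+1) + a)) = snd s (B + (u' * (q+1) + a))" if "u' < u" "a \<le> q" for u' a
  proof -
    have "u' * (q+1) + a < (u' + 1) * (q+1)" using that by simp
    also have "\<dots> \<le> u * (q+1)" using that by (intro mult_right_mono) auto
    finally show ?thesis unfolding h1 by simp
  qed
  have AB: "A0 \<le> base x" "A0 \<le> B" using base_ge B_def by auto
  have "env s1" by (rule env_cong[OF env]) (use f1 low AB in auto)
  have adr: "v * n + u < A0"
  proof -
    have "v * n + u < (v + 1) * n" using u by simp
    also have "\<dots> \<le> n * n" using inst(2) by (intro mult_right_mono) auto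
    finally show ?thesis by (simp add: A0_def)
  qed
  have f1r: "fst s1 0 = n" "fst s1 14 = base x" "fst s1 15 = B" "fst s1 16 = k" "fst s1 17 = i" "fst s1 18 = j" "fst s1 19 = p" "fst s1 20 = u" "fst s1 22 = v"
    "fst s1 33 = fst s 33"
    using f1 r r19 env by (auto simp: env_def B_def p_def)
  have adj: "snd s1 (v * n + u) = (if {v, u} \<in> E then 1 else 0)"
    using low[of "v * n + u"] adr AB env u inst(2) by (simp add: env_def)
  have al: "snd s1 (base x + (u * (q+1) + q)) = (if u \<in> U then 1 else 0)"
    using low cs[of q] inst(1) u by (simp add: inst_at_def)
  have al': "snd s1 (base x + (u + u * q + q)) = (if u \<in> U then 1 else 0)" using al by (simp add: add_ac)
  define R where "R = IfLe (N 1) (Rd (Plus (Times (V 22) (V 0)) (V 20))) (IfLe (N 1) (Rd (row_addr 14 20 (N q))) NEIGHBOUR Skip) Skip"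
  have s': "s' = sem X R s1" and tm: "time X ROW s = time X COPY_ROW s + time X R s1"
    by (simp_all add: s'_def ROW_def R_def s1_def)
  have sR: "sem X R s1 = (if u \<in> nb U v then sem X NEIGHBOUR s1 else s1)"
    using f1r adj al al' by (auto simp: R_def row_addr_def nb_def)
  have tR: "time X R s1 \<le> 50 * Q + (if u \<in> nb U v then time X NEIGHBOUR s1 else 0)"
    using f1r adj al al' Q(1,2,3) by (auto simp: R_def row_addr_def nb_def)
  have tN: "time X NEIGHBOUR s1 \<le> 80 * Q"
    using Q(1,3) by (auto simp: NEIGHBOUR_def PIN_def row_addr_def)
  have sN: "sem X NEIGHBOUR s1 = (if p < k then put 19 (p + 1) (fst s1, (snd s1)(B + (u * (q+1) + i) := Suc (snd s1 (B + (u * (q+1) + i)))))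
     else if p = k then put 19 (p + 1) (put 33 u s1) else put 19 (p + 1) (fst s1, (snd s1)(B + (u * (q+1) + j) := Suc (snd s1 (B + (u * (q+1) + j))))))"
    using f1r by (auto simp: NEIGHBOUR_def PIN_def row_addr_def)
  have Q2: "Q \<le> Q ^ 2" using Q(1) by (simp add: power2_eq_square)
  show "time X ROW s \<le> 250 * Q ^ 2" using tm t1 tR tN Q2 by (auto split: if_splits)
  show "snd s' a = snd s a" if "a < base y" for a
    using that low[of a] by (auto simp: s' sR sN B_def[symmetric])
  show "fst s' 19 = card {x \<in> nb U v. x < Suc u}"
    using f1r card_less_Suc_nb[OF inst(3), of v u] by (auto simp: s' sR sN p_def)
  show "fst s' 33 = (if k < length (nbl U v) \<and> nbl U v ! k < Suc u then nbl U v ! k else n)"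
  proof (cases "k < length (nbl U v)")
    case True
    then show ?thesis using nth_nbl_iff[OF inst(3) True, of u] f1r r33 by (auto simp: s' sR sN less_Suc_eq p_def)
  next
    case False
    then have "p \<noteq> k" if "u \<in> nb U v" using nbl_locate(1)[OF inst(3) that] by (auto simp: p_def)
    then show ?thesis using False f1r r33 by (auto simp: s' sR sN)
  qed
  have keep: "snd s' (B + (u' * (q+1) + a)) = snd s1 (B + (u' * (q+1) + a))" if "u' < u" "a \<le> q" for u' a
  proof -
    have "u' * (q+1) + a < (u' + 1) * (q+1)" using that by simp
    also have "\<dots> \<le> u * (q+1)" using that by (intro mult_right_mono) auto
    finally show ?thesis by (auto simp: s' sR sN)
  qed
  have cur: "snd s' (B + (u * (q+1) + a)) = (if a = q then (if u \<in> U then 1 else 0) else child U m v k i j u a)" if "a \<le> q" for a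
    using new[OF that] new[of i] new[of j] ij child_row[OF inst(3), of m v k i j u a] by (auto simp: s' sR sN p_def)
  show "rows_done (snd s') (base y) U m v k i j (Suc u)"
    using rows keep old cur by (auto simp: rows_done_def less_Suc_eq B_def[symmetric])
qed

lemma node_correct:
  assumes env: "env s" and r: "fst s 14 = base x" "fst s 15 = base y" "x < y" "fst s 16 = k" "fst s 17 = i" "fst s 18 = j" and ij: "i < q" "j < q"
    and r22: "fst s 22 = snd s (base x + n * (q+1))" and r19: "fst s 19 = 0" and r33: "fst s 33 = n"
    and par: "enc (snd s) x nd" and D: "k = D div (q*q)" "i = D mod (q*q) div q" "j = D mod (q*q) mod q"
  defines "s' \<equiv> sem X NODE s"
  shows "\<And>a. a < base y \<Longrightarrow> snd s' a = snd s a" "enc (snd s') y (case nd of None \<Rightarrow> None | Some nd \<Rightarrow> kid nd D)"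
    "time X NODE s \<le> 400 * Q ^ 3"
proof -
  define B where "B = base y"
  define C where "C = IfLe (Plus (V 22) (N 1)) (V 0) (Seq (For 20 (V 0) ROW) (Wr (row_addr 15 22 (N q)) (N 0))) Skip"
  define P where "P = Seq (Wr (root_addr 15) (V 33)) (Wr (lev_addr 15) (Plus (Rd (lev_addr 14)) (N 1)))"
  define s1 where "s1 = sem X C s"
  have s': "s' = sem X P s1" and tm: "time X NODE s = time X C s + time X P s1"
    by (simp_all add: s'_def NODE_def C_def P_def s1_def)
  have f1: "fst s1 z = fst s z" if "z \<notin> {19, 20, 21, 33}" for z
    unfolding s1_def by (rule sem_unassigned) (use that in \<open>simp add: C_def build_assigned\<close>)
  have n0: "fst s 0 = n" using env by (simp add: env_def)
  have f1r: "fst s1 0 = n" "fst s1 14 = base x" "fst s1 15 = B" using f1 r n0 by (auto simp: B_def)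
  have lv: "base x + (n * (q+1) + 1) < B" unfolding B_def by (rule base_less[OF r(3) cells_small(3)])
  have sP: "snd s' = (snd s1)(B + n * (q+1) := fst s1 33, B + (n * (q+1) + 1) := snd s1 (base x + (n * (q+1) + 1)) + 1)"
    using f1r lv by (simp add: s' P_def root_addr_def lev_addr_def)
  have tP: "time X P s1 \<le> 60 * Q" using Q(1,3) by (simp add: P_def root_addr_def lev_addr_def)
  have Q3: "Q \<le> Q ^ 3" using Q(1) by (simp add: power_increasing[of 1 3 Q, simplified])
  have *: "(\<forall>a<B. snd s1 a = snd s a) \<and> enc (snd s') y (case nd of None \<Rightarrow> None | Some nd \<Rightarrow> kid nd D) \<and> time X C s \<le> 300 * Q ^ 3"
  proof (cases nd)
    case None
    then have "fst s 22 = n" using par r22 by (simp add: enc_def)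
    then have "s1 = s" "time X C s \<le> 20 * Q" using n0 Q(1) by (auto simp: s1_def C_def)
    then show ?thesis using None r33 sP Q3 by (simp add: enc_def B_def)
  next
    case (Some a)
    obtain U m v l where a: "a = (U, m, v, l)" by (cases a) auto
    have en: "inst_at (snd s) (base x) U m v l" "U \<subseteq> {..<n}" "v \<in> U" "admissible \<Delta> U m"
      using par Some a by (auto simp: enc_def)
    have v: "v < n" "fst s 22 = v" using en r22 by (auto simp: inst_at_def)
    have fU: "finite U" by (rule admissible_finite[OF en(4)])
    define I where "I u t \<longleftrightarrow> env t \<and> (\<forall>z. z \<notin> {19, 20, 21, 33} \<longrightarrow> fst t z = fst s z) \<and> (\<forall>a<B. snd t a = snd s a) \<and>
      fst t 19 = card {x \<in> nb U v. x < u} \<and> fst t 33 = (if k < length (nbl U v) \<and> nbl U v ! k < u then nbl U v ! k else n) \<and>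
      rows_done (snd t) B U m v k i j u" for u t
    have inst_low: "inst_at h (base x) U m v l" if "\<forall>a<B. h a = snd s a" for h
    proof -
      have c: "h (base x + (u * (q+1) + a)) = snd s (base x + (u * (q+1) + a))" if "u < n" "a \<le> q" for u a
        using \<open>\<forall>a<B. h a = snd s a\<close> base_less[OF r(3) cells_small(1)[OF that]] unfolding B_def by blast
      have c': "h (base x + n * (q+1)) = snd s (base x + n * (q+1))" "h (base x + (n * (q+1) + 1)) = snd s (base x + (n * (q+1) + 1))"
        using that base_less[OF r(3) cells_small(2)] lv unfolding B_def by blast+
      show ?thesis unfolding inst_at_def c'
      proof (intro conjI allI impI)
        fix u assume u: "u < n"
        show "h (base x + (u * (q+1) + q)) = (if u \<in> U then 1 else 0)"
          unfolding c[OF u order_refl] using en(1) u unfolding inst_at_def by blast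
        fix a assume a: "a < q"
        show "h (base x + (u * (q+1) + a)) = m u a"
          unfolding c[OF u less_imp_le[OF a]] using en(1) u a unfolding inst_at_def by blast
      qed (use en(1) in \<open>auto simp: inst_at_def\<close>)
    qed
    have step: "I (Suc u) (sem X ROW (put 20 u t)) \<and> time X ROW (put 20 u t) \<le> 250 * Q ^ 2" if u: "u < n" and I: "I u t" for u t
    proof -
      have e: "env (put 20 u t)" using I by (simp add: I_def env_def)
      have rr: "fst (put 20 u t) 14 = base x" "fst (put 20 u t) 15 = base y" "fst (put 20 u t) 16 = k" "fst (put 20 u t) 17 = i"
        "fst (put 20 u t) 18 = j" "fst (put 20 u t) 20 = u" "fst (put 20 u t) 22 = v"
        using I r v by (simp_all add: I_def)
      have ii: "inst_at (snd (put 20 u t)) (base x) U m v l" using I by (simp add: I_def inst_low)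
      have r19': "fst (put 20 u t) 19 = card {x \<in> nb U v. x < u}"
        and r33': "fst (put 20 u t) 33 = (if k < length (nbl U v) \<and> nbl U v ! k < u then nbl U v ! k else n)"
        and rw: "rows_done (snd (put 20 u t)) (base y) U m v k i j u" using I by (simp_all add: I_def B_def)
      note rc = row_correct[OF e rr(1,2) r(3) rr(3-7) u ij ii v(1) fU r19' r33' rw]
      have un: "fst (sem X ROW (put 20 u t)) z = fst s z" if "z \<notin> {19, 20, 21, 33}" for z
      proof -
        have "fst (sem X ROW (put 20 u t)) z = fst (put 20 u t) z" by (rule sem_unassigned) (use that in \<open>simp add: build_assigned\<close>)
        then show ?thesis using I that by (simp add: I_def)
      qed
      have lo: "\<forall>a<B. snd (sem X ROW (put 20 u t)) a = snd s a" using rc(1) I by (simp add: I_def B_def)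
      have "env (sem X ROW (put 20 u t))"
        by (rule env_cong[OF env]) (use un lo base_ge[of y] in \<open>auto simp: B_def\<close>)
      then show ?thesis using rc un lo by (simp add: I_def B_def)
    qed
    have I0: "I 0 s" using env r19 r33 by (simp add: I_def rows_done_def)
    have e0: "eval (V 0) s = n" using n0 by simp
    note lp = for_rule[where I = I and X = X and x = 20 and e = "V 0" and m = n and s = s, OF I0 step e0]
    define s2 where "s2 = sem X (For 20 (V 0) ROW) s"
    have I2: "I n s2" using lp(1) by (simp add: s2_def)
    have "time X (For 20 (V 0) ROW) s \<le> 2 + 2 + n * (250 * Q ^ 2 + 6)" using lp(2) by simp
    also have "\<dots> \<le> (250 + 2 + 8) * Q ^ Suc 2" using Q(1,2) by (intro loop_bound) auto
    finally have tl: "time X (For 20 (V 0) ROW) s \<le> 260 * Q ^ 3" by (simp add: numeral_eq_Suc)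
    have s2r: "fst s2 15 = B" "fst s2 22 = v" using I2 r v by (auto simp: I_def B_def)
    have cond: "eval (Plus (V 22) (N 1)) s \<le> eval (V 0) s" using v n0 by simp
    have s1: "s1 = (fst s2, (snd s2)(B + (v * (q+1) + q) := 0))"
      using cond s2r by (simp add: s1_def C_def s2_def[symmetric] row_addr_def del: sem.simps(7))
    have "time X C s \<le> 40 * Q + time X (For 20 (V 0) ROW) s"
      using cond Q(1,3) by (simp add: C_def row_addr_def del: sem.simps(7) time.simps(7))
    then have tC: "time X C s \<le> 300 * Q ^ 3" using tl Q3 by linarith
    have low: "\<forall>a<B. snd s1 a = snd s a" using I2 by (simp add: s1 I_def)
    have r33e: "fst s1 33 = (if k < length (nbl U v) then nbl U v ! k else n)"
    proof -
      have "nbl U v ! k < n" if "k < length (nbl U v)" using nbl_mem(2)[OF fU that] en(2) by auto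
      then show ?thesis using I2 by (auto simp: s1 I_def)
    qed
    have kd: "kid a D = (if k < length (nbl U v) then Some (U - {v}, child U m v k i j, nbl U v ! k, Suc l) else None)"
      by (simp add: a kid_def Let_def D)
    have en': "enc (snd s') y (kid a D)"
    proof (cases "k < length (nbl U v)")
      case False
      then show ?thesis using kd r33e sP by (simp add: enc_def B_def)
    next
      case True
      have cell: "snd s' (B + (u * (q+1) + a)) = snd s1 (B + (u * (q+1) + a))" if "u < n" "a \<le> q" for u a
        using row_less[OF that] by (simp add: sP)
      have uniq: "u * (q+1) + a = v * (q+1) + q \<longleftrightarrow> u = v \<and> a = q" if "a \<le> q" for u a
      proof
        assume eq: "u * (q+1) + a = v * (q+1) + q"
        have "(u * (q+1) + a) div (q+1) = u + a div (q+1)" "(v * (q+1) + q) div (q+1) = v + q div (q+1)"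
          by (rule div_mult_self3, simp)+
        then have "(u * (q+1) + a) div (q+1) = u" "(v * (q+1) + q) div (q+1) = v" using that by simp_all
        then show "u = v \<and> a = q" using eq by auto
      qed simp
      have "inst_at (snd s') B (U - {v}) (child U m v k i j) (nbl U v ! k) (Suc l)"
        unfolding inst_at_def
      proof (intro conjI allI impI)
        fix u assume u: "u < n"
        show "snd s' (B + (u * (q+1) + q)) = (if u \<in> U - {v} then 1 else 0)"
          using cell[OF u order_refl] I2 uniq[OF order_refl, of u] u by (auto simp: s1 I_def rows_done_def)
        fix a assume a: "a < q"
        show "snd s' (B + (u * (q+1) + a)) = child U m v k i j u a"
          using cell[of u a] I2 uniq[of a u] u a by (auto simp: s1 I_def rows_done_def)
      next
        show "snd s' (B + n * (q+1)) = nbl U v ! k" using r33e True by (simp add: sP)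
        have "snd s1 (base x + (n * (q+1) + 1)) = l" using low lv en(1) by (simp add: inst_at_def)
        then show "snd s' (B + (n * (q+1) + 1)) = Suc l" by (simp add: sP)
      qed
      then show ?thesis using True kd en nbl_mem(2)[OF fU True] admissible_child[OF en(4,3) True, of i j] by (auto simp: enc_def B_def)
    qed
    show ?thesis using low en' tC Some by simp
  qed
  show "snd s' a = snd s a" if "a < base y" for a using * that by (simp add: sP B_def)
  show "enc (snd s') y (case nd of None \<Rightarrow> None | Some nd \<Rightarrow> kid nd D)" using * by blast
  show "time X NODE s \<le> 400 * Q ^ 3" using * tm tP Q3 by linarith
qed

lemma build_correct:
  assumes NN: "0 < NN" "0 < bb" and env: "env s" and enc0: "enc (snd s) 0 (Some nd0)"
  shows "env (sem X BUILD s)" "\<And>y. y < NN \<Longrightarrow> enc (snd (sem X BUILD s)) y (node nd0 y)" "time X BUILD s \<le> 800 * Q ^ 4"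
proof -
  define I where "I y s' \<longleftrightarrow> env s' \<and> (\<forall>y'\<le>y. enc (snd s') y' (node nd0 y'))" for y s'
  have step: "I (Suc y) (sem X (Seq LOCATE NODE) (put 12 y s')) \<and> time X (Seq LOCATE NODE) (put 12 y s') \<le> 750 * Q ^ 3"
    if y: "y < NN - 1" and I: "I y s'" for y s'
  proof -
    define x D where "x = y div bb" and "D = y mod bb"
    have ev: "fst s' 0 = n" "fst s' 9 = A0" "fst s' 8 = Bsz" using I by (auto simp: I_def env_def)
    define s1 where "s1 = sem X LOCATE (put 12 y s')"
    have DD: "y - x * bb = D" by (simp add: x_def D_def minus_div_mult_eq_mod)
    have DQ: "D - D div (q*q) * (q*q) = D mod (q*q)" by (rule minus_div_mult_eq_mod)
    have DR: "D mod (q*q) - D mod (q*q) div q * q = D mod (q*q) mod q" by (rule minus_div_mult_eq_mod)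
    have h1: "snd s1 = snd s'" by (simp add: s1_def LOCATE_def)
    have f1: "fst s1 14 = base x" "fst s1 15 = base (Suc y)" "fst s1 16 = D div (q*q)" "fst s1 17 = D mod (q*q) div q"
      "fst s1 18 = D mod (q*q) mod q" "fst s1 22 = snd s1 (base x + n * (q+1))" "fst s1 19 = 0" "fst s1 33 = n"
      using ev DD DQ DR by (simp_all add: s1_def LOCATE_def root_addr_def x_def[symmetric] base_def h1 del: diff_diff_left)
    have env1: "env s1"
    proof (rule env_cong)
      show "env s'" using I by (simp add: I_def)
      show "fst s1 z = fst s' z" if "z \<in> {0, 3, 4, 7, 8, 9, 10}" for z
        using sem_unassigned[of z LOCATE X "put 12 y s'"] that by (auto simp: build_assigned s1_def)
    qed (simp add: h1)
    have yQ: "y \<le> Q" "x \<le> Q" "D \<le> Q" "D div (q*q) \<le> Q" "D mod (q*q) div q \<le> Q"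
    proof -
      show "y \<le> Q" using y Q(9) by simp
      moreover have "x \<le> y" "D \<le> y" by (simp_all add: x_def D_def)
      moreover have "D div (q*q) \<le> D" "D mod (q*q) div q \<le> D mod (q*q)" "D mod (q*q) \<le> D" by simp_all
      ultimately show "x \<le> Q" "D \<le> Q" "D div (q*q) \<le> Q" "D mod (q*q) div q \<le> Q" by linarith+
    qed
    have tL: "time X LOCATE (put 12 y s') \<le> 300 * Q"
      using ev DD DQ DR yQ Q(1,3,4,5,10) by (simp add: LOCATE_def root_addr_def x_def[symmetric] Bsz_def del: diff_diff_left)
    have xy: "x < Suc y" by (simp add: x_def le_imp_less_Suc)
    have qq: "D mod (q*q) div q < q" "D mod (q*q) mod q < q" using q0 by (auto simp: less_mult_imp_div_less)
    have en1: "enc (snd s1) x (node nd0 x)" using I xy by (simp add: I_def h1)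
    note nc = node_correct[OF env1 f1(1,2) xy f1(3,4,5) qq f1(6,7,8) en1 refl refl refl]
    define s2 where "s2 = sem X NODE s1"
    have low: "snd s2 a = snd s' a" if "a < base (Suc y)" for a using nc(1)[OF that] by (simp add: s2_def h1)
    have "env s2"
    proof (rule env_cong[OF env1])
      show "fst s2 z = fst s1 z" if "z \<in> {0, 3, 4, 7, 8, 9, 10}" for z
        using sem_unassigned[of z NODE X s1] that by (auto simp: build_assigned s2_def)
      show "snd s2 a = snd s1 a" if "a < A0" for a using low[of a] that base_ge[of "Suc y"] by (simp add: h1)
    qed
    moreover have "enc (snd s2) y' (node nd0 y')" if "y' \<le> Suc y" for y'
    proof (cases "y' = Suc y")
      case True
      then show ?thesis using nc(2) unfolding s2_def x_def D_def True node.simps by simp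
    next
      case False
      have "enc (snd s2) y' (node nd0 y') = enc (snd s') y' (node nd0 y')"
      proof (rule enc_cong)
        fix off assume "off < n * (q+1) + 2"
        then show "snd s2 (base y' + off) = snd s' (base y' + off)"
          using that False by (intro low base_less) (auto simp: Bsz_def)
      qed
      then show ?thesis using I that False by (simp add: I_def)
    qed
    moreover have "Q \<le> Q ^ 3" using Q(1) by (simp add: power_increasing[of 1 3 Q, simplified])
    ultimately show ?thesis using nc(3) tL by (simp add: I_def s1_def[symmetric] s2_def[symmetric])
  qed
  have I0: "I 0 s" using env enc0 by (simp add: I_def)
  have e0: "eval (Minus (V 7) (N 1)) s = NN - 1" using env by (simp add: env_def)
  note lp = for_rule[where I = I and X = X and x = 12 and e = "Minus (V 7) (N 1)" and m = "NN - 1" and s = s, OF I0 step e0, folded BUILD_def]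
  show "env (sem X BUILD s)" using lp(1) by (simp add: I_def)
  show "enc (snd (sem X BUILD s)) y (node nd0 y)" if "y < NN" for y using lp(1) that by (simp add: I_def)
  have "time X BUILD s \<le> 4 + 2 + (NN - 1) * (750 * Q ^ 3 + 6)" using lp(2) by simp
  also have "\<dots> \<le> (750 + 4 + 8) * Q ^ Suc 3" using Q(1,9) by (intro loop_bound) auto
  also have "\<dots> \<le> 800 * Q ^ 4" by (simp add: numeral_eq_Suc)
  finally show "time X BUILD s \<le> 800 * Q ^ 4" .
qed

end

section \<open>Initialisation\<close>

text \<open>Variables that the body does not assign may be assumed constant.\<close>

lemma for_frame:
  assumes I0: "I 0 s" and e: "eval e s = m"
    and step: "\<And>i t. i < m \<Longrightarrow> I i t \<Longrightarrow> \<forall>z. z \<noteq> x \<longrightarrow> z \<notin> assigned c \<longrightarrow> fst t z = fst s z \<Longrightarrow>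
      I (Suc i) (sem X c (put x i t)) \<and> time X c (put x i t) \<le> T"
  shows "I m (sem X (For x e c) s) \<and> time X (For x e c) s \<le> etime e s + 2 + m * (T + 6)"
proof -
  define J where "J i t \<longleftrightarrow> I i t \<and> (\<forall>z. z \<noteq> x \<longrightarrow> z \<notin> assigned c \<longrightarrow> fst t z = fst s z)" for i t
  have J0: "J 0 s" using I0 by (simp add: J_def)
  have st: "J (Suc i) (sem X c (put x i t)) \<and> time X c (put x i t) \<le> T" if "i < m" "J i t" for i t
    using step[OF that(1), of t] that(2) sem_unassigned[of _ c X "put x i t"] by (auto simp: J_def)
  have "J m (sem X (For x e c) s)" "time X (For x e c) s \<le> etime e s + 2 + m * (T + 6)"
    by (rule for_rule[where I = J and m = m, OF J0 st e], assumption+)+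
  then show ?thesis by (simp add: J_def)
qed

definition "POW x z y e = For y e (Asg x (Times (V x) (V z)))"

lemma pow_correct:
  assumes "x \<noteq> z" "x \<noteq> y" "z \<noteq> y"
  shows "fst (sem X (POW x z y e) s) x = fst s x * fst s z ^ eval e s"
    "time X (POW x z y e) s \<le> etime e s + 2 + eval e s * (4 * fst s z + 17)"
proof -
  define I where "I i t \<longleftrightarrow> fst t x = fst s x * fst s z ^ i \<and> fst t z = fst s z" for i and t :: store
  have I0: "I 0 s" by (simp add: I_def)
  have st: "I (Suc i) (sem X (Asg x (Times (V x) (V z))) (put y i t)) \<and> time X (Asg x (Times (V x) (V z))) (put y i t) \<le> 4 * fst s z + 11" if "I i t" for i t
    using that assms by (simp add: I_def)
  note lp = for_rule[where I = I and x = y and e = e and m = "eval e s" and X = X, OF I0 st refl, folded POW_def]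
  show "fst (sem X (POW x z y e) s) x = fst s x * fst s z ^ eval e s" using lp(1) by (simp add: I_def)
  show "time X (POW x z y e) s \<le> etime e s + 2 + eval e s * (4 * fst s z + 17)" using lp(2) by (simp add: add_ac)
qed

lemma pow_assigned: "assigned (POW x z y e) = {x, y}" "no_write (POW x z y e)" by (auto simp: POW_def)

context program
begin

text \<open>The following programs determine \<open>M\<close>, then \<open>W\<close> as the largest number with \<open>W \<le> w M\<close>, and then the largest power of
  \<open>bb + 1\<close> that is at most \<open>M\<close> together with its exponent.\<close>

definition "SCALE K = Seq (Asg 2 (Times (V 0) (N K))) (Seq (Asg 3 (Plus (V 2) (N K))) (Grow 2))"
definition "WEIGHT = For 12 (Plus (V 3) (N 1)) (IfW (V 12) (V 3) (Asg 4 (V 12)) Skip)"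
definition "DEPTH = Seq (Asg 5 (N 1)) (For 12 (V 3) (IfLe (Times (V 5) (N (bb+1))) (V 3)
   (Seq (Asg 5 (Times (V 5) (N (bb+1)))) (Asg 6 (Plus (V 6) (N 1)))) Skip))"
definition "LAYOUT c0 = Seq (Asg 7 (N (bb+1))) (Seq (POW 7 5 12 (N (2*c0))) (Seq (Asg 10 (Plus (Times (V 6) (N (2*c0))) (N 1)))
   (Seq (Asg 8 (Plus (Plus (Times (V 0) (N (q+1))) (N 2)) (N (q*q)))) (Asg 9 (Plus (Plus (Times (V 0) (V 0)) (N \<Delta>)) (N 1))))))"
definition "POWERS = For 12 (N (\<Delta>+1)) (Seq (Asg 28 (N 1)) (Seq (POW 28 4 27 (V 12)) (Seq (POW 28 3 27 (Minus (N \<Delta>) (V 12)))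
   (Wr (Plus (Times (V 0) (V 0)) (V 12)) (V 28)))))"
definition "ALIVE = For 20 (V 0) (Wr (row_addr 9 20 (N q)) (N 1))"
definition "INIT K c0 = Seq (SCALE K) (Seq WEIGHT (Seq DEPTH (Seq (LAYOUT c0) (Seq POWERS (Seq ALIVE (Seq (Asg 31 (N 1)) (Asg 32 (N 1))))))))"

definition "ROOT_SUM = Seq (Asg 28 (N 0)) (For 27 (N q) (Asg 28 (Plus (V 28)
   (Times (Rd (Plus (Times (V 0) (V 0)) (Rd (row_addr 9 11 (V 27))))) (Rd (val_addr 9 (Times (V 27) (N q))))))))"
definition "PIN_ROOT = Seq (Wr (row_addr 9 11 (N q)) (N 0))
  (For 20 (V 0) (IfLe (N 1) (Rd (Plus (Times (V 11) (V 0)) (V 20))) (IfLe (N 1) (Rd (row_addr 9 20 (N q)))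
     (Wr (row_addr 9 20 (N 0)) (Plus (Rd (row_addr 9 20 (N 0))) (N 1))) Skip) Skip))"
definition "VERTEX = Seq (Wr (root_addr 9) (V 11)) (Seq BUILD (Seq EVAL (Seq ROOT_SUM
  (Seq (Asg 31 (Times (V 31) (V 28))) (Seq (POW 32 3 27 (N (\<Delta>+1))) PIN_ROOT)))))"
definition "MAIN K c0 = Seq (INIT K c0) (Seq (For 11 (V 0) VERTEX) (Seq (Asg 0 (V 31)) (Asg 1 (V 32))))"

lemma init_assigned: "assigned (SCALE K) = {2, 3}" "no_write (SCALE K)" "assigned WEIGHT = {12, 4}" "no_write WEIGHT"
  "assigned DEPTH = {5, 6, 12}" "no_write DEPTH" "assigned (LAYOUT c0) = {7, 8, 9, 10, 12}" "no_write (LAYOUT c0)"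
  "assigned POWERS = {12, 28, 27}" "assigned ALIVE = {20}"
  by (auto simp: SCALE_def WEIGHT_def DEPTH_def LAYOUT_def POWERS_def ALIVE_def pow_assigned)

lemma eval_assigned: "assigned EVAL = {12, 13, 15, 40, 17, 18, 24, 25, 14, 16, 22, 27, 28, 29, 30, 35, 36, 37, 38, 39}"
  by (auto simp: EVAL_def VALUE_def FACTOR_def SIDE_def)

lemma root_assigned: "assigned ROOT_SUM = {28, 27}" "no_write ROOT_SUM" "assigned PIN_ROOT = {20}"
  by (auto simp: ROOT_SUM_def PIN_ROOT_def)

end

context run
begin

lemma init_correct:
  assumes s0: "fst s = (\<lambda>_. 0)(0 := n)" "snd s = (\<lambda>a. if a < n * n \<and> {a div n, a mod n} \<in> E then 1 else 0)"
    and K: "K \<le> Q" "2 * c0 \<le> Q" and Md: "M = grown X (n * K) (n * K + K)" "n * K + K \<le> M"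
    and Wd: "\<And>y. real y \<le> X Weight * real M \<longleftrightarrow> y \<le> W"
    and td: "(bb + 1) ^ t \<le> M" "M < (bb + 1) ^ Suc t" "0 < bb" and dd: "d = 2 * c0 * t + 1" "NN = (bb + 1) ^ d"
  defines "s' \<equiv> sem X (INIT K c0) s"
  shows "env s'" "\<And>u a. u < n \<Longrightarrow> a \<le> q \<Longrightarrow> snd s' (base 0 + (u * (q+1) + a)) = (if a = q then 1 else 0)"
    "snd s' (base 0 + (n * (q+1) + 1)) = 0" "fst s' 31 = 1" "fst s' 32 = 1" "time X (INIT K c0) s \<le> 500 * Q ^ 3"
proof -
  define s1 where "s1 = sem X (SCALE K) s"
  define s2 where "s2 = sem X WEIGHT s1"
  define s3 where "s3 = sem X DEPTH s2"
  define s4 where "s4 = sem X (LAYOUT c0) s3"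
  define s5 where "s5 = sem X POWERS s4"
  define s6 where "s6 = sem X ALIVE s5"
  have s': "s' = put 32 1 (put 31 1 s6)"
    by (simp add: s'_def INIT_def s1_def s2_def s3_def s4_def s5_def s6_def)
  have tm: "time X (INIT K c0) s = time X (SCALE K) s + (time X WEIGHT s1 + (time X DEPTH s2 + (time X (LAYOUT c0) s3 + (time X POWERS s4 + (time X ALIVE s5 + 6)))))"
    by (simp add: INIT_def s1_def s2_def s3_def s4_def s5_def s6_def)
  have un1: "fst s1 z = fst s z" if "z \<notin> {2, 3}" for z unfolding s1_def by (rule sem_unassigned) (use that in \<open>simp add: init_assigned\<close>)
  have un2: "fst s2 z = fst s1 z" if "z \<notin> {12, 4}" for z unfolding s2_def by (rule sem_unassigned) (use that in \<open>simp add: init_assigned\<close>)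
  have un3: "fst s3 z = fst s2 z" if "z \<notin> {5, 6, 12}" for z unfolding s3_def by (rule sem_unassigned) (use that in \<open>simp add: init_assigned\<close>)
  have un4: "fst s4 z = fst s3 z" if "z \<notin> {7, 8, 9, 10, 12}" for z unfolding s4_def by (rule sem_unassigned) (use that in \<open>simp add: init_assigned\<close>)
  have un5: "fst s5 z = fst s4 z" if "z \<notin> {12, 28, 27}" for z unfolding s5_def by (rule sem_unassigned) (use that in \<open>simp add: init_assigned\<close>)
  have un6: "fst s6 z = fst s5 z" if "z \<notin> {20}" for z unfolding s6_def by (rule sem_unassigned) (use that in \<open>simp add: init_assigned\<close>)
  have h4: "snd s4 = snd s"
    unfolding s4_def s3_def s2_def s1_def by (simp add: sem_no_write init_assigned)
  have r1: "fst s1 0 = n" "fst s1 3 = M" "fst s1 4 = 0" "fst s1 6 = 0" using s0 un1 by (auto simp: s1_def SCALE_def Md(1))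
  have t1: "time X (SCALE K) s \<le> 60 * Q" using s0 Md K Q(1,8) by (simp add: SCALE_def)
  have QQ: "Q \<le> Q ^ 2" "Q \<le> Q ^ 3" "Q ^ 2 \<le> Q ^ 3" using Q(1) by (simp_all add: power_increasing[of 1 2 Q, simplified] power_increasing[of 1 3 Q, simplified] power_increasing[of 2 3 Q, simplified])
  have pows: "Q ^ Suc 1 = Q ^ 2" "Q ^ Suc 2 = Q ^ 3" by (simp_all add: numeral_eq_Suc)
  define I1 where "I1 i t' \<longleftrightarrow> fst t' 4 = min (i - 1) W" for i and t' :: store
  have st1: "I1 (Suc i) (sem X (IfW (V 12) (V 3) (Asg 4 (V 12)) Skip) (put 12 i t')) \<and> time X (IfW (V 12) (V 3) (Asg 4 (V 12)) Skip) (put 12 i t') \<le> 20 * Q ^ 1"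
    if "I1 i t'" "\<forall>z. z \<noteq> 12 \<longrightarrow> z \<notin> assigned (IfW (V 12) (V 3) (Asg 4 (V 12)) Skip) \<longrightarrow> fst t' z = fst s1 z" for i t'
  proof -
    have "fst t' 3 = M" using that(2)[rule_format, of 3] r1 by simp
    then show ?thesis using that(1) Wd[of i] Q(1) by (auto simp: I1_def)
  qed
  have i1: "I1 0 s1" using r1 by (simp add: I1_def)
  have e1: "eval (Plus (V 3) (N 1)) s1 = M + 1" using r1 by simp
  have "I1 (M + 1) s2 \<and> time X WEIGHT s1 \<le> etime (Plus (V 3) (N 1)) s1 + 2 + (M + 1) * (20 * Q ^ 1 + 6)"
    unfolding s2_def WEIGHT_def by (rule for_frame[where I = I1, OF i1 e1]) (rule st1, assumption+)
  then have W2: "fst s2 4 = W" and "time X WEIGHT s1 \<le> 6 + (M + 1) * (20 * Q ^ 1 + 6)" using WM by (auto simp: I1_def)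
  moreover have "4 + 2 + M * (20 * Q ^ 1 + 6) \<le> (20 + 4 + 8) * Q ^ Suc 1" using Q(1,8) by (intro loop_bound) auto
  ultimately have "time X WEIGHT s1 \<le> 32 * Q ^ 2 + 20 * Q + 8" unfolding pows distrib_right by simp
  then have t2: "time X WEIGHT s1 \<le> 60 * Q ^ 2" using QQ Q(1) by linarith
  have r2: "fst s2 3 = M" "fst s2 6 = 0" "fst s2 0 = n" using un2 r1 by auto
  define I2 where "I2 i t' \<longleftrightarrow> fst t' 6 = min i t \<and> fst t' 5 = (bb + 1) ^ min i t" for i and t' :: store
  define D where "D = IfLe (Times (V 5) (N (bb+1))) (V 3) (Seq (Asg 5 (Times (V 5) (N (bb+1)))) (Asg 6 (Plus (V 6) (N 1)))) Skip"
  have "I2 M s3 \<and> time X DEPTH s2 \<le> 3 + (etime (V 3) (put 5 1 s2) + 2 + M * (60 * Q ^ 1 + 6))"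
  proof -
    have st: "I2 (Suc i) (sem X D (put 12 i t')) \<and> time X D (put 12 i t') \<le> 60 * Q ^ 1"
      if I: "I2 i t'" and fr: "\<forall>z. z \<noteq> 12 \<longrightarrow> z \<notin> assigned D \<longrightarrow> fst t' z = fst (put 5 1 s2) z" for i t'
    proof -
      have r: "fst t' 3 = M" "fst t' 5 = (bb + 1) ^ min i t" "fst t' 6 = min i t" using fr[rule_format, of 3] r2 I by (simp_all add: D_def I2_def)
      have "i < t \<longleftrightarrow> (bb + 1) ^ Suc (min i t) \<le> M"
      proof
        assume "i < t"
        then have "(bb + 1) ^ Suc (min i t) \<le> (bb + 1) ^ t" by (intro power_increasing) auto
        then show "(bb + 1) ^ Suc (min i t) \<le> M" using td by linarith
      next
        assume a: "(bb + 1) ^ Suc (min i t) \<le> M"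
        show "i < t"
        proof (rule ccontr)
          assume "\<not> i < t"
          then have "min i t = t" by simp
          then show False using a td by simp
        qed
      qed
      moreover have "eval (Times (V 5) (N (bb+1))) (put 12 i t') = (bb + 1) ^ Suc (min i t)" "eval (V 3) (put 12 i t') = M"
        using r(1,2) by (simp_all only: eval.simps put_simps power_Suc mult.commute) simp_all
      ultimately have c: "eval (Times (V 5) (N (bb+1))) (put 12 i t') \<le> eval (V 3) (put 12 i t') \<longleftrightarrow> i < t" by (simp only:)
      have tt: "time X D (put 12 i t') \<le> 60 * Q" using Q(1,5) by (auto simp: D_def)
      show ?thesis
      proof (cases "i < t")
        case True
        then have "eval (Times (V 5) (N (bb+1))) (put 12 i t') \<le> eval (V 3) (put 12 i t')" using c by blast
        then have "sem X D (put 12 i t') = sem X (Seq (Asg 5 (Times (V 5) (N (bb+1)))) (Asg 6 (Plus (V 6) (N 1)))) (put 12 i t')"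
          unfolding D_def sem.simps(5) by (simp only: if_True)
        moreover have "min i t = i" using True by simp
        ultimately have "sem X D (put 12 i t') = put 6 (Suc i) (put 5 ((bb + 1) ^ Suc i) (put 12 i t'))"
          using r(2,3) by (simp add: algebra_simps)
        then show ?thesis using True tt by (simp add: I2_def)
      next
        case False
        then have "sem X D (put 12 i t') = put 12 i t'" using c unfolding D_def sem.simps by (simp only: if_False)
        then show ?thesis using False tt I by (simp add: I2_def)
      qed
    qed
    have i2: "I2 0 (put 5 1 s2)" using r2 by (simp add: I2_def)
    have e2: "eval (V 3) (put 5 1 s2) = M" using r2 by simp
    have "I2 M (sem X (For 12 (V 3) D) (put 5 1 s2)) \<and> time X (For 12 (V 3) D) (put 5 1 s2) \<le> etime (V 3) (put 5 1 s2) + 2 + M * (60 * Q ^ 1 + 6)"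
      by (rule for_frame[where I = I2, OF i2 e2]) (rule st, assumption+)
    moreover have "s3 = sem X (For 12 (V 3) D) (put 5 1 s2)" "time X DEPTH s2 = 3 + time X (For 12 (V 3) D) (put 5 1 s2)"
      unfolding s3_def DEPTH_def D_def[symmetric] by simp_all
    ultimately show ?thesis by simp
  qed
  moreover have "2 + 2 + M * (60 * Q ^ 1 + 6) \<le> (60 + 2 + 8) * Q ^ Suc 1" using Q(1,8) by (intro loop_bound) auto
  ultimately have t3: "time X DEPTH s2 \<le> 80 * Q ^ 2" and I3: "I2 M s3" using QQ Q(1) unfolding pows by (simp_all add: pows)
  have tM: "t \<le> M"
  proof -
    have "t < 2 ^ t" by (rule less_exp)
    also have "(2::nat) ^ t \<le> (bb + 1) ^ t" using td(3) by (intro power_mono) auto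
    finally show ?thesis using td(1) by simp
  qed
  then have r3: "fst s3 6 = t" "fst s3 5 = (bb + 1) ^ t" "fst s3 0 = n" "fst s3 3 = M" "fst s3 4 = W" using I3 un3 r2 W2 by (auto simp: I2_def)
  define s7 where "s7 = sem X (POW 7 5 12 (N (2*c0))) (put 7 (bb + 1) s3)"
  have "fst s7 7 = (bb + 1) * ((bb + 1) ^ t) ^ (2 * c0)" using r3 pow_correct(1)[of 7 5 12 X "N (2*c0)" "put 7 (bb + 1) s3"] by (simp add: s7_def)
  also have "\<dots> = NN" unfolding dd by (simp add: power_mult[symmetric] mult_ac)
  finally have N7: "fst s7 7 = NN" .
  have un7: "fst s7 z = fst s3 z" if "z \<notin> {7, 12}" for z
    using sem_unassigned[of z "POW 7 5 12 (N (2*c0))" X "put 7 (bb + 1) s3"] that by (simp add: s7_def pow_assigned)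
  have s4: "s4 = put 9 (n * n + \<Delta> + 1) (put 8 Bsz (put 10 d s7))"
    unfolding s4_def LAYOUT_def sem.simps eval.simps s7_def[symmetric]
    using un7 r3 by (simp add: Bsz_def dd(1) mult_ac)
  have "time X (POW 7 5 12 (N (2*c0))) (put 7 (bb + 1) s3) \<le> 1 + 2 + 2 * c0 * (4 * (bb + 1) ^ t + 17)"
    using pow_correct(2)[of 7 5 12 X "N (2*c0)" "put 7 (bb + 1) s3"] r3 by simp
  moreover have "2 * c0 * (4 * (bb + 1) ^ t + 17) \<le> 2 * c0 * (4 * M + 17)" using td(1) by (intro mult_left_mono) auto
  ultimately have tP: "time X (POW 7 5 12 (N (2*c0))) (put 7 (bb + 1) s3) \<le> 1 + 2 + 2 * c0 * (4 * M + 17)" by linarith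
  have "2 * c0 * (4 * M + 17) \<le> Q * (21 * Q)" using K Q(1,8) by (intro mult_mono) auto
  then have "time X (POW 7 5 12 (N (2*c0))) (put 7 (bb + 1) s3) \<le> 3 + 21 * Q ^ 2" using tP by (simp add: power2_eq_square)
  moreover have "time X (LAYOUT c0) s3 \<le> 60 * Q + time X (POW 7 5 12 (N (2*c0))) (put 7 (bb + 1) s3)"
    unfolding LAYOUT_def time.simps sem.simps eval.simps s7_def[symmetric] using un7 r3 K Q(1,2,3) by simp
  ultimately have t4: "time X (LAYOUT c0) s3 \<le> 100 * Q ^ 2" using QQ Q(1) by simp
  have r4: "fst s4 0 = n" "fst s4 3 = M" "fst s4 4 = W" "fst s4 7 = NN" "fst s4 8 = Bsz" "fst s4 9 = A0" "fst s4 10 = d"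
    using un7 r3 N7 by (simp_all add: s4 A0_def)
  define I5 where "I5 k t' \<longleftrightarrow> (\<forall>a. snd t' a = (if n * n \<le> a \<and> a < n * n + k then W ^ (a - n * n) * M ^ (\<Delta> - (a - n * n)) else snd s a))" for k and t' :: store
  define P where "P = Seq (Asg 28 (N 1)) (Seq (POW 28 4 27 (V 12)) (Seq (POW 28 3 27 (Minus (N \<Delta>) (V 12)))
     (Wr (Plus (Times (V 0) (V 0)) (V 12)) (V 28))))"
  have aP: "assigned P = {28, 27}" by (auto simp: P_def pow_assigned)
  have "I5 (\<Delta> + 1) s5 \<and> time X POWERS s4 \<le> etime (N (\<Delta>+1)) s4 + 2 + (\<Delta> + 1) * (80 * Q ^ 2 + 6)"
  proof -
    have st: "I5 (Suc k) (sem X P (put 12 k t')) \<and> time X P (put 12 k t') \<le> 80 * Q ^ 2"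
      if k: "k < \<Delta> + 1" and I: "I5 k t'" and fr: "\<forall>z. z \<noteq> 12 \<longrightarrow> z \<notin> assigned P \<longrightarrow> fst t' z = fst s4 z" for k t'
    proof -
      define t1 where "t1 = put 28 1 (put 12 k t')"
      define t2 where "t2 = sem X (POW 28 4 27 (V 12)) t1"
      define t3 where "t3 = sem X (POW 28 3 27 (Minus (N \<Delta>) (V 12))) t2"
      have r: "fst t' 0 = n" "fst t' 3 = M" "fst t' 4 = W" using fr[rule_format, of 0] fr[rule_format, of 3] fr[rule_format, of 4] r4 by (simp_all add: aP)
      have u2: "fst t2 z = fst t1 z" if "z \<notin> {28, 27}" for z unfolding t2_def by (rule sem_unassigned) (use that in \<open>simp add: pow_assigned\<close>)
      have u3: "fst t3 z = fst t2 z" if "z \<notin> {28, 27}" for z unfolding t3_def by (rule sem_unassigned) (use that in \<open>simp add: pow_assigned\<close>)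
      have h3: "snd t3 = snd t'" unfolding t3_def t2_def t1_def by (simp add: sem_no_write pow_assigned)
      have v2: "fst t2 28 = W ^ k" using pow_correct(1)[of 28 4 27 X "V 12" t1] r by (simp add: t2_def t1_def)
      have v3: "fst t3 28 = W ^ k * M ^ (\<Delta> - k)" using pow_correct(1)[of 28 3 27 X "Minus (N \<Delta>) (V 12)" t2] r v2 u2 by (simp add: t3_def t1_def)
      have rt3: "fst t3 0 = n" "fst t3 12 = k" using u3 u2 r by (simp_all add: t1_def)
      have sm: "sem X P (put 12 k t') = (fst t3, (snd t')(n * n + k := W ^ k * M ^ (\<Delta> - k)))"
        unfolding P_def sem.simps eval.simps t1_def[symmetric] t2_def[symmetric] t3_def[symmetric] using rt3 v3 h3 by simp
      have "time X (POW 28 4 27 (V 12)) t1 \<le> 4 + k * (4 * W + 17)" using pow_correct(2)[of 28 4 27 X "V 12" t1] r by (simp add: t1_def)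
      also have "k * (4 * W + 17) \<le> Q * (21 * Q)" using k WM Q(1,6,8) by (intro mult_mono) auto
      finally have a: "time X (POW 28 4 27 (V 12)) t1 \<le> 4 + 21 * Q ^ 2" by (simp add: power2_eq_square)
      have "time X (POW 28 3 27 (Minus (N \<Delta>) (V 12))) t2 \<le> 6 + (\<Delta> - k) * (4 * M + 17)"
        using pow_correct(2)[of 28 3 27 X "Minus (N \<Delta>) (V 12)" t2] r u2 by (simp add: t1_def)
      also have "(\<Delta> - k) * (4 * M + 17) \<le> Q * (21 * Q)" using Q(1,6,8) by (intro mult_mono) auto
      finally have b: "time X (POW 28 3 27 (Minus (N \<Delta>) (V 12))) t2 \<le> 6 + 21 * Q ^ 2" by (simp add: power2_eq_square)
      have "time X P (put 12 k t') = 3 + (time X (POW 28 4 27 (V 12)) t1 + (time X (POW 28 3 27 (Minus (N \<Delta>) (V 12))) t2 + (15 + 4 * n)))"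
        unfolding P_def time.simps sem.simps eval.simps t1_def[symmetric] t2_def[symmetric] t3_def[symmetric] using rt3 by simp
      then have "time X P (put 12 k t') \<le> 80 * Q ^ 2" using a b Q(1,2) QQ by linarith
      moreover have "I5 (Suc k) (sem X P (put 12 k t'))" using I unfolding sm by (auto simp: I5_def less_Suc_eq)
      ultimately show ?thesis by blast
    qed
    have i0: "I5 0 s4" by (simp add: I5_def h4)
    have e5: "eval (N (\<Delta>+1)) s4 = \<Delta> + 1" by simp
    show ?thesis
      unfolding s5_def POWERS_def P_def[symmetric] by (rule for_frame[where I = I5, OF i0 e5]) (rule st, assumption+)
  qed
  moreover have "1 + 2 + (\<Delta> + 1) * (80 * Q ^ 2 + 6) \<le> (80 + 1 + 8) * Q ^ Suc 2" using Q(1,6) by (intro loop_bound) auto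
  ultimately have I5: "I5 (\<Delta> + 1) s5" and t5: "time X POWERS s4 \<le> 90 * Q ^ 3" unfolding pows by simp_all
  have h5: "snd s5 a = (if n * n \<le> a \<and> a < A0 then W ^ (a - n * n) * M ^ (\<Delta> - (a - n * n)) else snd s a)" for a
    using I5 by (simp add: I5_def A0_def)
  define I6 where "I6 u t' \<longleftrightarrow> (\<forall>a<A0. snd t' a = snd s5 a) \<and> (\<forall>a\<ge>A0. snd t' a = (if \<exists>u'<u. a = A0 + (u' * (q+1) + q) then 1 else 0))" for u and t' :: store
  have "I6 n s6 \<and> time X ALIVE s5 \<le> etime (V 0) s5 + 2 + n * (30 * Q ^ 1 + 6)"
  proof -
    have st: "I6 (Suc u) (sem X (Wr (row_addr 9 20 (N q)) (N 1)) (put 20 u t')) \<and> time X (Wr (row_addr 9 20 (N q)) (N 1)) (put 20 u t') \<le> 30 * Q ^ 1"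
      if u: "u < n" and I: "I6 u t'" and fr: "\<forall>z. z \<noteq> 20 \<longrightarrow> z \<notin> assigned (Wr (row_addr 9 20 (N q)) (N 1)) \<longrightarrow> fst t' z = fst s5 z" for u t'
    proof -
      have "fst t' 9 = A0" using fr[rule_format, of 9] un5 r4 by simp
      then have "snd (sem X (Wr (row_addr 9 20 (N q)) (N 1)) (put 20 u t')) = (snd t')(A0 + (u * (q+1) + q) := 1)" by (simp add: row_addr_def)
      then have "I6 (Suc u) (sem X (Wr (row_addr 9 20 (N q)) (N 1)) (put 20 u t'))" using I unfolding I6_def by (auto simp: less_Suc_eq)
      moreover have "time X (Wr (row_addr 9 20 (N q)) (N 1)) (put 20 u t') \<le> 30 * Q ^ 1" using Q(1,3) by (simp add: row_addr_def)
      ultimately show ?thesis by blast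
    qed
    have "snd s5 a = 0" if "A0 \<le> a" for a using that h5[of a] s0(2) by (simp add: A0_def)
    then have i0: "I6 0 s5" by (simp add: I6_def)
    have e6: "eval (V 0) s5 = n" using un5 r4 by simp
    show ?thesis
      unfolding s6_def ALIVE_def by (rule for_frame[where I = I6, OF i0 e6]) (rule st, assumption+)
  qed
  moreover have "2 + 2 + n * (30 * Q ^ 1 + 6) \<le> (30 + 2 + 8) * Q ^ Suc 1" using Q(1,2) by (intro loop_bound) auto
  ultimately have I6: "I6 n s6" and t6: "time X ALIVE s5 \<le> 40 * Q ^ 2" unfolding pows by simp_all
  have lowh: "snd s6 a = snd s5 a" if "a < A0" for a using I6 that by (simp add: I6_def)
  show "env s'"
  proof -
    have r: "fst s' 0 = n" "fst s' 3 = M" "fst s' 4 = W" "fst s' 7 = NN" "fst s' 8 = Bsz" "fst s' 9 = A0" "fst s' 10 = d"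
      using un6 un5 r4 by (auto simp: s')
    have adj: "snd s' (u * n + v) = (if {u, v} \<in> E then 1 else 0)" if "u < n" "v < n" for u v
    proof -
      have "u * n + v < (u + 1) * n" using that by simp
      also have "\<dots> \<le> n * n" using that by (intro mult_right_mono) auto
      finally have l: "u * n + v < n * n" .
      have "(u * n + v) div n = u + v div n" "(u * n + v) mod n = v mod n" using that by (auto intro: div_mult_self3)
      then have "snd s (u * n + v) = (if {u, v} \<in> E then 1 else 0)" using that l by (simp add: s0(2))
      then show ?thesis using l lowh[of "u * n + v"] h5[of "u * n + v"] by (simp add: s' A0_def)
    qed
    have tab: "snd s' (n * n + k) = W ^ k * M ^ (\<Delta> - k)" if "k \<le> \<Delta>" for k
      using that lowh[of "n * n + k"] h5[of "n * n + k"] by (simp add: s' A0_def)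
    show ?thesis using r adj tab by (simp add: env_def)
  qed
  have b0: "base 0 = A0" by (simp add: base_def)
  show "snd s' (base 0 + (u * (q+1) + a)) = (if a = q then 1 else 0)" if "u < n" "a \<le> q" for u a
  proof -
    have "(\<exists>u'<n. A0 + (u * (q+1) + a) = A0 + (u' * (q+1) + q)) \<longleftrightarrow> a = q"
    proof
      assume "\<exists>u'<n. A0 + (u * (q+1) + a) = A0 + (u' * (q+1) + q)"
      then obtain u' where eq: "u * (q+1) + a = u' * (q+1) + q" by auto
      have "(u * (q+1) + a) mod (q+1) = a mod (q+1)" "(u' * (q+1) + q) mod (q+1) = q mod (q+1)" by (rule mod_mult_self3)+
      then show "a = q" using eq that by simp
    qed (use that in auto)
    then show ?thesis using I6 unfolding I6_def by (simp only: s' put_simps b0 le_add1)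
  qed
  show "snd s' (base 0 + (n * (q+1) + 1)) = 0"
  proof -
    have "\<not> (\<exists>u'<n. A0 + (n * (q+1) + 1) = A0 + (u' * (q+1) + q))" using row_less[of _ q] by force
    then show ?thesis using I6 unfolding I6_def by (simp only: s' put_simps b0 le_add1 if_False)
  qed
  show "fst s' 31 = 1" "fst s' 32 = 1" by (simp_all add: s')
  show "time X (INIT K c0) s \<le> 500 * Q ^ 3" using tm t1 t2 t3 t4 t5 t6 QQ Q(1) by linarith
qed

end

section \<open>The loop over the vertices\<close>

context run
begin

text \<open>Node \<open>0\<close> is the instance left after removing the vertices below \<open>v\<close>, but for the choice of its root.\<close>

definition todo :: "(nat \<Rightarrow> nat) \<Rightarrow> nat \<Rightarrow> bool" where
  "todo h v \<longleftrightarrow> (\<forall>u<n. h (base 0 + (u * (q+1) + q)) = (if v \<le> u then 1 else 0)) \<and>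
     (\<forall>u<n. \<forall>a<q. h (base 0 + (u * (q+1) + a)) = chain n v u a) \<and> h (base 0 + (n * (q+1) + 1)) = 0"

lemma cell_eq: "a \<le> q \<Longrightarrow> a' \<le> q \<Longrightarrow> u * (q+1) + a = u' * (q+1) + a' \<longleftrightarrow> u = u' \<and> a = a'"
proof
  assume a: "a \<le> q" "a' \<le> q" and eq: "u * (q+1) + a = u' * (q+1) + a'"
  have "(u * (q+1) + a) div (q+1) = u + a div (q+1)" "(u' * (q+1) + a') div (q+1) = u' + a' div (q+1)"
    by (rule div_mult_self3, simp)+
  then show "u = u' \<and> a = a'" using eq a by auto
qed simp

lemma adj_small: "u < n \<Longrightarrow> v < n \<Longrightarrow> v * n + u < A0"
proof -
  assume "u < n" "v < n"
  then have "v * n + u < (v + 1) * n" by simp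
  also have "\<dots> \<le> n * n" using \<open>v < n\<close> by (intro mult_right_mono) auto
  finally show ?thesis by (simp add: A0_def)
qed

lemma pin_root_correct:
  assumes env: "env s" and v: "fst s 11 = v" "v < n" and inst: "inst_at (snd s) (base 0) {v..<n} (chain n v) v 0"
  defines "s' \<equiv> sem X PIN_ROOT s"
  shows "env s'" "todo (snd s') (Suc v)" "time X PIN_ROOT s \<le> 300 * Q ^ 2"
proof -
  define B where "B = base 0"
  have b0: "B = A0" by (simp add: B_def base_def)
  define c where "c = IfLe (N 1) (Rd (Plus (Times (V 11) (V 0)) (V 20))) (IfLe (N 1) (Rd (row_addr 9 20 (N q)))
     (Wr (row_addr 9 20 (N 0)) (Plus (Rd (row_addr 9 20 (N 0))) (N 1))) Skip) Skip"
  define s1 where "s1 = (fst s, (snd s)(B + (v * (q+1) + q) := 0))"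
  have r: "fst s 0 = n" "fst s 9 = A0" using env by (auto simp: env_def)
  have sm: "s' = sem X (For 20 (V 0) c) s1" and tm: "time X PIN_ROOT s = etime (row_addr 9 11 (N q)) s + 2 + time X (For 20 (V 0) c) s1"
  proof -
    have "eval (row_addr 9 11 (N q)) s = B + (v * (q+1) + q)" using r v by (simp add: row_addr_def b0)
    then have "sem X (Wr (row_addr 9 11 (N q)) (N 0)) s = s1" by (simp add: s1_def)
    then show "s' = sem X (For 20 (V 0) c) s1" "time X PIN_ROOT s = etime (row_addr 9 11 (N q)) s + 2 + time X (For 20 (V 0) c) s1"
      by (simp_all add: s'_def PIN_ROOT_def c_def del: sem.simps(7) time.simps(7))
  qed
  define I where "I u t \<longleftrightarrow> fst t 0 = n \<and> fst t 9 = A0 \<and> fst t 11 = v \<and> (\<forall>a<A0. snd t a = snd s a) \<and>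
    (\<forall>u'<n. snd t (B + (u' * (q+1) + q)) = (if Suc v \<le> u' then 1 else 0)) \<and>
    (\<forall>u'<n. \<forall>a<q. snd t (B + (u' * (q+1) + a)) = chain n v u' a + (if u' < u \<and> u' \<in> nb {v..<n} v \<and> a = 0 then 1 else 0)) \<and>
    snd t (B + (n * (q+1) + 1)) = 0" for u and t :: store
  have st: "I (Suc u) (sem X c (put 20 u t)) \<and> time X c (put 20 u t) \<le> 100 * Q ^ 1" if u: "u < n" and I: "I u t" for u t
  proof -
    have rt: "fst t 0 = n" "fst t 9 = A0" "fst t 11 = v" using I by (auto simp: I_def)
    have adj: "snd t (v * n + u) = (if {v, u} \<in> E then 1 else 0)"
      using I adj_small[OF u v(2)] env u v(2) by (simp add: I_def env_def)
    have al: "snd t (B + (u * (q+1) + q)) = (if Suc v \<le> u then 1 else 0)" using I u by (simp add: I_def)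
    have nbu: "u \<in> nb {v..<n} v \<longleftrightarrow> {v, u} \<in> E \<and> Suc v \<le> u"
      using u nb_irrefl[of v "{v..<n}"] by (cases "u = v") (auto simp: nb_def)
    have e1: "eval (Rd (Plus (Times (V 11) (V 0)) (V 20))) (put 20 u t) = snd t (v * n + u)" using rt by simp
    have e2: "eval (Rd (row_addr 9 20 (N q))) (put 20 u t) = snd t (B + (u * (q+1) + q))" using rt by (simp add: row_addr_def b0)
    have sc: "sem X c (put 20 u t) = (if u \<in> nb {v..<n} v
       then (fst (put 20 u t), (snd t)(B + (u * (q+1) + 0) := Suc (snd t (B + (u * (q+1) + 0))))) else put 20 u t)"
      unfolding c_def sem.simps(5) e1 e2 using adj al nbu rt by (simp add: row_addr_def b0)
    have tc: "time X c (put 20 u t) \<le> 100 * Q ^ 1" using rt Q(1,2,3) by (simp add: c_def row_addr_def)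
    have "I (Suc u) (sem X c (put 20 u t))"
    proof (cases "u \<in> nb {v..<n} v")
      case False
      then have "sem X c (put 20 u t) = put 20 u t" using sc by (simp only: if_False)
      then show ?thesis using I False by (auto simp: I_def less_Suc_eq)
    next
      case True
      define h where "h = (snd t)(B + (u * (q+1) + 0) := Suc (snd t (B + (u * (q+1) + 0))))"
      have s2: "sem X c (put 20 u t) = (fst (put 20 u t), h)" using sc True unfolding h_def by (simp only: if_True)
      have low: "h a = snd t a" if "a < A0" for a using that by (simp add: h_def b0)
      have cell: "h (B + (u' * (q+1) + a)) = snd t (B + (u' * (q+1) + a)) + (if u' = u \<and> a = 0 then 1 else 0)" if "a \<le> q" for u' a
        using cell_eq[OF that le0, of u' u] unfolding h_def by (auto simp del: add_Suc_right mult_Suc_right)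
      have lv: "h (B + (n * (q+1) + 1)) = snd t (B + (n * (q+1) + 1))" using row_less[OF u le0] by (simp add: h_def)
      show ?thesis unfolding I_def s2 fst_conv snd_conv lv
      proof (intro conjI allI impI)
        fix u' assume u': "u' < n"
        show "h (B + (u' * (q+1) + q)) = (if Suc v \<le> u' then 1 else 0)"
          unfolding cell[OF order_refl] using I u' q0 by (simp add: I_def)
        fix a assume a: "a < q"
        show "h (B + (u' * (q+1) + a)) = chain n v u' a + (if u' < Suc u \<and> u' \<in> nb {v..<n} v \<and> a = 0 then 1 else 0)"
          unfolding cell[OF less_imp_le[OF a]] using I u' a True by (auto simp: I_def less_Suc_eq)
      qed (use I low in \<open>auto simp: I_def\<close>)
    qed
    then show ?thesis using tc by blast
  qed
  have i0: "I 0 s1"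
  proof -
    have cell: "snd s1 (B + (u * (q+1) + a)) = (if u = v \<and> a = q then 0 else snd s (B + (u * (q+1) + a)))" if "a \<le> q" for u a
      using cell_eq[OF that order_refl, of u v] unfolding s1_def by (auto simp del: add_Suc_right mult_Suc_right)
    have lv: "snd s1 (B + (n * (q+1) + 1)) = snd s (B + (n * (q+1) + 1))" using row_less[OF v(2) order_refl] by (simp add: s1_def)
    have fs: "fst s1 = fst s" by (simp add: s1_def)
    show ?thesis unfolding I_def lv fs
    proof (intro conjI allI impI)
      fix u assume u: "u < n"
      show "snd s1 (B + (u * (q+1) + q)) = (if Suc v \<le> u then 1 else 0)"
        unfolding cell[OF order_refl] using inst u by (auto simp: inst_at_def B_def)
      fix a assume a: "a < q"
      show "snd s1 (B + (u * (q+1) + a)) = chain n v u a + (if u < 0 \<and> u \<in> nb {v..<n} v \<and> a = 0 then 1 else 0)"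
        unfolding cell[OF less_imp_le[OF a]] using inst u a by (auto simp: inst_at_def B_def)
    qed (use r v inst in \<open>auto simp: inst_at_def B_def[symmetric] s1_def b0\<close>)
  qed
  have e0: "eval (V 0) s1 = n" using r by (simp add: s1_def)
  have lp: "I n s'" "time X (For 20 (V 0) c) s1 \<le> etime (V 0) s1 + 2 + n * (100 * Q ^ 1 + 6)"
    unfolding sm by (rule for_rule[where I = I and m = n, OF i0 st e0], assumption+)+
  show "env s'"
  proof (rule env_cong[OF env])
    show "fst s' x = fst s x" if "x \<in> {0, 3, 4, 7, 8, 9, 10}" for x
      unfolding s'_def by (rule sem_unassigned) (use that in \<open>auto simp: root_assigned\<close>)
  qed (use lp(1) in \<open>simp add: I_def\<close>)
  show "todo (snd s') (Suc v)" using lp(1) by (auto simp: I_def todo_def B_def tilt_def)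
  have "2 + 2 + n * (100 * Q ^ 1 + 6) \<le> (100 + 2 + 8) * Q ^ Suc 1" using Q(1,2) by (intro loop_bound) auto
  moreover have "Q ^ Suc 1 = Q ^ 2" by (simp add: numeral_eq_Suc)
  moreover have "etime (row_addr 9 11 (N q)) s + 2 \<le> 30 * Q" using Q(1,3) by (simp add: row_addr_def)
  moreover have "Q \<le> Q ^ 2" using Q(1) by (simp add: power2_eq_square)
  ultimately show "time X PIN_ROOT s \<le> 300 * Q ^ 2" using tm lp(2) by simp
qed

lemma root_sum_correct:
  assumes env: "env s" and v: "fst s 11 = v" "v < n" and enc: "enc (snd s) 0 (Some ({v..<n}, chain n v, v, 0))"
    and vals: "vals_at (snd s) 0 d {v..<n} (chain n v) v"
  shows "fst (sem X ROOT_SUM s) 28 = iS \<Delta> M W d n v" "iS \<Delta> M W d n v \<le> Q" "time X ROOT_SUM s \<le> 300 * Q ^ 2"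
proof -
  let ?m = "chain n v" and ?U = "{v..<n}"
  define c where "c = Asg 28 (Plus (V 28) (Times (Rd (Plus (Times (V 0) (V 0)) (Rd (row_addr 9 11 (V 27))))) (Rd (val_addr 9 (Times (V 27) (N q))))))"
  have b0: "base 0 = A0" by (simp add: base_def)
  have inst: "inst_at (snd s) A0 ?U ?m v 0" "admissible \<Delta> ?U ?m" "v \<in> ?U" using enc by (auto simp: enc_def b0)
  have r: "fst s 0 = n" "fst s 9 = A0" using env by (auto simp: env_def)
  have F: "snd s (n * n + snd s (A0 + (v * (q+1) + b))) = iF \<Delta> M W ?m v b" if b: "b < q" for b
    using inst(1) v(2) b env pins_small[OF inst(2,3) b] by (simp add: inst_at_def env_def iF_def)
  have R: "snd s (A0 + (n * (q+1) + 2 + b * q)) = est \<Delta> M W d ?U ?m v b 0" if b: "b < q" for b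
  proof -
    have "b * q < q * q" using b pair_less[OF b q0] by simp
    then show ?thesis using vals q0 unfolding vals_at_def b0 by auto
  qed
  define I where "I b t \<longleftrightarrow> fst t 0 = n \<and> fst t 9 = A0 \<and> fst t 11 = v \<and> snd t = snd s \<and>
    fst t 28 = (\<Sum>b'<b. iF \<Delta> M W ?m v b' * est \<Delta> M W d ?U ?m v b' 0)" for b and t :: store
  have st: "I (Suc b) (sem X c (put 27 b t)) \<and> time X c (put 27 b t) \<le> 150 * Q ^ 1" if b: "b < q" and I: "I b t" for b t
  proof -
    have rt: "fst t 0 = n" "fst t 9 = A0" "fst t 11 = v" "snd t = snd s" using I by (auto simp: I_def)
    have e1: "eval (Rd (Plus (Times (V 0) (V 0)) (Rd (row_addr 9 11 (V 27))))) (put 27 b t) = iF \<Delta> M W ?m v b"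
      using rt F[OF b] by (simp add: row_addr_def)
    have e2: "eval (Rd (val_addr 9 (Times (V 27) (N q)))) (put 27 b t) = est \<Delta> M W d ?U ?m v b 0"
      using rt R[OF b] by (simp add: val_addr_def)
    have "sem X c (put 27 b t) = put 28 (fst t 28 + iF \<Delta> M W ?m v b * est \<Delta> M W d ?U ?m v b 0) (put 27 b t)"
      unfolding c_def sem.simps(2) eval.simps(2,3,5) e1 e2 by simp
    then have "I (Suc b) (sem X c (put 27 b t))" using I by (simp add: I_def)
    moreover have "etime (Rd (Plus (Times (V 0) (V 0)) (Rd (row_addr 9 11 (V 27))))) (put 27 b t) \<le> 40 * Q"
      "etime (Rd (val_addr 9 (Times (V 27) (N q)))) (put 27 b t) \<le> 40 * Q"
      using rt Q(1,2,3) by (simp_all add: row_addr_def val_addr_def)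
    then have "time X c (put 27 b t) \<le> 150 * Q ^ 1"
      using est_Q[OF inst(2,3), of d b 0] Q(1) unfolding c_def time.simps(2) etime.simps(2,3,5) e2 by simp
    ultimately show ?thesis by blast
  qed
  have i0: "I 0 (put 28 0 s)" using r v by (simp add: I_def)
  have e0: "eval (N q) (put 28 0 s) = q" by simp
  have lp: "I q (sem X (For 27 (N q) c) (put 28 0 s))" "time X (For 27 (N q) c) (put 28 0 s) \<le> etime (N q) (put 28 0 s) + 2 + q * (150 * Q ^ 1 + 6)"
    by (rule for_rule[where I = I and m = q, OF i0 st e0], assumption+)+
  have RS: "sem X ROOT_SUM s = sem X (For 27 (N q) c) (put 28 0 s)" "time X ROOT_SUM s = 3 + time X (For 27 (N q) c) (put 28 0 s)"
    unfolding ROOT_SUM_def c_def[symmetric] by simp_all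
  show "fst (sem X ROOT_SUM s) 28 = iS \<Delta> M W d n v" unfolding RS iS_def using lp(1) by (simp add: I_def)
  have "1 + 2 + q * (150 * Q ^ 1 + 6) \<le> (150 + 1 + 8) * Q ^ Suc 1" using Q(1,3) by (intro loop_bound) auto
  moreover have "Q ^ Suc 1 = Q ^ 2" "1 \<le> Q ^ 2" using Q(1) by (simp_all add: numeral_eq_Suc)
  ultimately show "time X ROOT_SUM s \<le> 300 * Q ^ 2" unfolding RS using lp(2) by simp
  have "iS \<Delta> M W d n v \<le> (\<Sum>b<q. M ^ \<Delta> * (2 ^ \<Delta> * M))"
    unfolding iS_def
  proof (rule sum_mono)
    fix b assume b: "b \<in> {..<q}"
    have "W ^ ?m v b * M ^ (\<Delta> - ?m v b) \<le> M ^ ?m v b * M ^ (\<Delta> - ?m v b)"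
      using WM by (intro mult_right_mono power_mono) auto
    then have "iF \<Delta> M W ?m v b \<le> M ^ \<Delta>" using pins_small[OF inst(2,3), of b] b by (simp add: iF_def power_add[symmetric])
    moreover have "est \<Delta> M W d ?U ?m v b 0 \<le> 2 ^ \<Delta> * M" by (rule est_le[OF _ length_nbl_le[OF inst(2,3)]]) (use \<Delta>q in simp)
    ultimately show "iF \<Delta> M W ?m v b * est \<Delta> M W d ?U ?m v b 0 \<le> M ^ \<Delta> * (2 ^ \<Delta> * M)" by (rule mult_mono) auto
  qed
  also have "\<dots> = q * (M ^ \<Delta> * (2 ^ \<Delta> * M))" by simp
  also have "\<dots> \<le> 1 * (q * (M ^ \<Delta> * (2 ^ \<Delta> * M)) + sn * (M ^ \<Delta> * M))" by simp
  also have "\<dots> \<le> M * (q * (M ^ \<Delta> * (2 ^ \<Delta> * M)) + sn * (M ^ \<Delta> * M))" using M0 by (intro mult_right_mono) auto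
  finally show "iS \<Delta> M W d n v \<le> Q" using Q(12) by linarith
qed

lemma vertex_correct:
  assumes NN: "NN = (bb + 1) ^ d" "0 < bb" and adm0: "admissible \<Delta> {..<n} (\<lambda>_ _. 0)"
    and env: "env s" and td: "todo (snd s) v" and v: "fst s 11 = v" "v < n"
  defines "s' \<equiv> sem X VERTEX s"
  shows "env s'" "todo (snd s') (Suc v)" "fst s' 31 = fst s 31 * iS \<Delta> M W d n v" "fst s' 32 = fst s 32 * M ^ Suc \<Delta>"
    "time X VERTEX s \<le> 3000 * Q ^ 5"
proof -
  let ?nd = "({v..<n}, chain n v, v, 0::nat)"
  define s1 where "s1 = (fst s, (snd s)(A0 + n * (q+1) := v))"
  define s2 where "s2 = sem X BUILD s1"
  define s3 where "s3 = sem X EVAL s2"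
  define s4 where "s4 = sem X ROOT_SUM s3"
  define s5 where "s5 = put 31 (fst s4 31 * fst s4 28) s4"
  define s6 where "s6 = sem X (POW 32 3 27 (N (\<Delta>+1))) s5"
  have b0: "base 0 = A0" by (simp add: base_def)
  have r: "fst s 0 = n" "fst s 9 = A0" using env by (auto simp: env_def)
  have w1: "sem X (Wr (root_addr 9) (V 11)) s = s1" using r v by (simp add: root_addr_def s1_def)
  have s': "s' = sem X PIN_ROOT s6"
    unfolding s'_def VERTEX_def sem.simps(4) w1 by (simp add: s2_def s3_def s4_def s5_def s6_def)
  have tm: "time X VERTEX s = time X (Wr (root_addr 9) (V 11)) s + (time X BUILD s1 + (time X EVAL s2 + (time X ROOT_SUM s3 +
     (time X (Asg 31 (Times (V 31) (V 28))) s4 + (time X (POW 32 3 27 (N (\<Delta>+1))) s5 + time X PIN_ROOT s6)))))"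
    unfolding VERTEX_def time.simps(4) w1 by (simp add: s2_def s3_def s4_def s5_def s6_def)
  have env1: "env s1" by (rule env_cong[OF env]) (auto simp: s1_def)
  have enc1: "enc (snd s1) 0 (Some ?nd)"
  proof -
    have cell: "snd s1 (A0 + (u * (q+1) + a)) = snd s (A0 + (u * (q+1) + a))" if "u < n" "a \<le> q" for u a
      using row_less[OF that] by (simp add: s1_def)
    have "inst_at (snd s1) (base 0) {v..<n} (chain n v) v 0" unfolding inst_at_def b0
    proof (intro conjI allI impI)
      fix u assume u: "u < n"
      show "snd s1 (A0 + (u * (q+1) + q)) = (if u \<in> {v..<n} then 1 else 0)"
        unfolding cell[OF u order_refl] using td u by (simp add: todo_def b0)
      fix a assume a: "a < q"
      show "snd s1 (A0 + (u * (q+1) + a)) = chain n v u a"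
        unfolding cell[OF u less_imp_le[OF a]] using td u a by (simp add: todo_def b0)
    qed (use td in \<open>auto simp: s1_def todo_def b0\<close>)
    moreover have "admissible \<Delta> {v..<n} (chain n v)" by (rule chain_admissible[OF adm0]) (use v in simp)
    ultimately show ?thesis using v by (auto simp: enc_def)
  qed
  have NN0: "0 < NN" using NN by simp
  note b = build_correct[OF NN0 NN(2) env1 enc1, folded s2_def]
  have enc2: "\<And>y. y < NN \<Longrightarrow> enc (snd s2) y (node ?nd y)" by (rule b(2))
  note e = eval_correct[OF NN b(1) enc2, folded s3_def]
  have e3: "env s3" "enc (snd s3) 0 (Some ?nd)" "vals_at (snd s3) 0 d {v..<n} (chain n v) v" "time X EVAL s2 \<le> 1300 * Q ^ 5"
    by (rule e; assumption)+
  have u2: "fst s2 z = fst s z" if "z \<in> {11, 31, 32}" for z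
    using that sem_unassigned[of z BUILD X s1] by (auto simp: s2_def s1_def build_assigned)
  have u3: "fst s3 z = fst s z" if "z \<in> {11, 31, 32}" for z
    using that u2 sem_unassigned[of z EVAL X s2] by (auto simp: s3_def eval_assigned)
  have u4: "fst s4 z = fst s3 z" if "z \<notin> {28, 27}" for z
    unfolding s4_def by (rule sem_unassigned) (use that in \<open>simp add: root_assigned\<close>)
  have v3: "fst s3 11 = v" using u3 v by simp
  note rs = root_sum_correct[OF e3(1) v3 v(2) e3(2,3), folded s4_def]
  have h4: "snd s4 = snd s3" unfolding s4_def by (simp add: sem_no_write root_assigned)
  have u6: "fst s6 z = fst s5 z" if "z \<notin> {32, 27}" for z
    unfolding s6_def by (rule sem_unassigned) (use that in \<open>simp add: pow_assigned\<close>)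
  have h6: "snd s6 = snd s3" unfolding s6_def by (simp add: sem_no_write pow_assigned s5_def h4)
  have env6: "env s6" by (rule env_cong[OF e3(1)]) (auto simp: h6 u6 u4 s5_def)
  have M5: "fst s5 3 = M" using e3(1) u4 by (simp add: s5_def env_def)
  have v6: "fst s6 11 = v" using u6 u4 v3 by (simp add: s5_def)
  have i6: "inst_at (snd s6) (base 0) {v..<n} (chain n v) v 0" using e3(2) by (simp add: h6 enc_def)
  note p = pin_root_correct[OF env6 v6 v(2) i6, folded s']
  have u7: "fst s' z = fst s6 z" if "z \<noteq> 20" for z
    unfolding s' by (rule sem_unassigned) (use that in \<open>simp add: root_assigned\<close>)
  show "env s'" "todo (snd s') (Suc v)" by (rule p)+
  show "fst s' 31 = fst s 31 * iS \<Delta> M W d n v" using u7 u6 u4 u3 rs(1) by (simp add: s5_def)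
  have "fst s6 32 = fst s5 32 * M ^ (\<Delta> + 1)" using pow_correct(1)[of 32 3 27 X "N (\<Delta>+1)" s5] M5 by (simp add: s6_def)
  then show "fst s' 32 = fst s 32 * M ^ Suc \<Delta>" using u7 u4 u3 by (simp add: s5_def)
  have Qp: "Q \<le> Q ^ 5" "Q ^ 2 \<le> Q ^ 5" "Q ^ 4 \<le> Q ^ 5" "1 \<le> Q ^ 5"
    using Q(1) by (simp_all add: power_increasing[of 1 5 Q, simplified] power_increasing[of 2 5 Q] power_increasing[of 4 5 Q])
  have tw: "time X (Wr (root_addr 9) (V 11)) s \<le> 30 * Q" using Q(1,3) by (simp add: root_addr_def)
  have ta: "time X (Asg 31 (Times (V 31) (V 28))) s4 \<le> 20 * Q" using rs(1,2) Q(1) by simp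
  have "(\<Delta> + 1) * (4 * M + 17) \<le> Q * (21 * Q)" using Q(1,6,8) by (intro mult_mono) auto
  then have tp: "time X (POW 32 3 27 (N (\<Delta>+1))) s5 \<le> 3 + 21 * Q ^ 2"
    using pow_correct(2)[of 32 3 27 X "N (\<Delta>+1)" s5] M5 by (simp add: power2_eq_square)
  show "time X VERTEX s \<le> 3000 * Q ^ 5"
    using tm tw ta tp b(3) e3(4) rs(3) p(3) Qp by linarith
qed

lemma main_correct:
  assumes s0: "fst s = (\<lambda>_. 0)(0 := n)" "snd s = (\<lambda>a. if a < n * n \<and> {a div n, a mod n} \<in> E then 1 else 0)"
    and K: "K \<le> Q" "2 * c0 \<le> Q" and Md: "M = grown X (n * K) (n * K + K)" "n * K + K \<le> M"
    and Wd: "\<And>y. real y \<le> X Weight * real M \<longleftrightarrow> y \<le> W"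
    and td: "(bb + 1) ^ t \<le> M" "M < (bb + 1) ^ Suc t" "0 < bb" and dd: "d = 2 * c0 * t + 1" "NN = (bb + 1) ^ d"
    and adm0: "admissible \<Delta> {..<n} (\<lambda>_ _. 0)"
  defines "s' \<equiv> sem X (MAIN K c0) s"
  shows "fst s' 0 = (\<Prod>v<n. iS \<Delta> M W d n v)" "fst s' 1 = (M ^ Suc \<Delta>) ^ n" "time X (MAIN K c0) s \<le> 5000 * Q ^ 6"
proof -
  define s1 where "s1 = sem X (INIT K c0) s"
  note i = init_correct[OF s0 K Md Wd td dd, folded s1_def]
  define I where "I v t \<longleftrightarrow> env t \<and> todo (snd t) v \<and> fst t 31 = (\<Prod>v<v. iS \<Delta> M W d n v) \<and> fst t 32 = (M ^ Suc \<Delta>) ^ v" for v and t :: store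
  have st: "I (Suc v) (sem X VERTEX (put 11 v t')) \<and> time X VERTEX (put 11 v t') \<le> 3000 * Q ^ 5" if v: "v < n" and I: "I v t'" for v t'
  proof -
    have a: "env (put 11 v t')" "todo (snd (put 11 v t')) v" "fst (put 11 v t') 11 = v" using I by (auto simp: I_def env_def)
    note vc = vertex_correct[OF dd(2) td(3) adm0 a v]
    show ?thesis using vc I by (simp add: I_def)
  qed
  have ic: "env s1" "fst s1 31 = 1" "fst s1 32 = 1" "snd s1 (base 0 + (n * (q+1) + 1)) = 0" "time X (INIT K c0) s \<le> 500 * Q ^ 3"
    using i by blast+
  have cells: "snd s1 (base 0 + (u * (q+1) + a)) = (if a = q then 1 else 0)" if "u < n" "a \<le> q" for u a
    using i(2) that by blast
  have i0: "I 0 s1" unfolding I_def todo_def using ic cells by simp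
  have e0: "eval (V 0) s1 = n" using ic(1) by (simp add: env_def)
  have lp: "I n (sem X (For 11 (V 0) VERTEX) s1)" "time X (For 11 (V 0) VERTEX) s1 \<le> etime (V 0) s1 + 2 + n * (3000 * Q ^ 5 + 6)"
    by (rule for_rule[where I = I and m = n, OF i0 st e0], assumption+)+
  have s': "s' = put 1 (fst (sem X (For 11 (V 0) VERTEX) s1) 32) (put 0 (fst (sem X (For 11 (V 0) VERTEX) s1) 31) (sem X (For 11 (V 0) VERTEX) s1))"
    by (simp add: s'_def MAIN_def s1_def del: sem.simps(7))
  show "fst s' 0 = (\<Prod>v<n. iS \<Delta> M W d n v)" "fst s' 1 = (M ^ Suc \<Delta>) ^ n" using lp(1) by (simp_all add: s' I_def)
  have tm: "time X (MAIN K c0) s = time X (INIT K c0) s + (time X (For 11 (V 0) VERTEX) s1 + 8)"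
    by (simp add: MAIN_def s1_def del: sem.simps(7) time.simps(7))
  define L R where "L = n * (3000 * Q ^ 5 + 6)" and "R = Q ^ 6"
  have "2 + 2 + L \<le> (3000 + 2 + 8) * Q ^ Suc 5" unfolding L_def using Q(1,2) by (intro loop_bound) auto
  also have "Q ^ Suc 5 = R" by (simp add: R_def numeral_eq_Suc)
  finally have "4 + L \<le> 3010 * R" by simp
  moreover have "Q ^ 3 \<le> R" "1 \<le> R" using Q(1) by (simp_all add: R_def power_increasing[of 3 6 Q])
  moreover have "time X (For 11 (V 0) VERTEX) s1 \<le> 4 + L" using lp(2) unfolding L_def etime.simps by linarith
  ultimately show "time X (MAIN K c0) s \<le> 5000 * Q ^ 6" unfolding R_def[symmetric] using tm ic(5) by linarith
qed

end

section \<open>Choice of the parameters\<close>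

text \<open>The search stops because the accuracy is positive.\<close>

lemma grown_bounds:
  assumes "0 < X Accuracy"
  shows "b \<le> grown X a b" "real a \<le> X Accuracy * real (grown X a b)"
    "b \<le> k \<Longrightarrow> real a \<le> X Accuracy * real k \<Longrightarrow> grown X a b \<le> k"
proof -
  let ?P = "\<lambda>k. b \<le> k \<and> real a \<le> X Accuracy * real k"
  obtain k :: nat where k: "real a / X Accuracy \<le> real k" using real_arch_simple by blast
  have "X Accuracy * real k \<le> X Accuracy * real (max b k)" using assms by (intro mult_left_mono) auto
  moreover have "real a \<le> X Accuracy * real k" using k assms by (simp add: pos_divide_le_eq mult.commute)
  ultimately have "?P (max b k)" by simp
  then have "?P (grown X a b)" unfolding grown_def by (rule LeastI)
  then show "b \<le> grown X a b" "real a \<le> X Accuracy * real (grown X a b)" by auto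
  show "grown X a b \<le> k" if "b \<le> k" "real a \<le> X Accuracy * real k" for k
    unfolding grown_def using that by (intro Least_le) simp
qed

lemma monomial_bound:
  fixes c C M :: nat
  assumes "a \<le> c * M ^ e" "c \<le> C" "e \<le> r" "1 \<le> M"
  shows "a \<le> C * M ^ r"
proof -
  have "c * M ^ e \<le> C * M ^ r" using assms by (intro mult_mono power_increasing) auto
  then show ?thesis using assms(1) by linarith
qed

context program
begin

text \<open>A sum of coefficients, one for each of the quantities that have to stay below \<open>Q\<close>.\<close>

definition "coef K c0 = 2 ^ \<Delta> * q + sn + (q + 3 + q * q) + (bb + 1) + 2 ^ \<Delta> + \<Delta> + K + 2 * c0"

lemma quantities_bound:
  fixes M n K c0 t :: nat
  assumes M: "1 \<le> M" "n \<le> M" and t: "(bb + 1) ^ t \<le> M"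
  defines "Q \<equiv> coef K c0 * M ^ (2 * c0 + \<Delta> + 2)"
  shows "1 \<le> Q" "n \<le> Q" "q + 1 \<le> Q" "q * q \<le> Q" "bb \<le> Q" "\<Delta> + 1 \<le> Q" "sn \<le> Q" "M \<le> Q"
    "(bb + 1) ^ (2 * c0 * t + 1) \<le> Q" "n * (q + 1) + 2 + q * q \<le> Q" "2 ^ \<Delta> * M \<le> Q"
    "M * (q * (M ^ \<Delta> * (2 ^ \<Delta> * M)) + sn * (M ^ \<Delta> * M)) + 1 \<le> Q" "K \<le> Q" "2 * c0 \<le> Q"
proof -
  have *: "a \<le> Q" if "a \<le> c * M ^ e" "c \<le> coef K c0" "e \<le> 2 * c0 + \<Delta> + 2" for a c e
    unfolding Q_def by (rule monomial_bound[OF that M(1)])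
  have const: "a \<le> Q" if "a \<le> coef K c0" for a by (rule *[of _ a 0]) (use that in auto)
  show "1 \<le> Q" "q + 1 \<le> Q" "q * q \<le> Q" "bb \<le> Q" "\<Delta> + 1 \<le> Q" "sn \<le> Q" "K \<le> Q" "2 * c0 \<le> Q"
    by (rule const; simp add: coef_def)+
  show "n \<le> Q" "M \<le> Q" by (rule *[of _ 1 1]; use M in \<open>simp add: coef_def\<close>)+
  show "2 ^ \<Delta> * M \<le> Q" by (rule *[of _ "2 ^ \<Delta>" 1]) (auto simp: coef_def)
  have "(bb + 1) ^ (2 * c0 * t + 1) = (bb + 1) * ((bb + 1) ^ t) ^ (2 * c0)" by (simp add: power_mult[symmetric] mult_ac)
  also have "\<dots> \<le> (bb + 1) * M ^ (2 * c0)" using t by (intro mult_left_mono power_mono) auto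
  finally show "(bb + 1) ^ (2 * c0 * t + 1) \<le> Q" by (rule *) (auto simp: coef_def)
  have "n * (q + 1) \<le> M * (q + 1)" using M by (intro mult_right_mono) auto
  moreover have "(2 + q * q) * 1 \<le> (2 + q * q) * M" using M by (intro mult_left_mono) auto
  ultimately have "n * (q + 1) + 2 + q * q \<le> (q + 3 + q * q) * M ^ 1" by (simp add: algebra_simps)
  then show "n * (q + 1) + 2 + q * q \<le> Q" by (rule *) (auto simp: coef_def)
  have "M * (q * (M ^ \<Delta> * (2 ^ \<Delta> * M)) + sn * (M ^ \<Delta> * M)) = (2 ^ \<Delta> * q + sn) * M ^ (\<Delta> + 2)"
    by (simp add: algebra_simps power2_eq_square)
  moreover have "1 \<le> M ^ (\<Delta> + 2)" using M by (intro one_le_power) auto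
  ultimately have "M * (q * (M ^ \<Delta> * (2 ^ \<Delta> * M)) + sn * (M ^ \<Delta> * M)) + 1 \<le> (2 ^ \<Delta> * q + sn + 1) * M ^ (\<Delta> + 2)"
    by (simp add: distrib_right)
  then show "M * (q * (M ^ \<Delta> * (2 ^ \<Delta> * M)) + sn * (M ^ \<Delta> * M)) + 1 \<le> Q" by (rule *) (auto simp: coef_def)
qed

lemma main_vars: "x \<in> cvars (MAIN K c0) \<Longrightarrow> x < 41"
  by (auto simp: MAIN_def INIT_def SCALE_def WEIGHT_def DEPTH_def LAYOUT_def POWERS_def ALIVE_def VERTEX_def ROOT_SUM_def PIN_ROOT_def
      POW_def BUILD_def LOCATE_def NODE_def ROW_def NEIGHBOUR_def PIN_def COPY_ROW_def row_addr_def EVAL_def VALUE_def FACTOR_def SIDE_def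
      F_at_def R_at_def cnt_at_def root_addr_def lev_addr_def val_addr_def)

text \<open>\<open>M\<close> is about \<open>K\<close> times \<open>n / \<epsilon>\<close>. The depth is \<open>2 c0 t + 1\<close> where \<open>(bb + 1) ^ t \<le> M < (bb + 1) ^ (t + 1)\<close>: then the tree has
  \<open>(bb + 1) ^ (2 c0 t + 1)\<close> nodes, polynomial in \<open>M\<close>, and \<open>c0\<close> double steps contract by \<open>1 / (bb + 1)\<close>, so that the error due to
  the cut is at most \<open>(bb + 1) / M\<close>.\<close>

lemma program_approximates:
  fixes w \<epsilon> :: real
  assumes dl: "3 \<le> \<Delta>" "\<Delta> < q" and regime: "2 * \<Delta> \<le> q \<or> 500 \<le> \<Delta> \<and> 1998 * real \<Delta> \<le> 1000 * real q"
    and w: "0 \<le> w" "w \<le> 1" and eps: "0 < \<epsilon>"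
    and graph: "simple_graph {..<n} E" "max_degree_le {..<n} E \<Delta>"
    and K: "2 * (real bb + 1) + 2 * Kc \<Delta> + 6 + real \<Delta> \<le> real K" and c0: "kap \<Delta> ^ c0 \<le> 1 / (real bb + 1)"
  defines "P \<equiv> ccode 0 41 (MAIN K c0)"
  shows "\<exists>t \<xi>. outputs_in P w n E \<epsilon> t \<xi> \<and>
    real t \<le> 5000 * (real (coef K c0) * (real K * (real n / min 1 \<epsilon>) + real K + 1) ^ (2 * c0 + \<Delta> + 2)) ^ 6 \<and>
    exp (- \<epsilon>) \<le> potts {..<n} E q w / \<xi> \<and> potts {..<n} E q w / \<xi> \<le> exp \<epsilon>"
proof -
  define X where "X = case_real_arg w \<epsilon>"
  have X: "X Weight = w" "X Accuracy = \<epsilon>" by (simp_all add: X_def)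
  have X0: "0 < X Accuracy" using eps X by simp
  define M where "M = grown X (n * K) (n * K + K)"
  define W where "W = nat \<lfloor>w * real M\<rfloor>"
  have b3: "2 \<le> bb + 1"
  proof -
    have "1 * 1 \<le> \<Delta> * (q * q)" using dl by (intro mult_mono) auto
    then show ?thesis by (simp add: bb_def)
  qed
  have Kc0: "0 \<le> Kc \<Delta>" by (simp add: Kc_def)
  have "1 \<le> k \<and> z \<le> k" if "2 * (x + 1) + 2 * z + 6 + y \<le> k" "0 \<le> x" "0 \<le> y" "0 \<le> z" for x y z k :: real
    using that by simp
  from this[OF K _ _ Kc0] have "1 \<le> real K \<and> Kc \<Delta> \<le> real K" by simp
  then have K1: "1 \<le> K" "Kc \<Delta> \<le> real K" by simp_all
  have Mb: "n * K + K \<le> M" "real (n * K) \<le> \<epsilon> * real M"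
    using grown_bounds(1,2)[where X = X and b = "n * K + K" and a = "n * K", OF X0] X by (auto simp: M_def)
  have nK: "n \<le> n * K" using K1 by simp
  have M1: "1 \<le> M" "n \<le> M" "Kc \<Delta> \<le> real M" using Mb(1) K1 nK by linarith+
  have Mu: "real M \<le> real K * (real n / min 1 \<epsilon>) + real K + 1"
  proof -
    let ?z = "real (n * K) / min 1 \<epsilon>"
    define k where "k = nat \<lceil>?z\<rceil> + K"
    have m0: "0 < min 1 \<epsilon>" using eps by simp
    have z: "real (n * K) \<le> ?z" using m0 by (simp add: pos_le_divide_eq mult_left_le)
    have z0: "0 \<le> ?z" using z of_nat_0_le_iff order_trans by blast
    have kz: "?z + real K \<le> real k" "real k \<le> ?z + real K + 1" using z0 unfolding k_def by linarith+
    have "real (n * K + K) \<le> real k" using z kz by simp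
    then have a: "n * K + K \<le> k" by linarith
    have "real (n * K) \<le> \<epsilon> * ?z"
    proof -
      have "min 1 \<epsilon> * ?z \<le> \<epsilon> * ?z" using z0 by (intro mult_right_mono) auto
      then show ?thesis using m0 by simp
    qed
    also have "\<dots> \<le> \<epsilon> * real k" using kz eps by (intro mult_left_mono) auto
    finally have "M \<le> k" using grown_bounds(3)[where X = X, OF X0 a] X by (simp add: M_def)
    then show ?thesis using kz by (simp add: mult.commute)
  qed
  have wM: "0 \<le> w * real M" using w by simp
  have Wd: "real y \<le> X Weight * real M \<longleftrightarrow> y \<le> W" for y
    using wM unfolding X W_def by (simp add: le_nat_iff le_floor_iff)
  have WM: "W \<le> M"
  proof -
    have "real W \<le> w * real M" using Wd[of W] X by simp
    also have "\<dots> \<le> 1 * real M" using w by (intro mult_right_mono) auto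
    finally show ?thesis by simp
  qed
  have W: "real W \<le> w * real M" "w * real M \<le> real W + 1"
    using Wd[of W] Wd[of "Suc W"] X by auto
  obtain t where t: "(bb + 1) ^ t \<le> M" "M < (bb + 1) ^ Suc t" using ex_power_ivl1[OF b3 M1(1)] by auto
  define d where "d = 2 * c0 * t + 1"
  define Q where "Q = coef K c0 * M ^ (2 * c0 + \<Delta> + 2)"
  note qb = quantities_bound[where K = K and ?c0.0 = c0, OF M1(1,2) t(1), folded Q_def d_def]
  have pm: "potts_model E w" using graph w by unfold_locales (auto simp: simple_graph_def)
  interpret potts_model E q w by (rule pm)
  interpret run E q \<Delta> w X n M W "(bb + 1) ^ d" d Q
    using dl WM M1 qb by unfold_locales auto
  define h0 where "h0 = (\<lambda>a. if a < n * n \<and> {a div n, a mod n} \<in> E then 1 else (0::nat))"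
  define s0 :: store where "s0 = ((\<lambda>_. 0)(0 := n), h0)"
  have adm: "admissible \<Delta> {..<n} (\<lambda>_ _. 0)" by (rule admissible_zero[OF graph])
  have bb0: "0 < bb" using b3 by simp
  have s0': "fst s0 = (\<lambda>_. 0)(0 := n)" "snd s0 = (\<lambda>a. if a < n * n \<and> {a div n, a mod n} \<in> E then 1 else 0)"
    by (simp_all add: s0_def h0_def)
  have mc: "fst (sem X (MAIN K c0) s0) 0 = (\<Prod>v<n. iS \<Delta> M W d n v)" "fst (sem X (MAIN K c0) s0) 1 = (M ^ Suc \<Delta>) ^ n"
    "time X (MAIN K c0) s0 \<le> 5000 * Q ^ 6"
    by (rule main_correct[where t = t]; fact s0' qb(13,14) M_def Mb(1) Wd t bb0 d_def refl adm)+
  have "\<exists>N r. N \<le> time X (MAIN K c0) s0 \<and>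
      (step X P ^^ N) (conf 0 ((\<lambda>_. 0)(0 := n)) h0) = conf (clen (MAIN K c0)) r (snd (sem X (MAIN K c0) s0)) \<and>
      (\<forall>x<41. r x = fst (sem X (MAIN K c0) s0) x)"
    unfolding P_def s0_def by (rule compile_correct) (use main_vars X0 in blast)+
  then obtain N r where run: "N \<le> time X (MAIN K c0) s0"
      "(step X P ^^ N) (conf 0 ((\<lambda>_. 0)(0 := n)) h0) = conf (clen (MAIN K c0)) r (snd (sem X (MAIN K c0) s0))"
      "\<forall>x<41. r x = fst (sem X (MAIN K c0) s0) x" by blast
  define \<xi> where "\<xi> = real (\<Prod>v<n. iS \<Delta> M W d n v) / real ((M ^ Suc \<Delta>) ^ n)"
  have in0: "graph_input n E = conf 0 ((\<lambda>_. 0)(0 := n)) h0" by (simp add: graph_input_def h0_def)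
  have r: "r 0 = (\<Prod>v<n. iS \<Delta> M W d n v)" "r 1 = (M ^ Suc \<Delta>) ^ n"
    using run(3) mc(1,2) by simp_all
  have out: "outputs_in P w n E \<epsilon> N \<xi>"
    unfolding outputs_in_def Let_def X_def[symmetric] in0 run(2) \<xi>_def
    using r M1(1) by (simp add: halted_def P_def)
  have "real N \<le> real (5000 * Q ^ 6)" using run(1) mc(3) by linarith
  also have "\<dots> = 5000 * (real (coef K c0) * real M ^ (2 * c0 + \<Delta> + 2)) ^ 6" by (simp add: Q_def)
  also have "\<dots> \<le> 5000 * (real (coef K c0) * (real K * (real n / min 1 \<epsilon>) + real K + 1) ^ (2 * c0 + \<Delta> + 2)) ^ 6"
    using Mu by (intro mult_left_mono power_mono) auto
  finally have time: "real N \<le> 5000 * (real (coef K c0) * (real K * (real n / min 1 \<epsilon>) + real K + 1) ^ (2 * c0 + \<Delta> + 2)) ^ 6" .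
  have M0: "0 < real M" using M1 by simp
  have kt: "kap \<Delta> ^ (c0 * t) \<le> (real bb + 1) / real M"
  proof -
    have "kap \<Delta> ^ (c0 * t) = (kap \<Delta> ^ c0) ^ t" by (rule power_mult)
    also have "\<dots> \<le> (1 / (real bb + 1)) ^ t" using c0 kap_range[of \<Delta>] by (intro power_mono) auto
    also have "\<dots> = (real bb + 1) / (real bb + 1) ^ Suc t" by (simp add: power_one_over divide_simps)
    also have "\<dots> \<le> (real bb + 1) / real M"
    proof (rule divide_left_mono)
      have "real M \<le> real ((bb + 1) ^ Suc t)" using t(2) by linarith
      then show "real M \<le> (real bb + 1) ^ Suc t" by (simp add: algebra_simps)
    qed (use M0 in auto)
    finally show ?thesis .
  qed
  have eM: "real n * (2 * (real bb + 1) + 2 * Kc \<Delta> + 6 + real \<Delta>) \<le> \<epsilon> * real M"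
  proof -
    have "real n * (2 * (real bb + 1) + 2 * Kc \<Delta> + 6 + real \<Delta>) \<le> real n * real K" using K by (intro mult_left_mono) auto
    then show ?thesis using Mb(2) by simp
  qed
  have dS: "d = Suc (2 * (c0 * t))" by (simp add: d_def)
  note oc = output_correct[OF graph w dl regime WM W M1(3) kt _ eM, folded dS, folded \<xi>_def]
  show ?thesis using out time oc by auto
qed

end

theorem corollary1p2:
  "\<exists>\<eta>::real. \<eta> \<ge> 0.002 \<and>
     (\<forall>\<Delta> q :: nat. \<forall>w :: real.
        \<Delta> \<ge> 3 \<longrightarrow> real q \<ge> (2 - \<eta>) * real \<Delta> \<longrightarrow> w \<in> {0..1} \<longrightarrow>
        (\<exists>P. approximates_potts_in_poly_time P \<Delta> q w))"
proof (rule exI[of _ "0.002"], intro conjI allI impI)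
  show "(0.002::real) \<le> 0.002" by simp
  fix \<Delta> q :: nat and w :: real
  assume dl: "3 \<le> \<Delta>" and ql: "(2 - 0.002) * real \<Delta> \<le> real q" and w: "w \<in> {0..1}"
  have q': "1998 * real \<Delta> \<le> 1000 * real q" using ql by simp
  have dq: "\<Delta> < q" using q' dl by linarith
  have regime: "2 * \<Delta> \<le> q \<or> 500 \<le> \<Delta> \<and> 1998 * real \<Delta> \<le> 1000 * real q"
  proof (cases "500 \<le> \<Delta>")
    case False
    then have "2 * real \<Delta> - 1 < real q" using q' by linarith
    then show ?thesis by linarith
  qed (use q' in simp)
  interpret program q \<Delta> .
  define K where "K = nat \<lceil>2 * (real bb + 1) + 2 * Kc \<Delta> + 6 + real \<Delta>\<rceil>"
  have K: "2 * (real bb + 1) + 2 * Kc \<Delta> + 6 + real \<Delta> \<le> real K" unfolding K_def by linarith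
  obtain c0 where c0: "kap \<Delta> ^ c0 < 1 / (real bb + 1)"
    using real_arch_pow_inv[OF _ kap_range(2), of "1 / (real bb + 1)" \<Delta>] by auto
  define p :: "real poly" where "p = smult 5000 (([:real (coef K c0):] * [:real K + 1, real K:] ^ (2 * c0 + \<Delta> + 2)) ^ 6)"
  have p: "poly p x = 5000 * (real (coef K c0) * (real K * x + real K + 1) ^ (2 * c0 + \<Delta> + 2)) ^ 6" for x
  proof -
    have "poly [:real K + 1, real K:] x = real K * x + real K + 1" by (simp add: algebra_simps)
    then show ?thesis by (simp only: p_def poly_smult poly_power poly_mult) simp
  qed
  have "approximates_potts_in_poly_time (ccode 0 41 (MAIN K c0)) \<Delta> q w"
    unfolding approximates_potts_in_poly_time_def
  proof (rule exI[of _ p], intro allI impI)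
    fix n :: nat and E :: "nat set set" and \<epsilon> :: real
    assume a: "simple_graph {..<n} E \<and> max_degree_le {..<n} E \<Delta> \<and> 0 < \<epsilon>"
    show "\<exists>t \<xi>. outputs_in (ccode 0 41 (MAIN K c0)) w n E \<epsilon> t \<xi> \<and> real t \<le> poly p (real n / min 1 \<epsilon>) \<and>
        exp (- \<epsilon>) \<le> potts {..<n} E q w / \<xi> \<and> potts {..<n} E q w / \<xi> \<le> exp \<epsilon>"
      unfolding p
      by (rule program_approximates) (use dl dq regime w a K c0 in auto)
  qed
  then show "\<exists>P. approximates_potts_in_poly_time P \<Delta> q w" by blast
qed

end
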